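(* Let $(\Omega,\Sigma,\mu)$ (complete) and $(S,\mathcal F,m)$ be finite measure spaces. Let $T:L_{2,2}(\Omega\times S)\to L_{2,2}(\Omega\times S)$ be a self-adjoint cyclically compact partial integral operator $$T(f)(\omega,t)=\int_S k(\omega,t,s)f(\omega,s)\,dm(s),\qquad f\in L_{2,2}(\Omega\times S),$$ where $k\in L_\infty(\Omega\times S^2)$, $k(\omega,t,s)=\overline{k(\omega,s,t)}$, and the kernel is positive semidefinite: $$\int_S\int_S k(\omega,t,s)\,x(\omega,s)\,\overline{x(\omega,t)}\,dm(t)\,dm(s)\ge 0\qquad\text{for all }x\in L_{2,2}(\Omega\times S).$$ Let $m_T=\inf_{\|x\|=\mathbf 1}\langle Tx,x\rangle$, $M_T=\sup_{\|x\|=\mathbf 1}\langle Tx,x\rangle$. Then: (1) $T$ has the decomposition $$T(f)(\omega,t)=\sum_{n=1}^\infty\lambda_n(\omega)\,\langle f(\omega,\cdot),x_n(\omega,\cdot)\rangle\,x_n(\omega,t),$$ where $\lambda_n(\omega)\in\mathbb R$, $\lambda_n(\omega)\to0$, $\{x_n(\omega,\cdot)\}_{n=1}^\infty\subset L_2(S)$ are measurable orthonormal eigenfunctions, and the series converges in the norm of $L_{2,2}(\Omega\times S)$. (2) For the family of orthogonal projectors $\{E_\lambda\}_{\lambda\in L_0^h}$ given by $$(E_\lambda f)(\omega,t)=\sum_{\{n:\ \lambda_n(\omega)\le\lambda(\omega)\}}\langle f(\omega,\cdot),x_n(\omega,\cdot)\rangle\,x_n(\omega,t)$$ one has, for every $\varepsilon>0$,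 $$T=\int_{m_T}^{M_T+\varepsilon\mathbf 1}\lambda\,dE_\lambda,$$ where the integral converges in the strong operator topology. (3) For every continuous function $\varphi$ on $[m_T,M_T+\varepsilon\mathbf 1]$ and every $\varepsilon>0$, $$\varphi(T)=\int_{m_T}^{M_T+\varepsilon\mathbf 1}\varphi(\lambda)\,dE_\lambda,$$ where the integral converges in the strong operator topology. (4) For $\lambda\in\operatorname{spm}_{\mathrm{disc}}(T)$ the space $\ker(\lambda I-T)$ is a $\sigma$-finitely generated module over $L_0$. (5) The cyclic modular spectrum is $$\operatorname{spm}(T)=\operatorname{mix}\Big\{\sum_{n=0}^\infty\chi_{A_n}\tilde\lambda_n:\ \tilde\lambda_n(\omega)=\lambda_n(\omega)\ (n\ge1),\ \tilde\lambda_0=0,\ A_n\in\Sigma,\ A_n\cap A_j=\varnothing\ (n\ne j)\Big\}.$$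
   Context: $L_0=L_0(\Omega)$ is the algebra of (classes mod a.e. equality of) complex measurable functions on $\Omega$; $L_0^h$ is its real part, ordered by a.e. inequality; $\mathbf 1$ is the constant function $1$; $\nabla=\{\chi_A:A\in\Sigma\}$ is the Boolean algebra of idempotents of $L_0$. $L_{2,2}(\Omega\times S)$ is the space of (classes of) measurable $f$ on $\Omega\times S$ with $\big(\int_S|f(\omega,s)|^2dm(s)\big)^{1/2}\in L_2(\Omega)$, with scalar norm $\|f\|_{2,2}=\big(\int_\Omega\int_S|f|^2\,dm\,d\mu\big)^{1/2}$, function-valued inner product $\langle x,y\rangle(\omega)=\int_S x(\omega,s)\overline{y(\omega,s)}\,dm(s)$ and function-valued norm $\|x\|=\langle x,x\rangle^{1/2}$; the infimum and supremum defining $m_T,M_T$ are taken in $L_0^h$. For functions on $S$, $\langle\cdot,\cdot\rangle$ is the $L_2(S)$ inner product. Elements $f$ are regarded as measurable sections $\omega\mapsto f(\omega,\cdot)\in L_2(S)$. The fibre operators are $(T_\omega g)(t)=\int_S k(\omega,t,s)g(s)\,dm(s)$, $g\in L_2(S)$; they are compact and self-adjoint. The $\lambda_n(\omega)$ are eigenvalues of $T_\omega$ (with $\lambda_n\in L_0^h$), the $x_n(\omega,\cdot)$ corresponding eigenfunctions, and $\operatorname{sp}(T_\omega)=\{\lambda_n(\omega):n\in\mathbb N\}\cup\{0\}$ is the spectrum of $T_\omega$. Mixing and cyclic compactness: for a family $(u_\alpha)$ and a partition of unity $(\pi_\alpha)$ in $\nabla$, $\operatorname{mix}(\pi_\alpha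 u_\alpha)=\sum_\alpha\pi_\alpha u_\alpha$; $\operatorname{mix}K$ is the set of all mixings of elements of $K$; $K$ is cyclic if $\operatorname{mix}K=K$. For a directed set $A$, $\nabla(A)$ is the set of partitions of unity $\nu:A\to\nabla$, ordered by $\nu_1\le\nu_2$ iff ($\nu_1(\alpha)\wedge\nu_2(\beta)\ne0\Rightarrow\alpha\le\beta$). For a net $(u_\alpha)_{\alpha\in A}$ put $u_\nu=\operatorname{mix}(\nu(\alpha)u_\alpha)$; cyclic subnets are subnets of $(u_\nu)_{\nu\in\nabla(A)}$. $K$ is cyclically compact if it is cyclic and every net in $K$ has a cyclic subnet converging to a point of $K$; an operator is cyclically compact if it maps every set with order bounded norms into a subset of a cyclically compact set. Interval, functions, integral: $[m_T,M_T+\varepsilon\mathbf 1]=\{\lambda\in L_0^h: m_T(\omega)\le\lambda(\omega)\le M_T(\omega)+\varepsilon\}$. A continuous function $\varphi$ on it is used fibrewise, as a bounded continuous function of a real variable on the intervals $[m_T(\omega),M_T(\omega)+\varepsilon]$, and $\varphi(T)$ acts fibrewise by the continuous functional calculus: $(\varphi(T)g)(\omega,\cdot)=\varphi(T_\omega)g(\omega,\cdot)$. The integrals are likewise fibrewise: $\big(\int_{m_T}^{M_T+\varepsilon\mathbf 1}\varphi(\lambda)\,dE_\lambda\, g\big)(\omega,\cdot)=\int_{m_T(\omega)}^{M_T(\omega)+\varepsilon}\varphi(\lambda)\,dE_\lambda(\omega)\,g(\omega,\cdot)$, where $E_\lambda(\omega)h=\sum_{\{n:\lambda_n(\omega)\le\lambda\}}\langle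 h,x_n(\omega,\cdot)\rangle x_n(\omega,\cdot)$, all jumps at the points $\lambda_n(\omega)$ (including one at $m_T(\omega)$) being counted; strong convergence is with respect to $\|\cdot\|_{2,2}$. Spectra and modules: $\operatorname{spm}(T)=\{\lambda\in L_0^h:\lambda(\omega)\in\operatorname{sp}(T_\omega)\text{ for a.e. }\omega\}$. $\operatorname{spm}_{\mathrm{disc}}(T)$ is read as the set of $\lambda\in\operatorname{spm}(T)$ such that the sets $\{\omega:\lambda(\omega)=\lambda_n(\omega)\}$, $n\ge1$, cover $\Omega$ up to a null set and $\ker(\lambda(\omega)I-T_\omega)$ is finite-dimensional for a.e. $\omega$. $\ker(\lambda I-T)=\{f\in L_{2,2}(\Omega\times S):(\lambda(\omega)I-T_\omega)f(\omega,\cdot)=0\text{ for a.e. }\omega\}$. That it is a $\sigma$-finitely generated module over $L_0$ is read as: it is closed under addition and under multiplication by $\alpha\in L_0$ (products being taken within $L_{2,2}(\Omega\times S)$), and there is a countable measurable partition $(B_j)$ of $\Omega$ and, for each $j$, finitely many elements $g_{j,1},\dots,g_{j,r_j}$ of the kernel such that every $f$ in the kernel satisfies $\chi_{B_j}f=\sum_k c_k\,\chi_{B_j}g_{j,k}$ with some $c_k\in L_0$.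
   Formalization: (3) assumes L_2(S) separable or φ(0)=0 (false otherwise: k=0, φ=1, L_2(S) nonseparable); if L_2(S) is finite-dimensional the orthonormal sequence may be padded with x_n=0, λ_n=0; m_T, M_T are inf and sup only when m(S)>0. *)

theory Defs
  imports "HOL-Analysis.Analysis" "HOL-Computational_Algebra.Polynomial"
begin

(* Classes modulo a.e. equality are represented by functions, and all equations between such
   functions are stated a.e.  L_0 is borel_measurable M with complex values, L_0^h is
   borel_measurable M with real values, and the idempotents in the Boolean algebra of L_0
   are represented by sets in sets M. *)

section \<open>The spaces\<close>

definition L2_inner :: "'b measure \<Rightarrow> ('b \<Rightarrow> complex) \<Rightarrow> ('b \<Rightarrow> complex) \<Rightarrow> complex" where
  "L2_inner N g h = (\<integral>s. g s * cnj (h s) \<partial>N)"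

definition L2_norm :: "'b measure \<Rightarrow> ('b \<Rightarrow> complex) \<Rightarrow> real" where
  "L2_norm N g = sqrt (Re (L2_inner N g g))"

definition L2 :: "'b measure \<Rightarrow> ('b \<Rightarrow> complex) set" where
  "L2 N = {g \<in> borel_measurable N. integrable N (\<lambda>s. (cmod (g s))\<^sup>2)}"

(* The section f(w, .) is curry f w. *)

definition fun_inner ::
  "'b measure \<Rightarrow> ('a \<times> 'b \<Rightarrow> complex) \<Rightarrow> ('a \<times> 'b \<Rightarrow> complex) \<Rightarrow> 'a \<Rightarrow> complex" where
  "fun_inner N f g \<omega> = L2_inner N (curry f \<omega>) (curry g \<omega>)"

definition fun_norm :: "'b measure \<Rightarrow> ('a \<times> 'b \<Rightarrow> complex) \<Rightarrow> 'a \<Rightarrow> real" where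
  "fun_norm N f \<omega> = L2_norm N (curry f \<omega>)"

definition L22 :: "'a measure \<Rightarrow> 'b measure \<Rightarrow> ('a \<times> 'b \<Rightarrow> complex) set" where
  "L22 M N = {f \<in> borel_measurable (M \<Otimes>\<^sub>M N).
     (AE \<omega> in M. curry f \<omega> \<in> L2 N) \<and> integrable M (\<lambda>\<omega>. (fun_norm N f \<omega>)\<^sup>2)}"

definition norm22 :: "'a measure \<Rightarrow> 'b measure \<Rightarrow> ('a \<times> 'b \<Rightarrow> complex) \<Rightarrow> real" where
  "norm22 M N f = sqrt (\<integral>\<omega>. (\<integral>s. (cmod (f (\<omega>, s)))\<^sup>2 \<partial>N) \<partial>M)"

definition L2_tendsto ::
  "'b measure \<Rightarrow> (nat \<Rightarrow> 'b \<Rightarrow> complex) \<Rightarrow> ('b \<Rightarrow> complex) \<Rightarrow> bool" where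
  "L2_tendsto N F g \<longleftrightarrow> (\<forall>n. F n \<in> L2 N) \<and> g \<in> L2 N \<and>
     (\<lambda>n. L2_norm N (\<lambda>s. F n s - g s)) \<longlonglongrightarrow> 0"

definition L22_tendsto ::
  "'a measure \<Rightarrow> 'b measure \<Rightarrow> (nat \<Rightarrow> 'a \<times> 'b \<Rightarrow> complex) \<Rightarrow> ('a \<times> 'b \<Rightarrow> complex) \<Rightarrow> bool" where
  "L22_tendsto M N F g \<longleftrightarrow> (\<forall>n. F n \<in> L22 M N) \<and> g \<in> L22 M N \<and>
     (\<lambda>n. norm22 M N (\<lambda>z. F n z - g z)) \<longlonglongrightarrow> 0"

definition L2_separable :: "'b measure \<Rightarrow> bool" where
  "L2_separable N \<longleftrightarrow> (\<exists>d :: nat \<Rightarrow> 'b \<Rightarrow> complex. (\<forall>n. d n \<in> L2 N) \<and>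
     (\<forall>h\<in>L2 N. \<forall>\<eta>>0. \<exists>n. L2_norm N (\<lambda>s. h s - d n s) < \<eta>))"

definition L2_fin_dim :: "'b measure \<Rightarrow> ('b \<Rightarrow> complex) set \<Rightarrow> bool" where
  "L2_fin_dim N V \<longleftrightarrow> (\<exists>(r::nat) b. (\<forall>i<r. b i \<in> V) \<and>
     (\<forall>g\<in>V. \<exists>c :: nat \<Rightarrow> complex. AE s in N. g s = (\<Sum>i<r. c i * b i s)))"


section \<open>Partial integral operators\<close>

definition fibre_op ::
  "'b measure \<Rightarrow> ('a \<times> 'b \<times> 'b \<Rightarrow> complex) \<Rightarrow> 'a \<Rightarrow> ('b \<Rightarrow> complex) \<Rightarrow> 'b \<Rightarrow> complex" where
  "fibre_op N k \<omega> g t = (\<integral>s. k (\<omega>, t, s) * g s \<partial>N)"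

definition partial_int_op ::
  "'b measure \<Rightarrow> ('a \<times> 'b \<times> 'b \<Rightarrow> complex) \<Rightarrow> ('a \<times> 'b \<Rightarrow> complex) \<Rightarrow> 'a \<times> 'b \<Rightarrow> complex" where
  "partial_int_op N k f = (\<lambda>(\<omega>, t). \<integral>s. k (\<omega>, t, s) * f (\<omega>, s) \<partial>N)"

definition self_adjoint22 ::
  "'a measure \<Rightarrow> 'b measure \<Rightarrow> (('a \<times> 'b \<Rightarrow> complex) \<Rightarrow> 'a \<times> 'b \<Rightarrow> complex) \<Rightarrow> bool" where
  "self_adjoint22 M N T \<longleftrightarrow> (\<forall>f\<in>L22 M N. T f \<in> L22 M N) \<and>
     (\<forall>f\<in>L22 M N. \<forall>g\<in>L22 M N. AE \<omega> in M. fun_inner N (T f) g \<omega> = fun_inner N f (T g) \<omega>)"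

definition orth_projector22 ::
  "'a measure \<Rightarrow> 'b measure \<Rightarrow> (('a \<times> 'b \<Rightarrow> complex) \<Rightarrow> 'a \<times> 'b \<Rightarrow> complex) \<Rightarrow> bool" where
  "orth_projector22 M N P \<longleftrightarrow> self_adjoint22 M N P \<and>
     (\<forall>f\<in>L22 M N. AE z in M \<Otimes>\<^sub>M N. P (P f) z = P f z)"

definition is_L0_inf :: "'a measure \<Rightarrow> ('a \<Rightarrow> real) set \<Rightarrow> ('a \<Rightarrow> real) \<Rightarrow> bool" where
  "is_L0_inf M F g \<longleftrightarrow> g \<in> borel_measurable M \<and> (\<forall>f\<in>F. AE \<omega> in M. g \<omega> \<le> f \<omega>) \<and>
     (\<forall>h\<in>borel_measurable M. (\<forall>f\<in>F. AE \<omega> in M. h \<omega> \<le> f \<omega>) \<longrightarrow> (AE \<omega> in M. h \<omega> \<le> g \<omega>))"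

definition is_L0_sup :: "'a measure \<Rightarrow> ('a \<Rightarrow> real) set \<Rightarrow> ('a \<Rightarrow> real) \<Rightarrow> bool" where
  "is_L0_sup M F g \<longleftrightarrow> g \<in> borel_measurable M \<and> (\<forall>f\<in>F. AE \<omega> in M. f \<omega> \<le> g \<omega>) \<and>
     (\<forall>h\<in>borel_measurable M. (\<forall>f\<in>F. AE \<omega> in M. f \<omega> \<le> h \<omega>) \<longrightarrow> (AE \<omega> in M. g \<omega> \<le> h \<omega>))"

(* The functions <Tx,x> with ||x|| = 1.  For self-adjoint T they are real a.e. *)
definition num_range ::
  "'a measure \<Rightarrow> 'b measure \<Rightarrow> (('a \<times> 'b \<Rightarrow> complex) \<Rightarrow> 'a \<times> 'b \<Rightarrow> complex) \<Rightarrow> ('a \<Rightarrow> real) set" where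
  "num_range M N T = {q \<in> borel_measurable M. \<exists>x\<in>L22 M N. (AE \<omega> in M. fun_norm N x \<omega> = 1) \<and>
     (AE \<omega> in M. complex_of_real (q \<omega>) = fun_inner N (T x) x \<omega>)}"

definition lower_bound ::
  "'a measure \<Rightarrow> 'b measure \<Rightarrow> (('a \<times> 'b \<Rightarrow> complex) \<Rightarrow> 'a \<times> 'b \<Rightarrow> complex) \<Rightarrow> 'a \<Rightarrow> real" where
  "lower_bound M N T = (SOME g. is_L0_inf M (num_range M N T) g)"

definition upper_bound ::
  "'a measure \<Rightarrow> 'b measure \<Rightarrow> (('a \<times> 'b \<Rightarrow> complex) \<Rightarrow> 'a \<times> 'b \<Rightarrow> complex) \<Rightarrow> 'a \<Rightarrow> real" where
  "upper_bound M N T = (SOME g. is_L0_sup M (num_range M N T) g)"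


section \<open>Mixing and cyclic compactness\<close>

(* The last conjunct says that the supremum of the family in the measure algebra is the unit. *)
definition partition_of_unity :: "'a measure \<Rightarrow> 'i set \<Rightarrow> ('i \<Rightarrow> 'a set) \<Rightarrow> bool" where
  "partition_of_unity M I A \<longleftrightarrow> (\<forall>i\<in>I. A i \<in> sets M) \<and>
     (\<forall>i\<in>I. \<forall>j\<in>I. i \<noteq> j \<longrightarrow> A i \<inter> A j \<in> null_sets M) \<and>
     (\<forall>B\<in>sets M. (\<forall>i\<in>I. A i - B \<in> null_sets M) \<longrightarrow> space M - B \<in> null_sets M)"

(* v = mix(A_i u_i), i.e. v agrees with u_i over A_i; this is what the sum of the A_i u_i over a
   possibly uncountable partition of unity means.  The functions live on P, which lies over M via
   p: P = M and p = id for L_0, and P = M x N (product measure) and p = fst for L_{2,2}. *)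
definition is_mixing ::
  "'p measure \<Rightarrow> ('p \<Rightarrow> 'a) \<Rightarrow> 'i set \<Rightarrow> ('i \<Rightarrow> 'a set) \<Rightarrow>
    ('i \<Rightarrow> 'p \<Rightarrow> 'c::topological_space) \<Rightarrow> ('p \<Rightarrow> 'c) \<Rightarrow> bool" where
  "is_mixing P p I A u v \<longleftrightarrow> v \<in> borel_measurable P \<and>
     (\<forall>i\<in>I. AE z in P. p z \<in> A i \<longrightarrow> v z = u i z)"

(* Countable index sets suffice: over a finite measure only countably many members of a
   partition of unity are non-zero. *)
definition mix_hull ::
  "'a measure \<Rightarrow> 'p measure \<Rightarrow> ('p \<Rightarrow> 'a) \<Rightarrow> ('p \<Rightarrow> 'c::topological_space) set \<Rightarrow> ('p \<Rightarrow> 'c) set" where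
  "mix_hull M P p K = {v. \<exists>(I :: nat set) A u.
     partition_of_unity M I A \<and> (\<forall>i\<in>I. u i \<in> K) \<and> is_mixing P p I A u v}"

definition directed_preorder :: "'i set \<Rightarrow> 'i rel \<Rightarrow> bool" where
  "directed_preorder A r \<longleftrightarrow> A \<noteq> {} \<and> preorder_on A r \<and>
     (\<forall>a\<in>A. \<forall>b\<in>A. \<exists>c\<in>A. (a, c) \<in> r \<and> (b, c) \<in> r)"

definition partition_le ::
  "'a measure \<Rightarrow> 'i set \<Rightarrow> 'i rel \<Rightarrow> ('i \<Rightarrow> 'a set) \<Rightarrow> ('i \<Rightarrow> 'a set) \<Rightarrow> bool" where
  "partition_le M A r \<nu>1 \<nu>2 \<longleftrightarrow>
     (\<forall>\<alpha>\<in>A. \<forall>\<beta>\<in>A. \<nu>1 \<alpha> \<inter> \<nu>2 \<beta> \<notin> null_sets M \<longrightarrow> (\<alpha>, \<beta>) \<in> r)"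

(* Order convergence in L_0^h of the norms to 0.  Over a finite measure L_0^h has the countable
   supremum property, so a decreasing sequence e serves as regulator. *)
definition net_converges ::
  "'a measure \<Rightarrow> 'b measure \<Rightarrow> 'j set \<Rightarrow> 'j rel \<Rightarrow> ('j \<Rightarrow> 'a \<times> 'b \<Rightarrow> complex) \<Rightarrow>
    ('a \<times> 'b \<Rightarrow> complex) \<Rightarrow> bool" where
  "net_converges M N B s v y \<longleftrightarrow> (\<exists>e :: nat \<Rightarrow> 'a \<Rightarrow> real.
     (\<forall>n. e n \<in> borel_measurable M) \<and>
     (AE \<omega> in M. decseq (\<lambda>n. e n \<omega>) \<and> (\<lambda>n. e n \<omega>) \<longlonglongrightarrow> 0) \<and>
     (\<forall>n. \<exists>b0\<in>B. \<forall>b\<in>B. (b0, b) \<in> s \<longrightarrow>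
        (AE \<omega> in M. fun_norm N (\<lambda>z. v b z - y z) \<omega> \<le> e n \<omega>)))"

(* Nets are indexed by directed subsets of the type 'i, cyclic subnets by directed subsets of the
   type 'j.  A subnet of the net of mixings u_\<nu> is given by a map h from B into the set of
   partitions of unity that is eventually above each of its elements. *)
definition cyclically_compact ::
  "'i itself \<Rightarrow> 'j itself \<Rightarrow> 'a measure \<Rightarrow> 'b measure \<Rightarrow> ('a \<times> 'b \<Rightarrow> complex) set \<Rightarrow> bool" where
  "cyclically_compact _ _ M N K \<longleftrightarrow> K \<subseteq> L22 M N \<and> mix_hull M (M \<Otimes>\<^sub>M N) fst K = K \<and>
     (\<forall>(A :: 'i set) r u. directed_preorder A r \<and> (\<forall>\<alpha>\<in>A. u \<alpha> \<in> K) \<longrightarrow>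
       (\<exists>(B :: 'j set) s h v. directed_preorder B s \<and>
          (\<forall>b\<in>B. partition_of_unity M A (h b)) \<and>
          (\<forall>\<nu>. partition_of_unity M A \<nu> \<longrightarrow>
             (\<exists>b0\<in>B. \<forall>b\<in>B. (b0, b) \<in> s \<longrightarrow> partition_le M A r \<nu> (h b))) \<and>
          (\<forall>b\<in>B. is_mixing (M \<Otimes>\<^sub>M N) fst A (h b) u (v b)) \<and>
          (\<exists>y\<in>K. net_converges M N B s v y)))"

(* Order boundedness is meant in L_2(\<Omega>), where the norms of elements of L_{2,2} take their values. *)
definition cyclically_compact_op ::
  "'i itself \<Rightarrow> 'j itself \<Rightarrow> 'a measure \<Rightarrow> 'b measure \<Rightarrow>
    (('a \<times> 'b \<Rightarrow> complex) \<Rightarrow> 'a \<times> 'b \<Rightarrow> complex) \<Rightarrow> bool" where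
  "cyclically_compact_op I J M N T \<longleftrightarrow>
     (\<forall>V \<subseteq> L22 M N.
        (\<exists>e :: 'a \<Rightarrow> real. e \<in> borel_measurable M \<and> integrable M (\<lambda>\<omega>. (e \<omega>)\<^sup>2) \<and>
           (\<forall>f\<in>V. AE \<omega> in M. fun_norm N f \<omega> \<le> e \<omega>)) \<longrightarrow>
        (\<exists>K. cyclically_compact I J M N K \<and> T ` V \<subseteq> K))"


section \<open>Spectral family and spectral integrals\<close>

definition fibre_E ::
  "'b measure \<Rightarrow> (nat \<Rightarrow> real) \<Rightarrow> (nat \<Rightarrow> 'b \<Rightarrow> complex) \<Rightarrow> real \<Rightarrow> ('b \<Rightarrow> complex) \<Rightarrow> 'b \<Rightarrow> complex" where
  "fibre_E N l y r h =
     (SOME g. L2_tendsto N (\<lambda>K s. \<Sum>n | n < K \<and> l n \<le> r. L2_inner N h (y n) * y n s) g)"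

definition E_partial_sum ::
  "'b measure \<Rightarrow> (nat \<Rightarrow> 'a \<Rightarrow> real) \<Rightarrow> (nat \<Rightarrow> 'a \<times> 'b \<Rightarrow> complex) \<Rightarrow> ('a \<Rightarrow> real) \<Rightarrow>
    ('a \<times> 'b \<Rightarrow> complex) \<Rightarrow> nat \<Rightarrow> 'a \<times> 'b \<Rightarrow> complex" where
  "E_partial_sum N lam x l f K = (\<lambda>(\<omega>, t).
     \<Sum>n | n < K \<and> lam n \<omega> \<le> l \<omega>. fun_inner N f (x n) \<omega> * x n (\<omega>, t))"

definition spectral_E ::
  "'a measure \<Rightarrow> 'b measure \<Rightarrow> (nat \<Rightarrow> 'a \<Rightarrow> real) \<Rightarrow> (nat \<Rightarrow> 'a \<times> 'b \<Rightarrow> complex) \<Rightarrow> ('a \<Rightarrow> real) \<Rightarrow>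
    ('a \<times> 'b \<Rightarrow> complex) \<Rightarrow> 'a \<times> 'b \<Rightarrow> complex" where
  "spectral_E M N lam x l f = (SOME g. L22_tendsto M N (E_partial_sum N lam x l f) g)"

definition rs_partition ::
  "real \<Rightarrow> real \<Rightarrow> nat \<Rightarrow> (nat \<Rightarrow> real) \<Rightarrow> (nat \<Rightarrow> real) \<Rightarrow> real \<Rightarrow> bool" where
  "rs_partition a b n d \<xi> \<delta> \<longleftrightarrow> d 0 = a \<and> d n = b \<and>
     (\<forall>i<n. d i \<le> \<xi> i \<and> \<xi> i \<le> d (Suc i) \<and> d (Suc i) - d i < \<delta>)"

(* Riemann-Stieltjes sums on [a,b]; the term at a is the jump of the spectral family at the left
   end point a = m_T(\<omega>), since the family vanishes to the left of m_T(\<omega>). *)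
definition fibre_rs_sum ::
  "'b measure \<Rightarrow> (nat \<Rightarrow> real) \<Rightarrow> (nat \<Rightarrow> 'b \<Rightarrow> complex) \<Rightarrow> (real \<Rightarrow> complex) \<Rightarrow> real \<Rightarrow> nat \<Rightarrow>
    (nat \<Rightarrow> real) \<Rightarrow> (nat \<Rightarrow> real) \<Rightarrow> ('b \<Rightarrow> complex) \<Rightarrow> 'b \<Rightarrow> complex" where
  "fibre_rs_sum N l y \<phi> a n d \<xi> h s = \<phi> a * fibre_E N l y a h s +
     (\<Sum>i<n. \<phi> (\<xi> i) * (fibre_E N l y (d (Suc i)) h s - fibre_E N l y (d i) h s))"

definition has_fibre_integral ::
  "'b measure \<Rightarrow> (nat \<Rightarrow> real) \<Rightarrow> (nat \<Rightarrow> 'b \<Rightarrow> complex) \<Rightarrow> (real \<Rightarrow> complex) \<Rightarrow> real \<Rightarrow> real \<Rightarrow>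
    ('b \<Rightarrow> complex) \<Rightarrow> ('b \<Rightarrow> complex) \<Rightarrow> bool" where
  "has_fibre_integral N l y \<phi> a b h g \<longleftrightarrow> g \<in> L2 N \<and>
     (\<forall>\<eta>>0. \<exists>\<delta>>0. \<forall>n d \<xi>. rs_partition a b n d \<xi> \<delta> \<longrightarrow>
        fibre_rs_sum N l y \<phi> a n d \<xi> h \<in> L2 N \<and>
        L2_norm N (\<lambda>s. fibre_rs_sum N l y \<phi> a n d \<xi> h s - g s) < \<eta>)"

definition rs_sum22 ::
  "'a measure \<Rightarrow> 'b measure \<Rightarrow> (nat \<Rightarrow> 'a \<Rightarrow> real) \<Rightarrow> (nat \<Rightarrow> 'a \<times> 'b \<Rightarrow> complex) \<Rightarrow>
    ('a \<Rightarrow> real \<Rightarrow> complex) \<Rightarrow> ('a \<Rightarrow> real) \<Rightarrow> nat \<Rightarrow> (nat \<Rightarrow> 'a \<Rightarrow> real) \<Rightarrow> (nat \<Rightarrow> 'a \<Rightarrow> real) \<Rightarrow>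
    ('a \<times> 'b \<Rightarrow> complex) \<Rightarrow> 'a \<times> 'b \<Rightarrow> complex" where
  "rs_sum22 M N lam x \<phi> a n d \<xi> g = (\<lambda>(\<omega>, t).
     \<phi> \<omega> (a \<omega>) * spectral_E M N lam x a g (\<omega>, t) +
     (\<Sum>i<n. \<phi> \<omega> (\<xi> i \<omega>) *
        (spectral_E M N lam x (d (Suc i)) g (\<omega>, t) - spectral_E M N lam x (d i) g (\<omega>, t))))"

(* \<Phi> is the integral of \<phi> dE over [a,b]: fibre by fibre, and as the limit in the strong operator
   topology of the Riemann-Stieltjes sums over partitions of [a,b] in L_0^h. *)
definition has_spectral_integral ::
  "'a measure \<Rightarrow> 'b measure \<Rightarrow> (nat \<Rightarrow> 'a \<Rightarrow> real) \<Rightarrow> (nat \<Rightarrow> 'a \<times> 'b \<Rightarrow> complex) \<Rightarrow>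
    ('a \<Rightarrow> real \<Rightarrow> complex) \<Rightarrow> ('a \<Rightarrow> real) \<Rightarrow> ('a \<Rightarrow> real) \<Rightarrow>
    (('a \<times> 'b \<Rightarrow> complex) \<Rightarrow> 'a \<times> 'b \<Rightarrow> complex) \<Rightarrow> bool" where
  "has_spectral_integral M N lam x \<phi> a b \<Phi> \<longleftrightarrow> (\<forall>g\<in>L22 M N. \<Phi> g \<in> L22 M N \<and>
     (AE \<omega> in M. has_fibre_integral N (\<lambda>n. lam n \<omega>) (\<lambda>n. curry (x n) \<omega>) (\<phi> \<omega>) (a \<omega>) (b \<omega>)
        (curry g \<omega>) (curry (\<Phi> g) \<omega>)) \<and>
     (\<forall>\<eta>>0. \<exists>\<delta>>0. \<forall>n d \<xi>.
        (\<forall>i\<le>n. d i \<in> borel_measurable M) \<and> (\<forall>i<n. \<xi> i \<in> borel_measurable M) \<and>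
        (AE \<omega> in M. rs_partition (a \<omega>) (b \<omega>) n (\<lambda>i. d i \<omega>) (\<lambda>i. \<xi> i \<omega>) \<delta>) \<longrightarrow>
        rs_sum22 M N lam x \<phi> a n d \<xi> g \<in> L22 M N \<and>
        norm22 M N (\<lambda>z. rs_sum22 M N lam x \<phi> a n d \<xi> g z - \<Phi> g z) < \<eta>))"

(* A bounded continuous function on the interval [a,b] of L_0^h with values in L_0, acting
   fibrewise.  A single function of a real variable is the case where \<phi> \<omega> is independent of \<omega>. *)
definition fibrewise_continuous ::
  "'a measure \<Rightarrow> ('a \<Rightarrow> real) \<Rightarrow> ('a \<Rightarrow> real) \<Rightarrow> ('a \<Rightarrow> real \<Rightarrow> complex) \<Rightarrow> bool" where
  "fibrewise_continuous M a b \<phi> \<longleftrightarrow>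
     (\<forall>l\<in>borel_measurable M. (AE \<omega> in M. l \<omega> \<in> {a \<omega>..b \<omega>}) \<longrightarrow>
        (\<lambda>\<omega>. \<phi> \<omega> (l \<omega>)) \<in> borel_measurable M) \<and>
     (AE \<omega> in M. continuous_on {a \<omega>..b \<omega>} (\<phi> \<omega>)) \<and>
     (\<exists>C. AE \<omega> in M. \<forall>r\<in>{a \<omega>..b \<omega>}. cmod (\<phi> \<omega> r) \<le> C)"


section \<open>Spectra and functional calculus\<close>

(* z belongs to the spectrum unless zI - A is a bijection of L_2 with bounded inverse. *)
definition L2_spectrum :: "'b measure \<Rightarrow> (('b \<Rightarrow> complex) \<Rightarrow> 'b \<Rightarrow> complex) \<Rightarrow> complex set" where
  "L2_spectrum N A = {z. \<not> ((\<forall>h\<in>L2 N. \<exists>g\<in>L2 N. AE s in N. z * g s - A g s = h s) \<and>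
     (\<exists>C. \<forall>g\<in>L2 N. L2_norm N g \<le> C * L2_norm N (\<lambda>s. z * g s - A g s)))}"

definition poly_op ::
  "(('b \<Rightarrow> complex) \<Rightarrow> 'b \<Rightarrow> complex) \<Rightarrow> complex poly \<Rightarrow> ('b \<Rightarrow> complex) \<Rightarrow> 'b \<Rightarrow> complex" where
  "poly_op A p h s = (\<Sum>i\<le>degree p. coeff p i * (A ^^ i) h s)"

(* f(A) h = g for self-adjoint A: f(A) is the limit of p_j(A) for polynomials p_j that converge to f
   uniformly on the (real) spectrum of A. *)
definition has_fun_calc ::
  "'b measure \<Rightarrow> (('b \<Rightarrow> complex) \<Rightarrow> 'b \<Rightarrow> complex) \<Rightarrow> (real \<Rightarrow> complex) \<Rightarrow>
    ('b \<Rightarrow> complex) \<Rightarrow> ('b \<Rightarrow> complex) \<Rightarrow> bool" where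
  "has_fun_calc N A f h g \<longleftrightarrow> (\<exists>p :: nat \<Rightarrow> complex poly.
     uniform_limit {r. complex_of_real r \<in> L2_spectrum N A}
       (\<lambda>j r. poly (p j) (complex_of_real r)) f sequentially \<and>
     L2_tendsto N (\<lambda>j. poly_op A (p j) h) g)"

definition is_fun_calc_op ::
  "'a measure \<Rightarrow> 'b measure \<Rightarrow> ('a \<times> 'b \<times> 'b \<Rightarrow> complex) \<Rightarrow> ('a \<Rightarrow> real \<Rightarrow> complex) \<Rightarrow>
    (('a \<times> 'b \<Rightarrow> complex) \<Rightarrow> 'a \<times> 'b \<Rightarrow> complex) \<Rightarrow> bool" where
  "is_fun_calc_op M N k \<phi> \<Phi> \<longleftrightarrow> (\<forall>g\<in>L22 M N. \<Phi> g \<in> L22 M N \<and>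
     (AE \<omega> in M. has_fun_calc N (fibre_op N k \<omega>) (\<phi> \<omega>) (curry g \<omega>) (curry (\<Phi> g) \<omega>)))"

(* For compact operators 0 always lies in the spectrum, except possibly when L_2(S) is
   finite-dimensional; there, too, 0 is counted as an element of sp. *)
definition fibre_sp :: "'b measure \<Rightarrow> ('a \<times> 'b \<times> 'b \<Rightarrow> complex) \<Rightarrow> 'a \<Rightarrow> complex set" where
  "fibre_sp N k \<omega> = L2_spectrum N (fibre_op N k \<omega>) \<union> {0}"

definition spm ::
  "'a measure \<Rightarrow> 'b measure \<Rightarrow> ('a \<times> 'b \<times> 'b \<Rightarrow> complex) \<Rightarrow> ('a \<Rightarrow> real) set" where
  "spm M N k = {l \<in> borel_measurable M. AE \<omega> in M. complex_of_real (l \<omega>) \<in> fibre_sp N k \<omega>}"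

definition fibre_ker ::
  "'b measure \<Rightarrow> ('a \<times> 'b \<times> 'b \<Rightarrow> complex) \<Rightarrow> ('a \<Rightarrow> real) \<Rightarrow> 'a \<Rightarrow> ('b \<Rightarrow> complex) set" where
  "fibre_ker N k l \<omega> =
     {g \<in> L2 N. AE t in N. complex_of_real (l \<omega>) * g t - fibre_op N k \<omega> g t = 0}"

definition spm_disc ::
  "'a measure \<Rightarrow> 'b measure \<Rightarrow> ('a \<times> 'b \<times> 'b \<Rightarrow> complex) \<Rightarrow> (nat \<Rightarrow> 'a \<Rightarrow> real) \<Rightarrow>
    ('a \<Rightarrow> real) set" where
  "spm_disc M N k lam = {l \<in> spm M N k. (AE \<omega> in M. \<exists>n. l \<omega> = lam n \<omega>) \<and>
     (AE \<omega> in M. L2_fin_dim N (fibre_ker N k l \<omega>))}"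

definition ker22 ::
  "'a measure \<Rightarrow> 'b measure \<Rightarrow> ('a \<times> 'b \<times> 'b \<Rightarrow> complex) \<Rightarrow> ('a \<Rightarrow> real) \<Rightarrow>
    ('a \<times> 'b \<Rightarrow> complex) set" where
  "ker22 M N k l = {f \<in> L22 M N. AE \<omega> in M. curry f \<omega> \<in> fibre_ker N k l \<omega>}"

definition sigma_fin_gen_module ::
  "'a measure \<Rightarrow> 'b measure \<Rightarrow> ('a \<times> 'b \<Rightarrow> complex) set \<Rightarrow> bool" where
  "sigma_fin_gen_module M N V \<longleftrightarrow>
     (\<forall>f\<in>V. \<forall>g\<in>V. (\<lambda>z. f z + g z) \<in> V) \<and>
     (\<forall>\<alpha>\<in>borel_measurable M. \<forall>f\<in>V.
        (\<lambda>(\<omega>, t). \<alpha> \<omega> * f (\<omega>, t)) \<in> L22 M N \<longrightarrow> (\<lambda>(\<omega>, t). \<alpha> \<omega> * f (\<omega>, t)) \<in> V) \<and>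
     (\<exists>(B :: nat \<Rightarrow> 'a set) (r :: nat \<Rightarrow> nat) g.
        (\<forall>j. B j \<in> sets M) \<and> disjoint_family B \<and> (\<Union>j. B j) = space M \<and>
        (\<forall>j. \<forall>i<r j. g j i \<in> V) \<and>
        (\<forall>f\<in>V. \<forall>j. \<exists>c :: nat \<Rightarrow> 'a \<Rightarrow> complex. (\<forall>i<r j. c i \<in> borel_measurable M) \<and>
           (AE z in M \<Otimes>\<^sub>M N. indicator (B j) (fst z) * f z =
              (\<Sum>i<r j. c i (fst z) * (indicator (B j) (fst z) * g j i z)))))"

(* The sums in the description of spm(T); lam n is the (n+1)-st eigenvalue function, so that the
   \<open>n = 0\<close> term, with value 0, is followed by lam 0, lam 1, ... *)
definition eigenvalue_sums :: "'a measure \<Rightarrow> (nat \<Rightarrow> 'a \<Rightarrow> real) \<Rightarrow> ('a \<Rightarrow> real) set" where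
  "eigenvalue_sums M lam = {l. \<exists>A :: nat \<Rightarrow> 'a set. (\<forall>n. A n \<in> sets M) \<and> disjoint_family A \<and>
     l = (\<lambda>\<omega>. \<Sum>n. indicator (A n) \<omega> * (case n of 0 \<Rightarrow> 0 | Suc m \<Rightarrow> lam m \<omega>))}"

end

theory Submission imports Defs
begin

text \<open>
  After a change on a null set the kernel is bounded and Hermitian everywhere, and the fibre operators
  are Hilbert-Schmidt operators with ranges in one separable subspace, which has a countable dense
  family that does not depend on \<open>\<omega>\<close>. The absolute value of the top eigenvalue of a fibre is a supremum
  over this family, hence measurable; and the even powers of the operator divided by it converge
  strongly, so that applied to a suitable member of the family they give in the limit a measurable
  eigenvector. Deflation produces the non-zero eigenvalues one after another, and Gram-Schmidt applied
  to the projections of the dense family to the kernel completes the eigenvectors to a basis. The fibrewise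
  assertions pass to \<open>L22\<close> by dominated convergence.
\<close>

section \<open>Square integrable functions\<close>

text \<open>Every choice that depends on \<omega> is made as a least index with a measurable
  property, which is why one countable family has to serve all fibres. The space \<open>L2 N\<close>
  itself may be non-separable; the family is then dense only in the ranges of the operators, and
  estimates have to be carried from the range to the whole space by self-adjointness. Even powers
  are used because the top eigenvalue may be negative. That their limits do not all vanish on the
  family is where compactness enters, in the form of square integrable column norms.
  Finite-dimensional spaces force zero vectors into the sequence of eigenvectors; multipliers are
  therefore controlled at non-zero vectors only. What a sequence misses in a non-separable space
  lies in the kernel: there a function of the operator acts as its value at \<open>0\<close>,
  whereas sums over the sequence vanish. Spectral projections, resolvents, functions of the operator
  and Riemann-Stieltjes sums are all diagonal in the eigenvectors, so that one set of estimates for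
  multipliers serves them all.\<close>

lemma borel_measurable_cnj[measurable (raw)]:
  "g \<in> borel_measurable N \<Longrightarrow> (\<lambda>s. cnj (g s)) \<in> borel_measurable N"
  by (rule measurable_compose[OF _ borel_measurable_continuous_onI]) (auto intro: continuous_intros)

lemma L2_measurable[measurable_dest]: "g \<in> L2 N \<Longrightarrow> g \<in> borel_measurable N"
  by (simp add: L2_def)

lemma L2_integrable_sq: "g \<in> L2 N \<Longrightarrow> integrable N (\<lambda>s. (cmod (g s))\<^sup>2)"
  by (simp add: L2_def)

lemma L2_dominated:
  assumes "f \<in> borel_measurable N" "g \<in> L2 N" "AE s in N. cmod (f s) \<le> cmod (g s)"
  shows "f \<in> L2 N"
proof -
  have "integrable N (\<lambda>s. (cmod (f s))\<^sup>2)"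
  proof (rule Bochner_Integration.integrable_bound[OF L2_integrable_sq[OF assms(2)]])
    show "(\<lambda>s. (cmod (f s))\<^sup>2) \<in> borel_measurable N" using assms(1) by measurable
    show "AE s in N. norm ((cmod (f s))\<^sup>2) \<le> norm ((cmod (g s))\<^sup>2)"
      using assms(3) by eventually_elim (simp add: power_mono)
  qed
  then show ?thesis using assms(1) by (simp add: L2_def)
qed

lemma L2_cong_AE:
  assumes "f \<in> borel_measurable N" "g \<in> L2 N" "AE s in N. f s = g s"
  shows "f \<in> L2 N"
  by (rule L2_dominated[OF assms(1,2)]) (use assms(3) in auto)

lemma L2_zero[simp]: "(\<lambda>s. 0) \<in> L2 N"
  by (simp add: L2_def)

lemma L2_scale[intro]: "g \<in> L2 N \<Longrightarrow> (\<lambda>s. c * g s) \<in> L2 N"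
  by (auto simp: L2_def norm_mult power_mult_distrib)

lemma L2_scale_right[intro]: "g \<in> L2 N \<Longrightarrow> (\<lambda>s. g s * c) \<in> L2 N"
  by (auto simp: L2_def norm_mult power_mult_distrib)

lemma L2_divide[intro]: "g \<in> L2 N \<Longrightarrow> (\<lambda>s. g s / c) \<in> L2 N"
  unfolding divide_inverse by (rule L2_scale_right)

lemma norm_add_sq_le: "(norm (x + y))\<^sup>2 \<le> 2 * (norm x)\<^sup>2 + 2 * (norm (y::'a::real_normed_vector))\<^sup>2"
proof -
  have "(norm (x + y))\<^sup>2 \<le> (norm x + norm y)\<^sup>2" by (simp add: norm_triangle_ineq power_mono)
  also have "\<dots> \<le> 2 * (norm x)\<^sup>2 + 2 * (norm y)\<^sup>2" using sum_squares_bound[of "norm x" "norm y"] by (simp add: power2_sum)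
  finally show ?thesis .
qed

lemma L2_add[intro]:
  assumes "g \<in> L2 N" "h \<in> L2 N" shows "(\<lambda>s. g s + h s) \<in> L2 N"
proof -
  have "integrable N (\<lambda>s. (cmod (g s + h s))\<^sup>2)"
  proof (rule Bochner_Integration.integrable_bound)
    show "integrable N (\<lambda>s. 2 * (cmod (g s))\<^sup>2 + 2 * (cmod (h s))\<^sup>2)"
      using assms by (auto simp: L2_def)
    show "(\<lambda>s. (cmod (g s + h s))\<^sup>2) \<in> borel_measurable N" using assms by measurable
  qed (use norm_add_sq_le in auto)
  then show ?thesis using assms by (auto simp: L2_def)
qed

lemma L2_diff[intro]:
  assumes "g \<in> L2 N" "h \<in> L2 N" shows "(\<lambda>s. g s - h s) \<in> L2 N"
  using L2_add[OF assms(1) L2_scale[OF assms(2), of "-1"]] by simp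

lemma L2_sum[intro]:
  assumes "\<And>i. i \<in> I \<Longrightarrow> f i \<in> L2 N" shows "(\<lambda>s. \<Sum>i\<in>I. f i s) \<in> L2 N"
  using assms by (induction I rule: infinite_finite_induct) auto

lemma (in finite_measure) L2_bounded:
  assumes "f \<in> borel_measurable M" "AE s in M. cmod (f s) \<le> C" shows "f \<in> L2 M"
proof -
  have "(\<lambda>s. complex_of_real \<bar>C\<bar>) \<in> L2 M" by (simp add: L2_def)
  then show ?thesis by (rule L2_dominated[OF assms(1)]) (use assms(2) in auto)
qed

lemma L2_integrable_mult:
  assumes "g \<in> L2 N" "h \<in> L2 N"
  shows "integrable N (\<lambda>s. g s * cnj (h s))" "integrable N (\<lambda>s. g s * h s)"
proof -
  have *: "integrable N (\<lambda>s. (cmod (g s))\<^sup>2 + (cmod (h s))\<^sup>2)" using assms by (auto simp: L2_def)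
  have b: "cmod x * cmod y \<le> (cmod x)\<^sup>2 + (cmod y)\<^sup>2" for x y
  proof -
    have "cmod x * cmod y \<le> 2 * cmod x * cmod y" by simp
    then show ?thesis using sum_squares_bound[of "cmod x" "cmod y"] by linarith
  qed
  have [measurable]: "g \<in> borel_measurable N" "h \<in> borel_measurable N" using assms by auto
  have m: "(\<lambda>s. g s * cnj (h s)) \<in> borel_measurable N" "(\<lambda>s. g s * h s) \<in> borel_measurable N" by measurable
  show "integrable N (\<lambda>s. g s * cnj (h s))"
    by (rule Bochner_Integration.integrable_bound[OF * m(1)]) (auto simp: norm_mult b)
  show "integrable N (\<lambda>s. g s * h s)"
    by (rule Bochner_Integration.integrable_bound[OF * m(2)]) (auto simp: norm_mult b)
qed

lemma L2_cnj[intro]: "g \<in> L2 N \<Longrightarrow> (\<lambda>s. cnj (g s)) \<in> L2 N"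
  by (auto simp: L2_def)

section \<open>The sesquilinear form and its norm\<close>

lemma L2_inner_add_left:
  "\<lbrakk>f \<in> L2 N; g \<in> L2 N; h \<in> L2 N\<rbrakk> \<Longrightarrow> L2_inner N (\<lambda>s. f s + g s) h = L2_inner N f h + L2_inner N g h"
  by (simp add: L2_inner_def distrib_right L2_integrable_mult)

lemma L2_inner_diff_left:
  "\<lbrakk>f \<in> L2 N; g \<in> L2 N; h \<in> L2 N\<rbrakk> \<Longrightarrow> L2_inner N (\<lambda>s. f s - g s) h = L2_inner N f h - L2_inner N g h"
  by (simp add: L2_inner_def left_diff_distrib L2_integrable_mult)

lemma L2_inner_scale_left: "L2_inner N (\<lambda>s. c * g s) h = c * L2_inner N g h"
  by (simp add: L2_inner_def mult.assoc)

lemma L2_inner_divide_left: "L2_inner N (\<lambda>s. g s / c) h = L2_inner N g h / c"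
  by (simp add: L2_inner_def)

lemma L2_inner_cnj: "L2_inner N g h = cnj (L2_inner N h g)"
  unfolding L2_inner_def by (simp add: mult.commute flip: Bochner_Integration.integral_cnj)

lemma L2_inner_add_right:
  assumes "f \<in> L2 N" "g \<in> L2 N" "h \<in> L2 N" 
  shows "L2_inner N h (\<lambda>s. f s + g s) = L2_inner N h f + L2_inner N h g"
  using L2_inner_add_left[OF assms] by (metis L2_inner_cnj complex_cnj_add)

lemma L2_inner_scale_right: "L2_inner N h (\<lambda>s. c * g s) = cnj c * L2_inner N h g"
  using L2_inner_scale_left[of N c g h] by (metis L2_inner_cnj complex_cnj_mult)

lemma L2_inner_divide_right: "L2_inner N h (\<lambda>s. g s / c) = L2_inner N h g / cnj c"
  using L2_inner_divide_left[of N g c h] by (metis L2_inner_cnj complex_cnj_divide)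

lemma L2_inner_zero[simp]: "L2_inner N (\<lambda>s. 0) h = 0" "L2_inner N h (\<lambda>s. 0) = 0"
  by (simp_all add: L2_inner_def)

lemma L2_inner_sum_left:
  assumes "\<And>i. i \<in> I \<Longrightarrow> f i \<in> L2 N" "h \<in> L2 N"
  shows "L2_inner N (\<lambda>s. \<Sum>i\<in>I. f i s) h = (\<Sum>i\<in>I. L2_inner N (f i) h)"
  using assms
proof (induction I rule: infinite_finite_induct)
  case (insert i I)
  then show ?case by (simp add: L2_inner_add_left L2_sum)
qed auto

lemma L2_inner_sum_right:
  assumes "\<And>i. i \<in> I \<Longrightarrow> f i \<in> L2 N" "h \<in> L2 N"
  shows "L2_inner N h (\<lambda>s. \<Sum>i\<in>I. f i s) = (\<Sum>i\<in>I. L2_inner N h (f i))"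
proof -
  have "cnj (L2_inner N (\<lambda>s. \<Sum>i\<in>I. f i s) h) = (\<Sum>i\<in>I. cnj (L2_inner N (f i) h))"
    using L2_inner_sum_left[of I f N h] assms by simp
  then show ?thesis by (simp flip: L2_inner_cnj)
qed

lemma L2_inner_cong_AE:
  assumes "f \<in> borel_measurable N" "g \<in> borel_measurable N" "AE s in N. f s = f' s" "AE s in N. g s = g' s"
    "f' \<in> borel_measurable N" "g' \<in> borel_measurable N"
  shows "L2_inner N f g = L2_inner N f' g'"
  unfolding L2_inner_def
  by (rule integral_cong_AE) (use assms in \<open>measurable, auto\<close>)

lemma L2_inner_self: "L2_inner N g g = complex_of_real (\<integral>s. (cmod (g s))\<^sup>2 \<partial>N)"
  unfolding L2_inner_def integral_complex_of_real[symmetric] by (simp only: complex_norm_square)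

lemma L2_norm_sq: "(L2_norm N g)\<^sup>2 = (\<integral>s. (cmod (g s))\<^sup>2 \<partial>N)"
  by (simp add: L2_norm_def L2_inner_self)

lemma L2_norm_alt: "L2_norm N g = sqrt (\<integral>s. (cmod (g s))\<^sup>2 \<partial>N)"
  by (simp add: L2_norm_def L2_inner_self)

lemma L2_inner_norm: "L2_inner N g g = complex_of_real ((L2_norm N g)\<^sup>2)"
  by (simp add: L2_norm_sq L2_inner_self)

lemma L2_norm_nonneg[simp]: "L2_norm N g \<ge> 0"
  by (simp add: L2_norm_alt)

lemma L2_norm_cong_AE:
  assumes "f \<in> borel_measurable N" "f' \<in> borel_measurable N" "AE s in N. f s = f' s"
  shows "L2_norm N f = L2_norm N f'"
  unfolding L2_norm_def using L2_inner_cong_AE[OF assms(1,1,3,3,2,2)] by simp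

lemma L2_norm_zero[simp]: "L2_norm N (\<lambda>s. 0) = 0"
  by (simp add: L2_norm_def)

lemma L2_norm_eq_0_iff:
  assumes "g \<in> L2 N" shows "L2_norm N g = 0 \<longleftrightarrow> (AE s in N. g s = 0)"
  unfolding L2_norm_alt using integral_nonneg_eq_0_iff_AE[OF L2_integrable_sq[OF assms]] by simp

lemma L2_norm_scale: "L2_norm N (\<lambda>s. c * g s) = cmod c * L2_norm N g"
  by (simp add: L2_norm_alt norm_mult power_mult_distrib real_sqrt_mult)

lemma L2_norm_divide: "L2_norm N (\<lambda>s. g s / c) = L2_norm N g / cmod c"
  using L2_norm_scale[of N "inverse c" g] by (simp add: divide_inverse mult.commute norm_inverse)

lemma L2_norm_uminus[simp]: "L2_norm N (\<lambda>s. - g s) = L2_norm N g"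
  by (simp add: L2_norm_alt)

lemma L2_inner_uminus_right[simp]: "L2_inner N h (\<lambda>s. - g s) = - L2_inner N h g"
  by (simp add: L2_inner_def)

lemma L2_norm_minus_commute: "L2_norm N (\<lambda>s. g s - h s) = L2_norm N (\<lambda>s. h s - g s)"
  by (simp add: L2_norm_alt norm_minus_commute)

lemma L2_norm_add_sq:
  assumes "g \<in> L2 N" "h \<in> L2 N"
  shows "(L2_norm N (\<lambda>s. g s + h s))\<^sup>2 = (L2_norm N g)\<^sup>2 + 2 * Re (L2_inner N g h) + (L2_norm N h)\<^sup>2"
proof -
  have "complex_of_real ((L2_norm N (\<lambda>s. g s + h s))\<^sup>2) = 
     L2_inner N g g + L2_inner N g h + (L2_inner N h g + L2_inner N h h)"
    unfolding L2_inner_norm[symmetric]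
    using assms by (simp add: L2_inner_add_left L2_inner_add_right L2_add)
  then have "Re (complex_of_real ((L2_norm N (\<lambda>s. g s + h s))\<^sup>2)) = Re (
     L2_inner N g g + L2_inner N g h + (L2_inner N h g + L2_inner N h h))" by simp
  then show ?thesis by (subst (asm) L2_inner_cnj[of N h g]) (simp add: L2_inner_norm)
qed

lemma L2_norm_diff_sq:
  assumes "g \<in> L2 N" "h \<in> L2 N"
  shows "(L2_norm N (\<lambda>s. g s - h s))\<^sup>2 = (L2_norm N g)\<^sup>2 - 2 * Re (L2_inner N g h) + (L2_norm N h)\<^sup>2"
  using L2_norm_add_sq[OF assms(1) L2_scale[OF assms(2), of "-1"]] 
  by (simp add: L2_norm_scale L2_inner_scale_right)

text \<open>The squared norm of \<open>g - c * h\<close> is non-negative;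
  \<open>c = a / q\<^sup>2\<close>, the coefficient of the projection of \<open>g\<close> on
  \<open>h\<close>, minimises it. A null \<open>h\<close> admits no such coefficient, but then the
  inner product is an integral of a function that vanishes almost everywhere.\<close>

lemma L2_Cauchy_Schwarz:
  assumes g: "g \<in> L2 N" and h: "h \<in> L2 N"
  shows "cmod (L2_inner N g h) \<le> L2_norm N g * L2_norm N h"
proof (cases "L2_norm N h = 0")
  case True
  then have "AE s in N. h s = 0" using L2_norm_eq_0_iff h by auto
  then have "L2_inner N g h = L2_inner N g (\<lambda>s. 0)"
    using g h by (intro L2_inner_cong_AE) auto
  then show ?thesis by (simp add: True)
next
  case False
  define a p q where "a = L2_inner N g h" and "p = L2_norm N g" and "q = L2_norm N h"
  have q: "q > 0" using False L2_norm_nonneg[of N h] unfolding q_def by linarith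
  have expand: "(L2_norm N (\<lambda>s. g s - c * h s))\<^sup>2 = p\<^sup>2 - 2 * Re (cnj c * a) + (cmod c * q)\<^sup>2" for c
    using L2_norm_diff_sq[OF g L2_scale[OF h, of c]]
    unfolding L2_norm_scale L2_inner_scale_right a_def p_def q_def .
  have "0 \<le> (L2_norm N (\<lambda>s. g s - a / q\<^sup>2 * h s))\<^sup>2" by simp
  also note expand
  also have "cnj (a / q\<^sup>2) * a = complex_of_real ((cmod a)\<^sup>2 / q\<^sup>2)"
    using complex_norm_square[of a] by (simp add: mult.commute)
  also have "cmod (a / q\<^sup>2) * q = cmod a / q"
    unfolding norm_divide norm_of_real using q by (simp add: power2_eq_square)
  also have "(cmod a / q)\<^sup>2 = (cmod a)\<^sup>2 / q\<^sup>2" by (rule power_divide)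
  finally have "0 \<le> p\<^sup>2 - 2 * ((cmod a)\<^sup>2 / q\<^sup>2) + (cmod a)\<^sup>2 / q\<^sup>2" by (simp only: Re_complex_of_real)
  then have "(cmod a)\<^sup>2 / q\<^sup>2 \<le> p\<^sup>2" by linarith
  then have "(cmod a / q)\<^sup>2 \<le> p\<^sup>2" by (simp only: power_divide)
  then have "cmod a / q \<le> p" by (rule power2_le_imp_le) (simp add: p_def)
  then show ?thesis using q unfolding a_def p_def q_def by (simp only: pos_divide_le_eq)
qed

lemma L2_norm_triangle:
  assumes "g \<in> L2 N" "h \<in> L2 N"
  shows "L2_norm N (\<lambda>s. g s + h s) \<le> L2_norm N g + L2_norm N h"
proof (rule power2_le_imp_le)
  have "Re (L2_inner N g h) \<le> L2_norm N g * L2_norm N h"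
    using L2_Cauchy_Schwarz[OF assms] complex_Re_le_cmod order_trans by blast
  then show "(L2_norm N (\<lambda>s. g s + h s))\<^sup>2 \<le> (L2_norm N g + L2_norm N h)\<^sup>2"
    by (simp add: L2_norm_add_sq[OF assms] power2_sum)
qed simp

lemma L2_norm_triangle_diff:
  assumes "g \<in> L2 N" "h \<in> L2 N"
  shows "L2_norm N (\<lambda>s. g s - h s) \<le> L2_norm N g + L2_norm N h"
  using L2_norm_triangle[OF assms(1) L2_scale[OF assms(2), of "-1"]] by (simp add: L2_norm_scale)

lemma L2_norm_triangle3:
  assumes "f \<in> L2 N" "g \<in> L2 N" "h \<in> L2 N"
  shows "L2_norm N (\<lambda>s. f s - h s) \<le> L2_norm N (\<lambda>s. f s - g s) + L2_norm N (\<lambda>s. g s - h s)"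
  using L2_norm_triangle[OF L2_diff[OF assms(1,2)] L2_diff[OF assms(2,3)]] by simp

lemma L2_norm_triangle_sub:
  assumes "g \<in> L2 N" "h \<in> L2 N"
  shows "L2_norm N g \<le> L2_norm N h + L2_norm N (\<lambda>s. g s - h s)"
  using L2_norm_triangle[OF assms(2) L2_diff[OF assms]] by simp

lemma L2_norm_sum:
  assumes "\<And>i. i \<in> I \<Longrightarrow> f i \<in> L2 N"
  shows "L2_norm N (\<lambda>s. \<Sum>i\<in>I. f i s) \<le> (\<Sum>i\<in>I. L2_norm N (f i))"
  using assms
proof (induction I rule: infinite_finite_induct)
  case (insert i I)
  have "L2_norm N (\<lambda>s. f i s + (\<Sum>i\<in>I. f i s)) \<le> L2_norm N (f i) + L2_norm N (\<lambda>s. \<Sum>i\<in>I. f i s)"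
    using insert by (intro L2_norm_triangle) auto
  then show ?case using insert by auto
qed auto

lemma L2_norm_mono:
  assumes "f \<in> borel_measurable N" "g \<in> L2 N" "AE s in N. cmod (f s) \<le> cmod (g s)"
  shows "L2_norm N f \<le> L2_norm N g"
  unfolding L2_norm_alt
  using L2_dominated[OF assms] assms
  by (auto intro!: integral_mono_AE simp: L2_def power_mono)

subsection \<open>Convergence\<close>

lemma null_squeeze_nonneg:
  fixes f :: "nat \<Rightarrow> real"
  shows "(\<And>n. 0 \<le> f n) \<Longrightarrow> (\<And>n. f n \<le> g n) \<Longrightarrow> g \<longlonglongrightarrow> 0 \<Longrightarrow> f \<longlonglongrightarrow> 0"
  by (rule Lim_null_comparison[of f g]) auto

lemma null_squeeze:
  fixes f :: "nat \<Rightarrow> 'a::real_normed_vector"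
  shows "(\<And>n. norm (f n) \<le> g n) \<Longrightarrow> g \<longlonglongrightarrow> 0 \<Longrightarrow> f \<longlonglongrightarrow> 0"
  by (rule Lim_null_comparison) auto

lemma L2_tendstoD:
  assumes "L2_tendsto N F g"
  shows "F n \<in> L2 N" "g \<in> L2 N" "(\<lambda>n. L2_norm N (\<lambda>s. F n s - g s)) \<longlonglongrightarrow> 0"
  using assms by (auto simp: L2_tendsto_def)

lemma L2_tendsto_norm:
  assumes "L2_tendsto N F g" shows "(\<lambda>n. L2_norm N (F n)) \<longlonglongrightarrow> L2_norm N g"
proof -
  note F = L2_tendstoD[OF assms]
  have "\<bar>L2_norm N (F n) - L2_norm N g\<bar> \<le> L2_norm N (\<lambda>s. F n s - g s)" for n
    using L2_norm_triangle_sub[OF F(1,2), of n] L2_norm_triangle_sub[OF F(2,1), of n] 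
    by (simp add: L2_norm_minus_commute[of N g])
  then have "(\<lambda>n. L2_norm N (F n) - L2_norm N g) \<longlonglongrightarrow> 0"
    by (intro null_squeeze[OF _ F(3)]) auto
  then show ?thesis by (simp add: LIM_zero_iff)
qed

lemma L2_tendsto_inner:
  assumes "L2_tendsto N F g" "h \<in> L2 N" shows "(\<lambda>n. L2_inner N (F n) h) \<longlonglongrightarrow> L2_inner N g h"
proof -
  note F = L2_tendstoD[OF assms(1)]
  have "norm (L2_inner N (F n) h - L2_inner N g h) \<le> L2_norm N (\<lambda>s. F n s - g s) * L2_norm N h" for n
    using L2_Cauchy_Schwarz[OF L2_diff[OF F(1,2)] assms(2), of n] F assms(2) by (simp add: L2_inner_diff_left)
  moreover have "(\<lambda>n. L2_norm N (\<lambda>s. F n s - g s) * L2_norm N h) \<longlonglongrightarrow> 0"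
    using tendsto_mult_right[OF F(3), of "L2_norm N h"] by simp
  ultimately have "(\<lambda>n. L2_inner N (F n) h - L2_inner N g h) \<longlonglongrightarrow> 0"
    by (rule null_squeeze)
  then show ?thesis by (simp add: LIM_zero_iff)
qed

lemma L2_tendsto_unique:
  assumes "L2_tendsto N F g" "L2_tendsto N F h" shows "AE s in N. g s = h s"
proof -
  note F = L2_tendstoD[OF assms(1)] and G = L2_tendstoD[OF assms(2)]
  have *: "L2_norm N (\<lambda>s. g s - h s) \<le> L2_norm N (\<lambda>s. F n s - g s) + L2_norm N (\<lambda>s. F n s - h s)" for n
    using L2_norm_triangle3[OF F(2) F(1) G(2), of n] by (simp add: L2_norm_minus_commute[of N g])
  have "L2_norm N (\<lambda>s. g s - h s) \<le> 0 + 0"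
    by (rule LIMSEQ_le_const[OF tendsto_add[OF F(3) G(3)]]) (use * in auto)
  then have "L2_norm N (\<lambda>s. g s - h s) = 0" by (simp add: antisym)
  then show ?thesis using L2_norm_eq_0_iff[OF L2_diff[OF F(2) G(2)]] by auto
qed

lemma L2_tendsto_add:
  assumes "L2_tendsto N F f" "L2_tendsto N G g"
  shows "L2_tendsto N (\<lambda>n s. F n s + G n s) (\<lambda>s. f s + g s)"
proof -
  note F = L2_tendstoD[OF assms(1)] and G = L2_tendstoD[OF assms(2)]
  have "L2_norm N (\<lambda>s. (F n s + G n s) - (f s + g s)) \<le> L2_norm N (\<lambda>s. F n s - f s) + L2_norm N (\<lambda>s. G n s - g s)" for n
    using L2_norm_triangle[OF L2_diff[OF F(1,2)] L2_diff[OF G(1,2)], of n n] by (simp add: algebra_simps)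
  moreover have "(\<lambda>n. L2_norm N (\<lambda>s. F n s - f s) + L2_norm N (\<lambda>s. G n s - g s)) \<longlonglongrightarrow> 0"
    using tendsto_add[OF F(3) G(3)] by simp
  ultimately have "(\<lambda>n. L2_norm N (\<lambda>s. (F n s + G n s) - (f s + g s))) \<longlonglongrightarrow> 0"
    by (intro null_squeeze_nonneg[OF L2_norm_nonneg])
  then show ?thesis using F G by (auto simp: L2_tendsto_def)
qed

lemma L2_tendsto_scale:
  assumes "L2_tendsto N F f"
  shows "L2_tendsto N (\<lambda>n s. c * F n s) (\<lambda>s. c * f s)"
proof -
  have "(\<lambda>n. cmod c * L2_norm N (\<lambda>s. F n s - f s)) \<longlonglongrightarrow> 0"
    using tendsto_mult_left[OF L2_tendstoD(3)[OF assms], of "cmod c"] by simp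
  then show ?thesis using L2_tendstoD[OF assms]
    by (auto simp: L2_tendsto_def L2_norm_scale simp flip: right_diff_distrib)
qed

lemma L2_tendsto_diff:
  assumes "L2_tendsto N F f" "L2_tendsto N G g"
  shows "L2_tendsto N (\<lambda>n s. F n s - G n s) (\<lambda>s. f s - g s)"
  using L2_tendsto_add[OF assms(1) L2_tendsto_scale[OF assms(2), of "-1"]] by simp

lemma L2_tendsto_const: "g \<in> L2 N \<Longrightarrow> L2_tendsto N (\<lambda>n. g) g"
  by (simp add: L2_tendsto_def)

lemma L2_tendsto_sum:
  assumes "\<And>i. i \<in> I \<Longrightarrow> L2_tendsto N (F i) (f i)"
  shows "L2_tendsto N (\<lambda>n s. \<Sum>i\<in>I. F i n s) (\<lambda>s. \<Sum>i\<in>I. f i s)"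
  using assms by (induction I rule: infinite_finite_induct) (auto intro: L2_tendsto_add L2_tendsto_const)

lemma L2_tendsto_cong_AE:
  assumes "L2_tendsto N F f" "f' \<in> borel_measurable N" "AE s in N. f s = f' s"
  shows "L2_tendsto N F f'"
proof -
  note F = L2_tendstoD[OF assms(1)]
  have f': "f' \<in> L2 N" using L2_cong_AE[OF assms(2) F(2)] assms(3) by (simp add: eq_commute)
  have "L2_norm N (\<lambda>s. F n s - f s) = L2_norm N (\<lambda>s. F n s - f' s)" for n
    using F f' assms by (intro L2_norm_cong_AE) auto
  then show ?thesis using F f' by (simp add: L2_tendsto_def)
qed

lemma L2_tendsto_subseq:
  assumes "L2_tendsto N F f" "filterlim r at_top sequentially"
  shows "L2_tendsto N (\<lambda>n. F (r n)) f"
  using L2_tendstoD[OF assms(1)] filterlim_compose[OF L2_tendstoD(3)[OF assms(1)] assms(2)]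
  by (auto simp: L2_tendsto_def)

lemma L2_nn_integral: "f \<in> L2 N \<Longrightarrow> (\<integral>\<^sup>+s. ennreal ((cmod (f s))\<^sup>2) \<partial>N) = ennreal ((L2_norm N f)\<^sup>2)"
  unfolding L2_norm_sq by (rule nn_integral_eq_integral) (auto simp: L2_def)

text \<open>Fatou's lemma bounds the extended integral before square integrability is known; hence
  membership and norm bound are concluded together.\<close>

lemma L2_nn_integralI:
  assumes "f \<in> borel_measurable N" "(\<integral>\<^sup>+s. ennreal ((cmod (f s))\<^sup>2) \<partial>N) \<le> ennreal (c\<^sup>2)" "c \<ge> 0"
  shows "f \<in> L2 N" "L2_norm N f \<le> c"
proof -
  have "integrable N (\<lambda>s. (cmod (f s))\<^sup>2)"
    by (rule integrableI_bounded) (use assms in \<open>auto simp: le_less_trans\<close>)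
  then show *: "f \<in> L2 N" using assms by (simp add: L2_def)
  have "(L2_norm N f)\<^sup>2 \<le> c\<^sup>2" using assms(2) unfolding L2_nn_integral[OF *] by (simp add: ennreal_le_iff)
  then show "L2_norm N f \<le> c" using assms(3) power2_le_imp_le by blast
qed

section \<open>Measurable dependence on the parameter, and completeness\<close>

lemma curry_measurable[measurable]:
  "f \<in> borel_measurable (M \<Otimes>\<^sub>M N) \<Longrightarrow> \<omega> \<in> space M \<Longrightarrow> curry f \<omega> \<in> borel_measurable N"
  unfolding curry_def by (rule measurable_compose[OF measurable_Pair1'])

context
  fixes N :: "'b measure" assumes fN: "finite_measure N"
begin

interpretation N: finite_measure N by (rule fN)

lemma fun_inner_measurable[measurable (raw)]:
  assumes "f \<in> borel_measurable (M \<Otimes>\<^sub>M N)" "g \<in> borel_measurable (M \<Otimes>\<^sub>M N)"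
  shows "fun_inner N f g \<in> borel_measurable M"
  unfolding fun_inner_def L2_inner_def curry_def using assms by measurable

lemma L2_norm_measurable_param[measurable (raw)]:
  assumes "f \<in> borel_measurable (M \<Otimes>\<^sub>M N)"
  shows "(\<lambda>\<omega>. L2_norm N (\<lambda>s. f (\<omega>, s))) \<in> borel_measurable M"
  unfolding L2_norm_def L2_inner_def using assms by measurable

lemma fun_norm_measurable[measurable (raw)]:
  assumes "f \<in> borel_measurable (M \<Otimes>\<^sub>M N)"
  shows "fun_norm N f \<in> borel_measurable M"
  using L2_norm_measurable_param[OF assms] by (simp add: fun_norm_def[abs_def] curry_def)

text \<open>Completeness of \<open>L2 N\<close>: the limits of the Cauchy sections are chosen jointly measurable, since
  the indices of a rapidly convergent subsequence can be chosen measurably.\<close>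

lemma L2_limit_measurable:
  fixes F :: "nat \<Rightarrow> 'a \<times> 'b \<Rightarrow> complex"
  assumes F[measurable]: "\<And>n. F n \<in> borel_measurable (M \<Otimes>\<^sub>M N)"
  obtains G where "G \<in> borel_measurable (M \<Otimes>\<^sub>M N)"
    "\<And>\<omega>. \<omega> \<in> space M \<Longrightarrow> (\<And>n. curry (F n) \<omega> \<in> L2 N) \<Longrightarrow>
      (\<And>e. e > 0 \<Longrightarrow> \<exists>K. \<forall>m\<ge>K. \<forall>n\<ge>K. L2_norm N (\<lambda>s. F m (\<omega>, s) - F n (\<omega>, s)) < e) \<Longrightarrow>
      L2_tendsto N (\<lambda>n. curry (F n) \<omega>) (curry G \<omega>)"
proof -
  define D where "D m n \<omega> = L2_norm N (\<lambda>s. F m (\<omega>, s) - F n (\<omega>, s))" for m n \<omega>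
  have [measurable]: "D m n \<in> borel_measurable M" for m n
    unfolding D_def[abs_def] using L2_norm_measurable_param[of "\<lambda>z. F m z - F n z" M] by simp
  define P where "P k K \<omega> \<longleftrightarrow> (\<forall>m\<ge>K. \<forall>n\<ge>K. D m n \<omega> < 1 / 2 ^ k)" for k K :: nat and \<omega>
  have [measurable]: "Measurable.pred M (P k K)" for k K
    unfolding P_def[abs_def] by measurable
  \<comment> \<open>The summand \<open>k\<close> forces \<open>J k \<omega>\<close> to infinity even
    if the least admissible indices stay bounded, as they do for a constant sequence.\<close>
  define J where "J k \<omega> = (LEAST K. P k K \<omega>) + k" for k \<omega>
  have [measurable]: "J k \<in> measurable M (count_space UNIV)" for k
    unfolding J_def[abs_def] by measurable
  define H where "H k z = F (J k (fst z)) z" for k z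
  have [measurable]: "H k \<in> borel_measurable (M \<Otimes>\<^sub>M N)" for k
    unfolding H_def[abs_def] by (rule measurable_compose_countable) measurable
  \<comment> \<open>\<open>lim\<close> is arbitrary where the sequence diverges; over a fibre with
    Cauchy sections that is a null set of points.\<close>
  define G where "G z = lim (\<lambda>k. H k z)" for z
  have G[measurable]: "G \<in> borel_measurable (M \<Otimes>\<^sub>M N)"
    unfolding G_def[abs_def] by measurable
  have "L2_tendsto N (\<lambda>n. curry (F n) \<omega>) (curry G \<omega>)"
    if \<omega>: "\<omega> \<in> space M" and L: "\<And>n. curry (F n) \<omega> \<in> L2 N"
      and C: "\<And>e. e > 0 \<Longrightarrow> \<exists>K. \<forall>m\<ge>K. \<forall>n\<ge>K. L2_norm N (\<lambda>s. F m (\<omega>, s) - F n (\<omega>, s)) < e" for \<omega>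
  proof -
    have L': "(\<lambda>s. F n (\<omega>, s)) \<in> L2 N" for n using L[of n] by (simp add: curry_def)
    have m[measurable]: "(\<lambda>s. F n (\<omega>, s)) \<in> borel_measurable N" "(\<lambda>s. H n (\<omega>, s)) \<in> borel_measurable N"
      "(\<lambda>s. G (\<omega>, s)) \<in> borel_measurable N" for n
      using \<omega> by measurable
    have "\<exists>K. P k K \<omega>" for k using C[of "1/2^k"] by (simp add: P_def D_def)
    then have PL: "P k (LEAST K. P k K \<omega>) \<omega>" for k by (metis LeastI_ex)
    have Pmono: "P k K' \<omega>" if "P k K \<omega>" "K \<le> K'" for k K K' using that by (auto simp: P_def)
    have PJ: "P k (J k \<omega>) \<omega>" for k by (rule Pmono[OF PL]) (simp add: J_def)
    have PSuc: "P k K \<omega>" if "P (Suc k) K \<omega>" for k K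
    proof -
      have "1 / 2 ^ Suc k \<le> (1 / 2 ^ k :: real)" by (simp add: field_simps)
      then show ?thesis using that unfolding P_def by (meson less_le_trans)
    qed
    have Jmono: "J k \<omega> \<le> J (Suc k) \<omega>" for k
      unfolding J_def using Least_le[of "\<lambda>K. P k K \<omega>", OF PSuc[OF PL]] by simp
    have HF: "(\<lambda>s. H k (\<omega>, s)) = (\<lambda>s. F (J k \<omega>) (\<omega>, s))" for k by (simp add: H_def)
    have HL: "(\<lambda>s. H k (\<omega>, s)) \<in> L2 N" for k unfolding HF by (rule L')
    define a where "a k s = cmod (H (Suc k) (\<omega>, s) - H k (\<omega>, s))" for k s
    have [measurable]: "a k \<in> borel_measurable N" for k unfolding a_def by measurable
    have one: "(\<lambda>s. 1) \<in> L2 N" by (rule N.L2_bounded[of _ 1]) auto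
    have aL: "(\<lambda>s. complex_of_real (a k s)) \<in> L2 N" for k
      by (rule L2_dominated[OF _ L2_diff[OF HL[of "Suc k"] HL[of k]]]) (auto simp: a_def)
    have a_int: "integrable N (a k)" "integral\<^sup>L N (a k) \<le> 1/2^k * L2_norm N (\<lambda>s. 1)" for k
    proof -
      have "integrable N (\<lambda>s. complex_of_real (a k s))"
        using L2_integrable_mult(1)[OF aL one] by simp
      from integrable_Re[OF this] show "integrable N (a k)" by simp
      have "L2_norm N (\<lambda>s. complex_of_real (a k s)) = D (J (Suc k) \<omega>) (J k \<omega>) \<omega>"
        unfolding D_def HF[symmetric] by (simp add: L2_norm_alt a_def H_def)
      also have "\<dots> \<le> 1/2^k" using PJ[of k] Jmono[of k] unfolding P_def by (simp add: less_imp_le)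
      finally have *: "L2_norm N (\<lambda>s. complex_of_real (a k s)) \<le> 1/2^k" .
      have "complex_of_real (integral\<^sup>L N (a k)) = L2_inner N (\<lambda>s. complex_of_real (a k s)) (\<lambda>s. 1)"
        by (simp add: L2_inner_def)
      then have "integral\<^sup>L N (a k) \<le> L2_norm N (\<lambda>s. complex_of_real (a k s)) * L2_norm N (\<lambda>s. 1)"
        using L2_Cauchy_Schwarz[OF aL one, of k] by (metis Re_complex_of_real complex_Re_le_cmod order_trans)
      also have "\<dots> \<le> 1/2^k * L2_norm N (\<lambda>s. 1)" using * by (intro mult_right_mono) auto
      finally show "integral\<^sup>L N (a k) \<le> 1/2^k * L2_norm N (\<lambda>s. 1)" .
    qed
    \<comment> \<open>Consecutive terms of the subsequence differ by at most \<open>1/2^k\<close> in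
      norm, and over a finite measure the integral is dominated by a multiple of the norm. So the
      increments are summable in mean, hence absolutely summable at almost every point.\<close>
    have "(\<integral>\<^sup>+s. (\<Sum>k. ennreal (a k s)) \<partial>N) = (\<Sum>k. \<integral>\<^sup>+s. ennreal (a k s) \<partial>N)"
      by (rule nn_integral_suminf) measurable
    also have "\<dots> = (\<Sum>k. ennreal (integral\<^sup>L N (a k)))"
      by (intro suminf_cong nn_integral_eq_integral[OF a_int(1)]) (simp add: a_def)
    also have "\<dots> \<le> (\<Sum>k. ennreal (1/2^k * L2_norm N (\<lambda>s. 1)))"
      by (intro suminf_le ennreal_leI a_int) auto
    also have "\<dots> = ennreal (\<Sum>k. 1/2^k * L2_norm N (\<lambda>s. 1))"
    proof (rule suminf_ennreal2)
      show "summable (\<lambda>k. 1/2^k * L2_norm N (\<lambda>s. 1))"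
        using summable_mult2[OF summable_geometric[of "1/2::real"], of "L2_norm N (\<lambda>s. 1)"] by (simp add: power_one_over)
    qed simp
    finally have "(\<integral>\<^sup>+s. (\<Sum>k. ennreal (a k s)) \<partial>N) \<noteq> \<infinity>" by (auto simp: top_unique)
    then have "AE s in N. (\<Sum>k. ennreal (a k s)) \<noteq> \<infinity>"
      by (intro nn_integral_PInf_AE) measurable
    then have lim: "AE s in N. (\<lambda>k. H k (\<omega>, s)) \<longlonglongrightarrow> G (\<omega>, s)"
    proof eventually_elim
      case (elim s)
      have "summable (\<lambda>k. a k s)"
        by (rule summable_suminf_not_top) (use elim in \<open>auto simp: a_def\<close>)
      then have "summable (\<lambda>k. H (Suc k) (\<omega>, s) - H k (\<omega>, s))"
        unfolding a_def by (rule summable_norm_cancel)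
      then have "convergent (\<lambda>n. \<Sum>k<n. H (Suc k) (\<omega>, s) - H k (\<omega>, s))"
        by (simp add: summable_iff_convergent)
      then have "convergent (\<lambda>n. H n (\<omega>, s) - H 0 (\<omega>, s))" using sum_lessThan_telescope[of "\<lambda>k. H k (\<omega>, s)"] by simp
      then have "convergent (\<lambda>n. H n (\<omega>, s))"
        using convergent_diff_const_right_iff by blast
      then show ?case by (simp add: G_def convergent_LIMSEQ_iff)
    qed
    \<comment> \<open>Fatou's lemma along the subsequence \<open>H k\<close>, with \<open>n\<close>
      fixed: this controls the whole sequence \<open>F n\<close>, not only the subsequence, and at
      the same time puts the difference into \<open>L2 N\<close>.\<close>
    have est: "(\<lambda>s. F n (\<omega>, s) - G (\<omega>, s)) \<in> L2 N \<and> L2_norm N (\<lambda>s. F n (\<omega>, s) - G (\<omega>, s)) \<le> e"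
      if "e > 0" "\<forall>m\<ge>K. \<forall>n\<ge>K. D m n \<omega> < e" "n \<ge> K" for e K n
    proof -
      have "(\<integral>\<^sup>+s. ennreal ((cmod (F n (\<omega>, s) - G (\<omega>, s)))\<^sup>2) \<partial>N) =
        (\<integral>\<^sup>+s. liminf (\<lambda>k. ennreal ((cmod (F n (\<omega>, s) - H k (\<omega>, s)))\<^sup>2)) \<partial>N)"
      proof (rule nn_integral_cong_AE, use lim in eventually_elim)
        case (elim s)
        have "(\<lambda>k. ennreal ((cmod (F n (\<omega>, s) - H k (\<omega>, s)))\<^sup>2)) \<longlonglongrightarrow> ennreal ((cmod (F n (\<omega>, s) - G (\<omega>, s)))\<^sup>2)"
          by (intro tendsto_intros elim tendsto_ennrealI)
        from lim_imp_Liminf[OF _ this] show ?case by simp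
      qed
      also have "\<dots> \<le> liminf (\<lambda>k. \<integral>\<^sup>+s. ennreal ((cmod (F n (\<omega>, s) - H k (\<omega>, s)))\<^sup>2) \<partial>N)"
        by (rule nn_integral_liminf) measurable
      also have "\<dots> \<le> liminf (\<lambda>k. ennreal (e\<^sup>2))"
      proof (rule Liminf_mono, rule eventually_sequentiallyI[of K])
        fix k assume "K \<le> k"
        moreover have "k \<le> J k \<omega>" by (simp add: J_def)
        ultimately have "D n (J k \<omega>) \<omega> < e" using that by auto
        then have "(L2_norm N (\<lambda>s. F n (\<omega>, s) - H k (\<omega>, s)))\<^sup>2 \<le> e\<^sup>2"
          by (intro power_mono) (auto simp: D_def H_def)
        then show "(\<integral>\<^sup>+s. ennreal ((cmod (F n (\<omega>, s) - H k (\<omega>, s)))\<^sup>2) \<partial>N) \<le> ennreal (e\<^sup>2)"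
          unfolding L2_nn_integral[OF L2_diff[OF L' HL]] by (rule ennreal_leI)
      qed
      also have "\<dots> = ennreal (e\<^sup>2)" by (simp add: Liminf_const)
      finally show ?thesis using L2_nn_integralI[of "\<lambda>s. F n (\<omega>, s) - G (\<omega>, s)" N e] \<open>e > 0\<close> by auto
    qed
    obtain K where "\<forall>m\<ge>K. \<forall>n\<ge>K. D m n \<omega> < 1" using C[of 1] by (auto simp: D_def)
    then have "(\<lambda>s. F K (\<omega>, s) - G (\<omega>, s)) \<in> L2 N" using est[of 1 K K] by auto
    from L2_diff[OF L'[of K] this] have GL: "(\<lambda>s. G (\<omega>, s)) \<in> L2 N" by simp
    have "(\<lambda>n. L2_norm N (\<lambda>s. F n (\<omega>, s) - G (\<omega>, s))) \<longlonglongrightarrow> 0"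
    proof (rule LIMSEQ_I)
      fix r :: real assume "r > 0"
      then obtain K where "\<forall>m\<ge>K. \<forall>n\<ge>K. D m n \<omega> < r/2" using C[of "r/2"] by (auto simp: D_def)
      then have "\<forall>n\<ge>K. L2_norm N (\<lambda>s. F n (\<omega>, s) - G (\<omega>, s)) \<le> r/2" using est[of "r/2" K] \<open>r > 0\<close> by auto
      then show "\<exists>no. \<forall>n\<ge>no. norm (L2_norm N (\<lambda>s. F n (\<omega>, s) - G (\<omega>, s)) - 0) < r"
        using \<open>r > 0\<close> by (intro exI[of _ K]) force
    qed
    then show ?thesis using L' GL by (simp add: L2_tendsto_def curry_def)
  qed
  then show ?thesis using that G by blast
qed

lemma L2_complete:
  assumes "\<And>n. F n \<in> L2 N" "\<And>e. e > 0 \<Longrightarrow> \<exists>K. \<forall>m\<ge>K. \<forall>n\<ge>K. L2_norm N (\<lambda>s. F m s - F n s) < e"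
  obtains g where "L2_tendsto N F g"
proof -
  \<comment> \<open>A single sequence is a field over a one-point parameter space.\<close>
  let ?F = "\<lambda>n (z::unit \<times> 'b). F n (snd z)"
  have "?F n \<in> borel_measurable (count_space UNIV \<Otimes>\<^sub>M N)" for n
    using L2_measurable[OF assms(1)[of n]] by measurable
  then show ?thesis
  proof (rule L2_limit_measurable)
    fix G assume "\<And>\<omega>. \<omega> \<in> space (count_space UNIV) \<Longrightarrow> (\<And>n. curry (?F n) \<omega> \<in> L2 N) \<Longrightarrow>
      (\<And>e. e > 0 \<Longrightarrow> \<exists>K. \<forall>m\<ge>K. \<forall>n\<ge>K. L2_norm N (\<lambda>s. ?F m (\<omega>, s) - ?F n (\<omega>, s)) < e) \<Longrightarrow>
      L2_tendsto N (\<lambda>n. curry (?F n) \<omega>) (curry G \<omega>)"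
    from this[of "()"] show thesis using assms that by (simp add: curry_def)
  qed
qed

end

lemma cmod_diff_sq: "(cmod (u - v))\<^sup>2 - (cmod u)\<^sup>2 = (cmod v)\<^sup>2 - 2 * Re (cnj v * u)"
  unfolding cmod_power2 by (simp add: power2_eq_square algebra_simps)

section \<open>Orthonormal systems\<close>

text \<open>Zero vectors are admitted, so that finite systems can be padded.\<close>

locale ons =
  fixes N :: "'b measure" and y :: "nat \<Rightarrow> 'b \<Rightarrow> complex"
  assumes finite_N: "finite_measure N"
    and y_L2: "\<And>n. y n \<in> L2 N"
    and y_orth: "\<And>m n. m \<noteq> n \<Longrightarrow> L2_inner N (y m) (y n) = 0"
    and y_unit: "\<And>n. L2_inner N (y n) (y n) = 1 \<or> L2_inner N (y n) (y n) = 0"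
begin

lemma norm_y: "L2_norm N (y n) = 1 \<or> L2_norm N (y n) = 0"
proof -
  have "(L2_norm N (y n))\<^sup>2 = 1 \<or> (L2_norm N (y n))\<^sup>2 = 0"
    using y_unit[of n] unfolding L2_inner_norm by (simp only: of_real_eq_1_iff of_real_eq_0_iff)
  then show ?thesis using L2_norm_nonneg[of N "y n"] by (auto simp: power2_eq_1_iff simp del: L2_norm_nonneg)
qed

lemma norm_y_iff: "L2_norm N (y n) = 0 \<longleftrightarrow> L2_inner N (y n) (y n) = 0"
  by (simp add: L2_inner_norm)

lemma inner_y_zero: "L2_norm N (y n) = 0 \<Longrightarrow> g \<in> L2 N \<Longrightarrow> L2_inner N g (y n) = 0"
  using L2_Cauchy_Schwarz[OF _ y_L2, of g n] by simp

text \<open>For a zero vector both sides vanish, so the normalisation can be cancelled without a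
  case distinction.\<close>

lemma inner_y_mult: "g \<in> L2 N \<Longrightarrow> L2_inner N g (y n) * L2_inner N (y n) (y n) = L2_inner N g (y n)"
  using y_unit[of n] inner_y_zero[of n g] norm_y_iff[of n] by auto

lemma comb_L2: "(\<lambda>s. \<Sum>n\<in>I. c n * y n s) \<in> L2 N"
  by (intro L2_sum L2_scale y_L2)

lemma inner_comb:
  assumes "finite I"
  shows "L2_inner N (\<lambda>s. \<Sum>n\<in>I. c n * y n s) (y m) = (if m \<in> I then c m * L2_inner N (y m) (y m) else 0)"
proof -
  have "L2_inner N (\<lambda>s. \<Sum>n\<in>I. c n * y n s) (y m) = (\<Sum>n\<in>I. c n * L2_inner N (y n) (y m))"
    by (subst L2_inner_sum_left) (auto intro: y_L2 simp: L2_inner_scale_left)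
  also have "\<dots> = (\<Sum>n\<in>I. if n = m then c m * L2_inner N (y m) (y m) else 0)"
    by (rule sum.cong) (auto simp: y_orth)
  finally show ?thesis using assms by simp
qed

lemma norm_comb:
  assumes "finite I"
  shows "(L2_norm N (\<lambda>s. \<Sum>n\<in>I. c n * y n s))\<^sup>2 = (\<Sum>n\<in>I. (cmod (c n))\<^sup>2 * (L2_norm N (y n))\<^sup>2)"
proof -
  have "complex_of_real ((L2_norm N (\<lambda>s. \<Sum>n\<in>I. c n * y n s))\<^sup>2) =
      (\<Sum>m\<in>I. cnj (c m) * L2_inner N (\<lambda>s. \<Sum>n\<in>I. c n * y n s) (y m))"
    unfolding L2_inner_norm[symmetric]
    by (subst L2_inner_sum_right) (auto intro: y_L2 comb_L2 simp: L2_inner_scale_right)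
  also have "\<dots> = (\<Sum>m\<in>I. complex_of_real ((cmod (c m))\<^sup>2 * (L2_norm N (y m))\<^sup>2))"
    by (rule sum.cong) (auto simp: inner_comb[OF assms] L2_inner_norm complex_norm_square mult_ac simp del: of_real_power)
  finally show ?thesis by (simp only: of_real_eq_iff flip: of_real_sum)
qed

text \<open>Completing the square in each coefficient. Bessel's inequality is the case of the
  Fourier coefficients, and best approximation follows because the last sum is non-negative.\<close>

lemma norm_diff_comb:
  assumes "finite I" "g \<in> L2 N"
  shows "(L2_norm N (\<lambda>s. g s - (\<Sum>n\<in>I. c n * y n s)))\<^sup>2 =
    (L2_norm N g)\<^sup>2 - (\<Sum>n\<in>I. (cmod (L2_inner N g (y n)))\<^sup>2) +
    (\<Sum>n\<in>I. (cmod (L2_inner N g (y n) - c n))\<^sup>2 * (L2_norm N (y n))\<^sup>2)"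
proof -
  have "L2_inner N g (\<lambda>s. \<Sum>n\<in>I. c n * y n s) = (\<Sum>n\<in>I. cnj (c n) * L2_inner N g (y n))"
    using assms by (subst L2_inner_sum_right) (auto intro: y_L2 simp: L2_inner_scale_right)
  moreover have "(cmod (L2_inner N g (y n) - c n))\<^sup>2 * (L2_norm N (y n))\<^sup>2 - (cmod (L2_inner N g (y n)))\<^sup>2
      = (cmod (c n))\<^sup>2 * (L2_norm N (y n))\<^sup>2 - 2 * Re (cnj (c n) * L2_inner N g (y n))" for n
    using norm_y[of n] inner_y_zero[OF _ assms(2), of n] cmod_diff_sq[of "L2_inner N g (y n)" "c n"] by auto
  then have "(\<Sum>n\<in>I. (cmod (L2_inner N g (y n) - c n))\<^sup>2 * (L2_norm N (y n))\<^sup>2) - (\<Sum>n\<in>I. (cmod (L2_inner N g (y n)))\<^sup>2)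
    = (\<Sum>n\<in>I. (cmod (c n))\<^sup>2 * (L2_norm N (y n))\<^sup>2) - 2 * Re (\<Sum>n\<in>I. cnj (c n) * L2_inner N g (y n))"
    by (simp add: sum_subtractf[symmetric] sum_distrib_left)
  ultimately show ?thesis
    using L2_norm_diff_sq[OF assms(2) comb_L2[of c I]] norm_comb[OF assms(1), of c] by simp
qed

lemma Bessel:
  assumes "finite I" "g \<in> L2 N"
  shows "(\<Sum>n\<in>I. (cmod (L2_inner N g (y n)))\<^sup>2) \<le> (L2_norm N g)\<^sup>2"
  using norm_diff_comb[OF assms, of "\<lambda>n. L2_inner N g (y n)"]
    zero_le_power2[of "L2_norm N (\<lambda>s. g s - (\<Sum>n\<in>I. L2_inner N g (y n) * y n s))"] by simp

text \<open>Passing to the Fourier coefficients and enlarging the index set can both only decrease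
  the distance.\<close>

lemma best_approx:
  assumes "finite I" "J \<subseteq> I" "g \<in> L2 N"
  shows "L2_norm N (\<lambda>s. g s - (\<Sum>n\<in>I. L2_inner N g (y n) * y n s))
     \<le> L2_norm N (\<lambda>s. g s - (\<Sum>n\<in>J. c n * y n s))"
proof (rule power2_le_imp_le)
  have "finite J" using assms finite_subset by blast
  have "(\<Sum>n\<in>J. (cmod (L2_inner N g (y n)))\<^sup>2) \<le> (\<Sum>n\<in>I. (cmod (L2_inner N g (y n)))\<^sup>2)"
    by (rule sum_mono2) (use assms in auto)
  moreover have "0 \<le> (\<Sum>n\<in>J. (cmod (L2_inner N g (y n) - c n))\<^sup>2 * (L2_norm N (y n))\<^sup>2)"
    by (intro sum_nonneg) auto
  ultimately show "(L2_norm N (\<lambda>s. g s - (\<Sum>n\<in>I. L2_inner N g (y n) * y n s)))\<^sup>2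
     \<le> (L2_norm N (\<lambda>s. g s - (\<Sum>n\<in>J. c n * y n s)))\<^sup>2"
    using norm_diff_comb[OF assms(1,3), of "\<lambda>n. L2_inner N g (y n)"]
      norm_diff_comb[OF \<open>finite J\<close> assms(3), of c] by simp
qed simp

lemma Bessel_summable: "g \<in> L2 N \<Longrightarrow> summable (\<lambda>n. (cmod (L2_inner N g (y n)))\<^sup>2)"
  by (rule bounded_imp_summable[where B="(L2_norm N g)\<^sup>2"])
    (use Bessel[of "{.._}" g] in auto)

text \<open>\<open>a\<close> is the multiplier of an operator that is diagonal in \<open>y\<close>.
  Spectral projections, resolvents, functions of the operator and Riemann-Stieltjes sums are of this
  kind. The bound on \<open>a\<close> is asked for at non-zero vectors only, since at zero vectors
  the multiplier may be uncontrolled.\<close>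

lemma diag_norm_le:
  assumes "finite I" "g \<in> L2 N" "\<And>n. n \<in> I \<Longrightarrow> L2_norm N (y n) \<noteq> 0 \<Longrightarrow> cmod (a n) \<le> C"
  shows "(L2_norm N (\<lambda>s. \<Sum>n\<in>I. a n * L2_inner N g (y n) * y n s))\<^sup>2 \<le> C\<^sup>2 * (\<Sum>n\<in>I. (cmod (L2_inner N g (y n)))\<^sup>2)"
proof -
  have "(cmod (a n * L2_inner N g (y n)))\<^sup>2 * (L2_norm N (y n))\<^sup>2 \<le> C\<^sup>2 * (cmod (L2_inner N g (y n)))\<^sup>2" if "n \<in> I" for n
  proof (cases "L2_norm N (y n) = 0")
    case False
    then have "L2_norm N (y n) = 1" using norm_y[of n] by simp
    moreover have "(cmod (a n))\<^sup>2 \<le> C\<^sup>2" using assms(3)[OF that False] by (intro power_mono) auto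
    ultimately show ?thesis by (simp add: norm_mult power_mult_distrib mult_right_mono)
  qed simp
  then show ?thesis unfolding norm_comb[OF assms(1)] sum_distrib_left by (rule sum_mono)
qed

lemma diag_Cauchy:
  assumes "g \<in> L2 N" "\<And>n. L2_norm N (y n) \<noteq> 0 \<Longrightarrow> cmod (a n) \<le> C" "e > 0"
  shows "\<exists>K. \<forall>m\<ge>K. \<forall>n\<ge>K. L2_norm N (\<lambda>s. (\<Sum>i<m. a i * L2_inner N g (y i) * y i s) - (\<Sum>i<n. a i * L2_inner N g (y i) * y i s)) < e"
proof -
  \<comment> \<open>\<open>C\<close> may be zero, or even negative if all vectors vanish;
    \<open>\<bar>C\<bar> + 1\<close> is a safe divisor and makes the final inequality
    strict.\<close>
  have e': "(e / (\<bar>C\<bar> + 1))\<^sup>2 > 0" using assms(3) by (simp add: zero_less_power add_nonneg_pos)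
  obtain K where K: "\<And>m n. m \<ge> K \<Longrightarrow> norm (\<Sum>i=m..<n. (cmod (L2_inner N g (y i)))\<^sup>2) < (e / (\<bar>C\<bar> + 1))\<^sup>2"
    using Bessel_summable[OF assms(1)] e' unfolding summable_Cauchy by blast
  have *: "L2_norm N (\<lambda>s. (\<Sum>i<n. a i * L2_inner N g (y i) * y i s) - (\<Sum>i<m. a i * L2_inner N g (y i) * y i s)) < e"
    if "K \<le> m" "m \<le> n" for m n
  proof -
    have "(\<lambda>s. (\<Sum>i<n. a i * L2_inner N g (y i) * y i s) - (\<Sum>i<m. a i * L2_inner N g (y i) * y i s)) = 
       (\<lambda>s. \<Sum>i=m..<n. a i * L2_inner N g (y i) * y i s)"
      using that by (intro ext) (simp add: lessThan_atLeast0 sum_diff_nat_ivl)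
    then have "(L2_norm N (\<lambda>s. (\<Sum>i<n. a i * L2_inner N g (y i) * y i s) - (\<Sum>i<m. a i * L2_inner N g (y i) * y i s)))\<^sup>2
      \<le> C\<^sup>2 * (\<Sum>i=m..<n. (cmod (L2_inner N g (y i)))\<^sup>2)"
      using diag_norm_le[of "{m..<n}" g a C] assms by simp
    also have "\<dots> \<le> C\<^sup>2 * (e / (\<bar>C\<bar> + 1))\<^sup>2" using K[OF that(1), of n] by (intro mult_left_mono) auto
    also have "\<dots> = (\<bar>C\<bar> / (\<bar>C\<bar> + 1) * e)\<^sup>2" by (simp add: power_mult_distrib power_divide)
    also have "\<dots> < e\<^sup>2"
    proof (rule power_strict_mono)
      have "\<bar>C\<bar> / (\<bar>C\<bar> + 1) < 1" by simp
      then show "\<bar>C\<bar> / (\<bar>C\<bar> + 1) * e < e" using assms(3) mult_strict_right_mono[of "\<bar>C\<bar> / (\<bar>C\<bar> + 1)" 1 e] by simp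
    qed (use assms in auto)
    finally show ?thesis by (rule power2_less_imp_less) (use assms(3) in simp)
  qed
  have "L2_norm N (\<lambda>s. (\<Sum>i<m. a i * L2_inner N g (y i) * y i s) - (\<Sum>i<n. a i * L2_inner N g (y i) * y i s)) < e"
    if "m \<ge> K" "n \<ge> K" for m n
  proof (cases "m \<le> n")
    case True
    show ?thesis by (subst L2_norm_minus_commute) (rule *[OF that(1) True])
  next
    case False
    then show ?thesis using *[of n m] that by simp
  qed
  then show ?thesis by blast
qed

lemma diag_partial_L2: "(\<lambda>s. \<Sum>i<K::nat. a i * L2_inner N g (y i) * y i s) \<in> L2 N"
  by (rule comb_L2)

lemma diag_limit:
  assumes "g \<in> L2 N" "\<And>n. L2_norm N (y n) \<noteq> 0 \<Longrightarrow> cmod (a n) \<le> C"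
  obtains d where "L2_tendsto N (\<lambda>K s. \<Sum>i<K. a i * L2_inner N g (y i) * y i s) d"
proof (rule L2_complete[OF finite_N, where F = "\<lambda>K s. \<Sum>i<K. a i * L2_inner N g (y i) * y i s"])
  show "(\<lambda>s. \<Sum>i<n. a i * L2_inner N g (y i) * y i s) \<in> L2 N" for n by (rule diag_partial_L2)
qed (use diag_Cauchy[OF assms] that in auto)

text \<open>The coefficient of the partial sums along \<open>y n\<close> is constant from
  \<open>Suc n\<close> on.\<close>

lemma diag_inner:
  assumes "g \<in> L2 N" "L2_tendsto N (\<lambda>K s. \<Sum>i<K. a i * L2_inner N g (y i) * y i s) d"
  shows "L2_inner N d (y n) = a n * L2_inner N g (y n)"
proof -
  have "L2_inner N (\<lambda>s. \<Sum>i<K. a i * L2_inner N g (y i) * y i s) (y n) = a n * L2_inner N g (y n)" if "K > n" for K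
    using that by (subst inner_comb) (auto simp: inner_y_mult[OF assms(1)] mult.assoc)
  then have "(\<lambda>K. L2_inner N (\<lambda>s. \<Sum>i<K. a i * L2_inner N g (y i) * y i s) (y n)) \<longlonglongrightarrow> a n * L2_inner N g (y n)"
    by (intro tendsto_eventually eventually_sequentiallyI[of "Suc n"]) auto
  then show ?thesis using L2_tendsto_inner[OF assms(2) y_L2] LIMSEQ_unique by blast
qed

lemma diag_norm:
  assumes "g \<in> L2 N" "\<And>n. L2_norm N (y n) \<noteq> 0 \<Longrightarrow> cmod (a n) \<le> C" "C \<ge> 0"
    and "L2_tendsto N (\<lambda>K s. \<Sum>i<K. a i * L2_inner N g (y i) * y i s) d"
  shows "L2_norm N d \<le> C * L2_norm N g"
proof (rule LIMSEQ_le_const2[OF L2_tendsto_norm[OF assms(4)]], intro exI allI impI)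
  fix K :: nat
  have "(L2_norm N (\<lambda>s. \<Sum>i<K. a i * L2_inner N g (y i) * y i s))\<^sup>2 \<le> C\<^sup>2 * (\<Sum>i<K. (cmod (L2_inner N g (y i)))\<^sup>2)"
    using assms by (intro diag_norm_le) auto
  also have "\<dots> \<le> C\<^sup>2 * (L2_norm N g)\<^sup>2" using Bessel[OF _ assms(1), of "{..<K}"] by (intro mult_left_mono) auto
  finally have "(L2_norm N (\<lambda>s. \<Sum>i<K. a i * L2_inner N g (y i) * y i s))\<^sup>2 \<le> (C * L2_norm N g)\<^sup>2"
    by (simp only: power_mult_distrib)
  then show "L2_norm N (\<lambda>s. \<Sum>i<K. a i * L2_inner N g (y i) * y i s) \<le> C * L2_norm N g"
    by (rule power2_le_imp_le) (use assms(3) in simp)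
qed

text \<open>Partial Fourier sums are best approximations, so from \<open>K\<close> on they are at
  least as close to \<open>g\<close> as the given combination. The intermediate \<open>h\<close>
  fits the use, where \<open>g\<close> is first replaced by a member of a dense family.\<close>

lemma Fourier_closed:
  assumes "g \<in> L2 N" "\<And>e. e > 0 \<Longrightarrow> \<exists>h\<in>L2 N. \<exists>K c. L2_norm N (\<lambda>s. g s - h s) < e \<and> L2_norm N (\<lambda>s. h s - (\<Sum>n<K::nat. c n * y n s)) < e"
  shows "L2_tendsto N (\<lambda>K s. \<Sum>i<K. L2_inner N g (y i) * y i s) g"
proof -
  have "(\<lambda>K. L2_norm N (\<lambda>s. (\<Sum>i<K. L2_inner N g (y i) * y i s) - g s)) \<longlonglongrightarrow> 0"
  proof (rule LIMSEQ_I)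
    fix r :: real assume "r > 0"
    then obtain h K c where h: "h \<in> L2 N" "L2_norm N (\<lambda>s. g s - h s) < r/2" "L2_norm N (\<lambda>s. h s - (\<Sum>n<K. c n * y n s)) < r/2"
      using assms(2)[of "r/2"] by auto
    have "norm (L2_norm N (\<lambda>s. (\<Sum>i<n. L2_inner N g (y i) * y i s) - g s) - 0) < r" if "n \<ge> K" for n
    proof -
      have "L2_norm N (\<lambda>s. g s - (\<Sum>i<n. L2_inner N g (y i) * y i s)) \<le> L2_norm N (\<lambda>s. g s - (\<Sum>i<K. c i * y i s))"
        by (rule best_approx) (use that assms in auto)
      also have "\<dots> \<le> L2_norm N (\<lambda>s. g s - h s) + L2_norm N (\<lambda>s. h s - (\<Sum>i<K. c i * y i s))"
        by (rule L2_norm_triangle3) (use assms h comb_L2 in auto)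
      also have "\<dots> < r" using h by simp
      finally show ?thesis by (simp add: L2_norm_minus_commute)
    qed
    then show "\<exists>no. \<forall>n\<ge>no. norm (L2_norm N (\<lambda>s. (\<Sum>i<n. L2_inner N g (y i) * y i s) - g s) - 0) < r" by blast
  qed
  then show ?thesis using assms(1) comb_L2 by (auto simp: L2_tendsto_def)
qed

end

section \<open>Congruence, products and dominated convergence\<close>

lemma L2_norm_cong: "(\<And>s. s \<in> space N \<Longrightarrow> f s = g s) \<Longrightarrow> L2_norm N f = L2_norm N g"
  unfolding L2_norm_alt by (intro arg_cong[where f=sqrt] Bochner_Integration.integral_cong) auto

lemma L2_cong: "(\<And>s. s \<in> space N \<Longrightarrow> f s = g s) \<Longrightarrow> f \<in> L2 N \<longleftrightarrow> g \<in> L2 N"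
proof -
  assume *: "\<And>s. s \<in> space N \<Longrightarrow> f s = g s"
  have "f \<in> borel_measurable N \<longleftrightarrow> g \<in> borel_measurable N" by (rule measurable_cong) (rule *)
  moreover have "integrable N (\<lambda>s. (cmod (f s))\<^sup>2) \<longleftrightarrow> integrable N (\<lambda>s. (cmod (g s))\<^sup>2)"
    by (rule Bochner_Integration.integrable_cong) (auto simp: *)
  ultimately show ?thesis by (simp add: L2_def)
qed

lemma L2_abs: "g \<in> L2 N \<Longrightarrow> (\<lambda>s. complex_of_real (cmod (g s))) \<in> L2 N"
  by (auto simp: L2_def)

lemma L2_integrable_abs_mult:
  assumes "g \<in> L2 N" "h \<in> L2 N"
  shows "integrable N (\<lambda>s. cmod (g s) * cmod (h s))" "(\<integral>s. cmod (g s) * cmod (h s) \<partial>N) \<le> L2_norm N g * L2_norm N h"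
proof -
  have "integrable N (\<lambda>s. complex_of_real (cmod (g s)) * complex_of_real (cmod (h s)))"
    by (rule L2_integrable_mult(2)[OF L2_abs[OF assms(1)] L2_abs[OF assms(2)]])
  from integrable_Re[OF this] show i: "integrable N (\<lambda>s. cmod (g s) * cmod (h s))" by simp
  have "L2_inner N (\<lambda>s. complex_of_real (cmod (g s))) (\<lambda>s. complex_of_real (cmod (h s))) = 
      complex_of_real (\<integral>s. cmod (g s) * cmod (h s) \<partial>N)"
    unfolding L2_inner_def by (simp flip: of_real_mult integral_complex_of_real)
  then have "cmod (complex_of_real (\<integral>s. cmod (g s) * cmod (h s) \<partial>N)) \<le> 
    L2_norm N (\<lambda>s. complex_of_real (cmod (g s))) * L2_norm N (\<lambda>s. complex_of_real (cmod (h s)))"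
    using L2_Cauchy_Schwarz[OF L2_abs[OF assms(1)] L2_abs[OF assms(2)]] by simp
  then show "(\<integral>s. cmod (g s) * cmod (h s) \<partial>N) \<le> L2_norm N g * L2_norm N h"
    by (simp add: L2_norm_alt norm_of_real)
qed

lemma (in finite_measure) L2_integrable: "g \<in> L2 M \<Longrightarrow> integrable M g"
proof -
  assume g: "g \<in> L2 M"
  have "(\<lambda>_. 1) \<in> L2 M" by (rule L2_bounded[of _ 1]) auto
  from L2_integrable_mult(2)[OF g this] show "integrable M g" by simp
qed

lemma L2_dominated_tendsto:
  assumes m: "\<And>n. F n \<in> borel_measurable N" "g \<in> borel_measurable N"
    and lim: "AE s in N. (\<lambda>n. F n s) \<longlonglongrightarrow> g s"
    and w: "w \<in> L2 N" and b: "\<And>n. AE s in N. cmod (F n s) \<le> cmod (w s)"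
  shows "L2_tendsto N F g"
proof -
  have F: "F n \<in> L2 N" for n by (rule L2_dominated[OF m(1) w b])
  have "AE s in N. \<forall>n. cmod (F n s) \<le> cmod (w s)" using b by (simp add: AE_all_countable)
  with lim have gb: "AE s in N. cmod (g s) \<le> cmod (w s)"
  proof eventually_elim
    case (elim s)
    show ?case by (rule LIMSEQ_le_const2[OF tendsto_norm[OF elim(1)]]) (use elim(2) in auto)
  qed
  have g: "g \<in> L2 N" by (rule L2_dominated[OF m(2) w gb])
  have "(\<lambda>n. \<integral>s. (cmod (F n s - g s))\<^sup>2 \<partial>N) \<longlonglongrightarrow> (\<integral>s. 0 \<partial>N)"
  proof (rule integral_dominated_convergence)
    show "(\<lambda>s. (cmod (F n s - g s))\<^sup>2) \<in> borel_measurable N" for n using m by measurable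
    show "integrable N (\<lambda>s. 4 * (cmod (w s))\<^sup>2)" using w by (simp add: L2_def)
    show "AE s in N. (\<lambda>n. (cmod (F n s - g s))\<^sup>2) \<longlonglongrightarrow> 0"
      using lim
    proof eventually_elim
      case (elim s)
      have "(\<lambda>n. (cmod (F n s - g s))\<^sup>2) \<longlonglongrightarrow> (cmod (g s - g s))\<^sup>2"
        by (intro tendsto_intros elim)
      then show ?case by simp
    qed
    show "AE s in N. norm ((cmod (F n s - g s))\<^sup>2) \<le> 4 * (cmod (w s))\<^sup>2" for n
      using b[of n] gb
    proof eventually_elim
      case (elim s)
      have "cmod (F n s - g s) \<le> 2 * cmod (w s)" using norm_triangle_ineq4[of "F n s" "g s"] elim by simp
      then have "(cmod (F n s - g s))\<^sup>2 \<le> (2 * cmod (w s))\<^sup>2" by (intro power_mono) auto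
      then show ?case by (simp add: power_mult_distrib)
    qed
  qed simp
  from tendsto_real_sqrt[OF this] show ?thesis using F g by (simp add: L2_tendsto_def L2_norm_alt)
qed

section \<open>Hilbert-Schmidt kernels\<close>

text \<open>Symmetry and integrability are required at every point of \<open>space N\<close>, so
  that the operator has pointwise values given by inner products. Square integrability of the row
  norms is the Hilbert-Schmidt condition. Unlike a pointwise bound, it survives the subtraction of a
  rank-one kernel built from an eigenvector that is merely square integrable.\<close>

definition hs_kernel :: "'b measure \<Rightarrow> ('a \<times> 'b \<times> 'b \<Rightarrow> complex) \<Rightarrow> 'a \<Rightarrow> bool" where
  "hs_kernel N k \<omega> \<longleftrightarrow> (\<lambda>(t, s). k (\<omega>, t, s)) \<in> borel_measurable (N \<Otimes>\<^sub>M N) \<and>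
     (\<forall>t\<in>space N. (\<lambda>s. k (\<omega>, t, s)) \<in> L2 N) \<and>
     (\<lambda>t. complex_of_real (L2_norm N (\<lambda>s. k (\<omega>, t, s)))) \<in> L2 N \<and>
     (\<forall>t\<in>space N. \<forall>s\<in>space N. k (\<omega>, t, s) = cnj (k (\<omega>, s, t)))"

locale hs_op =
  fixes N :: "'b measure" and k :: "'a \<times> 'b \<times> 'b \<Rightarrow> complex" and \<omega> :: 'a
  assumes finite_N: "finite_measure N" and hs: "hs_kernel N k \<omega>"
begin

sublocale N: finite_measure N by (rule finite_N)

abbreviation T where "T \<equiv> fibre_op N k \<omega>"
abbreviation row where "row t \<equiv> (\<lambda>s. k (\<omega>, t, s))"
abbreviation col where "col t \<equiv> (\<lambda>s. k (\<omega>, s, t))"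

lemma k_meas[measurable]: "(\<lambda>z. k (\<omega>, fst z, snd z)) \<in> borel_measurable (N \<Otimes>\<^sub>M N)"
  using hs by (simp add: hs_kernel_def case_prod_beta')

lemma row_L2: "t \<in> space N \<Longrightarrow> row t \<in> L2 N"
  and rownorm_L2: "(\<lambda>t. complex_of_real (L2_norm N (row t))) \<in> L2 N"
  and k_herm: "t \<in> space N \<Longrightarrow> s \<in> space N \<Longrightarrow> k (\<omega>, t, s) = cnj (k (\<omega>, s, t))"
  using hs unfolding hs_kernel_def by blast+

lemma col_L2: "t \<in> space N \<Longrightarrow> col t \<in> L2 N"
  using L2_cnj[OF row_L2[of t]] by (subst L2_cong[of _ _ "\<lambda>s. cnj (k (\<omega>, t, s))"]) (auto intro: k_herm)

lemma norm_col: "t \<in> space N \<Longrightarrow> L2_norm N (col t) = L2_norm N (row t)"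
  unfolding L2_norm_alt by (intro arg_cong[where f=sqrt] Bochner_Integration.integral_cong) (auto simp: k_herm[of _ t])

lemma T_meas[measurable]: assumes "g \<in> L2 N" shows "T g \<in> borel_measurable N"
proof -
  have [measurable]: "g \<in> borel_measurable N" using assms by auto
  show ?thesis unfolding fibre_op_def[abs_def]
    by (rule N.borel_measurable_lebesgue_integral) (use k_meas in \<open>simp add: case_prod_beta'\<close>)
qed

text \<open>By Hermitian symmetry the columns are the conjugate rows. Values at points thereby
  become inner products, to which linearity, Cauchy-Schwarz and Bessel's inequality apply.\<close>

lemma T_inner: "t \<in> space N \<Longrightarrow> T g t = L2_inner N g (col t)"
  unfolding fibre_op_def L2_inner_def
  by (intro Bochner_Integration.integral_cong) (auto simp: k_herm[of t] mult.commute)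

lemma T_le: "g \<in> L2 N \<Longrightarrow> t \<in> space N \<Longrightarrow> cmod (T g t) \<le> L2_norm N g * L2_norm N (row t)"
  using L2_Cauchy_Schwarz[OF _ col_L2, of g t] by (simp add: T_inner norm_col)

lemma T_L2: "g \<in> L2 N \<Longrightarrow> T g \<in> L2 N"
  by (rule L2_dominated[OF T_meas L2_scale[OF rownorm_L2, of "complex_of_real (L2_norm N g)"]])
    (auto simp: norm_mult T_le)

definition hsn where "hsn = L2_norm N (\<lambda>t. complex_of_real (L2_norm N (row t)))"

lemma hsn_nonneg: "hsn \<ge> 0" by (simp add: hsn_def)

lemma T_norm: assumes "g \<in> L2 N" shows "L2_norm N (T g) \<le> hsn * L2_norm N g"
proof -
  have "L2_norm N (T g) \<le> L2_norm N (\<lambda>t. complex_of_real (L2_norm N g) * complex_of_real (L2_norm N (row t)))"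
    by (rule L2_norm_mono[OF T_meas L2_scale[OF rownorm_L2]]) (use assms in \<open>auto simp: norm_mult T_le\<close>)
  then show ?thesis by (simp add: L2_norm_scale hsn_def mult.commute)
qed

lemma T_diff: "g \<in> L2 N \<Longrightarrow> h \<in> L2 N \<Longrightarrow> t \<in> space N \<Longrightarrow> T (\<lambda>s. g s - h s) t = T g t - T h t"
  by (simp add: T_inner L2_inner_diff_left col_L2)

lemma T_scale: "t \<in> space N \<Longrightarrow> T (\<lambda>s. c * g s) t = c * T g t"
  by (simp add: T_inner L2_inner_scale_left)

lemma T_divide: "t \<in> space N \<Longrightarrow> T (\<lambda>s. g s / c) t = T g t / c"
  by (simp add: T_inner L2_inner_divide_left)

lemma T_sum: "(\<And>i. i \<in> I \<Longrightarrow> g i \<in> L2 N) \<Longrightarrow> t \<in> space N \<Longrightarrow> T (\<lambda>s. \<Sum>i\<in>I. g i s) t = (\<Sum>i\<in>I. T (g i) t)"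
  by (simp add: T_inner L2_inner_sum_left col_L2)

lemma T_tendsto:
  assumes "L2_tendsto N F g" shows "L2_tendsto N (\<lambda>n. T (F n)) (T g)"
proof -
  note F = L2_tendstoD[OF assms]
  have "L2_norm N (\<lambda>t. T (F n) t - T g t) \<le> hsn * L2_norm N (\<lambda>s. F n s - g s)" for n
    using T_norm[OF L2_diff[OF F(1,2)], of n] F
    by (subst L2_norm_cong[of _ _ "T (\<lambda>s. F n s - g s)"]) (auto simp: T_diff)
  moreover have "(\<lambda>n. hsn * L2_norm N (\<lambda>s. F n s - g s)) \<longlonglongrightarrow> 0"
    using tendsto_mult_left[OF F(3), of hsn] by simp
  ultimately have "(\<lambda>n. L2_norm N (\<lambda>t. T (F n) t - T g t)) \<longlonglongrightarrow> 0"
    by (intro null_squeeze_nonneg[OF L2_norm_nonneg])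
  then show ?thesis using F T_L2 by (auto simp: L2_tendsto_def)
qed

text \<open>Fubini's theorem. Integrability over the product follows from Cauchy-Schwarz in
  \<open>s\<close>, which produces the row norms, and once more in \<open>t\<close>.\<close>

lemma T_selfadj:
  assumes g: "g \<in> L2 N" and h: "h \<in> L2 N"
  shows "L2_inner N (T g) h = L2_inner N g (T h)"
proof -
  interpret NN: pair_sigma_finite N N by unfold_locales
  have [measurable]: "g \<in> borel_measurable N" "h \<in> borel_measurable N" using g h by auto
  define f where "f t s = k (\<omega>, t, s) * g s * cnj (h t)" for t s
  have fm[measurable]: "(\<lambda>z. f (fst z) (snd z)) \<in> borel_measurable (N \<Otimes>\<^sub>M N)"
    unfolding f_def by measurable
  have ig: "integrable N (f t)" and le: "(\<integral>s. cmod (f t s) \<partial>N) \<le> L2_norm N g * (cmod (complex_of_real (L2_norm N (row t))) * cmod (h t))" if "t \<in> space N" for t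
  proof -
    show "integrable N (f t)" unfolding f_def 
      by (intro integrable_mult_left L2_integrable_mult(2) row_L2 that g)
    have "(\<integral>s. cmod (f t s) \<partial>N) = (\<integral>s. cmod (row t s) * cmod (g s) \<partial>N) * cmod (h t)"
      by (simp add: f_def norm_mult)
    also have "\<dots> \<le> (L2_norm N (row t) * L2_norm N g) * cmod (h t)"
      by (intro mult_right_mono L2_integrable_abs_mult row_L2 that g) auto
    finally show "(\<integral>s. cmod (f t s) \<partial>N) \<le> L2_norm N g * (cmod (complex_of_real (L2_norm N (row t))) * cmod (h t))"
      by (simp add: mult_ac)
  qed
  have "integrable (N \<Otimes>\<^sub>M N) (\<lambda>z. f (fst z) (snd z))"
  proof (rule NN.Fubini_integrable[OF fm])
    show "integrable N (\<lambda>x. \<integral>y. norm (f (fst (x, y)) (snd (x, y))) \<partial>N)"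
    proof (rule Bochner_Integration.integrable_bound)
      show "integrable N (\<lambda>t. L2_norm N g * (cmod (complex_of_real (L2_norm N (row t))) * cmod (h t)))"
        by (intro integrable_mult_right L2_integrable_abs_mult(1)[OF rownorm_L2 h])
    next
      show "(\<lambda>x. \<integral>y. norm (f (fst (x, y)) (snd (x, y))) \<partial>N) \<in> borel_measurable N"
        by measurable
    next
      show "AE x in N. norm (\<integral>y. norm (f (fst (x, y)) (snd (x, y))) \<partial>N) \<le>
         norm (L2_norm N g * (cmod (complex_of_real (L2_norm N (row x))) * cmod (h x)))"
      proof (rule AE_I2)
        fix x assume "x \<in> space N"
        from le[OF this] show "norm (\<integral>y. norm (f (fst (x, y)) (snd (x, y))) \<partial>N) \<le>
         norm (L2_norm N g * (cmod (complex_of_real (L2_norm N (row x))) * cmod (h x)))"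
          by (simp add: Bochner_Integration.integral_nonneg abs_mult)
      qed
    qed
    show "AE x in N. integrable N (\<lambda>y. f (fst (x, y)) (snd (x, y)))" using ig by simp
  qed
  then have "(\<integral>s. \<integral>t. f t s \<partial>N \<partial>N) = (\<integral>t. \<integral>s. f t s \<partial>N \<partial>N)"
    using NN.Fubini_integral[of f] by (simp add: case_prod_beta')
  moreover have "L2_inner N (T g) h = (\<integral>t. \<integral>s. f t s \<partial>N \<partial>N)"
    unfolding L2_inner_def fibre_op_def f_def by simp
  moreover have "L2_inner N g (T h) = (\<integral>s. \<integral>t. f t s \<partial>N \<partial>N)"
    unfolding L2_inner_def fibre_op_def
  proof (rule Bochner_Integration.integral_cong[OF refl])
    fix s assume s: "s \<in> space N"
    have "g s * cnj (\<integral>t. k (\<omega>, s, t) * h t \<partial>N) = (\<integral>t. g s * cnj (k (\<omega>, s, t) * h t) \<partial>N)"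
      unfolding Bochner_Integration.integral_cnj[symmetric] integral_mult_right_zero[symmetric] ..
    also have "\<dots> = (\<integral>t. f t s \<partial>N)" 
      by (rule Bochner_Integration.integral_cong) (auto simp: f_def k_herm[of s] s mult_ac)
    finally show "g s * cnj (\<integral>t. k (\<omega>, s, t) * h t \<partial>N) = (\<integral>t. f t s \<partial>N)" .
  qed
  ultimately show ?thesis by simp
qed

end

section \<open>Separability\<close>

text \<open>The closed linear span of \<open>W \<inter> L2 N\<close>. Closure under limits is a
  generating rule, so iterated limits stay inside without an argument about diagonal
  sequences.\<close>

inductive_set cspan :: "'b measure \<Rightarrow> ('b \<Rightarrow> complex) set \<Rightarrow> ('b \<Rightarrow> complex) set" for N W where
  base: "f \<in> W \<Longrightarrow> f \<in> L2 N \<Longrightarrow> f \<in> cspan N W"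
| zero: "(\<lambda>s. 0) \<in> cspan N W"
| add: "f \<in> cspan N W \<Longrightarrow> g \<in> cspan N W \<Longrightarrow> (\<lambda>s. f s + g s) \<in> cspan N W"
| scale: "f \<in> cspan N W \<Longrightarrow> (\<lambda>s. c * f s) \<in> cspan N W"
| lim: "(\<And>n::nat. F n \<in> cspan N W) \<Longrightarrow> L2_tendsto N F g \<Longrightarrow> g \<in> cspan N W"

lemma cspan_mono: "f \<in> cspan N W \<Longrightarrow> W \<subseteq> W' \<Longrightarrow> f \<in> cspan N W'"
  by (induction rule: cspan.induct) (auto intro: cspan.intros)

lemma cspan_sum: "(\<And>i. i \<in> I \<Longrightarrow> f i \<in> cspan N W) \<Longrightarrow> (\<lambda>s. \<Sum>i\<in>I. f i s) \<in> cspan N W"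
  by (induction I rule: infinite_finite_induct) (auto intro: cspan.intros)

lemma cspan_L2: "f \<in> cspan N W \<Longrightarrow> f \<in> L2 N"
  by (induction rule: cspan.induct) (auto simp: L2_tendsto_def)

lemma cspan_cong: "f \<in> cspan N W \<Longrightarrow> (\<And>s. s \<in> space N \<Longrightarrow> f s = g s) \<Longrightarrow> g \<in> cspan N W"
proof (rule cspan.lim[of "\<lambda>n. f"])
  assume f: "f \<in> cspan N W" and eq: "\<And>s. s \<in> space N \<Longrightarrow> f s = g s"
  have "L2_norm N (\<lambda>s. f s - g s) = L2_norm N (\<lambda>s. 0)" by (rule L2_norm_cong) (simp add: eq)
  moreover have "g \<in> L2 N" using L2_cong[of N f g] cspan_L2[OF f] eq by auto
  ultimately show "L2_tendsto N (\<lambda>n. f) g" using cspan_L2[OF f] by (simp add: L2_tendsto_def)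
qed

lemma cspan_finite_approx:
  assumes "h \<in> cspan N (range f)" "\<And>n. f n \<in> L2 N" "e > 0"
  shows "\<exists>K c. L2_norm N (\<lambda>s. h s - (\<Sum>i<K::nat. c i * f i s)) < e"
  using assms(1,3)
proof (induction arbitrary: e rule: cspan.induct)
  case (base g)
  then obtain n where "g = f n" by auto
  then have "L2_norm N (\<lambda>s. g s - (\<Sum>i<Suc n. (if i = n then 1 else 0) * f i s)) < e" using base by (simp add: if_distrib if_distribR cong: if_cong)
  then show ?case by (rule exI[of _ "Suc n", OF exI[of _ "\<lambda>i. if i = n then 1 else 0"]])
next
  case zero
  then show ?case by (intro exI[of _ 0]) simp
next
  case (add g h)
  from add.IH(1)[of "e/2"] add.prems obtain K1 c1 where 1: "L2_norm N (\<lambda>s. g s - (\<Sum>i<K1. c1 i * f i s)) < e/2" by auto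
  from add.IH(2)[of "e/2"] add.prems obtain K2 c2 where 2: "L2_norm N (\<lambda>s. h s - (\<Sum>i<K2. c2 i * f i s)) < e/2" by auto
  \<comment> \<open>Coefficient sequences of different lengths are padded by zeros to the common
    length \<open>K1 + K2\<close>.\<close>
  define c where "c i = (if i < K1 then c1 i else 0) + (if i < K2 then c2 i else 0)" for i
  have *: "(\<Sum>i<K1 + K2. c i * f i s) = (\<Sum>i<K1. c1 i * f i s) + (\<Sum>i<K2. c2 i * f i s)" for s
  proof -
    have "(\<Sum>i<K1 + K2. (if i < K1 then c1 i else 0) * f i s) = (\<Sum>i<K1. c1 i * f i s)"
      by (rule sum.mono_neutral_cong_right) auto
    moreover have "(\<Sum>i<K1 + K2. (if i < K2 then c2 i else 0) * f i s) = (\<Sum>i<K2. c2 i * f i s)"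
      by (rule sum.mono_neutral_cong_right) auto
    ultimately show ?thesis by (simp add: c_def distrib_right sum.distrib)
  qed
  have "L2_norm N (\<lambda>s. (g s - (\<Sum>i<K1. c1 i * f i s)) + (h s - (\<Sum>i<K2. c2 i * f i s))) < e"
    using L2_norm_triangle[of "\<lambda>s. g s - (\<Sum>i<K1. c1 i * f i s)" N "\<lambda>s. h s - (\<Sum>i<K2. c2 i * f i s)"] 1 2
      cspan_L2[OF add.hyps(1)] cspan_L2[OF add.hyps(2)] assms(2) by (fastforce intro!: L2_diff L2_sum L2_scale)
  then have "L2_norm N (\<lambda>s. g s + h s - (\<Sum>i<K1 + K2. c i * f i s)) < e" by (simp add: * algebra_simps)
  then show ?case by blast
next
  case (scale g a)
  from scale.IH[of "e / (cmod a + 1)"] scale.prems obtain K c where 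
    1: "L2_norm N (\<lambda>s. g s - (\<Sum>i<K. c i * f i s)) < e / (cmod a + 1)" by (auto simp: add_nonneg_pos)
  have "L2_norm N (\<lambda>s. a * (g s - (\<Sum>i<K. c i * f i s))) \<le> cmod a * (e / (cmod a + 1))"
    unfolding L2_norm_scale using 1 by (intro mult_left_mono) auto
  also have "\<dots> < e"
  proof -
    have "cmod a * e < e * (cmod a + 1)" using scale.prems by (simp add: distrib_left mult.commute)
    moreover have "cmod a + 1 > 0" by (simp add: add_nonneg_pos)
    ultimately show ?thesis by (simp only: times_divide_eq_right pos_divide_less_eq)
  qed
  finally have "L2_norm N (\<lambda>s. a * g s - (\<Sum>i<K. (a * c i) * f i s)) < e"
    by (simp add: right_diff_distrib sum_distrib_left mult.assoc)
  then show ?case by (rule exI[of _ K, OF exI[of _ "\<lambda>i. a * c i"]])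
next
  case (lim F g)
  from LIMSEQ_D[OF L2_tendstoD(3)[OF lim.hyps(2)], of "e/2"] lim.prems obtain n where n: "L2_norm N (\<lambda>s. F n s - g s) < e/2"
    by auto
  from lim.IH[of "e/2" n] lim.prems obtain K c where 1: "L2_norm N (\<lambda>s. F n s - (\<Sum>i<K. c i * f i s)) < e/2" by auto
  have "L2_norm N (\<lambda>s. g s - (\<Sum>i<K. c i * f i s)) < e"
    using L2_norm_triangle3[of g N "F n" "\<lambda>s. \<Sum>i<K. c i * f i s"] n 1 L2_tendstoD[OF lim.hyps(2)] assms(2)
    by (fastforce simp: L2_norm_minus_commute[of N g] intro!: L2_sum L2_scale)
  then show ?case by blast
qed

lemma countable_dense_combinations:
  fixes f :: "nat \<Rightarrow> 'b \<Rightarrow> complex"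
  assumes f: "\<And>n. f n \<in> L2 N"
  obtains d :: "nat \<Rightarrow> 'b \<Rightarrow> complex" where "\<And>n. d n \<in> L2 N"
    "\<And>K c e. e > 0 \<Longrightarrow> \<exists>n. L2_norm N (\<lambda>s. (\<Sum>i<K::nat. c i * f i s) - d n s) < e"
proof -
  obtain Q :: "complex set" where Q: "countable Q" "\<And>X. open X \<Longrightarrow> X \<noteq> {} \<Longrightarrow> \<exists>q\<in>Q. q \<in> X"
    using countable_dense_setE by blast
  define D where "D = (\<lambda>qs s. \<Sum>i<length qs. qs ! i * f i s) ` lists Q"
  have "countable D" unfolding D_def using Q(1) by (intro countable_image countable_lists)
  moreover have "D \<noteq> {}" by (auto simp: D_def)
  ultimately obtain d :: "nat \<Rightarrow> 'b \<Rightarrow> complex" where d: "range d = D" using range_from_nat_into[of D] by blast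
  have 1: "d n \<in> L2 N" for n
  proof -
    have "d n \<in> D" using d by auto
    then show ?thesis unfolding D_def using f by (auto intro!: L2_sum L2_scale)
  qed
  have 2: "\<exists>n. L2_norm N (\<lambda>s. (\<Sum>i<K. c i * f i s) - d n s) < e" if "e > 0" for K c e
  proof -
    \<comment> \<open>\<open>B\<close> dominates the sum of the norms; the added \<open>1\<close>
      keeps it positive and yields the strict inequality at the end.\<close>
    define B where "B = (\<Sum>i<K. L2_norm N (f i)) + 1"
    have B: "B > 0" unfolding B_def by (simp add: sum_nonneg add_nonneg_pos)
    have "\<exists>q\<in>Q. q \<in> ball (c i) (e / B)" for i
    proof -
      have "c i \<in> ball (c i) (e / B)" using B \<open>e > 0\<close> by simp
      then show ?thesis using Q(2)[OF open_ball, of "c i" "e/B"] by blast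
    qed
    then obtain q where q: "\<And>i. q i \<in> Q" "\<And>i. cmod (c i - q i) < e / B" by (metis dist_norm mem_ball)
    define qs where "qs = map q [0..<K]"
    have qs: "length qs = K" "\<And>i. i < K \<Longrightarrow> qs ! i = q i" by (simp_all add: qs_def)
    have "qs \<in> lists Q" using q by (auto simp: qs_def)
    then have "(\<lambda>s. \<Sum>i<length qs. qs ! i * f i s) \<in> D" unfolding D_def by blast
    then obtain n where n: "d n = (\<lambda>s. \<Sum>i<length qs. qs ! i * f i s)" using d by auto
    have "L2_norm N (\<lambda>s. (\<Sum>i<K. c i * f i s) - d n s) = L2_norm N (\<lambda>s. \<Sum>i<K. (c i - q i) * f i s)"
      by (simp add: n qs sum_subtractf left_diff_distrib)
    also have "\<dots> \<le> (\<Sum>i<K. L2_norm N (\<lambda>s. (c i - q i) * f i s))"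
      by (rule L2_norm_sum) (auto intro: f)
    also have "\<dots> \<le> (\<Sum>i<K. e / B * L2_norm N (f i))"
      unfolding L2_norm_scale by (intro sum_mono mult_right_mono less_imp_le[OF q(2)]) auto
    also have "\<dots> = e / B * (B - 1)" by (simp add: B_def sum_distrib_left)
    also have "\<dots> < e" using B \<open>e > 0\<close> by (simp add: pos_divide_less_eq algebra_simps)
    finally show ?thesis by blast
  qed
  show ?thesis by (rule that[OF 1 2])
qed

text \<open>A measurable kernel is, up to limits, built from rectangles, of which only countably many are
  needed; hence all its fibre operators have their ranges in one separable subspace.\<close>

definition sep_range :: "'a measure \<Rightarrow> 'b measure \<Rightarrow> ('a \<times> 'b \<times> 'b \<Rightarrow> complex) \<Rightarrow> bool" where
  "sep_range M N k \<longleftrightarrow> (\<exists>W. countable W \<and> (\<forall>\<omega>\<in>space M. \<forall>g\<in>L2 N. fibre_op N k \<omega> g \<in> cspan N W))"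

definition bounded_kernel :: "'a measure \<Rightarrow> 'b measure \<Rightarrow> real \<Rightarrow> ('a \<times> 'b \<times> 'b \<Rightarrow> complex) \<Rightarrow> bool" where
  "bounded_kernel M N C k \<longleftrightarrow> k \<in> borel_measurable (M \<Otimes>\<^sub>M (N \<Otimes>\<^sub>M N)) \<and> (\<forall>z\<in>space (M \<Otimes>\<^sub>M (N \<Otimes>\<^sub>M N)). cmod (k z) \<le> C)"

context
  fixes M :: "'a measure" and N :: "'b measure" assumes fN: "finite_measure N"
begin

interpretation N: finite_measure N by (rule fN)

lemma bounded_kernel_meas:
  assumes "bounded_kernel M N C k" "\<omega> \<in> space M"
  shows "(\<lambda>z. k (\<omega>, z)) \<in> borel_measurable (N \<Otimes>\<^sub>M N)" "t \<in> space N \<Longrightarrow> (\<lambda>s. k (\<omega>, t, s)) \<in> borel_measurable N"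
    "t \<in> space N \<Longrightarrow> s \<in> space N \<Longrightarrow> cmod (k (\<omega>, t, s)) \<le> C"
proof -
  show 1: "(\<lambda>z. k (\<omega>, z)) \<in> borel_measurable (N \<Otimes>\<^sub>M N)"
    using measurable_compose[OF measurable_Pair1'[OF assms(2)]] assms(1) unfolding bounded_kernel_def by blast
  show "t \<in> space N \<Longrightarrow> (\<lambda>s. k (\<omega>, t, s)) \<in> borel_measurable N"
    by (rule measurable_compose[OF measurable_Pair1' 1])
  show "t \<in> space N \<Longrightarrow> s \<in> space N \<Longrightarrow> cmod (k (\<omega>, t, s)) \<le> C"
    using assms unfolding bounded_kernel_def by (auto simp: space_pair_measure)
qed

lemma fibre_op_meas:
  assumes "bounded_kernel M N C k" "\<omega> \<in> space M" "g \<in> L2 N"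
  shows "fibre_op N k \<omega> g \<in> borel_measurable N"
proof -
  have [measurable]: "(\<lambda>z. k (\<omega>, fst z, snd z)) \<in> borel_measurable (N \<Otimes>\<^sub>M N)" "g \<in> borel_measurable N"
    using bounded_kernel_meas(1)[OF assms(1,2)] assms(3) by auto
  have "(\<lambda>z. k (\<omega>, fst z, snd z) * g (snd z)) \<in> borel_measurable (N \<Otimes>\<^sub>M N)" by measurable
  then show ?thesis unfolding fibre_op_def[abs_def]
    by (intro N.borel_measurable_lebesgue_integral) (simp add: case_prod_beta')
qed

lemma bounded_kernel_integrable:
  assumes "bounded_kernel M N C k" "\<omega> \<in> space M" "g \<in> L2 N" "t \<in> space N"
  shows "integrable N (\<lambda>s. k (\<omega>, t, s) * g s)" 
proof -
  have "(\<lambda>s. k (\<omega>, t, s)) \<in> L2 N"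
    using bounded_kernel_meas[OF assms(1,2)] assms(4) by (intro N.L2_bounded[of _ C]) auto
  then show ?thesis using L2_integrable_mult(2) assms(3) by blast
qed

lemma fibre_op_le:
  assumes "bounded_kernel M N C k" "\<omega> \<in> space M" "g \<in> L2 N" "t \<in> space N"
  shows "cmod (fibre_op N k \<omega> g t) \<le> C * (\<integral>s. cmod (g s) \<partial>N)"
proof -
  have "cmod (fibre_op N k \<omega> g t) \<le> (\<integral>s. cmod (k (\<omega>, t, s) * g s) \<partial>N)"
    unfolding fibre_op_def by (rule integral_norm_bound)
  also have "\<dots> \<le> (\<integral>s. C * cmod (g s) \<partial>N)"
  proof (rule integral_mono)
    show "integrable N (\<lambda>s. cmod (k (\<omega>, t, s) * g s))" by (rule integrable_norm[OF bounded_kernel_integrable[OF assms]])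
    show "integrable N (\<lambda>s. C * cmod (g s))" using N.L2_integrable[OF assms(3)] by simp
    show "cmod (k (\<omega>, t, s) * g s) \<le> C * cmod (g s)" if "s \<in> space N" for s
      using bounded_kernel_meas(3)[OF assms(1,2,4) that] by (simp add: norm_mult mult_right_mono)
  qed
  finally show ?thesis by simp
qed

text \<open>Dominated convergence twice, in \<open>s\<close> for the value at a point
  \<open>t\<close> and in \<open>t\<close> for the norm. The countable sets that belong to the
  approximating kernels are united.\<close>

lemma sep_range_lim:
  assumes K: "\<And>n. bounded_kernel M N C (K n)" and "\<And>n::nat. sep_range M N (K n)"
    and k: "k \<in> borel_measurable (M \<Otimes>\<^sub>M (N \<Otimes>\<^sub>M N))"
    and lim: "\<And>z. z \<in> space (M \<Otimes>\<^sub>M (N \<Otimes>\<^sub>M N)) \<Longrightarrow> (\<lambda>n. K n z) \<longlonglongrightarrow> k z"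
  shows "sep_range M N k"
proof -
  have "\<forall>n. \<exists>W. countable W \<and> (\<forall>\<omega>\<in>space M. \<forall>g\<in>L2 N. fibre_op N (K n) \<omega> g \<in> cspan N W)"
    using assms(2) unfolding sep_range_def by blast
  then obtain W where W: "\<And>n. countable (W n)" "\<And>n \<omega> g. \<omega> \<in> space M \<Longrightarrow> g \<in> L2 N \<Longrightarrow> fibre_op N (K n) \<omega> g \<in> cspan N (W n)"
    by metis
  have bk: "bounded_kernel M N C k"
    unfolding bounded_kernel_def
  proof (intro conjI ballI k)
    fix z assume z: "z \<in> space (M \<Otimes>\<^sub>M (N \<Otimes>\<^sub>M N))"
    show "cmod (k z) \<le> C"
      by (rule LIMSEQ_le_const2[OF tendsto_norm[OF lim[OF z]]]) (use K z in \<open>auto simp: bounded_kernel_def\<close>)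
  qed
  have "fibre_op N k \<omega> g \<in> cspan N (\<Union>n. W n)" if \<omega>: "\<omega> \<in> space M" and g: "g \<in> L2 N" for \<omega> g
  proof (rule cspan.lim)
    show "fibre_op N (K n) \<omega> g \<in> cspan N (\<Union>n. W n)" for n
      by (rule cspan_mono[OF W(2)[OF \<omega> g]]) auto
    show "L2_tendsto N (\<lambda>n. fibre_op N (K n) \<omega> g) (fibre_op N k \<omega> g)"
    proof (rule L2_dominated_tendsto)
      show "fibre_op N (K n) \<omega> g \<in> borel_measurable N" for n by (rule fibre_op_meas[OF K \<omega> g])
      show "fibre_op N k \<omega> g \<in> borel_measurable N" by (rule fibre_op_meas[OF bk \<omega> g])
      show "(\<lambda>s. complex_of_real (C * (\<integral>s. cmod (g s) \<partial>N))) \<in> L2 N"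
        by (simp add: L2_def)
      show "AE t in N. cmod (fibre_op N (K n) \<omega> g t) \<le> cmod (complex_of_real (C * (\<integral>s. cmod (g s) \<partial>N)))" for n
        using fibre_op_le[OF K \<omega> g] by (intro AE_I2) (metis abs_ge_self norm_of_real order_trans)
      show "AE t in N. (\<lambda>n. fibre_op N (K n) \<omega> g t) \<longlonglongrightarrow> fibre_op N k \<omega> g t"
      proof (rule AE_I2)
        fix t assume t: "t \<in> space N"
        show "(\<lambda>n. fibre_op N (K n) \<omega> g t) \<longlonglongrightarrow> fibre_op N k \<omega> g t"
          unfolding fibre_op_def
        proof (rule integral_dominated_convergence[where w="\<lambda>s. C * cmod (g s)"])
          show "(\<lambda>s. k (\<omega>, t, s) * g s) \<in> borel_measurable N" 
            by (rule borel_measurable_integrable[OF bounded_kernel_integrable[OF bk \<omega> g t]])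
          show "(\<lambda>s. K n (\<omega>, t, s) * g s) \<in> borel_measurable N" for n
            by (rule borel_measurable_integrable[OF bounded_kernel_integrable[OF K \<omega> g t]])
          show "integrable N (\<lambda>s. C * cmod (g s))" using N.L2_integrable[OF g] by simp
          show "AE s in N. (\<lambda>n. K n (\<omega>, t, s) * g s) \<longlonglongrightarrow> k (\<omega>, t, s) * g s"
            using lim \<omega> t by (intro AE_I2 tendsto_mult_right) (simp add: space_pair_measure)
          show "AE s in N. norm (K n (\<omega>, t, s) * g s) \<le> C * cmod (g s)" for n
            using bounded_kernel_meas(3)[OF K \<omega> t] by (intro AE_I2) (simp add: norm_mult mult_right_mono)
        qed
      qed
    qed
  qed
  then show ?thesis unfolding sep_range_def using W(1) by (intro exI[of _ "\<Union>n. W n"]) auto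
qed

lemma sep_range_sum:
  assumes K: "\<And>i. i \<in> I \<Longrightarrow> bounded_kernel M N (C i) (K i)" and "\<And>i. i \<in> I \<Longrightarrow> sep_range M N (K i)" "finite I"
  shows "sep_range M N (\<lambda>z. \<Sum>i\<in>I. K i z)"
proof -
  have "\<forall>i\<in>I. \<exists>W. countable W \<and> (\<forall>\<omega>\<in>space M. \<forall>g\<in>L2 N. fibre_op N (K i) \<omega> g \<in> cspan N W)"
    using assms(2) unfolding sep_range_def by blast
  then obtain W where W: "\<And>i. i \<in> I \<Longrightarrow> countable (W i)" 
      "\<And>i \<omega> g. i \<in> I \<Longrightarrow> \<omega> \<in> space M \<Longrightarrow> g \<in> L2 N \<Longrightarrow> fibre_op N (K i) \<omega> g \<in> cspan N (W i)"
    by metis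
  have "fibre_op N (\<lambda>z. \<Sum>i\<in>I. K i z) \<omega> g \<in> cspan N (\<Union>i\<in>I. W i)" if \<omega>: "\<omega> \<in> space M" and g: "g \<in> L2 N" for \<omega> g
  proof (rule cspan_cong[where f="\<lambda>t. \<Sum>i\<in>I. fibre_op N (K i) \<omega> g t"])
    show "(\<lambda>t. \<Sum>i\<in>I. fibre_op N (K i) \<omega> g t) \<in> cspan N (\<Union>i\<in>I. W i)"
      by (intro cspan_sum cspan_mono[OF W(2)[OF _ \<omega> g]]) auto
    fix t assume "t \<in> space N"
    then show "(\<Sum>i\<in>I. fibre_op N (K i) \<omega> g t) = fibre_op N (\<lambda>z. \<Sum>i\<in>I. K i z) \<omega> g t"
      unfolding fibre_op_def using bounded_kernel_integrable[OF K \<omega> g]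
      by (subst Bochner_Integration.integral_sum[symmetric]) (auto simp: sum_distrib_right)
  qed
  then show ?thesis unfolding sep_range_def using W(1) assms(3) 
    by (intro exI[of _ "\<Union>i\<in>I. W i"]) (auto intro: countable_finite)
qed

lemma sep_range_scale: assumes "sep_range M N k" shows "sep_range M N (\<lambda>z. c * k z)"
proof -
  have "fibre_op N (\<lambda>z. c * k z) \<omega> g = (\<lambda>t. c * fibre_op N k \<omega> g t)" for \<omega> g
    by (simp add: fibre_op_def mult.assoc fun_eq_iff)
  then show ?thesis using assms unfolding sep_range_def by (metis cspan.scale)
qed

lemma sep_range_cong:
  assumes "sep_range M N k" "\<And>z. z \<in> space (M \<Otimes>\<^sub>M (N \<Otimes>\<^sub>M N)) \<Longrightarrow> k z = k' z"
  shows "sep_range M N k'"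
proof -
  have "fibre_op N k' \<omega> g \<in> cspan N W" if "\<omega> \<in> space M" "fibre_op N k \<omega> g \<in> cspan N W" for \<omega> g W
    by (rule cspan_cong[OF that(2)]) 
      (use that assms(2) in \<open>auto simp: fibre_op_def space_pair_measure intro!: Bochner_Integration.integral_cong\<close>)
  then show ?thesis using assms(1) unfolding sep_range_def by blast
qed

text \<open>A pi-lambda argument for indicators pulled back along \<open>pr\<close>. It is applied
  first with \<open>pr = snd\<close>, to kernels that do not depend on \<omega>, and then with the
  identity, starting from products of a set in \<open>M\<close> with the sets so obtained.\<close>

lemma sep_range_Dynkin:
  fixes \<Phi> :: "'c set \<Rightarrow> 'a \<times> 'b \<times> 'b \<Rightarrow> complex" and P :: "'c measure"
  assumes gen: "sets P = sigma_sets (space P) G" "Int_stable G" "G \<subseteq> Pow (space P)"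
    and \<Phi>: "\<And>X z. \<Phi> X z = indicator X (pr z)" and pr: "pr \<in> measurable (M \<Otimes>\<^sub>M (N \<Otimes>\<^sub>M N)) P"
    and G: "\<And>X. X \<in> G \<Longrightarrow> sep_range M N (\<Phi> X)" and top: "sep_range M N (\<Phi> (space P))"
    and X: "X \<in> sets P"
  shows "sep_range M N (\<Phi> X)"
proof -
  have bk: "bounded_kernel M N 1 (\<Phi> X)" if "X \<in> sets P" for X
    unfolding bounded_kernel_def \<Phi>
  proof (intro conjI ballI)
    show "(\<lambda>z. indicator X (pr z) :: complex) \<in> borel_measurable (M \<Otimes>\<^sub>M (N \<Otimes>\<^sub>M N))"
      using that pr by measurable
  qed (auto simp: indicator_def)
  have "X \<in> sigma_sets (space P) G" using X gen by simp
  then show ?thesis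
  proof (induct rule: sigma_sets_induct_disjoint[OF gen(2,3), consumes 1, case_names basic empty compl union])
    case (basic A) then show ?case by (rule G)
  next
    case empty
    have "sep_range M N (\<lambda>z. \<Sum>i\<in>({}::nat set). 0)" by (rule sep_range_sum[where C="\<lambda>_. 0"]) auto
    then show ?case by (rule sep_range_cong) (simp add: \<Phi>)
  next
    case (compl A)
    then have A: "A \<in> sets P" by (simp add: gen)
    \<comment> \<open>The indicator of the complement as a sum of two kernels, indexed by the
      Booleans.\<close>
    define K where "K i = (if i then \<Phi> (space P) else (\<lambda>z. (-1) * \<Phi> A z))" for i
    have "bounded_kernel M N 1 (K i)" for i
      using bk[OF A] bk[of "space P"] unfolding K_def bounded_kernel_def by auto
    moreover have "sep_range M N (K i)" for i
      using top compl sep_range_scale[of "\<Phi> A" "-1"] unfolding K_def by auto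
    ultimately have "sep_range M N (\<lambda>z. \<Sum>i\<in>UNIV. K i z)" by (intro sep_range_sum[where C="\<lambda>_. 1"]) auto
    then show ?case
    proof (rule sep_range_cong)
      fix z assume "z \<in> space (M \<Otimes>\<^sub>M (N \<Otimes>\<^sub>M N))"
      then have "pr z \<in> space P" using pr by (rule measurable_space[rotated])
      then show "(\<Sum>i\<in>UNIV. K i z) = \<Phi> (space P - A) z" by (simp add: K_def UNIV_bool \<Phi> indicator_def)
    qed
  next
    case (union A)
    have A: "A i \<in> sets P" for i using union(2) unfolding gen(1) by blast
    have A': "(\<Union>i<n. A i) \<in> sets P" for n using A by auto
    have part: "\<Phi> (\<Union>i<n. A i) z = (\<Sum>i<n. \<Phi> (A i) z)" for n z
      unfolding \<Phi> by (rule indicator_UN_disjoint) (use union(1) in \<open>auto simp: disjoint_family_on_def\<close>)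
    have "sep_range M N (\<lambda>z. \<Sum>i<n. \<Phi> (A i) z)" for n
      by (rule sep_range_sum[OF bk[OF A]]) (use union in auto)
    then have "sep_range M N (\<Phi> (\<Union>i<n. A i))" for n 
      by (rule sep_range_cong) (simp add: part)
    then show ?case
    proof (rule sep_range_lim[rotated])
      show "bounded_kernel M N 1 (\<Phi> (\<Union>i<n. A i))" for n by (rule bk[OF A'])
      show "\<Phi> (\<Union>i. A i) \<in> borel_measurable (M \<Otimes>\<^sub>M (N \<Otimes>\<^sub>M N))"
        using bk[of "\<Union>i. A i"] A unfolding bounded_kernel_def by auto
      show "(\<lambda>n. \<Phi> (\<Union>i<n. A i) z) \<longlonglongrightarrow> \<Phi> (\<Union>i. A i) z" for z
        unfolding \<Phi> by (rule LIMSEQ_indicator_UN)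
    qed
  qed
qed

lemma sep_range_bounded:
  assumes bk: "bounded_kernel M N C k" shows "sep_range M N k"
proof -
  \<comment> \<open>The kernel of a rectangle has rank one: every value of the operator is a
    multiple of \<open>indicator B\<close>.\<close>
  have rect: "sep_range M N (\<lambda>z. indicator (B \<times> B') (snd z))" if "B \<in> sets N" "B' \<in> sets N" for B B'
    unfolding sep_range_def
  proof (intro exI[of _ "{indicator B}"] conjI ballI)
    fix \<omega> g
    have "indicator B \<in> L2 N" by (rule N.L2_bounded[of _ 1]) (use that in \<open>auto simp: indicator_def\<close>)
    then have "(\<lambda>t. (\<integral>s. indicator B' s * g s \<partial>N) * indicator B t) \<in> cspan N {indicator B}"
      by (intro cspan.scale cspan.base) auto
    moreover have "fibre_op N (\<lambda>z. indicator (B \<times> B') (snd z)) \<omega> g = (\<lambda>t. (\<integral>s. indicator B' s * g s \<partial>N) * indicator B t)"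
    proof
      fix t
      have "fibre_op N (\<lambda>z. indicator (B \<times> B') (snd z)) \<omega> g t = (\<integral>s. indicator B t * (indicator B' s * g s) \<partial>N)"
        by (simp add: fibre_op_def indicator_times mult.assoc)
      also have "\<dots> = indicator B t * (\<integral>s. indicator B' s * g s \<partial>N)" by (rule integral_mult_right_zero)
      finally show "fibre_op N (\<lambda>z. indicator (B \<times> B') (snd z)) \<omega> g t = (\<integral>s. indicator B' s * g s \<partial>N) * indicator B t"
        by (simp add: mult.commute)
    qed
    ultimately show "fibre_op N (\<lambda>z. indicator (B \<times> B') (snd z)) \<omega> g \<in> cspan N {indicator B}" by simp
  qed simp
  have NN: "sep_range M N (\<lambda>z. indicator X (snd z))" if "X \<in> sets (N \<Otimes>\<^sub>M N)" for X
  proof (rule sep_range_Dynkin[where P="N \<Otimes>\<^sub>M N" and pr=snd and \<Phi>="\<lambda>X z. indicator X (snd z)" and G="{a \<times> b |a b. a \<in> sets N \<and> b \<in> sets N}"])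
    show "sets (N \<Otimes>\<^sub>M N) = sigma_sets (space (N \<Otimes>\<^sub>M N)) {a \<times> b |a b. a \<in> sets N \<and> b \<in> sets N}"
      by (simp add: sets_pair_measure space_pair_measure)
    show "{a \<times> b |a b. a \<in> sets N \<and> b \<in> sets N} \<subseteq> Pow (space (N \<Otimes>\<^sub>M N))"
      by (auto simp: space_pair_measure dest: sets.sets_into_space)
    show "sep_range M N (\<lambda>z. indicator (space (N \<Otimes>\<^sub>M N)) (snd z))"
      unfolding space_pair_measure by (rule rect) auto
  qed (use rect that in \<open>auto intro: Int_stable_pair_measure_generator\<close>)
  \<comment> \<open>The additional factor \<open>indicator A \<omega>\<close> is a scalar on each
    fibre, so the countable set found for \<open>X\<close> serves for every
    \<open>A\<close>.\<close>
  have rect': "sep_range M N (indicator (A \<times> X))" if "A \<in> sets M" and X: "X \<in> sets (N \<Otimes>\<^sub>M N)" for A X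
  proof -
    obtain W where W: "countable W" "\<And>\<omega> g. \<omega> \<in> space M \<Longrightarrow> g \<in> L2 N \<Longrightarrow> fibre_op N (\<lambda>z. indicator X (snd z)) \<omega> g \<in> cspan N W"
      using NN[OF X] unfolding sep_range_def by blast
    have "fibre_op N (indicator (A \<times> X)) \<omega> g = (\<lambda>t. indicator A \<omega> * fibre_op N (\<lambda>z. indicator X (snd z)) \<omega> g t)" for \<omega> g
      by (rule ext) (simp add: fibre_op_def indicator_times mult.assoc)
    then show ?thesis unfolding sep_range_def using W by (metis cspan.scale)
  qed
  have sets: "sep_range M N (indicator E)" if "E \<in> sets (M \<Otimes>\<^sub>M (N \<Otimes>\<^sub>M N))" for E
  proof (rule sep_range_Dynkin[where P="M \<Otimes>\<^sub>M (N \<Otimes>\<^sub>M N)" and pr="\<lambda>z. z" and \<Phi>="\<lambda>X z. indicator X z" and G="{a \<times> b |a b. a \<in> sets M \<and> b \<in> sets (N \<Otimes>\<^sub>M N)}"])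
    show "sets (M \<Otimes>\<^sub>M (N \<Otimes>\<^sub>M N)) = sigma_sets (space (M \<Otimes>\<^sub>M (N \<Otimes>\<^sub>M N))) {a \<times> b |a b. a \<in> sets M \<and> b \<in> sets (N \<Otimes>\<^sub>M N)}"
      unfolding sets_pair_measure[of M "N \<Otimes>\<^sub>M N"] space_pair_measure[of M "N \<Otimes>\<^sub>M N"] ..
    show "{a \<times> b |a b. a \<in> sets M \<and> b \<in> sets (N \<Otimes>\<^sub>M N)} \<subseteq> Pow (space (M \<Otimes>\<^sub>M (N \<Otimes>\<^sub>M N)))"
      unfolding space_pair_measure[of M "N \<Otimes>\<^sub>M N"] by (auto dest: sets.sets_into_space)
    show "sep_range M N (indicator (space (M \<Otimes>\<^sub>M (N \<Otimes>\<^sub>M N))))"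
      unfolding space_pair_measure[of M "N \<Otimes>\<^sub>M N"] by (rule rect') auto
  qed (use rect' that in \<open>auto intro: Int_stable_pair_measure_generator\<close>)
  have k: "k \<in> borel_measurable (M \<Otimes>\<^sub>M (N \<Otimes>\<^sub>M N))" using bk by (simp add: bounded_kernel_def)
  from borel_measurable_implies_sequence_metric[OF this, of 0] obtain F where
    F: "\<And>i. simple_function (M \<Otimes>\<^sub>M (N \<Otimes>\<^sub>M N)) (F i)" "\<And>x. x \<in> space (M \<Otimes>\<^sub>M (N \<Otimes>\<^sub>M N)) \<Longrightarrow> (\<lambda>i. F i x) \<longlonglongrightarrow> k x"
      "\<And>i x. x \<in> space (M \<Otimes>\<^sub>M (N \<Otimes>\<^sub>M N)) \<Longrightarrow> dist (F i x) 0 \<le> 2 * dist (k x) 0"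
    by metis
  let ?P = "M \<Otimes>\<^sub>M (N \<Otimes>\<^sub>M N)"
  show ?thesis
  proof (rule sep_range_lim[OF _ _ k F(2)])
    fix i
    \<comment> \<open>The approximating simple functions may reach twice the modulus of the
      kernel.\<close>
    show "bounded_kernel M N (2 * C) (F i)"
      unfolding bounded_kernel_def
    proof (intro conjI ballI)
      show "F i \<in> borel_measurable ?P" by (rule borel_measurable_simple_function[OF F(1)])
      fix z assume "z \<in> space ?P"
      then show "cmod (F i z) \<le> 2 * C" using F(3)[of z i] bk unfolding bounded_kernel_def by fastforce
    qed
    have E: "F i -` {y} \<inter> space ?P \<in> sets ?P" for y by (rule simple_functionD(2)[OF F(1)])
    have "sep_range M N (\<lambda>z. \<Sum>y\<in>F i ` space ?P. y * indicator (F i -` {y} \<inter> space ?P) z)"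
    proof (rule sep_range_sum[where C="cmod"])
      show "finite (F i ` space ?P)" by (rule simple_functionD(1)[OF F(1)])
      show "bounded_kernel M N (cmod y) (\<lambda>z. y * indicator (F i -` {y} \<inter> space ?P) z)" for y
        unfolding bounded_kernel_def
      proof (intro conjI ballI)
        show "(\<lambda>z. y * indicator (F i -` {y} \<inter> space ?P) z) \<in> borel_measurable ?P" using E[of y] by measurable
      qed (auto simp: indicator_def)
      show "sep_range M N (\<lambda>z. y * indicator (F i -` {y} \<inter> space ?P) z)" for y
        by (rule sep_range_scale[OF sets[OF E]])
    qed
    then show "sep_range M N (F i)"
    proof (rule sep_range_cong)
      fix z assume z: "z \<in> space ?P"
      have "(\<Sum>y\<in>F i ` space ?P. y * indicator (F i -` {y} \<inter> space ?P) z) = (\<Sum>y\<in>F i ` space ?P. if y = F i z then F i z else 0)"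
        by (rule sum.cong) (auto simp: indicator_def z)
      also have "\<dots> = F i z" using z simple_functionD(1)[OF F(1)] by simp
      finally show "(\<Sum>y\<in>F i ` space ?P. y * indicator (F i -` {y} \<inter> space ?P) z) = F i z" .
    qed
  qed
qed

end

section \<open>The top eigenvalue of a Hilbert-Schmidt operator\<close>

locale hs_contraction = hs_op N k \<omega> for N :: "'b measure" and k :: "'a \<times> 'b \<times> 'b \<Rightarrow> complex" and \<omega> :: 'a +
  assumes contr: "\<And>g. g \<in> L2 N \<Longrightarrow> L2_norm N (T g) \<le> L2_norm N g"
begin

lemma pow_L2: "g \<in> L2 N \<Longrightarrow> (T ^^ n) g \<in> L2 N"
  by (induction n) (auto intro: T_L2)

lemma pow_selfadj:
  assumes "g \<in> L2 N" "h \<in> L2 N" shows "L2_inner N ((T ^^ n) g) h = L2_inner N g ((T ^^ n) h)"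
  using assms(2)
proof (induction n arbitrary: h)
  case (Suc n)
  have "L2_inner N (T ((T ^^ n) g)) h = L2_inner N ((T ^^ n) g) (T h)"
    by (rule T_selfadj[OF pow_L2[OF assms(1)] Suc.prems])
  also have "\<dots> = L2_inner N g ((T ^^ n) (T h))" by (rule Suc.IH[OF T_L2[OF Suc.prems]])
  finally show ?case by (simp add: funpow_swap1)
qed simp

lemma pow_inner:
  assumes g: "g \<in> L2 N" shows "L2_inner N ((T ^^ m) g) ((T ^^ n) g) = L2_inner N g ((T ^^ (m + n)) g)"
  using pow_selfadj[OF g pow_L2[OF g]] by (simp add: funpow_add)

lemma pow_norm_mono:
  assumes g: "g \<in> L2 N" and "m \<le> n" shows "L2_norm N ((T ^^ n) g) \<le> L2_norm N ((T ^^ m) g)"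
  using assms(2)
proof (induction rule: dec_induct)
  case (step n)
  then show ?case using contr[OF pow_L2[OF g, of n]] by simp
qed simp

text \<open>By self-adjointness the inner product of two powers depends only on the sum of the
  exponents, so the squared distance is \<open>c (2 * m) + c (2 * n) - 2 * c (m + n)\<close>, and
  \<open>c\<close> converges because it decreases. Even exponents matter here: for exponents of
  different parity the sum is odd, and the inner product is negative at the eigenvalue
  \<open>-1\<close>.\<close>

lemma pow_Cauchy:
  assumes g: "g \<in> L2 N" and e: "e > 0"
  shows "\<exists>K. \<forall>m\<ge>K. \<forall>n\<ge>K. L2_norm N (\<lambda>s. (T ^^ (2 * m)) g s - (T ^^ (2 * n)) g s) < e"
proof -
  define c where "c n = (L2_norm N ((T ^^ n) g))\<^sup>2" for n
  have "decseq c" unfolding c_def by (intro decseq_SucI power_mono pow_norm_mono[OF g]) auto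
  moreover have "0 \<le> c n" for n by (simp add: c_def)
  ultimately obtain L where "c \<longlonglongrightarrow> L" using decseq_convergent[of c 0] by blast
  then have "Cauchy c" by (rule LIMSEQ_imp_Cauchy)
  then obtain K where K: "\<And>m n. m \<ge> K \<Longrightarrow> n \<ge> K \<Longrightarrow> norm (c m - c n) < e\<^sup>2 / 2"
    using e CauchyD[of c "e\<^sup>2/2"] by auto
  have "L2_norm N (\<lambda>s. (T ^^ (2 * m)) g s - (T ^^ (2 * n)) g s) < e" if "m \<ge> K" "n \<ge> K" for m n
  proof -
    have "L2_inner N ((T ^^ (2 * m)) g) ((T ^^ (2 * n)) g) = L2_inner N ((T ^^ (m + n)) g) ((T ^^ (m + n)) g)"
      unfolding pow_inner[OF g] by (rule arg_cong[where f="\<lambda>j. L2_inner N g ((T ^^ j) g)"]) simp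
    then have "Re (L2_inner N ((T ^^ (2 * m)) g) ((T ^^ (2 * n)) g)) = c (m + n)"
      unfolding L2_inner_norm c_def by (simp only: Re_complex_of_real)
    then have "(L2_norm N (\<lambda>s. (T ^^ (2 * m)) g s - (T ^^ (2 * n)) g s))\<^sup>2 = (c (2 * m) - c (m + n)) + (c (2 * n) - c (m + n))"
      unfolding L2_norm_diff_sq[OF pow_L2[OF g] pow_L2[OF g]] c_def by simp
    also have "\<dots> < e\<^sup>2 / 2 + e\<^sup>2 / 2"
    proof (rule add_strict_mono)
      show "c (2 * m) - c (m + n) < e\<^sup>2 / 2" "c (2 * n) - c (m + n) < e\<^sup>2 / 2"
        using K[of "2*m" "m+n"] K[of "2*n" "m+n"] that unfolding real_norm_def by linarith+
    qed
    finally show ?thesis by (intro power2_less_imp_less[of _ e]) (use e in auto)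
  qed
  then show ?thesis by blast
qed

text \<open>Shifting the sequence of even powers by one index amounts to two applications of the
  operator.\<close>

lemma pow_limit:
  assumes g: "g \<in> L2 N" and y: "L2_tendsto N (\<lambda>n. (T ^^ (2 * n)) g) y"
  shows "AE t in N. T (T y) t = y t"
proof (rule L2_tendsto_unique)
  show "L2_tendsto N (\<lambda>n. T (T ((T ^^ (2 * n)) g))) (T (T y))" by (intro T_tendsto y)
  have "T (T ((T ^^ (2 * n)) g)) = (T ^^ (2 * Suc n)) g" for n by simp
  then show "L2_tendsto N (\<lambda>n. T (T ((T ^^ (2 * n)) g))) y"
    using L2_tendsto_subseq[OF y filterlim_Suc] by simp
qed

lemma pow_diff_le:
  assumes "g \<in> L2 N" "h \<in> L2 N"
  shows "L2_norm N (\<lambda>s. (T ^^ n) g s - (T ^^ n) h s) \<le> L2_norm N (\<lambda>s. g s - h s)"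
proof (induction n)
  case (Suc n)
  have "L2_norm N (\<lambda>s. T ((T ^^ n) g) s - T ((T ^^ n) h) s) = L2_norm N (T (\<lambda>s. (T ^^ n) g s - (T ^^ n) h s))"
    by (rule L2_norm_cong) (simp add: T_diff pow_L2 assms)
  also have "\<dots> \<le> L2_norm N (\<lambda>s. (T ^^ n) g s - (T ^^ n) h s)"
    by (intro contr L2_diff pow_L2 assms)
  finally show ?case using Suc by simp
qed simp

text \<open>Joint measurability, needed to integrate the norms of the powers over the
  columns.\<close>

lemma pow_col_measurable: "(\<lambda>z. (T ^^ n) (col (fst z)) (snd z)) \<in> borel_measurable (N \<Otimes>\<^sub>M N)"
proof (induction n)
  case 0
  have "(\<lambda>z. k (\<omega>, snd z, fst z)) \<in> borel_measurable (N \<Otimes>\<^sub>M N)"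
    using measurable_compose[OF measurable_pair_swap' k_meas] by (simp add: case_prod_beta')
  then show ?case by simp
next
  case (Suc n)
  have [measurable]: "(\<lambda>y. (T ^^ n) (col (fst (fst y))) (snd y)) \<in> borel_measurable ((N \<Otimes>\<^sub>M N) \<Otimes>\<^sub>M N)"
  proof -
    have m: "(\<lambda>y. (fst (fst y), snd y)) \<in> (N \<Otimes>\<^sub>M N) \<Otimes>\<^sub>M N \<rightarrow>\<^sub>M N \<Otimes>\<^sub>M N" by measurable
    show ?thesis using measurable_compose[OF m Suc] by simp
  qed
  have [measurable]: "(\<lambda>y. k (\<omega>, snd (fst y), snd y)) \<in> borel_measurable ((N \<Otimes>\<^sub>M N) \<Otimes>\<^sub>M N)"
  proof -
    have m: "(\<lambda>y. (snd (fst y), snd y)) \<in> (N \<Otimes>\<^sub>M N) \<Otimes>\<^sub>M N \<rightarrow>\<^sub>M N \<Otimes>\<^sub>M N" by measurable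
    show ?thesis using measurable_compose[OF m k_meas] by simp
  qed
  have "(\<lambda>y. k (\<omega>, snd (fst y), snd y) * (T ^^ n) (col (fst (fst y))) (snd y)) \<in> borel_measurable ((N \<Otimes>\<^sub>M N) \<Otimes>\<^sub>M N)"
    by measurable
  then have "(\<lambda>z. \<integral>s. k (\<omega>, snd z, s) * (T ^^ n) (col (fst z)) s \<partial>N) \<in> borel_measurable (N \<Otimes>\<^sub>M N)"
    by (intro N.borel_measurable_lebesgue_integral) (simp add: case_prod_beta')
  then show ?case by (simp add: fibre_op_def[of N k \<omega> "(T ^^ n) _"])
qed

text \<open>Self-adjointness moves the powers onto the columns: the value of the
  \<open>Suc n\<close>-th power at \<open>s\<close> is the inner product of \<open>h\<close> with
  \<open>(T ^^ n) (col s)\<close>. The integral is the squared Hilbert-Schmidt norm of that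
  power.\<close>

lemma pow_Suc_le:
  assumes h: "h \<in> L2 N"
  shows "(L2_norm N ((T ^^ Suc n) h))\<^sup>2 \<le> (L2_norm N h)\<^sup>2 * (\<integral>s. (L2_norm N ((T ^^ n) (col s)))\<^sup>2 \<partial>N)"
    "integrable N (\<lambda>s. (L2_norm N ((T ^^ n) (col s)))\<^sup>2)"
proof -
  interpret NN: pair_sigma_finite N N by unfold_locales
  have m[measurable]: "(\<lambda>s. L2_norm N ((T ^^ n) (col s))) \<in> borel_measurable N"
    using L2_norm_measurable_param[OF finite_N pow_col_measurable] by simp
  have le: "L2_norm N ((T ^^ n) (col s)) \<le> L2_norm N (row s)" if "s \<in> space N" for s
    using pow_norm_mono[OF col_L2[OF that], of 0 n] norm_col[OF that] by simp
  show i: "integrable N (\<lambda>s. (L2_norm N ((T ^^ n) (col s)))\<^sup>2)"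
  proof (rule Bochner_Integration.integrable_bound)
    show "integrable N (\<lambda>s. (L2_norm N (row s))\<^sup>2)" using rownorm_L2 by (simp add: L2_def)
    show "(\<lambda>s. (L2_norm N ((T ^^ n) (col s)))\<^sup>2) \<in> borel_measurable N" by measurable
    show "AE s in N. norm ((L2_norm N ((T ^^ n) (col s)))\<^sup>2) \<le> norm ((L2_norm N (row s))\<^sup>2)"
      by (rule AE_I2) (simp add: power_mono le)
  qed
  have "(L2_norm N ((T ^^ Suc n) h))\<^sup>2 = (\<integral>s. (cmod (T ((T ^^ n) h) s))\<^sup>2 \<partial>N)"
    by (simp add: L2_norm_sq)
  also have "\<dots> \<le> (\<integral>s. (L2_norm N h)\<^sup>2 * (L2_norm N ((T ^^ n) (col s)))\<^sup>2 \<partial>N)"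
  proof (rule integral_mono)
    show "integrable N (\<lambda>s. (cmod (T ((T ^^ n) h) s))\<^sup>2)" by (intro L2_integrable_sq T_L2 pow_L2 h)
    show "integrable N (\<lambda>s. (L2_norm N h)\<^sup>2 * (L2_norm N ((T ^^ n) (col s)))\<^sup>2)" using i by simp
    fix s assume s: "s \<in> space N"
    have "T ((T ^^ n) h) s = L2_inner N h ((T ^^ n) (col s))"
      using T_inner[OF s] pow_selfadj[OF h col_L2[OF s]] by simp
    then have "cmod (T ((T ^^ n) h) s) \<le> L2_norm N h * L2_norm N ((T ^^ n) (col s))"
      using L2_Cauchy_Schwarz[OF h pow_L2[OF col_L2[OF s]]] by simp
    then have "(cmod (T ((T ^^ n) h) s))\<^sup>2 \<le> (L2_norm N h * L2_norm N ((T ^^ n) (col s)))\<^sup>2"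
      by (intro power_mono) auto
    then show "(cmod (T ((T ^^ n) h) s))\<^sup>2 \<le> (L2_norm N h)\<^sup>2 * (L2_norm N ((T ^^ n) (col s)))\<^sup>2"
      by (simp add: power_mult_distrib)
  qed
  finally show "(L2_norm N ((T ^^ Suc n) h))\<^sup>2 \<le> (L2_norm N h)\<^sup>2 * (\<integral>s. (L2_norm N ((T ^^ n) (col s)))\<^sup>2 \<partial>N)"
    by simp
qed

text \<open>The squared norm of \<open>(T ^^ m) h\<close> is the inner product of \<open>h\<close>
  with \<open>(T ^^ (2 * m)) h\<close>, so a bound \<open>c\<close> for the exponent
  \<open>2 * m\<close> gives \<open>sqrt c\<close> for \<open>m\<close>. Halving leads from
  \<open>2 ^ j\<close> down to \<open>1\<close>.\<close>

lemma pow_two_bound: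
  assumes "\<exists>c<1. \<forall>h\<in>L2 N. L2_norm N ((T ^^ (2 ^ j)) h) \<le> c * L2_norm N h"
  shows "\<exists>c<1. \<forall>h\<in>L2 N. L2_norm N (T h) \<le> c * L2_norm N h"
  using assms
proof (induction j)
  case (Suc j)
  then obtain c where c: "c < 1" "\<And>h. h \<in> L2 N \<Longrightarrow> L2_norm N ((T ^^ (2 ^ Suc j)) h) \<le> c * L2_norm N h" by blast
  \<comment> \<open>A negative \<open>c\<close> is possible if all norms vanish, and a square root
    is to be taken.\<close>
  define c' where "c' = max c 0"
  have c': "0 \<le> c'" "c' < 1" using c(1) by (auto simp: c'_def)
  have "L2_norm N ((T ^^ (2 ^ j)) h) \<le> sqrt c' * L2_norm N h" if h: "h \<in> L2 N" for h
  proof (rule power2_le_imp_le)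
    have "complex_of_real ((L2_norm N ((T ^^ (2 ^ j)) h))\<^sup>2) = L2_inner N h ((T ^^ (2 ^ Suc j)) h)"
      unfolding L2_inner_norm[symmetric] pow_inner[OF h] by (simp add: mult_2)
    then have "(L2_norm N ((T ^^ (2 ^ j)) h))\<^sup>2 = cmod (L2_inner N h ((T ^^ (2 ^ Suc j)) h))"
      by (metis norm_of_real abs_of_nonneg zero_le_power2)
    also have "\<dots> \<le> L2_norm N h * L2_norm N ((T ^^ (2 ^ Suc j)) h)"
      by (rule L2_Cauchy_Schwarz[OF h pow_L2[OF h]])
    also have "\<dots> \<le> L2_norm N h * (c * L2_norm N h)"
      by (intro mult_left_mono c(2) h) simp
    also have "\<dots> \<le> L2_norm N h * (c' * L2_norm N h)"
      by (intro mult_left_mono mult_right_mono) (auto simp: c'_def)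
    also have "\<dots> = (sqrt c' * L2_norm N h)\<^sup>2" using c'(1) by (simp add: power_mult_distrib power2_eq_square[of "L2_norm N h"])
    finally show "(L2_norm N ((T ^^ (2 ^ j)) h))\<^sup>2 \<le> (sqrt c' * L2_norm N h)\<^sup>2" .
  qed (use c' in simp)
  moreover have "sqrt c' < 1" using c' by simp
  ultimately have "\<exists>c<1. \<forall>h\<in>L2 N. L2_norm N ((T ^^ (2 ^ j)) h) \<le> c * L2_norm N h" by blast
  then show ?case by (rule Suc.IH)
qed simp

text \<open>If all even powers of the operator tended to zero strongly on a dense part of the range, then
  by dominated convergence the Hilbert-Schmidt norms of the powers would tend to zero, and the
  operator would have norm less than one.\<close>

lemma pow_not_null:
  assumes d: "\<And>i::nat. d i \<in> L2 N" and dense: "\<And>g e. g \<in> L2 N \<Longrightarrow> e > 0 \<Longrightarrow> \<exists>i. L2_norm N (\<lambda>t. T g t - d i t) < e"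
    and null: "\<And>i. (\<lambda>n. L2_norm N ((T ^^ (2 * n)) (d i))) \<longlonglongrightarrow> 0"
  shows "\<exists>c<1. \<forall>h\<in>L2 N. L2_norm N (T h) \<le> c * L2_norm N h"
proof -
  have pow0: "(\<lambda>n. L2_norm N ((T ^^ n) g)) \<longlonglongrightarrow> 0" if g: "g \<in> L2 N" for g
  proof (rule LIMSEQ_I)
    fix e :: real assume e: "e > 0"
    obtain i where i: "L2_norm N (\<lambda>t. T g t - d i t) < e / 2" using dense[OF g, of "e/2"] e by auto
    obtain K where K: "\<And>n. n \<ge> K \<Longrightarrow> L2_norm N ((T ^^ (2 * n)) (d i)) < e / 2"
      using LIMSEQ_D[OF null[of i], of "e/2"] e by auto
    \<comment> \<open>The odd exponent provides one application of \<open>T\<close> that moves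
      \<open>g\<close> into the range, where \<open>d\<close> is dense.\<close>
    have "norm (L2_norm N ((T ^^ n) g) - 0) < e" if "n \<ge> Suc (2 * K)" for n
    proof -
      have "L2_norm N ((T ^^ n) g) \<le> L2_norm N ((T ^^ Suc (2 * K)) g)" by (rule pow_norm_mono[OF g that])
      also have "\<dots> = L2_norm N ((T ^^ (2 * K)) (T g))" by (simp add: funpow_swap1)
      also have "\<dots> \<le> L2_norm N ((T ^^ (2 * K)) (d i)) + L2_norm N (\<lambda>s. (T ^^ (2 * K)) (T g) s - (T ^^ (2 * K)) (d i) s)"
        by (intro L2_norm_triangle_sub pow_L2 T_L2 g d)
      also have "\<dots> \<le> L2_norm N ((T ^^ (2 * K)) (d i)) + L2_norm N (\<lambda>s. T g s - d i s)"
        by (intro add_left_mono pow_diff_le T_L2 g d)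
      also have "\<dots> < e" using K[of K] i by simp
      finally show ?thesis by simp
    qed
    then show "\<exists>no. \<forall>n\<ge>no. norm (L2_norm N ((T ^^ n) g) - 0) < e" by blast
  qed
  define a where "a n = (\<integral>s. (L2_norm N ((T ^^ n) (col s)))\<^sup>2 \<partial>N)" for n
  have "a \<longlonglongrightarrow> (\<integral>s. 0 \<partial>N)"
    unfolding a_def
  proof (rule integral_dominated_convergence)
    show "integrable N (\<lambda>s. (L2_norm N (row s))\<^sup>2)" using rownorm_L2 by (simp add: L2_def)
    show "AE s in N. (\<lambda>n. (L2_norm N ((T ^^ n) (col s)))\<^sup>2) \<longlonglongrightarrow> 0"
      using tendsto_power[OF pow0[OF col_L2], of _ 2] by (intro AE_I2) simp
    show "(\<lambda>s. (L2_norm N ((T ^^ n) (col s)))\<^sup>2) \<in> borel_measurable N" for n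
      by (rule borel_measurable_integrable[OF pow_Suc_le(2)]) (rule L2_zero)
    show "AE s in N. norm ((L2_norm N ((T ^^ n) (col s)))\<^sup>2) \<le> (L2_norm N (row s))\<^sup>2" for n
    proof (rule AE_I2)
      fix s assume "s \<in> space N"
      then have "L2_norm N ((T ^^ n) (col s)) \<le> L2_norm N (row s)"
        using pow_norm_mono[OF col_L2, of s 0 n] norm_col[of s] by simp
      then show "norm ((L2_norm N ((T ^^ n) (col s)))\<^sup>2) \<le> (L2_norm N (row s))\<^sup>2" by (simp add: power_mono)
    qed
  qed simp
  then have "a \<longlonglongrightarrow> 0" by simp
  \<comment> \<open>\<open>1/4\<close> is the square of the factor \<open>1/2\<close> that the power
    \<open>2 ^ j\<close> is to have; any bound below \<open>1\<close> would do.\<close>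
  then obtain n where n: "\<bar>a n\<bar> < 1/4" using LIMSEQ_D[of a 0 "1/4"] by auto
  obtain j where j: "Suc n \<le> 2 ^ j" by (metis less_exp less_imp_le)
  have "L2_norm N ((T ^^ (2 ^ j)) h) \<le> 1/2 * L2_norm N h" if h: "h \<in> L2 N" for h
  proof -
    have "(L2_norm N ((T ^^ Suc n) h))\<^sup>2 \<le> (L2_norm N h)\<^sup>2 * a n" unfolding a_def by (rule pow_Suc_le(1)[OF h])
    also have "\<dots> \<le> (L2_norm N h)\<^sup>2 * (1/4)" using n by (intro mult_left_mono) auto
    also have "\<dots> = (1/2 * L2_norm N h)\<^sup>2" by (simp add: power_mult_distrib power2_eq_square)
    finally have "L2_norm N ((T ^^ Suc n) h) \<le> 1/2 * L2_norm N h" by (rule power2_le_imp_le) simp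
    then show ?thesis using pow_norm_mono[OF h j] by simp
  qed
  then have "\<exists>c<1. \<forall>h\<in>L2 N. L2_norm N ((T ^^ (2 ^ j)) h) \<le> c * L2_norm N h" by (intro exI[of _ "1/2"]) auto
  then show ?thesis by (rule pow_two_bound)
qed

end

section \<open>Measurable fields of Hilbert-Schmidt operators\<close>

lemma curry_partial_int_op: "curry (partial_int_op N k f) \<omega> = fibre_op N k \<omega> (curry f \<omega>)"
  by (simp add: partial_int_op_def fibre_op_def curry_def fun_eq_iff)

lemma partial_int_op_apply: "partial_int_op N k f (\<omega>, t) = fibre_op N k \<omega> (curry f \<omega>) t"
  by (simp add: partial_int_op_def fibre_op_def curry_def)

lemma curry_partial_int_op_pow: "curry ((partial_int_op N k ^^ n) f) \<omega> = (fibre_op N k \<omega> ^^ n) (curry f \<omega>)"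
proof (induction n)
  case (Suc n)
  show ?case unfolding funpow.simps o_apply curry_partial_int_op Suc.IH ..
qed simp

lemma partial_int_op_measurable[measurable (raw)]:
  assumes "finite_measure N" and [measurable]: "k \<in> borel_measurable (M \<Otimes>\<^sub>M (N \<Otimes>\<^sub>M N))" "f \<in> borel_measurable (M \<Otimes>\<^sub>M N)"
  shows "partial_int_op N k f \<in> borel_measurable (M \<Otimes>\<^sub>M N)"
proof -
  interpret N: finite_measure N by fact
  have "(\<lambda>y. k (fst (fst y), snd (fst y), snd y) * f (fst (fst y), snd y)) \<in> borel_measurable ((M \<Otimes>\<^sub>M N) \<Otimes>\<^sub>M N)"
    by measurable
  then have "(\<lambda>z. \<integral>s. k (fst z, snd z, s) * f (fst z, s) \<partial>N) \<in> borel_measurable (M \<Otimes>\<^sub>M N)"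
    by (intro N.borel_measurable_lebesgue_integral) (simp add: case_prod_beta')
  then show ?thesis by (simp add: partial_int_op_def[abs_def] case_prod_beta')
qed

lemma partial_int_op_pow_measurable:
  assumes "finite_measure N" "k \<in> borel_measurable (M \<Otimes>\<^sub>M (N \<Otimes>\<^sub>M N))" "f \<in> borel_measurable (M \<Otimes>\<^sub>M N)"
  shows "(partial_int_op N k ^^ n) f \<in> borel_measurable (M \<Otimes>\<^sub>M N)"
  by (induction n) (simp_all add: partial_int_op_measurable assms)

text \<open>Density is required in the ranges of the fibre operators only, with a family independent
  of \<omega>. Both features are inherited by deflated kernels, so that the same \<open>d\<close>
  serves throughout the recursion.\<close>

locale kernel_field =
  fixes M :: "'a measure" and N :: "'b measure" and d :: "nat \<Rightarrow> 'b \<Rightarrow> complex" and k :: "'a \<times> 'b \<times> 'b \<Rightarrow> complex"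
  assumes finite_N: "finite_measure N" and d_L2: "\<And>n. d n \<in> L2 N"
    and k_meas[measurable]: "k \<in> borel_measurable (M \<Otimes>\<^sub>M (N \<Otimes>\<^sub>M N))"
    and hs: "\<And>\<omega>. \<omega> \<in> space M \<Longrightarrow> hs_kernel N k \<omega>"
    and dense: "\<And>\<omega> g e. \<omega> \<in> space M \<Longrightarrow> g \<in> L2 N \<Longrightarrow> e > 0 \<Longrightarrow> \<exists>i. L2_norm N (\<lambda>t. fibre_op N k \<omega> g t - d i t) < e"
begin

sublocale N: finite_measure N by (rule finite_N)

lemma hs_op: "\<omega> \<in> space M \<Longrightarrow> hs_op N k \<omega>"
  by unfold_locales (rule hs)

text \<open>This turns out to be the norm of the fibre operator although \<open>d\<close> need not
  be dense in \<open>L2 N\<close>. Null members contribute \<open>0\<close>, the value of a division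
  by zero.\<close>

definition top_abs :: "'a \<Rightarrow> real" where
  "top_abs \<omega> = (SUP n. L2_norm N (fibre_op N k \<omega> (d n)) / L2_norm N (d n))"

context
  fixes \<omega> assumes \<omega>: "\<omega> \<in> space M"
begin

interpretation hs_op N k \<omega> by (rule hs_op[OF \<omega>])

lemma ratio_le: "L2_norm N (T (d n)) / L2_norm N (d n) \<le> hsn"
proof (cases "L2_norm N (d n) = 0")
  case False
  then have "L2_norm N (d n) > 0" using L2_norm_nonneg[of N "d n"] by linarith
  then show ?thesis using T_norm[OF d_L2] by (simp add: pos_divide_le_eq)
qed (simp add: hsn_nonneg)

lemma ratio_bdd: "bdd_above (range (\<lambda>n. L2_norm N (T (d n)) / L2_norm N (d n)))"
  using ratio_le by (auto simp: bdd_above_def)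

lemma top_abs_nonneg: "top_abs \<omega> \<ge> 0"
proof -
  have "0 \<le> L2_norm N (T (d 0)) / L2_norm N (d 0)" by simp
  also have "\<dots> \<le> top_abs \<omega>" unfolding top_abs_def by (rule cSUP_upper[OF UNIV_I ratio_bdd])
  finally show ?thesis .
qed

lemma T_d_le: "L2_norm N (T (d n)) \<le> top_abs \<omega> * L2_norm N (d n)"
proof (cases "L2_norm N (d n) = 0")
  case True
  then show ?thesis using T_norm[OF d_L2, of n] by simp
next
  case False
  then have "L2_norm N (d n) > 0" using L2_norm_nonneg[of N "d n"] by linarith
  moreover have "L2_norm N (T (d n)) / L2_norm N (d n) \<le> top_abs \<omega>"
    unfolding top_abs_def by (rule cSUP_upper[OF UNIV_I ratio_bdd])
  ultimately show ?thesis by (simp add: pos_divide_le_eq)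
qed

text \<open>Density yields the estimate only for vectors \<open>T g\<close>. It extends to
  \<open>g\<close> because the squared norm of \<open>T g\<close> is the inner product of
  \<open>T (T g)\<close> with \<open>g\<close>; one factor, the norm of \<open>T g\<close>, is
  cancelled.\<close>

lemma T_le_top: assumes g: "g \<in> L2 N" shows "L2_norm N (T g) \<le> top_abs \<omega> * L2_norm N g"
proof -
  have TT: "L2_norm N (T (T g)) \<le> top_abs \<omega> * L2_norm N (T g)"
  proof (rule field_le_epsilon)
    fix e :: real assume e: "e > 0"
    \<comment> \<open>Replacing \<open>T g\<close> by \<open>d i\<close> costs
      \<open>hsn * e'\<close> under the operator and \<open>top_abs \<omega> * e'\<close> in the
      norm of \<open>d i\<close>; the added \<open>1\<close> makes the divisor positive.\<close>
    define e' where "e' = e / (hsn + top_abs \<omega> + 1)"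
    have pos: "hsn + top_abs \<omega> + 1 > 0" using hsn_nonneg top_abs_nonneg by linarith
    have "e' > 0" using e pos by (simp add: e'_def)
    then obtain i where i: "L2_norm N (\<lambda>t. T g t - d i t) < e'" using dense[OF \<omega> g] by blast
    have "L2_norm N (T (T g)) \<le> L2_norm N (T (d i)) + L2_norm N (\<lambda>t. T (T g) t - T (d i) t)"
      by (intro L2_norm_triangle_sub T_L2 g d_L2)
    also have "L2_norm N (\<lambda>t. T (T g) t - T (d i) t) = L2_norm N (T (\<lambda>t. T g t - d i t))"
      by (rule L2_norm_cong) (simp add: T_diff T_L2 g d_L2)
    also have "L2_norm N (T (\<lambda>t. T g t - d i t)) \<le> hsn * L2_norm N (\<lambda>t. T g t - d i t)"
      by (intro T_norm L2_diff T_L2 g d_L2)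
    also have "\<dots> \<le> hsn * e'" using i hsn_nonneg by (intro mult_left_mono) auto
    also have "L2_norm N (T (d i)) \<le> top_abs \<omega> * L2_norm N (d i)" by (rule T_d_le)
    also have "L2_norm N (d i) \<le> L2_norm N (T g) + e'"
      using L2_norm_triangle_sub[OF d_L2 T_L2[OF g], of i] i by (simp add: L2_norm_minus_commute[of N "d i"])
    finally have "L2_norm N (T (T g)) \<le> top_abs \<omega> * (L2_norm N (T g) + e') + hsn * e'"
      using top_abs_nonneg by (simp add: mult_left_mono)
    also have "\<dots> = top_abs \<omega> * L2_norm N (T g) + (hsn + top_abs \<omega>) * e'" by (simp add: algebra_simps)
    also have "(hsn + top_abs \<omega>) * e' \<le> (hsn + top_abs \<omega> + 1) * e'" using \<open>e' > 0\<close> by (intro mult_right_mono) auto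
    also have "\<dots> = e" using pos by (simp add: e'_def)
    finally show "L2_norm N (T (T g)) \<le> top_abs \<omega> * L2_norm N (T g) + e" by simp
  qed
  show ?thesis
  proof (cases "L2_norm N (T g) = 0")
    case True
    then show ?thesis using top_abs_nonneg by simp
  next
    case False
    then have pos: "L2_norm N (T g) > 0" using L2_norm_nonneg[of N "T g"] by linarith
    have "complex_of_real ((L2_norm N (T g))\<^sup>2) = L2_inner N (T (T g)) g"
      unfolding L2_inner_norm[symmetric] by (rule T_selfadj[OF T_L2[OF g] g, symmetric])
    then have "(L2_norm N (T g))\<^sup>2 = cmod (L2_inner N (T (T g)) g)"
      by (metis norm_of_real abs_of_nonneg zero_le_power2)
    also have "\<dots> \<le> L2_norm N (T (T g)) * L2_norm N g" by (intro L2_Cauchy_Schwarz T_L2 g)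
    also have "\<dots> \<le> top_abs \<omega> * L2_norm N (T g) * L2_norm N g" by (intro mult_right_mono TT) simp
    finally have "L2_norm N (T g) * L2_norm N (T g) \<le> L2_norm N (T g) * (top_abs \<omega> * L2_norm N g)"
      by (simp add: power2_eq_square mult_ac)
    then show ?thesis using pos by simp
  qed
qed

lemma top_abs_least:
  assumes "\<And>g. g \<in> L2 N \<Longrightarrow> L2_norm N (T g) \<le> c * L2_norm N g" "c \<ge> 0" shows "top_abs \<omega> \<le> c"
  unfolding top_abs_def
proof (rule cSUP_least)
  fix n
  show "L2_norm N (T (d n)) / L2_norm N (d n) \<le> c"
  proof (cases "L2_norm N (d n) = 0")
    case False
    then have "L2_norm N (d n) > 0" using L2_norm_nonneg[of N "d n"] by linarith
    then show ?thesis using assms(1)[OF d_L2] by (simp add: pos_divide_le_eq)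
  qed (simp add: assms)
qed simp

end

lemma const_field_measurable[measurable]: "(\<lambda>z. d i (snd z)) \<in> borel_measurable (M \<Otimes>\<^sub>M N)"
  using measurable_compose[OF measurable_snd L2_measurable[OF d_L2[of i]]] .

lemma top_abs_measurable[measurable]: "top_abs \<in> borel_measurable M"
  unfolding top_abs_def[abs_def]
proof (rule borel_measurable_cSUP)
  fix n
  have "(\<lambda>\<omega>. L2_norm N (\<lambda>t. partial_int_op N k (\<lambda>z. d n (snd z)) (\<omega>, t))) \<in> borel_measurable M"
    by (intro L2_norm_measurable_param partial_int_op_measurable finite_N k_meas const_field_measurable)
  then have "(\<lambda>\<omega>. L2_norm N (fibre_op N k \<omega> (d n))) \<in> borel_measurable M"
    by (simp add: partial_int_op_apply curry_def)
  then show "(\<lambda>\<omega>. L2_norm N (fibre_op N k \<omega> (d n)) / L2_norm N (d n)) \<in> borel_measurable M" by measurable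
qed (use ratio_bdd in auto)

text \<open>Where \<open>top_abs\<close> vanishes this is the zero kernel, by division by zero, so
  that no fibre has to be excluded from the measurability statements.\<close>

definition k1 :: "'a \<times> 'b \<times> 'b \<Rightarrow> complex" where "k1 z = k z / complex_of_real (top_abs (fst z))"

lemma k1_meas[measurable]: "k1 \<in> borel_measurable (M \<Otimes>\<^sub>M (N \<Otimes>\<^sub>M N))"
  unfolding k1_def[abs_def] by measurable

lemma fibre_op_k1: "fibre_op N k1 \<omega> g t = fibre_op N k \<omega> g t / complex_of_real (top_abs \<omega>)"
  by (simp add: fibre_op_def k1_def)

lemma hs_k1: assumes \<omega>: "\<omega> \<in> space M" shows "hs_kernel N k1 \<omega>"
proof -
  interpret k: hs_op N k \<omega> by (rule hs_op[OF \<omega>])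
  have "(\<lambda>(t, s). k1 (\<omega>, t, s)) \<in> borel_measurable (N \<Otimes>\<^sub>M N)"
    unfolding k1_def case_prod_beta' fst_conv by (intro borel_measurable_divide k.k_meas borel_measurable_const)
  moreover have "(\<lambda>s. k1 (\<omega>, t, s)) \<in> L2 N" if "t \<in> space N" for t
    unfolding k1_def fst_conv by (intro L2_divide k.row_L2 that)
  moreover have "(\<lambda>t. complex_of_real (L2_norm N (\<lambda>s. k1 (\<omega>, t, s)))) \<in> L2 N"
    unfolding k1_def fst_conv L2_norm_divide of_real_divide by (intro L2_divide k.rownorm_L2)
  ultimately show ?thesis
    unfolding hs_kernel_def by (auto simp: k1_def intro: k.k_herm)
qed

lemma hs_contraction_k1:
  assumes \<omega>: "\<omega> \<in> space M" and pos: "top_abs \<omega> > 0"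
  shows "hs_contraction N k1 \<omega>"
proof unfold_locales
  show "hs_kernel N k1 \<omega>" by (rule hs_k1[OF \<omega>])
  fix g assume "g \<in> L2 N"
  then show "L2_norm N (fibre_op N k1 \<omega> g) \<le> L2_norm N g"
    using T_le_top[OF \<omega>, of g] pos by (simp add: fibre_op_k1[abs_def] L2_norm_divide pos_divide_le_eq mult.commute)
qed

text \<open>If the limits vanished for all members of the family, \<open>pow_not_null\<close> would
  bound the normalised operator by some \<open>c < 1\<close>, contrary to the minimality of
  \<open>top_abs\<close>. The least index with a non-zero limit is measurable in \<omega> and glues
  the limits to one field.\<close>

lemma eigenfield_exists:
  obtains Y where "Y \<in> borel_measurable (M \<Otimes>\<^sub>M N)"
    "\<And>\<omega>. \<omega> \<in> space M \<Longrightarrow> top_abs \<omega> > 0 \<Longrightarrow> curry Y \<omega> \<in> L2 N \<and> L2_norm N (curry Y \<omega>) \<noteq> 0 \<and>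
       (AE t in N. fibre_op N k1 \<omega> (fibre_op N k1 \<omega> (curry Y \<omega>)) t = Y (\<omega>, t))"
proof -
  define F where "F i n = (partial_int_op N k1 ^^ (2 * n)) (\<lambda>z. d i (snd z))" for i n
  have F[measurable]: "F i n \<in> borel_measurable (M \<Otimes>\<^sub>M N)" for i n
    unfolding F_def by (intro partial_int_op_pow_measurable finite_N k1_meas const_field_measurable)
  have Fc: "curry (F i n) \<omega> = (fibre_op N k1 \<omega> ^^ (2 * n)) (d i)" for i n \<omega>
    unfolding F_def curry_partial_int_op_pow by (simp add: curry_def)
  then have Fa: "F i n (\<omega>, t) = (fibre_op N k1 \<omega> ^^ (2 * n)) (d i) t" for i n \<omega> t
    by (metis curry_conv)
  have "\<exists>Y. Y \<in> borel_measurable (M \<Otimes>\<^sub>M N) \<and> (\<forall>\<omega>\<in>space M. top_abs \<omega> > 0 \<longrightarrow> L2_tendsto N (\<lambda>n. curry (F i n) \<omega>) (curry Y \<omega>))" for i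
  proof (rule L2_limit_measurable[OF finite_N F[of i]])
    fix G assume G: "G \<in> borel_measurable (M \<Otimes>\<^sub>M N)" and lim: "\<And>\<omega>. \<omega> \<in> space M \<Longrightarrow> (\<And>n. curry (F i n) \<omega> \<in> L2 N) \<Longrightarrow>
      (\<And>e. e > 0 \<Longrightarrow> \<exists>K. \<forall>m\<ge>K. \<forall>n\<ge>K. L2_norm N (\<lambda>s. F i m (\<omega>, s) - F i n (\<omega>, s)) < e) \<Longrightarrow>
      L2_tendsto N (\<lambda>n. curry (F i n) \<omega>) (curry G \<omega>)"
    have "L2_tendsto N (\<lambda>n. curry (F i n) \<omega>) (curry G \<omega>)" if \<omega>: "\<omega> \<in> space M" and pos: "top_abs \<omega> > 0" for \<omega>
    proof (rule lim[OF \<omega>])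
      interpret k1: hs_contraction N k1 \<omega> by (rule hs_contraction_k1[OF \<omega> pos])
      show "curry (F i n) \<omega> \<in> L2 N" for n unfolding Fc by (rule k1.pow_L2[OF d_L2])
      show "\<exists>K. \<forall>m\<ge>K. \<forall>n\<ge>K. L2_norm N (\<lambda>s. F i m (\<omega>, s) - F i n (\<omega>, s)) < e" if "e > 0" for e
        unfolding Fa by (rule k1.pow_Cauchy[OF d_L2 that])
    qed
    then show ?thesis using G by blast
  qed
  then obtain Y where Y[measurable]: "\<And>i. Y i \<in> borel_measurable (M \<Otimes>\<^sub>M N)"
    and Yl: "\<And>i \<omega>. \<omega> \<in> space M \<Longrightarrow> top_abs \<omega> > 0 \<Longrightarrow> L2_tendsto N (\<lambda>n. curry (F i n) \<omega>) (curry (Y i) \<omega>)"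
    by metis
  define I where "I \<omega> = (LEAST i. fun_norm N (Y i) \<omega> \<noteq> 0)" for \<omega>
  have fm[measurable]: "fun_norm N (Y i) \<in> borel_measurable M" for i by (rule fun_norm_measurable[OF finite_N Y])
  have [measurable]: "I \<in> measurable M (count_space UNIV)" unfolding I_def[abs_def] by measurable
  define Z where "Z z = Y (I (fst z)) z" for z
  have Z[measurable]: "Z \<in> borel_measurable (M \<Otimes>\<^sub>M N)"
    unfolding Z_def[abs_def] by (rule measurable_compose_countable) measurable
  have "curry Z \<omega> \<in> L2 N \<and> L2_norm N (curry Z \<omega>) \<noteq> 0 \<and>
       (AE t in N. fibre_op N k1 \<omega> (fibre_op N k1 \<omega> (curry Z \<omega>)) t = Z (\<omega>, t))" if \<omega>: "\<omega> \<in> space M" and pos: "top_abs \<omega> > 0" for \<omega>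
  proof -
    interpret k: hs_op N k \<omega> by (rule hs_op[OF \<omega>])
    interpret k1: hs_contraction N k1 \<omega> by (rule hs_contraction_k1[OF \<omega> pos])
    have Zc: "curry Z \<omega> = curry (Y (I \<omega>)) \<omega>" by (simp add: Z_def curry_def)
    have lim: "L2_tendsto N (\<lambda>n. (fibre_op N k1 \<omega> ^^ (2 * n)) (d i)) (curry (Y i) \<omega>)" for i
      using Yl[OF \<omega> pos, of i] unfolding Fc .
    have "\<exists>i. fun_norm N (Y i) \<omega> \<noteq> 0"
    proof (rule ccontr)
      assume "\<not> ?thesis"
      then have null: "(\<lambda>n. L2_norm N ((fibre_op N k1 \<omega> ^^ (2 * n)) (d i))) \<longlonglongrightarrow> 0" for i
        using L2_tendsto_norm[OF lim[of i]] by (simp add: fun_norm_def)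
      \<comment> \<open>Linearity: \<open>k1\<close> applied to \<open>g\<close> is \<open>k\<close>
        applied to \<open>g\<close> divided by \<open>top_abs \<omega>\<close>.\<close>
      have dense1: "\<exists>i. L2_norm N (\<lambda>t. fibre_op N k1 \<omega> g t - d i t) < e" if "g \<in> L2 N" "e > 0" for g e
      proof -
        from dense[OF \<omega> L2_divide[OF that(1), of "complex_of_real (top_abs \<omega>)"] that(2)] obtain i where
          "L2_norm N (\<lambda>t. fibre_op N k \<omega> (\<lambda>s. g s / complex_of_real (top_abs \<omega>)) t - d i t) < e" by blast
        moreover have "L2_norm N (\<lambda>t. fibre_op N k \<omega> (\<lambda>s. g s / complex_of_real (top_abs \<omega>)) t - d i t) = 
            L2_norm N (\<lambda>t. fibre_op N k1 \<omega> g t - d i t)"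
          by (rule L2_norm_cong) (simp add: k.T_divide fibre_op_k1)
        ultimately show ?thesis by auto
      qed
      obtain c where c: "c < 1" "\<And>h. h \<in> L2 N \<Longrightarrow> L2_norm N (fibre_op N k1 \<omega> h) \<le> c * L2_norm N h"
        using k1.pow_not_null[OF d_L2 dense1 null] by blast
      define c' where "c' = max c 0"
      have "top_abs \<omega> \<le> c' * top_abs \<omega>"
      proof (rule top_abs_least[OF \<omega>])
        fix g assume g: "g \<in> L2 N"
        have "L2_norm N (fibre_op N k \<omega> g) / top_abs \<omega> \<le> c * L2_norm N g"
          using c(2)[OF g] pos by (simp add: fibre_op_k1[abs_def] L2_norm_divide)
        also have "\<dots> \<le> c' * L2_norm N g" by (intro mult_right_mono) (auto simp: c'_def)
        finally show "L2_norm N (fibre_op N k \<omega> g) \<le> c' * top_abs \<omega> * L2_norm N g"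
          using pos by (simp add: pos_divide_le_eq mult_ac)
      qed (use pos in \<open>simp add: c'_def\<close>)
      moreover have "c' < 1" using c(1) by (simp add: c'_def)
      ultimately show False using pos by (metis mult_less_cancel_right2 not_le)
    qed
    then have "fun_norm N (Y (I \<omega>)) \<omega> \<noteq> 0" unfolding I_def by (rule LeastI_ex)
    moreover have "curry (Y (I \<omega>)) \<omega> \<in> L2 N" by (rule L2_tendstoD(2)[OF lim])
    moreover have "AE t in N. fibre_op N k1 \<omega> (fibre_op N k1 \<omega> (curry (Y (I \<omega>)) \<omega>)) t = curry (Y (I \<omega>)) \<omega> t"
      by (rule k1.pow_limit[OF d_L2 lim])
    ultimately show ?thesis unfolding Zc fun_norm_def by (simp add: Z_def)
  qed
  then show ?thesis using that Z by blast
qed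

text \<open>From \<open>T (T y) = y\<close> it follows that \<open>y\<close> or \<open>T y - y\<close> is an eigenvector, with eigenvalue \<open>1\<close> or \<open>-1\<close>.\<close>

definition eigenpair :: "('a \<Rightarrow> real) \<Rightarrow> ('a \<times> 'b \<Rightarrow> complex) \<Rightarrow> bool" where
  "eigenpair l x \<longleftrightarrow> l \<in> borel_measurable M \<and> x \<in> borel_measurable (M \<Otimes>\<^sub>M N) \<and>
    (\<forall>\<omega>\<in>space M. curry x \<omega> \<in> L2 N \<and>
       (AE t in N. fibre_op N k \<omega> (curry x \<omega>) t = complex_of_real (l \<omega>) * x (\<omega>, t)) \<and>
       L2_norm N (curry x \<omega>) = (if l \<omega> = 0 then 0 else 1) \<and>
       (\<forall>g\<in>L2 N. L2_norm N (fibre_op N k \<omega> g) \<le> \<bar>l \<omega>\<bar> * L2_norm N g))"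

lemma eigenpair_exists: "\<exists>l x. eigenpair l x"
proof (rule eigenfield_exists)
  fix Y assume Y[measurable]: "Y \<in> borel_measurable (M \<Otimes>\<^sub>M N)" and
    YP: "\<And>\<omega>. \<omega> \<in> space M \<Longrightarrow> top_abs \<omega> > 0 \<Longrightarrow> curry Y \<omega> \<in> L2 N \<and> L2_norm N (curry Y \<omega>) \<noteq> 0 \<and>
       (AE t in N. fibre_op N k1 \<omega> (fibre_op N k1 \<omega> (curry Y \<omega>)) t = Y (\<omega>, t))"
  define Z where "Z z = partial_int_op N k1 Y z - Y z" for z
  have [measurable]: "partial_int_op N k1 Y \<in> borel_measurable (M \<Otimes>\<^sub>M N)"
    by (intro partial_int_op_measurable finite_N k1_meas Y)
  have Z[measurable]: "Z \<in> borel_measurable (M \<Otimes>\<^sub>M N)" unfolding Z_def[abs_def] by measurable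
  have [measurable]: "fun_norm N Y \<in> borel_measurable M" "fun_norm N Z \<in> borel_measurable M"
    by (intro fun_norm_measurable finite_N Y Z)+
  \<comment> \<open>Three cases: the zero operator, with zero vector and zero eigenvalue; a null
    \<open>Z\<close>, with eigenvalue \<open>top_abs\<close>; and otherwise \<open>Z\<close>, which
    the normalised operator maps to its negative.\<close>
  define x where "x z = (if top_abs (fst z) = 0 then 0 else if fun_norm N Z (fst z) = 0 
     then Y z / complex_of_real (fun_norm N Y (fst z)) else Z z / complex_of_real (fun_norm N Z (fst z)))" for z
  define l where "l \<omega> = (if fun_norm N Z \<omega> = 0 then top_abs \<omega> else - top_abs \<omega>)" for \<omega>
  have "l \<in> borel_measurable M" unfolding l_def[abs_def] by measurable
  moreover have "x \<in> borel_measurable (M \<Otimes>\<^sub>M N)" unfolding x_def[abs_def] by measurable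
  moreover have "curry x \<omega> \<in> L2 N \<and>
       (AE t in N. fibre_op N k \<omega> (curry x \<omega>) t = complex_of_real (l \<omega>) * x (\<omega>, t)) \<and>
       L2_norm N (curry x \<omega>) = (if l \<omega> = 0 then 0 else 1) \<and>
       (\<forall>g\<in>L2 N. L2_norm N (fibre_op N k \<omega> g) \<le> \<bar>l \<omega>\<bar> * L2_norm N g)" if \<omega>: "\<omega> \<in> space M" for \<omega>
  proof -
    interpret k: hs_op N k \<omega> by (rule hs_op[OF \<omega>])
    have al: "\<bar>l \<omega>\<bar> = top_abs \<omega>" using top_abs_nonneg[OF \<omega>] by (simp add: l_def)
    have le: "\<forall>g\<in>L2 N. L2_norm N (fibre_op N k \<omega> g) \<le> \<bar>l \<omega>\<bar> * L2_norm N g" using T_le_top[OF \<omega>] al by simp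
    show ?thesis
    proof (cases "top_abs \<omega> = 0")
      case True
      then have "curry x \<omega> = (\<lambda>t. 0)" "l \<omega> = 0" by (auto simp: x_def l_def curry_def)
      then show ?thesis using le by (simp add: fibre_op_def)
    next
      case False
      then have pos: "top_abs \<omega> > 0" using top_abs_nonneg[OF \<omega>] by simp
      interpret k1: hs_contraction N k1 \<omega> by (rule hs_contraction_k1[OF \<omega> pos])
      define y where "y = curry Y \<omega>"
      have y: "y \<in> L2 N" "L2_norm N y \<noteq> 0" "AE t in N. k1.T (k1.T y) t = y t"
        using YP[OF \<omega> pos] by (simp_all add: y_def)
      define z where "z = curry Z \<omega>"
      have z: "z = (\<lambda>t. k1.T y t - y t)" by (simp add: z_def Z_def curry_def partial_int_op_apply y_def)
      have zL: "z \<in> L2 N" unfolding z by (intro L2_diff k1.T_L2 y)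
      have l0: "l \<omega> \<noteq> 0" using pos by (simp add: l_def)
      define v where "v = (if L2_norm N z = 0 then y else z)"
      have v: "v \<in> L2 N" "L2_norm N v \<noteq> 0" using y zL by (auto simp: v_def)
      have xv: "curry x \<omega> = (\<lambda>t. v t / complex_of_real (L2_norm N v))"
        using pos by (simp add: x_def curry_def v_def fun_norm_def z_def y_def)
      have "AE t in N. k.T v t = complex_of_real (l \<omega>) * v t"
      proof (cases "L2_norm N z = 0")
        case True
        then have "AE t in N. k1.T y t - y t = 0" using L2_norm_eq_0_iff[OF zL] unfolding z by simp
        then show ?thesis
        proof eventually_elim
          case (elim t)
          then show ?case using True pos by (simp add: v_def l_def fun_norm_def z_def fibre_op_k1 field_simps)
        qed
      next
        case F: False
        have "AE t in N. t \<in> space N" by simp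
        with y(3) show ?thesis
        proof eventually_elim
          case (elim t)
          have "k1.T z t = k1.T (k1.T y) t - k1.T y t" unfolding z by (rule k1.T_diff) (use k1.T_L2 y elim in auto)
          also have "\<dots> = - z t" using elim by (simp add: z)
          finally show ?case using F pos by (simp add: v_def l_def fun_norm_def z_def[symmetric] fibre_op_k1 field_simps)
        qed
      qed
      moreover have "AE t in N. t \<in> space N" by simp
      ultimately have "AE t in N. fibre_op N k \<omega> (curry x \<omega>) t = complex_of_real (l \<omega>) * x (\<omega>, t)"
      proof eventually_elim
        case (elim t)
        have "x (\<omega>, t) = v t / complex_of_real (L2_norm N v)" using xv by (metis curry_conv)
        then show ?case unfolding xv using elim by (simp add: k.T_divide)
      qed
      moreover have "curry x \<omega> \<in> L2 N" unfolding xv by (intro L2_divide v)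
      moreover have "L2_norm N (curry x \<omega>) = 1" unfolding xv L2_norm_divide using v(2) by simp
      ultimately show ?thesis using le l0 by simp
    qed
  qed
  ultimately have "eigenpair l x" unfolding eigenpair_def by blast
  then show ?thesis by blast
qed

end

section \<open>Deflation\<close>

declare curry_conv [simp del]

definition deflate :: "('a \<times> 'b \<times> 'b \<Rightarrow> complex) \<Rightarrow> ('a \<Rightarrow> real) \<Rightarrow> ('a \<times> 'b \<Rightarrow> complex) \<Rightarrow> 'a \<times> 'b \<times> 'b \<Rightarrow> complex" where
  "deflate k l x z = k z - complex_of_real (l (fst z)) * x (fst z, fst (snd z)) * cnj (x (fst z, snd (snd z)))"

context kernel_field
begin

context
  fixes l x assumes lx: "eigenpair l x"
begin

lemma l_meas[measurable]: "l \<in> borel_measurable M" and x_meas[measurable]: "x \<in> borel_measurable (M \<Otimes>\<^sub>M N)"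
  using lx by (auto simp: eigenpair_def)

lemma eigenpairD:
  assumes "\<omega> \<in> space M"
  shows "curry x \<omega> \<in> L2 N" "AE t in N. fibre_op N k \<omega> (curry x \<omega>) t = complex_of_real (l \<omega>) * x (\<omega>, t)"
    "L2_norm N (curry x \<omega>) = (if l \<omega> = 0 then 0 else 1)" 
    "g \<in> L2 N \<Longrightarrow> L2_norm N (fibre_op N k \<omega> g) \<le> \<bar>l \<omega>\<bar> * L2_norm N g"
  using lx assms by (auto simp: eigenpair_def)

lemma fibre_op_deflate:
  assumes \<omega>: "\<omega> \<in> space M" and g: "g \<in> L2 N" and t: "t \<in> space N"
  shows "fibre_op N (deflate k l x) \<omega> g t = fibre_op N k \<omega> g t - complex_of_real (l \<omega>) * L2_inner N g (curry x \<omega>) * x (\<omega>, t)"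
proof -
  interpret k: hs_op N k \<omega> by (rule hs_op[OF \<omega>])
  have "fibre_op N (deflate k l x) \<omega> g t = 
     (\<integral>s. k (\<omega>, t, s) * g s - complex_of_real (l \<omega>) * x (\<omega>, t) * (g s * cnj (curry x \<omega> s)) \<partial>N)"
    unfolding fibre_op_def deflate_def by (rule Bochner_Integration.integral_cong) (auto simp: algebra_simps curry_conv)
  also have "\<dots> = (\<integral>s. k (\<omega>, t, s) * g s \<partial>N) - (\<integral>s. complex_of_real (l \<omega>) * x (\<omega>, t) * (g s * cnj (curry x \<omega> s)) \<partial>N)"
    by (intro Bochner_Integration.integral_diff L2_integrable_mult(2) k.row_L2 g t integrable_mult_right L2_integrable_mult(1) eigenpairD(1) \<omega>)
  also have "\<dots> = fibre_op N k \<omega> g t - complex_of_real (l \<omega>) * L2_inner N g (curry x \<omega>) * x (\<omega>, t)"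
    by (simp add: fibre_op_def L2_inner_def)
  finally show ?thesis .
qed

lemma kernel_field_deflate: "kernel_field M N d (deflate k l x)"
proof
  show "deflate k l x \<in> borel_measurable (M \<Otimes>\<^sub>M (N \<Otimes>\<^sub>M N))"
  proof -
    have [measurable]: "(\<lambda>z. x (fst z, fst (snd z))) \<in> borel_measurable (M \<Otimes>\<^sub>M (N \<Otimes>\<^sub>M N))"
      by (rule measurable_compose[OF _ x_meas]) measurable
    have [measurable]: "(\<lambda>z. x (fst z, snd (snd z))) \<in> borel_measurable (M \<Otimes>\<^sub>M (N \<Otimes>\<^sub>M N))"
      by (rule measurable_compose[OF _ x_meas]) measurable
    show ?thesis unfolding deflate_def[abs_def] by measurable
  qed
  fix \<omega> assume \<omega>: "\<omega> \<in> space M"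
  interpret k: hs_op N k \<omega> by (rule hs_op[OF \<omega>])
  have xL: "(\<lambda>t. x (\<omega>, t)) \<in> L2 N" using eigenpairD(1)[OF \<omega>] by (simp add: curry_def)
  have rL: "(\<lambda>s. deflate k l x (\<omega>, t, s)) \<in> L2 N" if "t \<in> space N" for t
    unfolding deflate_def fst_conv snd_conv by (intro L2_diff L2_scale L2_cnj xL k.row_L2 that)
  show "hs_kernel N (deflate k l x) \<omega>"
    unfolding hs_kernel_def
  proof (intro conjI ballI)
    have [measurable]: "(\<lambda>t. x (\<omega>, t)) \<in> borel_measurable N" using xL by auto
    have "(\<lambda>z. k (\<omega>, fst z, snd z) - complex_of_real (l \<omega>) * x (\<omega>, fst z) * cnj (x (\<omega>, snd z))) \<in> borel_measurable (N \<Otimes>\<^sub>M N)"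
      by (intro borel_measurable_diff borel_measurable_times borel_measurable_const k.k_meas borel_measurable_cnj
          measurable_compose[OF measurable_fst L2_measurable[OF xL]] measurable_compose[OF measurable_snd L2_measurable[OF xL]])
    then show m: "(\<lambda>(t, s). deflate k l x (\<omega>, t, s)) \<in> borel_measurable (N \<Otimes>\<^sub>M N)"
      by (simp add: deflate_def case_prod_beta')
    show "(\<lambda>s. deflate k l x (\<omega>, t, s)) \<in> L2 N" if "t \<in> space N" for t by (rule rL[OF that])
    show "(\<lambda>t. complex_of_real (L2_norm N (\<lambda>s. deflate k l x (\<omega>, t, s)))) \<in> L2 N"
    proof (rule L2_dominated)
      show "(\<lambda>t. complex_of_real (L2_norm N (\<lambda>s. deflate k l x (\<omega>, t, s)))) \<in> borel_measurable N"
        using L2_norm_measurable_param[OF finite_N m] by simp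
      show "(\<lambda>t. complex_of_real (L2_norm N (\<lambda>s. k (\<omega>, t, s))) + 
          complex_of_real (\<bar>l \<omega>\<bar> * L2_norm N (\<lambda>t. x (\<omega>, t))) * complex_of_real (cmod (x (\<omega>, t)))) \<in> L2 N"
        by (intro L2_add L2_scale L2_abs k.rownorm_L2 xL)
      show "AE t in N. cmod (complex_of_real (L2_norm N (\<lambda>s. deflate k l x (\<omega>, t, s)))) \<le> 
        cmod (complex_of_real (L2_norm N (\<lambda>s. k (\<omega>, t, s))) + 
          complex_of_real (\<bar>l \<omega>\<bar> * L2_norm N (\<lambda>t. x (\<omega>, t))) * complex_of_real (cmod (x (\<omega>, t))))"
      proof (rule AE_I2)
        fix t assume t: "t \<in> space N"
        have "L2_norm N (\<lambda>s. deflate k l x (\<omega>, t, s)) \<le> L2_norm N (\<lambda>s. k (\<omega>, t, s)) + 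
            L2_norm N (\<lambda>s. complex_of_real (l \<omega>) * x (\<omega>, t) * cnj (x (\<omega>, s)))"
          unfolding deflate_def fst_conv snd_conv by (intro L2_norm_triangle_diff k.row_L2 t L2_scale L2_cnj xL)
        also have "L2_norm N (\<lambda>s. complex_of_real (l \<omega>) * x (\<omega>, t) * cnj (x (\<omega>, s))) = \<bar>l \<omega>\<bar> * L2_norm N (\<lambda>t. x (\<omega>, t)) * cmod (x (\<omega>, t))"
          unfolding L2_norm_scale by (simp add: norm_mult L2_norm_alt)
        finally have *: "L2_norm N (\<lambda>s. deflate k l x (\<omega>, t, s)) \<le> L2_norm N (\<lambda>s. k (\<omega>, t, s)) + \<bar>l \<omega>\<bar> * L2_norm N (\<lambda>t. x (\<omega>, t)) * cmod (x (\<omega>, t))" .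
        have "cmod (complex_of_real (L2_norm N (\<lambda>s. k (\<omega>, t, s))) + 
          complex_of_real (\<bar>l \<omega>\<bar> * L2_norm N (\<lambda>t. x (\<omega>, t))) * complex_of_real (cmod (x (\<omega>, t)))) = 
          \<bar>L2_norm N (\<lambda>s. k (\<omega>, t, s)) + \<bar>l \<omega>\<bar> * L2_norm N (\<lambda>t. x (\<omega>, t)) * cmod (x (\<omega>, t))\<bar>"
          by (simp only: norm_of_real flip: of_real_mult of_real_add)
        then show "cmod (complex_of_real (L2_norm N (\<lambda>s. deflate k l x (\<omega>, t, s)))) \<le> 
        cmod (complex_of_real (L2_norm N (\<lambda>s. k (\<omega>, t, s))) + 
          complex_of_real (\<bar>l \<omega>\<bar> * L2_norm N (\<lambda>t. x (\<omega>, t))) * complex_of_real (cmod (x (\<omega>, t))))"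
          using * by simp
      qed
    qed
    show "deflate k l x (\<omega>, t, s) = cnj (deflate k l x (\<omega>, s, t))" if "t \<in> space N" "s \<in> space N" for t s
      using k.k_herm[OF that] by (simp add: deflate_def mult_ac)
  qed
  fix g e assume g: "g \<in> L2 N" and e: "(e::real) > 0"
  \<comment> \<open>The deflated operator at \<open>g\<close> is the old one at the part
    \<open>h\<close> of \<open>g\<close> orthogonal to the eigenvector; its range is thus covered by
    the old one up to null sets.\<close>
  define h where "h s = g s - L2_inner N g (curry x \<omega>) * curry x \<omega> s" for s
  have h: "h \<in> L2 N" unfolding h_def by (intro L2_diff L2_scale g eigenpairD \<omega>)
  obtain i where i: "L2_norm N (\<lambda>t. fibre_op N k \<omega> h t - d i t) < e" using dense[OF \<omega> h e] by blast
  have "AE t in N. t \<in> space N" by simp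
  with eigenpairD(2)[OF \<omega>] have ae: "AE t in N. fibre_op N k \<omega> h t = fibre_op N (deflate k l x) \<omega> g t"
  proof eventually_elim
    case (elim t)
    have "fibre_op N k \<omega> h t = fibre_op N k \<omega> g t - L2_inner N g (curry x \<omega>) * fibre_op N k \<omega> (curry x \<omega>) t"
      unfolding h_def using elim by (subst k.T_diff) (auto intro: g eigenpairD(1)[OF \<omega>] simp: k.T_scale)
    then show ?case using elim by (simp add: fibre_op_deflate[OF \<omega> g])
  qed
  have mm: "fibre_op N (deflate k l x) \<omega> g \<in> borel_measurable N"
  proof -
    have "fibre_op N (deflate k l x) \<omega> g \<in> borel_measurable N \<longleftrightarrow> 
       (\<lambda>t. fibre_op N k \<omega> g t - complex_of_real (l \<omega>) * L2_inner N g (curry x \<omega>) * x (\<omega>, t)) \<in> borel_measurable N"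
      by (rule measurable_cong) (rule fibre_op_deflate[OF \<omega> g])
    then show ?thesis using L2_measurable[OF L2_diff[OF k.T_L2[OF g] L2_scale[OF xL]]] by simp
  qed
  have "L2_norm N (\<lambda>t. fibre_op N k \<omega> h t - d i t) = L2_norm N (\<lambda>t. fibre_op N (deflate k l x) \<omega> g t - d i t)"
  proof (rule L2_norm_cong_AE)
    show "(\<lambda>t. fibre_op N k \<omega> h t - d i t) \<in> borel_measurable N" using k.T_L2[OF h] d_L2[of i] by auto
    show "(\<lambda>t. fibre_op N (deflate k l x) \<omega> g t - d i t) \<in> borel_measurable N" using mm d_L2[of i] by auto
  qed (use ae in auto)
  then show "\<exists>i. L2_norm N (\<lambda>t. fibre_op N (deflate k l x) \<omega> g t - d i t) < e" using i by auto
qed (rule finite_N d_L2)+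

end

end

text \<open>Eigenvalues and eigenvectors of a self-adjoint operator on \<open>L2 N\<close>, with all non-zero
  eigenvalues counted with their multiplicities.\<close>

definition eig_sys :: "'b measure \<Rightarrow> (('b \<Rightarrow> complex) \<Rightarrow> 'b \<Rightarrow> complex) \<Rightarrow> (nat \<Rightarrow> real) \<Rightarrow> (nat \<Rightarrow> 'b \<Rightarrow> complex) \<Rightarrow> bool" where
  "eig_sys N A l y \<longleftrightarrow> ons N y \<and> (\<forall>n. L2_norm N (y n) = 0 \<longrightarrow> l n = 0) \<and> l \<longlonglongrightarrow> 0 \<and>
    (\<forall>n. AE t in N. A (y n) t = complex_of_real (l n) * y n t) \<and>
    (\<forall>g\<in>L2 N. A g \<in> L2 N \<and> L2_tendsto N (\<lambda>K s. \<Sum>n<K. complex_of_real (l n) * L2_inner N g (y n) * y n s) (A g))"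

text \<open>Each stage removes the top eigenpair, so what remains of the operator after
  \<open>J\<close> stages has norm at most \<open>\<bar>L J \<omega>\<bar>\<close>. Bessel's
  inequality, applied to each column and integrated, bounds the sum of the squared eigenvalues by
  the squared Hilbert-Schmidt norm; hence the eigenvalues, and with them the remainders, tend to
  zero.\<close>

lemma (in kernel_field) eigen_sequence:
  obtains L X where "\<And>n::nat. L n \<in> borel_measurable M" "\<And>n. X n \<in> borel_measurable (M \<Otimes>\<^sub>M N)"
    "\<And>\<omega>. \<omega> \<in> space M \<Longrightarrow> eig_sys N (fibre_op N k \<omega>) (\<lambda>n. L n \<omega>) (\<lambda>n. curry (X n) \<omega>)"
proof -
  \<comment> \<open>The choice concerns whole fields; their measurability is part of
    \<open>eigenpair\<close>.\<close>
  define st where "st k' = (SOME p. kernel_field.eigenpair M N k' (fst p) (snd p))" for k'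
  define K where "K = rec_nat k (\<lambda>n k'. deflate k' (fst (st k')) (snd (st k')))"
  define L where "L n = fst (st (K n))" for n
  define X where "X n = snd (st (K n))" for n
  have K0: "K 0 = k" and KSuc: "K (Suc n) = deflate (K n) (L n) (X n)" for n
    by (simp_all add: K_def L_def X_def)
  have ep: "kernel_field.eigenpair M N k' (fst (st k')) (snd (st k'))" if "kernel_field M N d k'" for k'
  proof -
    have "\<exists>p. kernel_field.eigenpair M N k' (fst p) (snd p)"
      using kernel_field.eigenpair_exists[OF that] by auto
    then show ?thesis unfolding st_def by (rule someI_ex)
  qed
  have kf: "kernel_field M N d (K n)" for n
  proof (induction n)
    case 0
    then show ?case by (simp add: K0 kernel_field_axioms)
  next
    case (Suc n)
    show ?case unfolding KSuc L_def X_def by (rule kernel_field.kernel_field_deflate[OF Suc ep[OF Suc]])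
  qed
  have LX: "kernel_field.eigenpair M N (K n) (L n) (X n)" for n
    unfolding L_def X_def by (rule ep[OF kf])
  have Lm: "L n \<in> borel_measurable M" and Xm: "X n \<in> borel_measurable (M \<Otimes>\<^sub>M N)" for n
    using kernel_field.l_meas[OF kf LX] kernel_field.x_meas[OF kf LX] by auto
  have "eig_sys N (fibre_op N k \<omega>) (\<lambda>n. L n \<omega>) (\<lambda>n. curry (X n) \<omega>)" if \<omega>: "\<omega> \<in> space M" for \<omega>
  proof -
    interpret k: hs_op N k \<omega> by (rule hs_op[OF \<omega>])
    define x where "x n = curry (X n) \<omega>" for n
    define l where "l n = complex_of_real (L n \<omega>)" for n
    note E = kernel_field.eigenpairD[OF kf LX \<omega>, folded x_def]
    have xL: "x n \<in> L2 N" for n by (rule E(1))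
    have Xx: "X n (\<omega>, t) = x n t" for n t by (simp add: x_def curry_conv)
    have K_Suc: "fibre_op N (K (Suc n)) \<omega> g t = fibre_op N (K n) \<omega> g t - l n * L2_inner N g (x n) * x n t" 
      if "g \<in> L2 N" "t \<in> space N" for n g t
      unfolding KSuc l_def x_def using kernel_field.fibre_op_deflate[OF kf LX \<omega> that] by (simp add: curry_conv)
    have K_sum: "fibre_op N (K n) \<omega> g t = fibre_op N k \<omega> g t - (\<Sum>i<n. l i * L2_inner N g (x i) * x i t)"
      if "g \<in> L2 N" "t \<in> space N" for n g t
      by (induction n) (simp_all add: K0 K_Suc that)
    have sa: "L2_inner N (fibre_op N (K n) \<omega> g) h = L2_inner N g (fibre_op N (K n) \<omega> h)" if "g \<in> L2 N" "h \<in> L2 N" for n g h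
      by (rule hs_op.T_selfadj[OF kernel_field.hs_op[OF kf \<omega>] that])
    have TL: "fibre_op N (K n) \<omega> g \<in> L2 N" if "g \<in> L2 N" for n g
      by (rule hs_op.T_L2[OF kernel_field.hs_op[OF kf \<omega>] that])
    have sp: "AE t in N. t \<in> space N" by simp
    have ev: "AE t in N. fibre_op N (K n) \<omega> (x n) t = l n * x n t" for n
      using E(2)[of n] by (simp add: l_def Xx)
    \<comment> \<open>The factor \<open>l n\<close> takes care of stages with eigenvalue
      \<open>0\<close>, at which orthogonality cannot be read off from self-adjointness.\<close>
    have inner0: "l n * L2_inner N (x i) (x n) = 0" if "AE t in N. fibre_op N (K n) \<omega> (x i) t = 0" for n i
    proof -
      have "l n * L2_inner N (x n) (x i) = L2_inner N (\<lambda>t. l n * x n t) (x i)" by (simp add: L2_inner_scale_left)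
      also have "\<dots> = L2_inner N (fibre_op N (K n) \<omega> (x n)) (x i)"
        by (rule L2_inner_cong_AE) (use ev[of n] in \<open>auto intro!: L2_measurable TL xL L2_scale\<close>)
      also have "\<dots> = L2_inner N (x n) (fibre_op N (K n) \<omega> (x i))" by (rule sa[OF xL xL])
      also have "\<dots> = L2_inner N (x n) (\<lambda>t. 0)"
        by (rule L2_inner_cong_AE) (use that in \<open>auto intro!: L2_measurable TL xL\<close>)
      finally have "l n * L2_inner N (x n) (x i) = 0" by simp
      then have "L2_inner N (x n) (x i) = 0 \<or> l n = 0" by auto
      then show ?thesis using L2_inner_cnj[of N "x i" "x n"] by auto
    qed
    have unit: "l n * L2_inner N (x n) (x n) = l n" for n
      using E(3)[of n] by (simp add: L2_inner_norm l_def)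
    \<comment> \<open>Once removed, an eigenvector lies in the kernel of all later operators: the
      removal itself cancels it, and every later correction is proportional to an expression that
      \<open>inner0\<close> shows to vanish.\<close>
    have ker: "AE t in N. fibre_op N (K n) \<omega> (x i) t = 0" if "i < n" for i n
      using that
    proof (induction n)
      case (Suc n)
      show ?case
      proof (cases "i = n")
        case True
        from ev[of n] sp show ?thesis
        proof eventually_elim
          case (elim t)
          then show ?case unfolding True K_Suc[OF xL elim(2)] unit by simp
        qed
      next
        case False
        then have IH: "AE t in N. fibre_op N (K n) \<omega> (x i) t = 0" using Suc by simp
        from IH sp show ?thesis
        proof eventually_elim
          case (elim t)
          then show ?case unfolding K_Suc[OF xL elim(2)] inner0[OF IH] by simp
        qed
      qed
    qed simp
    have orth: "L2_inner N (x i) (x n) = 0" if "i < n" for i n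
    proof (cases "L n \<omega> = 0")
      case True
      then have "L2_norm N (x n) = 0" using E(3)[of n] by simp
      then show ?thesis using L2_Cauchy_Schwarz[OF xL xL, of i n] by simp
    next
      case False
      then show ?thesis using inner0[OF ker[OF that]] by (simp add: l_def)
    qed
    have orth': "L2_inner N (x m) (x n) = 0" if "m \<noteq> n" for m n
      using that orth[of m n] orth[of n m] L2_inner_cnj[of N "x m" "x n"] by (cases "m < n") auto
    interpret x: ons N x
    proof
      show "L2_inner N (x n) (x n) = 1 \<or> L2_inner N (x n) (x n) = 0" for n
        using E(3)[of n] by (simp add: L2_inner_norm)
    qed (use xL orth' N.finite_measure_axioms in auto)
    have ev0: "AE t in N. fibre_op N k \<omega> (x n) t = l n * x n t" for n
      using ev[of n] sp
    proof eventually_elim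
      case (elim t)
      have "(\<Sum>i<n. l i * L2_inner N (x n) (x i) * x i t) = 0" by (rule sum.neutral) (auto simp: orth')
      then show ?case using elim K_sum[OF xL elim(2), of n n] by simp
    qed
    have normT: "L2_norm N (fibre_op N k \<omega> (x n)) = \<bar>L n \<omega>\<bar>" for n
    proof -
      have "L2_norm N (fibre_op N k \<omega> (x n)) = L2_norm N (\<lambda>t. l n * x n t)"
        by (rule L2_norm_cong_AE) (use ev0[of n] in \<open>auto intro!: L2_measurable k.T_L2 xL L2_scale\<close>)
      then show ?thesis using E(3)[of n] by (simp add: L2_norm_scale l_def)
    qed
    have bound: "(\<Sum>n<J. (L n \<omega>)\<^sup>2) \<le> (\<integral>t. (L2_norm N (k.row t))\<^sup>2 \<partial>N)" for J
    proof -
      have "(\<Sum>n<J. (L n \<omega>)\<^sup>2) = (\<Sum>n<J. \<integral>t. (cmod (fibre_op N k \<omega> (x n) t))\<^sup>2 \<partial>N)"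
        by (rule sum.cong) (auto simp: normT simp flip: L2_norm_sq)
      also have "\<dots> = (\<integral>t. (\<Sum>n<J. (cmod (fibre_op N k \<omega> (x n) t))\<^sup>2) \<partial>N)"
        by (rule Bochner_Integration.integral_sum[symmetric]) (auto intro!: L2_integrable_sq k.T_L2 xL)
      also have "\<dots> \<le> (\<integral>t. (L2_norm N (k.row t))\<^sup>2 \<partial>N)"
      proof (rule integral_mono)
        show "integrable N (\<lambda>t. \<Sum>n<J. (cmod (fibre_op N k \<omega> (x n) t))\<^sup>2)"
          by (auto intro!: Bochner_Integration.integrable_sum L2_integrable_sq k.T_L2 xL)
        show "integrable N (\<lambda>t. (L2_norm N (k.row t))\<^sup>2)" using k.rownorm_L2 by (simp add: L2_def)
        fix t assume t: "t \<in> space N"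
        have "cmod (fibre_op N k \<omega> (x n) t) = cmod (L2_inner N (k.col t) (x n))" for n
          unfolding k.T_inner[OF t] by (subst L2_inner_cnj) simp
        then have "(\<Sum>n<J. (cmod (fibre_op N k \<omega> (x n) t))\<^sup>2) \<le> (L2_norm N (k.col t))\<^sup>2"
          using x.Bessel[OF _ k.col_L2[OF t], of "{..<J}"] by simp
        then show "(\<Sum>n<J. (cmod (fibre_op N k \<omega> (x n) t))\<^sup>2) \<le> (L2_norm N (k.row t))\<^sup>2"
          by (simp add: k.norm_col[OF t])
      qed
      finally show ?thesis .
    qed
    have "summable (\<lambda>n. (L n \<omega>)\<^sup>2)"
      by (rule bounded_imp_summable[where B="\<integral>t. (L2_norm N (k.row t))\<^sup>2 \<partial>N"])
        (use bound[of "Suc _"] in \<open>auto simp: lessThan_Suc_atMost\<close>)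
    then have "(\<lambda>n. (L n \<omega>)\<^sup>2) \<longlonglongrightarrow> 0" by (rule summable_LIMSEQ_zero)
    from tendsto_real_sqrt[OF this] have L0: "(\<lambda>n. L n \<omega>) \<longlonglongrightarrow> 0"
      by (intro tendsto_rabs_zero_cancel[of "\<lambda>n. L n \<omega>"]) (simp add: real_sqrt_abs)
    have conv: "L2_tendsto N (\<lambda>J s. \<Sum>n<J. l n * L2_inner N g (x n) * x n s) (fibre_op N k \<omega> g)" if g: "g \<in> L2 N" for g
    proof -
      have "L2_norm N (\<lambda>s. (\<Sum>n<J. l n * L2_inner N g (x n) * x n s) - fibre_op N k \<omega> g s) \<le> \<bar>L J \<omega>\<bar> * L2_norm N g" for J
      proof -
        have "L2_norm N (\<lambda>s. (\<Sum>n<J. l n * L2_inner N g (x n) * x n s) - fibre_op N k \<omega> g s) = L2_norm N (fibre_op N (K J) \<omega> g)"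
          unfolding L2_norm_minus_commute[of N "\<lambda>s. \<Sum>n<J. _ n s"] by (rule L2_norm_cong) (simp add: K_sum[OF g])
        then show ?thesis using E(4)[OF g, of J] by simp
      qed
      moreover have "(\<lambda>J. \<bar>L J \<omega>\<bar> * L2_norm N g) \<longlonglongrightarrow> 0"
        using tendsto_mult_left_zero[OF tendsto_rabs_zero[OF L0]] by simp
      ultimately have "(\<lambda>J. L2_norm N (\<lambda>s. (\<Sum>n<J. l n * L2_inner N g (x n) * x n s) - fibre_op N k \<omega> g s)) \<longlonglongrightarrow> 0"
        by (intro null_squeeze_nonneg[OF L2_norm_nonneg])
      then show ?thesis using k.T_L2[OF g] by (auto simp: L2_tendsto_def intro!: x.comb_L2)
    qed
    show ?thesis
      unfolding eig_sys_def x_def[symmetric] l_def[symmetric]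
      using x.ons_axioms E(3) L0 ev0 conv k.T_L2 by (auto split: if_splits)
  qed
  with Lm Xm show ?thesis using that by blast
qed

section \<open>Gram-Schmidt orthonormalisation\<close>

text \<open>The zero vector is its own normalisation, as \<open>x / 0 = 0\<close>.\<close>

definition normal :: "'b measure \<Rightarrow> ('a \<times> 'b \<Rightarrow> complex) \<Rightarrow> 'a \<times> 'b \<Rightarrow> complex" where
  "normal N f z = f z / complex_of_real (fun_norm N f (fst z))"

text \<open>The modified process: stage \<open>n\<close> subtracts from all vectors at once their
  components along the \<open>n\<close>-th new vector. The recursion then runs over the stage alone,
  and measurability follows by induction.\<close>

primrec gs :: "'b measure \<Rightarrow> (nat \<Rightarrow> 'a \<times> 'b \<Rightarrow> complex) \<Rightarrow> nat \<Rightarrow> nat \<Rightarrow> 'a \<times> 'b \<Rightarrow> complex" where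
  "gs N r 0 = r"
| "gs N r (Suc n) = (\<lambda>i z. gs N r n i z - fun_inner N (gs N r n i) (normal N (gs N r n n)) (fst z) * normal N (gs N r n n) z)"

definition gs_ons :: "'b measure \<Rightarrow> (nat \<Rightarrow> 'a \<times> 'b \<Rightarrow> complex) \<Rightarrow> nat \<Rightarrow> 'a \<times> 'b \<Rightarrow> complex" where
  "gs_ons N r n = normal N (gs N r n n)"

lemma gs_Suc_conv: "gs N r (Suc n) i z = gs N r n i z - fun_inner N (gs N r n i) (gs_ons N r n) (fst z) * gs_ons N r n z"
  by (simp add: gs_ons_def)

lemma normal_measurable:
  assumes "finite_measure N" "f \<in> borel_measurable (M \<Otimes>\<^sub>M N)" shows "normal N f \<in> borel_measurable (M \<Otimes>\<^sub>M N)"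
proof -
  have [measurable]: "fun_norm N f \<in> borel_measurable M" "f \<in> borel_measurable (M \<Otimes>\<^sub>M N)"
    using fun_norm_measurable[OF assms] assms by auto
  show ?thesis unfolding normal_def[abs_def] by measurable
qed

lemma gs_measurable:
  assumes N: "finite_measure N" and r: "\<And>i. r i \<in> borel_measurable (M \<Otimes>\<^sub>M N)"
  shows "gs N r n i \<in> borel_measurable (M \<Otimes>\<^sub>M N)"
proof (induction n arbitrary: i)
  case (Suc n)
  note [measurable] = Suc[of i] normal_measurable[OF N Suc[of n]] fun_inner_measurable[OF N Suc[of i] normal_measurable[OF N Suc[of n]]]
  show ?case unfolding gs.simps by measurable
qed (simp add: r)

lemma gs_ons_measurable:
  assumes "finite_measure N" "\<And>i. r i \<in> borel_measurable (M \<Otimes>\<^sub>M N)"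
  shows "gs_ons N r n \<in> borel_measurable (M \<Otimes>\<^sub>M N)"
  unfolding gs_ons_def by (intro normal_measurable gs_measurable assms)

context
  fixes N :: "'b measure" and r :: "nat \<Rightarrow> 'a \<times> 'b \<Rightarrow> complex" and \<omega> :: 'a
  assumes r: "\<And>i. curry (r i) \<omega> \<in> L2 N"
begin

lemma gs_Suc_curry: "curry (gs N r (Suc n) i) \<omega> = 
   (\<lambda>s. curry (gs N r n i) \<omega> s - L2_inner N (curry (gs N r n i) \<omega>) (curry (gs_ons N r n) \<omega>) * curry (gs_ons N r n) \<omega> s)"
  unfolding curry_def gs_Suc_conv fun_inner_def by simp

lemma gs_ons_curry: "curry (gs_ons N r n) \<omega> = 
   (\<lambda>s. curry (gs N r n n) \<omega> s / complex_of_real (L2_norm N (curry (gs N r n n) \<omega>)))"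
  by (simp add: curry_def gs_ons_def normal_def fun_norm_def)

lemma gs_L2: "curry (gs N r n i) \<omega> \<in> L2 N"
proof (induction n arbitrary: i)
  case (Suc n)
  show ?case unfolding gs_Suc_curry by (intro L2_diff L2_scale Suc) (simp add: gs_ons_curry L2_divide Suc)
qed (simp add: r)

lemma gs_ons_L2: "curry (gs_ons N r n) \<omega> \<in> L2 N"
  unfolding gs_ons_curry by (intro L2_divide gs_L2)

lemma gs_ons_unit: "L2_norm N (curry (gs_ons N r n) \<omega>) = 1 \<or> curry (gs_ons N r n) \<omega> = (\<lambda>s. 0)"
  unfolding gs_ons_curry L2_norm_divide by auto

text \<open>Orthogonality to the \<open>m\<close>-th new vector is created at stage
  \<open>Suc m\<close>, and later stages subtract only multiples of vectors that share it.\<close>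

lemma gs_orth: "m < n \<Longrightarrow> L2_inner N (curry (gs N r n i) \<omega>) (curry (gs_ons N r m) \<omega>) = 0"
proof (induction n arbitrary: i)
  case (Suc n)
  let ?z = "\<lambda>n. curry (gs_ons N r n) \<omega>" and ?g = "curry (gs N r n i) \<omega>"
  have eq: "L2_inner N (curry (gs N r (Suc n) i) \<omega>) (?z m) = L2_inner N ?g (?z m) - L2_inner N ?g (?z n) * L2_inner N (?z n) (?z m)"
    unfolding gs_Suc_curry by (simp add: L2_inner_diff_left L2_inner_scale_left gs_L2 gs_ons_L2 L2_scale)
  show ?case
  proof (cases "m = n")
    case True
    then show ?thesis using gs_ons_unit[of n] unfolding eq by (auto simp: L2_inner_norm)
  next
    case False
    then have "m < n" using Suc by simp
    then show ?thesis unfolding eq using Suc.IH[of i] Suc.IH[of n] by (simp add: gs_ons_curry[of n] L2_inner_divide_left)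
  qed
qed simp

lemma gs_ons_orth: "m \<noteq> n \<Longrightarrow> L2_inner N (curry (gs_ons N r m) \<omega>) (curry (gs_ons N r n) \<omega>) = 0"
proof -
  have *: "L2_inner N (curry (gs_ons N r n) \<omega>) (curry (gs_ons N r m) \<omega>) = 0" if "m < n" for m n
    using gs_orth[OF that, of n] by (simp add: gs_ons_curry[of n] L2_inner_divide_left)
  assume "m \<noteq> n"
  then show ?thesis using *[of m n] *[of n m] L2_inner_cnj[of N "curry (gs_ons N r m) \<omega>" "curry (gs_ons N r n) \<omega>"]
    by (cases "m < n") auto
qed

lemma gs_expansion: "\<exists>c. \<forall>s. curry (r i) \<omega> s = curry (gs N r n i) \<omega> s + (\<Sum>m<n. c m * curry (gs_ons N r m) \<omega> s)"
proof (induction n)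
  case (Suc n)
  then obtain c where c: "\<And>s. curry (r i) \<omega> s = curry (gs N r n i) \<omega> s + (\<Sum>m<n. c m * curry (gs_ons N r m) \<omega> s)" by blast
  define c' where "c' = c(n := L2_inner N (curry (gs N r n i) \<omega>) (curry (gs_ons N r n) \<omega>))"
  have "(\<Sum>m<n. c' m * curry (gs_ons N r m) \<omega> s) = (\<Sum>m<n. c m * curry (gs_ons N r m) \<omega> s)" for s
    by (rule sum.cong) (auto simp: c'_def)
  then have "curry (r i) \<omega> s = curry (gs N r (Suc n) i) \<omega> s + (\<Sum>m<Suc n. c' m * curry (gs_ons N r m) \<omega> s)" for s
    unfolding gs_Suc_curry c by (simp add: c'_def)
  then show ?case by blast
qed simp

text \<open>Stage \<open>Suc i\<close> subtracts from the \<open>i\<close>-th vector its component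
  along its own normalisation. Hence the original \<open>i\<close>-th vector lies in the span of the
  first \<open>Suc i\<close> new ones, up to a null set.\<close>

lemma gs_diag: "L2_norm N (curry (gs N r (Suc i) i) \<omega>) = 0"
proof -
  define f where "f = curry (gs N r i i) \<omega>"
  have f: "f \<in> L2 N" by (simp add: f_def gs_L2)
  have eq: "curry (gs N r (Suc i) i) \<omega> = (\<lambda>s. f s - L2_inner N f (\<lambda>s. f s / complex_of_real (L2_norm N f)) * (f s / complex_of_real (L2_norm N f)))"
    unfolding gs_Suc_curry gs_ons_curry f_def ..
  show ?thesis
  proof (cases "L2_norm N f = 0")
    case True
    then show ?thesis unfolding eq by simp
  next
    case False
    have "L2_inner N f (\<lambda>s. f s / complex_of_real (L2_norm N f)) = complex_of_real (L2_norm N f)"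
      using False by (simp add: L2_inner_divide_right L2_inner_norm power2_eq_square)
    then show ?thesis unfolding eq using False by simp
  qed
qed

lemma gs_span: "\<exists>c. L2_norm N (\<lambda>s. curry (r i) \<omega> s - (\<Sum>m<Suc i. c m * curry (gs_ons N r m) \<omega> s)) = 0"
proof -
  obtain c where "\<And>s. curry (r i) \<omega> s = curry (gs N r (Suc i) i) \<omega> s + (\<Sum>m<Suc i. c m * curry (gs_ons N r m) \<omega> s)"
    using gs_expansion by blast
  then have "(\<lambda>s. curry (r i) \<omega> s - (\<Sum>m<Suc i. c m * curry (gs_ons N r m) \<omega> s)) = curry (gs N r (Suc i) i) \<omega>" by auto
  then show ?thesis using gs_diag by metis
qed

lemma gs_ons_inner_zero:
  assumes "\<And>i. L2_inner N (curry (r i) \<omega>) v = 0" "v \<in> L2 N"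
  shows "L2_inner N (curry (gs_ons N r n) \<omega>) v = 0"
proof -
  have "L2_inner N (curry (gs N r n i) \<omega>) v = 0" for i
  proof (induction n arbitrary: i)
    case (Suc n)
    then show ?case unfolding gs_Suc_curry
      by (simp add: L2_inner_diff_left L2_inner_scale_left gs_L2 gs_ons_L2 L2_scale assms(2))
        (simp add: gs_ons_curry L2_inner_divide_left)
  qed (simp add: assms)
  then show ?thesis by (simp add: gs_ons_curry L2_inner_divide_left)
qed

lemma gs_ons_ons: assumes "finite_measure N" shows "ons N (\<lambda>n. curry (gs_ons N r n) \<omega>)"
proof (rule ons.intro)
  show "finite_measure N" by fact
  show "curry (gs_ons N r n) \<omega> \<in> L2 N" for n by (rule gs_ons_L2)
  show "L2_inner N (curry (gs_ons N r m) \<omega>) (curry (gs_ons N r n) \<omega>) = 0" if "m \<noteq> n" for m n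
    by (rule gs_ons_orth[OF that])
  show "L2_inner N (curry (gs_ons N r n) \<omega>) (curry (gs_ons N r n) \<omega>) = 1 \<or> L2_inner N (curry (gs_ons N r n) \<omega>) (curry (gs_ons N r n) \<omega>) = 0" for n
    using gs_ons_unit[of n] by (auto simp: L2_inner_norm)
qed

end

lemma (in hs_op) gs_ons_kernel:
  assumes r: "\<And>i. curry (r i) \<omega>' \<in> L2 N" and T0: "\<And>i. AE t in N. T (curry (r i) \<omega>') t = 0"
  shows "AE t in N. T (curry (gs_ons N r n) \<omega>') t = 0"
proof -
  have sp: "AE t in N. t \<in> space N" by simp
  have div: "AE t in N. T (curry (gs_ons N r n) \<omega>') t = 0" if "AE t in N. T (curry (gs N r n n) \<omega>') t = 0" for n
    using that sp by eventually_elim (simp add: gs_ons_curry[OF r] T_divide)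
  have "AE t in N. T (curry (gs N r n i) \<omega>') t = 0" for i
  proof (induction n arbitrary: i)
    case (Suc n)
    from Suc[of i] div[OF Suc[of n]] sp show ?case
      by eventually_elim (simp add: gs_Suc_curry[OF r] T_diff T_scale gs_L2[OF r] gs_ons_L2[OF r] L2_scale del: gs.simps)
  qed (simp add: T0)
  then show ?thesis by (rule div)
qed

section \<open>Measurable bases of eigenvectors\<close>

text \<open>Bookkeeping for the interleaved sequence below, with eigenvectors from deflation at even
  and kernel vectors at odd places.\<close>

lemma sum_pairs: "(\<Sum>n<2 * K. f n) = (\<Sum>m<K. f (2 * m) + f (2 * m + 1))" for f :: "nat \<Rightarrow> 'a::comm_monoid_add"
  by (induction K) (simp_all add: add.assoc)

lemma sum_even_half: "(\<Sum>n<J. if even n then f (n div 2) else 0) = (\<Sum>m<(J + 1) div 2. f m)" for f :: "nat \<Rightarrow> 'a::comm_monoid_add"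
proof (induction J)
  case (Suc J)
  show ?case
  proof (cases "even J")
    case True
    then obtain j where "J = 2 * j" by blast
    then show ?thesis using Suc by simp
  next
    case False
    then obtain j where "J = 2 * j + 1" using oddE by blast
    then show ?thesis using Suc by simp
  qed
qed simp

lemma filterlim_half: "filterlim (\<lambda>n::nat. (n + c) div 2) at_top sequentially"
  unfolding filterlim_at_top
proof
  fix Z :: nat
  show "eventually (\<lambda>n. Z \<le> (n + c) div 2) sequentially"
    by (rule eventually_sequentiallyI[of "2 * Z"]) auto
qed

definition Fourier_sum :: "'b measure \<Rightarrow> (nat \<Rightarrow> 'b \<Rightarrow> complex) \<Rightarrow> ('b \<Rightarrow> complex) \<Rightarrow> bool" where
  "Fourier_sum N y g \<longleftrightarrow> L2_tendsto N (\<lambda>K s. \<Sum>i<K. L2_inner N g (y i) * y i s) g"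

text \<open>The residual \<open>r i\<close> of \<open>d i\<close> after projection on the
  eigenvectors lies in the kernel, so Gram-Schmidt applied to the residuals supplies the kernel
  vectors that are still missing to approximate every \<open>d i\<close>. Completeness is asserted
  only for vectors \<open>g\<close> that the family approximates, as \<open>L2 N\<close> may be
  non-separable.\<close>

lemma (in kernel_field) eigen_basis:
  obtains l y where "\<And>n::nat. l n \<in> borel_measurable M" "\<And>n. y n \<in> borel_measurable (M \<Otimes>\<^sub>M N)"
    "\<And>\<omega>. \<omega> \<in> space M \<Longrightarrow> eig_sys N (fibre_op N k \<omega>) (\<lambda>n. l n \<omega>) (\<lambda>n. curry (y n) \<omega>)"
    "\<And>\<omega> g. \<omega> \<in> space M \<Longrightarrow> g \<in> L2 N \<Longrightarrow> (\<And>e. e > 0 \<Longrightarrow> \<exists>i. L2_norm N (\<lambda>s. g s - d i s) < e) \<Longrightarrow>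
       Fourier_sum N (\<lambda>n. curry (y n) \<omega>) g"
proof (rule eigen_sequence)
  fix L X assume L: "\<And>n::nat. L n \<in> borel_measurable M" and X: "\<And>n. X n \<in> borel_measurable (M \<Otimes>\<^sub>M N)"
    and ES: "\<And>\<omega>. \<omega> \<in> space M \<Longrightarrow> eig_sys N (fibre_op N k \<omega>) (\<lambda>n. L n \<omega>) (\<lambda>n. curry (X n) \<omega>)"
  define F where "F i K z = (\<Sum>j<K. fun_inner N (\<lambda>z. d i (snd z)) (X j) (fst z) * X j z)" for i and K :: nat and z
  have F: "F i K \<in> borel_measurable (M \<Otimes>\<^sub>M N)" for i K
  proof -
    have [measurable]: "fun_inner N (\<lambda>z. d i (snd z)) (X j) \<in> borel_measurable M" "X j \<in> borel_measurable (M \<Otimes>\<^sub>M N)" for j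
      using fun_inner_measurable[OF finite_N const_field_measurable X] X by auto
    show ?thesis unfolding F_def[abs_def] by measurable
  qed
  have Fc: "curry (F i K) \<omega> = (\<lambda>s. \<Sum>j<K. L2_inner N (d i) (curry (X j) \<omega>) * curry (X j) \<omega> s)" for i K \<omega>
    by (simp add: F_def curry_def fun_inner_def)
  have "\<exists>R. R \<in> borel_measurable (M \<Otimes>\<^sub>M N) \<and> (\<forall>\<omega>\<in>space M. L2_tendsto N (\<lambda>K. curry (F i K) \<omega>) (curry R \<omega>))" for i
  proof (rule L2_limit_measurable[OF finite_N F[of i]])
    fix G assume G: "G \<in> borel_measurable (M \<Otimes>\<^sub>M N)" and lim: "\<And>\<omega>. \<omega> \<in> space M \<Longrightarrow> (\<And>n. curry (F i n) \<omega> \<in> L2 N) \<Longrightarrow>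
      (\<And>e. e > 0 \<Longrightarrow> \<exists>K. \<forall>m\<ge>K. \<forall>n\<ge>K. L2_norm N (\<lambda>s. F i m (\<omega>, s) - F i n (\<omega>, s)) < e) \<Longrightarrow>
      L2_tendsto N (\<lambda>n. curry (F i n) \<omega>) (curry G \<omega>)"
    have "L2_tendsto N (\<lambda>n. curry (F i n) \<omega>) (curry G \<omega>)" if \<omega>: "\<omega> \<in> space M" for \<omega>
    proof (rule lim[OF \<omega>])
      interpret x: ons N "\<lambda>n. curry (X n) \<omega>" using ES[OF \<omega>] by (simp add: eig_sys_def)
      show "curry (F i n) \<omega> \<in> L2 N" for n unfolding Fc by (rule x.comb_L2)
      show "\<exists>K. \<forall>m\<ge>K. \<forall>n\<ge>K. L2_norm N (\<lambda>s. F i m (\<omega>, s) - F i n (\<omega>, s)) < e" if e: "e > 0" for e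
      proof -
        have Fa: "F i n (\<omega>, s) = (\<Sum>j<n. 1 * L2_inner N (d i) (curry (X j) \<omega>) * curry (X j) \<omega> s)" for n s
          using fun_cong[OF Fc, of i n \<omega> s] by (simp add: curry_conv)
        show ?thesis unfolding Fa by (rule x.diag_Cauchy[OF d_L2 _ e, of _ 1]) simp
      qed
    qed
    then show ?thesis using G by blast
  qed
  then obtain R where R: "\<And>i. R i \<in> borel_measurable (M \<Otimes>\<^sub>M N)"
    and Rl: "\<And>i \<omega>. \<omega> \<in> space M \<Longrightarrow> L2_tendsto N (\<lambda>K. curry (F i K) \<omega>) (curry (R i) \<omega>)" by metis
  define r where "r i z = d i (snd z) - R i z" for i z
  have r: "r i \<in> borel_measurable (M \<Otimes>\<^sub>M N)" for i
    unfolding r_def[abs_def] by (intro borel_measurable_diff const_field_measurable R)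
  have rc: "curry (r i) \<omega> = (\<lambda>s. d i s - curry (R i) \<omega> s)" for i \<omega> by (simp add: r_def curry_def)
  \<comment> \<open>Both families may be infinite, so they are interleaved and not
    concatenated.\<close>
  define y where "y n = (if even n then X (n div 2) else gs_ons N r (n div 2))" for n
  define l where "l n = (if even n then L (n div 2) else (\<lambda>_. 0))" for n
  show ?thesis
  proof (rule that)
    show "l n \<in> borel_measurable M" for n using L by (simp add: l_def)
    show "y n \<in> borel_measurable (M \<Otimes>\<^sub>M N)" for n using X gs_ons_measurable[OF finite_N r] by (simp add: y_def)
    fix \<omega> assume \<omega>: "\<omega> \<in> space M"
    interpret k: hs_op N k \<omega> by (rule hs_op[OF \<omega>])
    define x where "x n = curry (X n) \<omega>" for n
    define z where "z n = curry (gs_ons N r n) \<omega>" for n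
    have yc: "curry (y n) \<omega> = (if even n then x (n div 2) else z (n div 2))" for n by (simp add: y_def x_def z_def)
    note E = ES[OF \<omega>, unfolded eig_sys_def, folded x_def]
    interpret x: ons N x using E by blast
    have RL: "L2_tendsto N (\<lambda>K s. \<Sum>j<K. 1 * L2_inner N (d i) (x j) * x j s) (curry (R i) \<omega>)" for i
      using Rl[OF \<omega>, of i] unfolding Fc x_def by simp
    have rL: "curry (r i) \<omega> \<in> L2 N" for i
      unfolding rc by (intro L2_diff d_L2 L2_tendstoD(2)[OF RL])
    interpret z: ons N z unfolding z_def by (rule gs_ons_ons[OF rL finite_N])
    have rx: "L2_inner N (curry (r i) \<omega>) (x j) = 0" for i j
    proof -
      have "L2_inner N (curry (r i) \<omega>) (x j) = L2_inner N (d i) (x j) - L2_inner N (curry (R i) \<omega>) (x j)"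
        unfolding rc by (rule L2_inner_diff_left[OF d_L2 L2_tendstoD(2)[OF RL] x.y_L2])
      moreover have "L2_inner N (curry (R i) \<omega>) (x j) = 1 * L2_inner N (d i) (x j)"
        by (rule x.diag_inner[OF d_L2 RL])
      ultimately show ?thesis by simp
    qed
    have zx: "L2_inner N (z n) (x j) = 0" for n j
      unfolding z_def by (rule gs_ons_inner_zero[OF rL rx x.y_L2])
    have sp: "AE t in N. t \<in> space N" by simp
    \<comment> \<open>The operator sends \<open>d i\<close> and its projection \<open>R i\<close> to
      limits of the same partial sums.\<close>
    have rT: "AE t in N. k.T (curry (r i) \<omega>) t = 0" for i
    proof -
      have 1: "L2_tendsto N (\<lambda>K. k.T (\<lambda>s. \<Sum>j<K. 1 * L2_inner N (d i) (x j) * x j s)) (k.T (curry (R i) \<omega>))"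
        by (rule k.T_tendsto[OF RL])
      have 2: "L2_tendsto N (\<lambda>K s. \<Sum>j<K. complex_of_real (L j \<omega>) * L2_inner N (d i) (x j) * x j s) (k.T (d i))"
        using E d_L2 by blast
      have eq: "L2_norm N (\<lambda>t. k.T (\<lambda>s. \<Sum>j<K. 1 * L2_inner N (d i) (x j) * x j s) t - k.T (curry (R i) \<omega>) t) =
         L2_norm N (\<lambda>t. (\<Sum>j<K. complex_of_real (L j \<omega>) * L2_inner N (d i) (x j) * x j t) - k.T (curry (R i) \<omega>) t)" for K
      proof (rule L2_norm_cong_AE)
        have "AE t in N. \<forall>j. k.T (x j) t = complex_of_real (L j \<omega>) * x j t" using E by (simp add: AE_all_countable)
        with sp show "AE t in N. k.T (\<lambda>s. \<Sum>j<K. 1 * L2_inner N (d i) (x j) * x j s) t - k.T (curry (R i) \<omega>) t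
           = (\<Sum>j<K. complex_of_real (L j \<omega>) * L2_inner N (d i) (x j) * x j t) - k.T (curry (R i) \<omega>) t"
          by eventually_elim (simp add: k.T_sum k.T_scale L2_scale x.y_L2 mult.left_commute mult.assoc)
      qed (intro L2_measurable L2_diff k.T_L2 x.comb_L2 L2_tendstoD(2)[OF RL])+
      have "L2_tendsto N (\<lambda>K s. \<Sum>j<K. complex_of_real (L j \<omega>) * L2_inner N (d i) (x j) * x j s) (k.T (curry (R i) \<omega>))"
        using L2_tendstoD[OF 1] unfolding eq by (auto simp: L2_tendsto_def intro!: x.comb_L2)
      from L2_tendsto_unique[OF 2 this] sp show ?thesis
        by eventually_elim (simp add: rc k.T_diff d_L2 L2_tendstoD(2)[OF RL])
    qed
    have zT: "AE t in N. k.T (z n) t = 0" for n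
      unfolding z_def by (rule k.gs_ons_kernel[OF rL rT])
    interpret y: ons N "\<lambda>n. curry (y n) \<omega>"
    proof (rule ons.intro)
      show "finite_measure N" by (rule finite_N)
      show "curry (y n) \<omega> \<in> L2 N" for n unfolding yc using x.y_L2 z.y_L2 by auto
      show "L2_inner N (curry (y n) \<omega>) (curry (y n) \<omega>) = 1 \<or> L2_inner N (curry (y n) \<omega>) (curry (y n) \<omega>) = 0" for n
        unfolding yc using x.y_unit z.y_unit by auto
      fix m n :: nat assume mn: "m \<noteq> n"
      have xz: "L2_inner N (x j) (z n) = 0" for n j using zx[of n j] L2_inner_cnj[of N "x j" "z n"] by simp
      have "m div 2 \<noteq> n div 2" if "even m \<longleftrightarrow> even n" using mn that by presburger
      then show "L2_inner N (curry (y m) \<omega>) (curry (y n) \<omega>) = 0"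
        unfolding yc using x.y_orth z.y_orth zx xz by auto
    qed
    show "eig_sys N (fibre_op N k \<omega>) (\<lambda>n. l n \<omega>) (\<lambda>n. curry (y n) \<omega>)"
      unfolding eig_sys_def
    proof (intro conjI allI impI ballI)
      show "ons N (\<lambda>n. curry (y n) \<omega>)" by (rule y.ons_axioms)
      show "l n \<omega> = 0" if "L2_norm N (curry (y n) \<omega>) = 0" for n
        using that E unfolding yc l_def by (auto split: if_splits)
      show "(\<lambda>n. l n \<omega>) \<longlonglongrightarrow> 0"
      proof (rule null_squeeze)
        show "norm (l n \<omega>) \<le> \<bar>L (n div 2) \<omega>\<bar>" for n by (simp add: l_def)
        have "(\<lambda>n. L n \<omega>) \<longlonglongrightarrow> 0" using E by blast
        from filterlim_compose[OF tendsto_rabs_zero[OF this] filterlim_half[of 0]] 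
        show "(\<lambda>n. \<bar>L (n div 2) \<omega>\<bar>) \<longlonglongrightarrow> 0" by simp
      qed
      show "AE t in N. k.T (curry (y n) \<omega>) t = complex_of_real (l n \<omega>) * curry (y n) \<omega> t" for n
        unfolding yc l_def using E zT by simp
      fix g assume g: "g \<in> L2 N"
      show "k.T g \<in> L2 N" by (rule k.T_L2[OF g])
      have "(\<Sum>n<J. complex_of_real (l n \<omega>) * L2_inner N g (curry (y n) \<omega>) * curry (y n) \<omega> s) =
         (\<Sum>m<(J + 1) div 2. complex_of_real (L m \<omega>) * L2_inner N g (x m) * x m s)" for J s
        unfolding sum_even_half[symmetric] by (rule sum.cong) (auto simp: yc l_def)
      then show "L2_tendsto N (\<lambda>J s. \<Sum>n<J. complex_of_real (l n \<omega>) * L2_inner N g (curry (y n) \<omega>) * curry (y n) \<omega> s) (k.T g)"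
        using L2_tendsto_subseq[OF _ filterlim_half[of 1], of N "\<lambda>K s. \<Sum>j<K. complex_of_real (L j \<omega>) * L2_inner N g (x j) * x j s"] E g by simp
    qed
    fix g assume g: "g \<in> L2 N" and gd: "\<And>e. e > 0 \<Longrightarrow> \<exists>i. L2_norm N (\<lambda>s. g s - d i s) < e"
    show "Fourier_sum N (\<lambda>n. curry (y n) \<omega>) g"
      unfolding Fourier_sum_def
    proof (rule y.Fourier_closed[OF g])
      fix e :: real assume e: "e > 0"
      obtain i where i: "L2_norm N (\<lambda>s. g s - d i s) < e" using gd[OF e] by blast
      obtain J where J: "L2_norm N (\<lambda>s. (\<Sum>j<J. 1 * L2_inner N (d i) (x j) * x j s) - curry (R i) \<omega> s) < e"
        using LIMSEQ_D[OF L2_tendstoD(3)[OF RL[of i]] e] by auto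
      obtain c where c: "L2_norm N (\<lambda>s. curry (r i) \<omega> s - (\<Sum>m<Suc i. c m * z m s)) = 0"
        unfolding z_def using gs_span[where r=r and i=i, OF rL] by blast
      \<comment> \<open>The first \<open>2 * K\<close> interleaved vectors comprise \<open>K\<close>
        of each kind; surplus coefficients are zero.\<close>
      define c' where "c' n = (if even n then if n div 2 < J then L2_inner N (d i) (x (n div 2)) else 0
         else if n div 2 < Suc i then c (n div 2) else 0)" for n
      define K where "K = J + Suc i"
      have "(\<Sum>n<2 * K. c' n * curry (y n) \<omega> s) = (\<Sum>j<J. L2_inner N (d i) (x j) * x j s) + (\<Sum>m<Suc i. c m * z m s)" for s
      proof -
        have "(\<Sum>n<2 * K. c' n * curry (y n) \<omega> s) = (\<Sum>m<K. (if m < J then L2_inner N (d i) (x m) else 0) * x m s)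
           + (\<Sum>m<K. (if m < Suc i then c m else 0) * z m s)"
          unfolding sum_pairs by (simp add: c'_def yc sum.distrib cong: if_cong)
        also have "(\<Sum>m<K. (if m < J then L2_inner N (d i) (x m) else 0) * x m s) = (\<Sum>j<J. L2_inner N (d i) (x j) * x j s)"
          by (rule sum.mono_neutral_cong_right) (auto simp: K_def)
        also have "(\<Sum>m<K. (if m < Suc i then c m else 0) * z m s) = (\<Sum>m<Suc i. c m * z m s)"
          by (rule sum.mono_neutral_cong_right) (auto simp: K_def)
        finally show ?thesis .
      qed
      then have "L2_norm N (\<lambda>s. d i s - (\<Sum>n<2 * K. c' n * curry (y n) \<omega> s)) = 
        L2_norm N (\<lambda>s. (curry (r i) \<omega> s - (\<Sum>m<Suc i. c m * z m s)) - ((\<Sum>j<J. 1 * L2_inner N (d i) (x j) * x j s) - curry (R i) \<omega> s))"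
        by (simp add: rc algebra_simps)
      also have "\<dots> \<le> L2_norm N (\<lambda>s. curry (r i) \<omega> s - (\<Sum>m<Suc i. c m * z m s)) + L2_norm N (\<lambda>s. (\<Sum>j<J. 1 * L2_inner N (d i) (x j) * x j s) - curry (R i) \<omega> s)"
        by (intro L2_norm_triangle_diff L2_diff rL z.comb_L2 x.comb_L2 L2_tendstoD(2)[OF RL])
      also have "\<dots> < e" using c J by simp
      finally show "\<exists>h\<in>L2 N. \<exists>K c. L2_norm N (\<lambda>s. g s - h s) < e \<and> L2_norm N (\<lambda>s. h s - (\<Sum>n<K. c n * curry (y n) \<omega> s)) < e"
        using i d_L2 by blast
    qed
  qed
qed

subsection \<open>Dimension\<close>

text \<open>Double counting of the squared coefficients
  \<open>(cmod (L2_inner N (u n) (z m)))\<^sup>2\<close>: each \<open>n\<close> contributes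
  \<open>1\<close> because \<open>u n\<close> lies in the span, and each \<open>m\<close> at most
  \<open>1\<close> by Bessel's inequality.\<close>

lemma ons_card_le:
  assumes u: "ons N u" and z: "ons N z" and fin: "finite F" "finite I"
    and unit: "\<And>n. n \<in> F \<Longrightarrow> L2_norm N (u n) = 1"
    and span: "\<And>n. n \<in> F \<Longrightarrow> \<exists>c. L2_norm N (\<lambda>s. u n s - (\<Sum>m\<in>I. c m * z m s)) = 0"
  shows "card F \<le> card I"
proof -
  interpret u: ons N u by fact
  interpret z: ons N z by fact
  have one: "(\<Sum>m\<in>I. (cmod (L2_inner N (u n) (z m)))\<^sup>2) = 1" if n: "n \<in> F" for n
  proof -
    obtain c where "L2_norm N (\<lambda>s. u n s - (\<Sum>m\<in>I. c m * z m s)) = 0" using span[OF n] by blast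
    then have "L2_norm N (\<lambda>s. u n s - (\<Sum>m\<in>I. L2_inner N (u n) (z m) * z m s)) = 0"
      using z.best_approx[OF fin(2) subset_refl u.y_L2, of n c] L2_norm_nonneg[of N "\<lambda>s. u n s - (\<Sum>m\<in>I. L2_inner N (u n) (z m) * z m s)"]
      by linarith
    then show ?thesis using z.norm_diff_comb[OF fin(2) u.y_L2, of n "\<lambda>m. L2_inner N (u n) (z m)"] unit[OF n] by simp
  qed
  have "real (card F) = (\<Sum>n\<in>F. \<Sum>m\<in>I. (cmod (L2_inner N (u n) (z m)))\<^sup>2)" by (simp add: one)
  also have "\<dots> = (\<Sum>m\<in>I. \<Sum>n\<in>F. (cmod (L2_inner N (z m) (u n)))\<^sup>2)"
    by (subst sum.swap) (simp add: L2_inner_cnj[of N "u _" "z _"])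
  also have "\<dots> \<le> (\<Sum>m\<in>I. 1)"
  proof (rule sum_mono)
    fix m
    have "(\<Sum>n\<in>F. (cmod (L2_inner N (z m) (u n)))\<^sup>2) \<le> (L2_norm N (z m))\<^sup>2" by (rule u.Bessel[OF fin(1) z.y_L2])
    also have "\<dots> \<le> 1" using z.norm_y[of m] by auto
    finally show "(\<Sum>n\<in>F. (cmod (L2_inner N (z m) (u n)))\<^sup>2) \<le> 1" .
  qed
  finally show ?thesis by simp
qed

text \<open>Gram-Schmidt over a one-point parameter space replaces the spanning functions by an
  orthonormal system whose first \<open>r\<close> members span them.\<close>

lemma fin_dim_card_le:
  assumes N: "finite_measure N" and u: "ons N u" and F: "finite F" "\<And>n. n \<in> F \<Longrightarrow> L2_norm N (u n) = 1"
    and b: "\<And>i. i < r \<Longrightarrow> b i \<in> L2 N" and span: "\<And>n. n \<in> F \<Longrightarrow> \<exists>c. AE s in N. u n s = (\<Sum>i<r::nat. c i * b i s)"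
  shows "card F \<le> r"
proof -
  define b' where "b' i z = (if i < r then b i (snd z) else 0)" for i and z :: "unit \<times> 'a"
  have b'c: "curry (b' i) () = (if i < r then b i else (\<lambda>s. 0))" for i by (auto simp: b'_def curry_def)
  have b'L: "curry (b' i) () \<in> L2 N" for i unfolding b'c using b by simp
  define z where "z n = curry (gs_ons N b' n) ()" for n
  have z: "ons N z" unfolding z_def by (rule gs_ons_ons[OF b'L N])
  interpret z: ons N z by (rule z)
  interpret u: ons N u by (rule u)
  have "\<exists>c. L2_norm N (\<lambda>s. curry (b' i) () s - (\<Sum>m<Suc i. c m * z m s)) = 0" for i
    unfolding z_def by (rule gs_span[OF b'L])
  then obtain C where C: "\<And>i. L2_norm N (\<lambda>s. curry (b' i) () s - (\<Sum>m<Suc i. C i m * z m s)) = 0" by metis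
  have "card F \<le> card {..<r}"
  proof (rule ons_card_le[OF u z F(1) _ F(2)])
    fix n assume "n \<in> F"
    then obtain c where c: "AE s in N. u n s = (\<Sum>i<r. c i * b i s)" using span by blast
    define c' where "c' m = (\<Sum>i<r. c i * (if m < Suc i then C i m else 0))" for m
    have "AE s in N. curry (b' i) () s - (\<Sum>m<Suc i. C i m * z m s) = 0" for i
      by (rule iffD1[OF L2_norm_eq_0_iff[OF L2_diff[OF b'L z.comb_L2]] C[of i]])
    then have "AE s in N. \<forall>i. curry (b' i) () s - (\<Sum>m<Suc i. C i m * z m s) = 0" by (simp add: AE_all_countable)
    with c have "AE s in N. u n s - (\<Sum>m<r. c' m * z m s) = 0"
    proof eventually_elim
      case (elim s)
      have "(\<Sum>m<r. c' m * z m s) = (\<Sum>i<r. c i * (\<Sum>m<r. (if m < Suc i then C i m else 0) * z m s))"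
        unfolding c'_def sum_distrib_right sum_distrib_left by (subst sum.swap) (simp add: mult.assoc)
      also have "\<dots> = (\<Sum>i<r. c i * b i s)"
      proof (rule sum.cong)
        fix i assume i: "i \<in> {..<r}"
        have "(\<Sum>m<r. (if m < Suc i then C i m else 0) * z m s) = (\<Sum>m<Suc i. C i m * z m s)"
          by (rule sum.mono_neutral_cong_right) (use i in auto)
        also have "\<dots> = curry (b' i) () s" using elim(2) by (metis eq_iff_diff_eq_0)
        also have "\<dots> = b i s" using i by (simp add: b'c)
        finally show "c i * (\<Sum>m<r. (if m < Suc i then C i m else 0) * z m s) = c i * b i s" by simp
      qed simp
      finally show ?case using elim(1) by simp
    qed
    then have "L2_norm N (\<lambda>s. u n s - (\<Sum>m<r. c' m * z m s)) = 0"
      using L2_norm_eq_0_iff[OF L2_diff[OF u.y_L2 z.comb_L2]] by blast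
    then show "\<exists>c. L2_norm N (\<lambda>s. u n s - (\<Sum>m\<in>{..<r}. c m * z m s)) = 0" by blast
  qed simp
  then show ?thesis by simp
qed

text \<open>As long as the vectors found do not span, some \<open>h\<close> has a non-null component
  orthogonal to them, which is normalised. The recursion uses no dense sequence and so covers
  non-separable spaces.\<close>

lemma infinite_ons:
  assumes N: "finite_measure N" and inf: "\<not> L2_fin_dim N (L2 N)"
  obtains u where "ons N u" "\<And>n::nat. L2_norm N (u n) = 1"
proof -
  define P where "P f n g \<longleftrightarrow> g \<in> L2 N \<and> L2_norm N g = 1 \<and> (\<forall>i<n. L2_inner N g (f i) = 0)" for f :: "nat \<Rightarrow> 'a \<Rightarrow> complex" and n :: nat and g
  have "\<exists>f. \<forall>n. P f n (f n)"
  proof (rule dependent_wf_choice[OF wf_less])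
    show "P f n g = P f' n g" if "\<And>m. (m, n) \<in> {(x, y). x < y} \<Longrightarrow> f m = f' m" for f f' n g
      using that by (simp add: P_def)
    fix n f assume prev: "\<And>m. (m, n) \<in> {(x, y). x < y} \<Longrightarrow> P f m (f m)"
    have fL: "f i \<in> L2 N" "L2_norm N (f i) = 1" if "i < n" for i using prev[of i] that by (auto simp: P_def)
    have orth: "L2_inner N (f i) (f j) = (if i = j then 1 else 0)" if "i < n" "j < n" for i j
      using prev[of i] prev[of j] that L2_inner_cnj[of N "f i" "f j"] fL(2)[of i]
      by (cases rule: linorder_cases[of i j]) (auto simp: P_def L2_inner_norm)
    obtain h where h: "h \<in> L2 N" "\<And>c. \<not> (AE s in N. h s = (\<Sum>i<n. c i * f i s))"
    proof -
      have "\<exists>h\<in>L2 N. \<forall>c. \<not> (AE s in N. h s = (\<Sum>i<n. c i * f i s))"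
      proof (rule ccontr)
        assume "\<not> ?thesis"
        then have "\<forall>g\<in>L2 N. \<exists>c. AE s in N. g s = (\<Sum>i<n. c i * f i s)" by blast
        moreover have "\<forall>i<n. f i \<in> L2 N" using fL by blast
        ultimately have "L2_fin_dim N (L2 N)"
          unfolding L2_fin_dim_def by (intro exI[of _ n] exI[of _ f] conjI)
        with inf show False by blast
      qed
      then show ?thesis using that by blast
    qed
    define v where "v s = h s - (\<Sum>i<n. L2_inner N h (f i) * f i s)" for s
    have vL: "v \<in> L2 N" unfolding v_def using h(1) fL by (intro L2_diff L2_sum L2_scale) auto
    have v0: "L2_norm N v \<noteq> 0"
      using L2_norm_eq_0_iff[OF vL] h(2)[of "\<lambda>i. L2_inner N h (f i)"] by (auto simp: v_def)
    have vo: "L2_inner N v (f j) = 0" if "j < n" for j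
    proof -
      have "L2_inner N v (f j) = L2_inner N h (f j) - (\<Sum>i<n. L2_inner N h (f i) * L2_inner N (f i) (f j))"
      proof -
        have "L2_inner N (\<lambda>s. \<Sum>i<n. L2_inner N h (f i) * f i s) (f j) = (\<Sum>i<n. L2_inner N (\<lambda>s. L2_inner N h (f i) * f i s) (f j))"
          by (rule L2_inner_sum_left) (use fL(1) that in \<open>auto intro!: L2_scale\<close>)
        moreover have "L2_inner N v (f j) = L2_inner N h (f j) - L2_inner N (\<lambda>s. \<Sum>i<n. L2_inner N h (f i) * f i s) (f j)"
          unfolding v_def by (rule L2_inner_diff_left) (use h(1) fL(1) that in \<open>auto intro!: L2_sum L2_scale\<close>)
        ultimately show ?thesis by (simp add: L2_inner_scale_left)
      qed
      also have "(\<Sum>i<n. L2_inner N h (f i) * L2_inner N (f i) (f j)) = (\<Sum>i<n. if i = j then L2_inner N h (f j) else 0)"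
        by (rule sum.cong) (auto simp: orth that)
      finally show ?thesis using that by simp
    qed
    have "P f n (\<lambda>s. v s / complex_of_real (L2_norm N v))"
      unfolding P_def using vL v0 vo by (auto simp: L2_norm_divide L2_inner_divide_left)
    then show "\<exists>g. P f n g" by blast
  qed
  then obtain u where u: "\<And>n. P u n (u n)" by blast
  have "ons N u"
  proof (rule ons.intro[OF N])
    show "L2_inner N (u m) (u n) = 0" if "m \<noteq> n" for m n
      using u[of m] u[of n] that L2_inner_cnj[of N "u m" "u n"] by (cases "m < n") (auto simp: P_def)
  qed (use u in \<open>auto simp: P_def L2_inner_norm\<close>)
  then show ?thesis using that u by (auto simp: P_def)
qed

lemma fin_dim_separable:
  assumes "L2_fin_dim N (L2 N)" shows "L2_separable N"
proof -
  obtain r b where b: "\<And>i. i < r \<Longrightarrow> b i \<in> L2 N" "\<And>g. g \<in> L2 N \<Longrightarrow> \<exists>c. AE s in N. g s = (\<Sum>i<r::nat. c i * b i s)"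
    using assms unfolding L2_fin_dim_def by blast
  define f where "f i = (if i < r then b i else (\<lambda>s. 0))" for i
  have f: "f i \<in> L2 N" for i using b by (simp add: f_def)
  show ?thesis
  proof (rule countable_dense_combinations[OF f])
    fix d :: "nat \<Rightarrow> 'a \<Rightarrow> complex" assume d: "\<And>n. d n \<in> L2 N" "\<And>K c e. e > 0 \<Longrightarrow> \<exists>n. L2_norm N (\<lambda>s. (\<Sum>i<K::nat. c i * f i s) - d n s) < e"
    have "\<exists>n. L2_norm N (\<lambda>s. h s - d n s) < e" if h: "h \<in> L2 N" and e: "e > 0" for h e
    proof -
      obtain c where "AE s in N. h s = (\<Sum>i<r. c i * b i s)" using b(2)[OF h] by blast
      then have c: "AE s in N. h s = (\<Sum>i<r. c i * f i s)" by (simp add: f_def)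
      obtain n where n: "L2_norm N (\<lambda>s. (\<Sum>i<r. c i * f i s) - d n s) < e" using d(2)[OF e] by blast
      have "L2_norm N (\<lambda>s. h s - d n s) = L2_norm N (\<lambda>s. (\<Sum>i<r. c i * f i s) - d n s)"
        by (rule L2_norm_cong_AE) (use c in \<open>auto intro!: L2_measurable L2_diff L2_sum L2_scale h d f\<close>)
      then show ?thesis using n by (intro exI[of _ n]) simp
    qed
    with d(1) have "(\<forall>n. d n \<in> L2 N) \<and> (\<forall>h\<in>L2 N. \<forall>\<eta>>0. \<exists>n. L2_norm N (\<lambda>s. h s - d n s) < \<eta>)" by simp
    then show ?thesis unfolding L2_separable_def by (rule exI[of _ d])
  qed
qed

subsection \<open>Removal of the zero vectors\<close>

context
  fixes M :: "'a measure" and N :: "'b measure" and y :: "nat \<Rightarrow> 'a \<times> 'b \<Rightarrow> complex"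
  assumes fN: "finite_measure N" and y[measurable]: "\<And>n. y n \<in> borel_measurable (M \<Otimes>\<^sub>M N)"
begin

text \<open>The increasing enumeration of the indices whose vectors do not vanish at \<omega>. It is
  meaningful on fibres with infinitely many of them; \<open>LEAST\<close> keeps it total and
  measurable.\<close>

primrec pos :: "nat \<Rightarrow> 'a \<Rightarrow> nat" where
  "pos 0 \<omega> = (LEAST m. fun_norm N (y m) \<omega> \<noteq> 0)"
| "pos (Suc n) \<omega> = (LEAST m. fun_norm N (y m) \<omega> \<noteq> 0 \<and> pos n \<omega> < m)"

declare pos.simps [simp del]

lemma pos_measurable: "pos n \<in> measurable M (count_space UNIV)"
proof (induction n)
  case 0
  have [measurable]: "fun_norm N (y i) \<in> borel_measurable M" for i by (rule fun_norm_measurable[OF fN y])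
  show ?case unfolding pos.simps[abs_def] by measurable
next
  case (Suc n)
  have [measurable]: "fun_norm N (y i) \<in> borel_measurable M" for i by (rule fun_norm_measurable[OF fN y])
  note [measurable] = Suc
  show ?case unfolding pos.simps[abs_def] by measurable
qed

lemma pos_props:
  assumes inf: "infinite {m. fun_norm N (y m) \<omega> \<noteq> 0}"
  shows "fun_norm N (y (pos n \<omega>)) \<omega> \<noteq> 0" "pos n \<omega> < pos (Suc n) \<omega>"
    "\<And>m. pos n \<omega> < m \<Longrightarrow> m < pos (Suc n) \<omega> \<Longrightarrow> fun_norm N (y m) \<omega> = 0"
    "\<And>m. m < pos 0 \<omega> \<Longrightarrow> fun_norm N (y m) \<omega> = 0"
proof -
  have "\<exists>m. fun_norm N (y m) \<omega> \<noteq> 0 \<and> j < m" for j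
    using inf unfolding infinite_nat_iff_unbounded by blast
  then have *: "fun_norm N (y (pos (Suc n) \<omega>)) \<omega> \<noteq> 0 \<and> pos n \<omega> < pos (Suc n) \<omega>" for n
    unfolding pos.simps by (rule LeastI_ex)
  have "\<exists>m. fun_norm N (y m) \<omega> \<noteq> 0" using inf not_finite_existsD by auto
  then have 0: "fun_norm N (y (pos 0 \<omega>)) \<omega> \<noteq> 0" unfolding pos.simps by (rule LeastI_ex)
  show "fun_norm N (y (pos n \<omega>)) \<omega> \<noteq> 0" using 0 * by (cases n) auto
  show "pos n \<omega> < pos (Suc n) \<omega>" using * by blast
  show "\<And>m. pos n \<omega> < m \<Longrightarrow> m < pos (Suc n) \<omega> \<Longrightarrow> fun_norm N (y m) \<omega> = 0"
    unfolding pos.simps using not_less_Least by blast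
  show "\<And>m. m < pos 0 \<omega> \<Longrightarrow> fun_norm N (y m) \<omega> = 0"
    unfolding pos.simps using not_less_Least by blast
qed

text \<open>Only vanishing terms are skipped. Partial sums of the thinned series therefore form a
  subsequence of the old ones and inherit their limits.\<close>

lemma sum_pos:
  fixes f :: "nat \<Rightarrow> complex"
  assumes inf: "infinite {m. fun_norm N (y m) \<omega> \<noteq> 0}" and f: "\<And>m. fun_norm N (y m) \<omega> = 0 \<Longrightarrow> f m = 0"
  shows "(\<Sum>n<K. f (pos n \<omega>)) = (\<Sum>m<pos K \<omega>. f m)"
proof (induction K)
  case 0
  have "(\<Sum>m<pos 0 \<omega>. f m) = 0" by (rule sum.neutral) (use pos_props(4)[OF inf] f in auto)
  then show ?case by simp
next
  case (Suc K)
  have "(\<Sum>m<pos (Suc K) \<omega>. f m) = (\<Sum>m\<in>{..<pos K \<omega>} \<union> {pos K \<omega>}. f m)"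
  proof (rule sum.mono_neutral_right)
    show "{..<pos K \<omega>} \<union> {pos K \<omega>} \<subseteq> {..<pos (Suc K) \<omega>}" using pos_props(2)[OF inf, of K] by auto
    show "\<forall>i\<in>{..<pos (Suc K) \<omega>} - ({..<pos K \<omega>} \<union> {pos K \<omega>}). f i = 0"
    proof
      fix i assume "i \<in> {..<pos (Suc K) \<omega>} - ({..<pos K \<omega>} \<union> {pos K \<omega>})"
      then have "pos K \<omega> < i" "i < pos (Suc K) \<omega>" by auto
      then show "f i = 0" by (intro f pos_props(3)[OF inf])
    qed
  qed simp
  also have "\<dots> = (\<Sum>m<pos K \<omega>. f m) + f (pos K \<omega>)" by (subst sum.union_disjoint) auto
  finally show ?case using Suc by simp
qed

lemma pos_strict_mono: "infinite {m. fun_norm N (y m) \<omega> \<noteq> 0} \<Longrightarrow> strict_mono (\<lambda>n. pos n \<omega>)"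
  by (rule strict_monoI_Suc) (rule pos_props)

lemma eig_sys_pos:
  assumes es: "eig_sys N A (\<lambda>n. l n) (\<lambda>n. curry (y n) \<omega>)" and inf: "infinite {m. fun_norm N (y m) \<omega> \<noteq> 0}"
  shows "eig_sys N A (\<lambda>n. l (pos n \<omega>)) (\<lambda>n. curry (y (pos n \<omega>)) \<omega>)"
    "L2_norm N (curry (y (pos n \<omega>)) \<omega>) = 1"
    "g \<in> L2 N \<Longrightarrow> Fourier_sum N (\<lambda>n. curry (y n) \<omega>) g \<Longrightarrow> Fourier_sum N (\<lambda>n. curry (y (pos n \<omega>)) \<omega>) g"
proof -
  interpret y: ons N "\<lambda>n. curry (y n) \<omega>" using es by (simp add: eig_sys_def)
  have sm: "strict_mono (\<lambda>n. pos n \<omega>)" by (rule pos_strict_mono[OF inf])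
  have fl: "filterlim (\<lambda>n. pos n \<omega>) at_top sequentially" by (rule filterlim_subseq[OF sm])
  have nz: "L2_norm N (curry (y (pos n \<omega>)) \<omega>) \<noteq> 0" for n using pos_props(1)[OF inf, of n] by (simp add: fun_norm_def)
  show n1: "L2_norm N (curry (y (pos n \<omega>)) \<omega>) = 1" for n using nz[of n] y.norm_y[of "pos n \<omega>"] by auto
  have sums: "(\<Sum>n<K. a (pos n \<omega>) * L2_inner N g (curry (y (pos n \<omega>)) \<omega>) * curry (y (pos n \<omega>)) \<omega> s) =
     (\<Sum>m<pos K \<omega>. a m * L2_inner N g (curry (y m) \<omega>) * curry (y m) \<omega> s)" if "g \<in> L2 N" for a g s K
    by (rule sum_pos[OF inf]) (use y.inner_y_zero[OF _ that] in \<open>simp add: fun_norm_def\<close>)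
  show "eig_sys N A (\<lambda>n. l (pos n \<omega>)) (\<lambda>n. curry (y (pos n \<omega>)) \<omega>)"
    unfolding eig_sys_def
  proof (intro conjI allI impI ballI)
    show "ons N (\<lambda>n. curry (y (pos n \<omega>)) \<omega>)"
      by (rule ons.intro[OF fN]) (use y.y_L2 y.y_unit y.y_orth strict_mono_eq[OF sm] in auto)
    show "(\<lambda>n. l (pos n \<omega>)) \<longlonglongrightarrow> 0"
      using filterlim_compose[OF _ fl, of l] es by (simp add: eig_sys_def)
    fix g assume g: "g \<in> L2 N"
    show "A g \<in> L2 N" using es g by (simp add: eig_sys_def)
    have "L2_tendsto N (\<lambda>K s. \<Sum>n<K. complex_of_real (l n) * L2_inner N g (curry (y n) \<omega>) * curry (y n) \<omega> s) (A g)"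
      using es g by (simp add: eig_sys_def)
    from L2_tendsto_subseq[OF this fl]
    show "L2_tendsto N (\<lambda>K s. \<Sum>n<K. complex_of_real (l (pos n \<omega>)) * L2_inner N g (curry (y (pos n \<omega>)) \<omega>) * curry (y (pos n \<omega>)) \<omega> s) (A g)"
      unfolding sums[OF g, of "\<lambda>m. complex_of_real (l m)"] .
  qed (use es nz in \<open>auto simp: eig_sys_def\<close>)
  assume g: "g \<in> L2 N" and Fs: "Fourier_sum N (\<lambda>n. curry (y n) \<omega>) g"
  have "L2_tendsto N (\<lambda>K s. \<Sum>n<K. 1 * L2_inner N g (curry (y n) \<omega>) * curry (y n) \<omega> s) g"
    using Fs by (simp add: Fourier_sum_def)
  from L2_tendsto_subseq[OF this fl] 
  have "L2_tendsto N (\<lambda>K s. \<Sum>n<K. 1 * L2_inner N g (curry (y (pos n \<omega>)) \<omega>) * curry (y (pos n \<omega>)) \<omega> s) g"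
    unfolding sums[OF g, of "\<lambda>m. 1"] .
  then show "Fourier_sum N (\<lambda>n. curry (y (pos n \<omega>)) \<omega>) g" by (simp add: Fourier_sum_def)
qed

end

subsection \<open>Bounded Hermitian kernels\<close>

lemma cspan_restrict: "f \<in> cspan N W \<Longrightarrow> f \<in> cspan N (W \<inter> L2 N)"
  by (induction rule: cspan.induct) (auto intro: cspan.intros)

text \<open>Three sets enter the dense family: \<open>W\<close> for the ranges; \<open>e\<close>,
  dense in \<open>L2 N\<close> if that is separable, which makes the system complete; and
  \<open>u\<close>, an infinite orthonormal sequence if the dimension is infinite, which guarantees
  infinitely many non-zero vectors, so that the zero vectors can be discarded.\<close>

lemma eigen_fields_exist:
  fixes M :: "'a measure" and N :: "'b measure"
  assumes N: "finite_measure N" and bk: "bounded_kernel M N C k"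
    and herm: "\<And>\<omega> t s. \<omega> \<in> space M \<Longrightarrow> t \<in> space N \<Longrightarrow> s \<in> space N \<Longrightarrow> k (\<omega>, t, s) = cnj (k (\<omega>, s, t))"
  obtains l y where "\<And>n::nat. l n \<in> borel_measurable M" "\<And>n. y n \<in> borel_measurable (M \<Otimes>\<^sub>M N)"
    "\<And>\<omega>. \<omega> \<in> space M \<Longrightarrow> eig_sys N (fibre_op N k \<omega>) (\<lambda>n. l n \<omega>) (\<lambda>n. curry (y n) \<omega>)"
    "\<And>\<omega> g. \<omega> \<in> space M \<Longrightarrow> L2_separable N \<Longrightarrow> g \<in> L2 N \<Longrightarrow> Fourier_sum N (\<lambda>n. curry (y n) \<omega>) g"
    "\<And>\<omega> n. \<omega> \<in> space M \<Longrightarrow> \<not> L2_fin_dim N (L2 N) \<Longrightarrow> L2_norm N (curry (y n) \<omega>) = 1"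
proof -
  interpret N: finite_measure N by fact
  obtain W where W: "countable W" "\<And>\<omega> g. \<omega> \<in> space M \<Longrightarrow> g \<in> L2 N \<Longrightarrow> fibre_op N k \<omega> g \<in> cspan N W"
    using sep_range_bounded[OF N bk] unfolding sep_range_def by blast
  obtain e :: "nat \<Rightarrow> 'b \<Rightarrow> complex" where e: "\<And>n. e n \<in> L2 N" "L2_separable N \<Longrightarrow> (\<forall>h\<in>L2 N. \<forall>\<eta>>0. \<exists>n. L2_norm N (\<lambda>s. h s - e n s) < \<eta>)"
  proof (cases "L2_separable N")
    case True
    then show ?thesis using that unfolding L2_separable_def by blast
  next
    case False
    then show ?thesis using that[of "\<lambda>n s. 0"] by simp
  qed
  obtain u :: "nat \<Rightarrow> 'b \<Rightarrow> complex" where u: "\<And>n. u n \<in> L2 N" "\<not> L2_fin_dim N (L2 N) \<Longrightarrow> ons N u \<and> (\<forall>n. L2_norm N (u n) = 1)"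
  proof (cases "L2_fin_dim N (L2 N)")
    case True
    then show ?thesis using that[of "\<lambda>n s. 0"] by simp
  next
    case False
    from infinite_ons[OF N this] obtain u where "ons N u" "\<And>n::nat. L2_norm N (u n) = 1" by blast
    then show ?thesis using that[of u] ons.y_L2 by blast
  qed
  define W' where "W' = (W \<inter> L2 N) \<union> range e \<union> range u"
  have W': "countable W'" "W' \<noteq> {}" "W' \<subseteq> L2 N" using W(1) e(1) u(1) by (auto simp: W'_def)
  define f where "f = from_nat_into W'"
  have f: "range f = W'" unfolding f_def by (rule range_from_nat_into[OF W'(2,1)])
  have fL: "f n \<in> L2 N" for n using f W'(3) by blast
  obtain d :: "nat \<Rightarrow> 'b \<Rightarrow> complex" where d: "\<And>n. d n \<in> L2 N" 
    "\<And>K c e. e > 0 \<Longrightarrow> \<exists>n. L2_norm N (\<lambda>s. (\<Sum>i<K::nat. c i * f i s) - d n s) < e"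
    by (rule countable_dense_combinations[OF fL]) (rule that, assumption+)
  have dense_W: "\<exists>n. L2_norm N (\<lambda>s. h s - d n s) < \<eta>" if h: "h \<in> cspan N W'" and \<eta>: "\<eta> > 0" for h \<eta>
  proof -
    obtain K c where 1: "L2_norm N (\<lambda>s. h s - (\<Sum>i<K::nat. c i * f i s)) < \<eta>/2"
      using cspan_finite_approx[of h N f "\<eta>/2"] h \<eta> fL f by auto
    obtain n where 2: "L2_norm N (\<lambda>s. (\<Sum>i<K. c i * f i s) - d n s) < \<eta>/2" using d(2)[of "\<eta>/2"] \<eta> by auto
    have "L2_norm N (\<lambda>s. h s - d n s) \<le> L2_norm N (\<lambda>s. h s - (\<Sum>i<K. c i * f i s)) + L2_norm N (\<lambda>s. (\<Sum>i<K. c i * f i s) - d n s)"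
      by (rule L2_norm_triangle3) (auto intro!: cspan_L2[OF h] L2_sum L2_scale fL d)
    then show ?thesis using 1 2 by (intro exI[of _ n]) linarith
  qed
  interpret kernel_field M N d k
  proof
    show "k \<in> borel_measurable (M \<Otimes>\<^sub>M (N \<Otimes>\<^sub>M N))" using bk by (simp add: bounded_kernel_def)
    fix \<omega> assume \<omega>: "\<omega> \<in> space M"
    show "hs_kernel N k \<omega>"
      unfolding hs_kernel_def
    proof (intro conjI ballI)
      show m: "(\<lambda>(t, s). k (\<omega>, t, s)) \<in> borel_measurable (N \<Otimes>\<^sub>M N)"
        using bounded_kernel_meas(1)[OF N bk \<omega>] by (simp add: case_prod_beta')
      show rL: "(\<lambda>s. k (\<omega>, t, s)) \<in> L2 N" if "t \<in> space N" for t
        using bounded_kernel_meas[OF N bk \<omega>] that by (intro N.L2_bounded[of _ C]) auto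
      show "(\<lambda>t. complex_of_real (L2_norm N (\<lambda>s. k (\<omega>, t, s)))) \<in> L2 N"
      proof (rule N.L2_bounded)
        show "(\<lambda>t. complex_of_real (L2_norm N (\<lambda>s. k (\<omega>, t, s)))) \<in> borel_measurable N"
          using L2_norm_measurable_param[OF N m] by simp
        show "AE t in N. cmod (complex_of_real (L2_norm N (\<lambda>s. k (\<omega>, t, s)))) \<le> L2_norm N (\<lambda>s. complex_of_real C)"
        proof (rule AE_I2)
          fix t assume t: "t \<in> space N"
          have "AE s in N. cmod (k (\<omega>, t, s)) \<le> cmod (complex_of_real C)"
            using bounded_kernel_meas(3)[OF N bk \<omega> t] by (intro AE_I2) (metis abs_ge_self norm_of_real order_trans)
          then have "L2_norm N (\<lambda>s. k (\<omega>, t, s)) \<le> L2_norm N (\<lambda>s. complex_of_real C)"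
            by (intro L2_norm_mono bounded_kernel_meas(2)[OF N bk \<omega> t]) (auto simp: L2_def)
          then show "cmod (complex_of_real (L2_norm N (\<lambda>s. k (\<omega>, t, s)))) \<le> L2_norm N (\<lambda>s. complex_of_real C)" by simp
        qed
      qed
      show "k (\<omega>, t, s) = cnj (k (\<omega>, s, t))" if "t \<in> space N" "s \<in> space N" for t s by (rule herm[OF \<omega> that])
    qed
    fix g e assume "g \<in> L2 N" "(e::real) > 0"
    moreover have "fibre_op N k \<omega> g \<in> cspan N W'"
      by (rule cspan_mono[OF cspan_restrict[OF W(2)[OF \<omega> \<open>g \<in> L2 N\<close>]]]) (auto simp: W'_def)
    ultimately show "\<exists>i. L2_norm N (\<lambda>t. fibre_op N k \<omega> g t - d i t) < e" using dense_W by blast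
  qed (rule N d)+
  show ?thesis
  proof (rule eigen_basis)
    fix l y assume l: "\<And>n::nat. l n \<in> borel_measurable M" and y: "\<And>n. y n \<in> borel_measurable (M \<Otimes>\<^sub>M N)"
      and es: "\<And>\<omega>. \<omega> \<in> space M \<Longrightarrow> eig_sys N (fibre_op N k \<omega>) (\<lambda>n. l n \<omega>) (\<lambda>n. curry (y n) \<omega>)"
      and Fs: "\<And>\<omega> g. \<omega> \<in> space M \<Longrightarrow> g \<in> L2 N \<Longrightarrow> (\<And>e. e > 0 \<Longrightarrow> \<exists>i. L2_norm N (\<lambda>s. g s - d i s) < e) \<Longrightarrow>
       Fourier_sum N (\<lambda>n. curry (y n) \<omega>) g"
    have base: "h \<in> cspan N W'" if "h \<in> W'" for h using that W'(3) by (intro cspan.base) auto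
    have complete: "Fourier_sum N (\<lambda>n. curry (y n) \<omega>) g" if "\<omega> \<in> space M" "L2_separable N" "g \<in> L2 N" for \<omega> g
    proof (rule Fs[OF that(1,3)], rule dense_W)
      have "\<exists>n. L2_norm N (\<lambda>s. e n s - g s) < r" if r: "0 < r" for r
        using e(2)[OF \<open>L2_separable N\<close>] \<open>g \<in> L2 N\<close> r unfolding L2_norm_minus_commute[of N "e _"] by blast
      then have "\<exists>n. L2_norm N (\<lambda>s. e n s - g s) < inverse (real (Suc j))" for j by simp
      then obtain \<sigma> where \<sigma>: "\<And>j. L2_norm N (\<lambda>s. e (\<sigma> j) s - g s) < inverse (real (Suc j))" by metis
      show "g \<in> cspan N W'"
      proof (rule cspan.lim)
        show "e (\<sigma> j) \<in> cspan N W'" for j by (rule base) (auto simp: W'_def)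
        have "(\<lambda>j. L2_norm N (\<lambda>s. e (\<sigma> j) s - g s)) \<longlonglongrightarrow> 0"
          by (rule null_squeeze_nonneg[OF L2_norm_nonneg less_imp_le[OF \<sigma>] LIMSEQ_inverse_real_of_nat])
        then show "L2_tendsto N (\<lambda>j. e (\<sigma> j)) g" using e(1) \<open>g \<in> L2 N\<close> by (simp add: L2_tendsto_def)
      qed
    qed
    show ?thesis
    proof (cases "L2_fin_dim N (L2 N)")
      case True
      then show ?thesis using that[OF l y es complete] by blast
    next
      case False
      \<comment> \<open>If only finitely many vectors were non-zero, their span would contain the
        infinite orthonormal sequence \<open>u\<close>, since every \<open>u n\<close> is
        approximated by the family \<open>d\<close>.\<close>
      have inf: "infinite {m. fun_norm N (y m) \<omega> \<noteq> 0}" if \<omega>: "\<omega> \<in> space M" for \<omega>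
      proof
        assume fin: "finite {m. fun_norm N (y m) \<omega> \<noteq> 0}"
        define F where "F = {m. L2_norm N (curry (y m) \<omega>) \<noteq> 0}"
        have F: "finite F" using fin by (simp add: F_def fun_norm_def)
        interpret y: ons N "\<lambda>n. curry (y n) \<omega>" using es[OF \<omega>] by (simp add: eig_sys_def)
        have uu: "ons N u" "\<And>n. L2_norm N (u n) = 1" using u(2)[OF False] by auto
        have "L2_norm N (\<lambda>s. u n s - (\<Sum>m\<in>F. L2_inner N (u n) (curry (y m) \<omega>) * curry (y m) \<omega> s)) = 0" for n
        proof -
          have "Fourier_sum N (\<lambda>n. curry (y n) \<omega>) (u n)"
            by (rule Fs[OF \<omega> u(1)]) (rule dense_W[OF base], auto simp: W'_def)
          then have lim: "L2_tendsto N (\<lambda>K s. \<Sum>i<K. L2_inner N (u n) (curry (y i) \<omega>) * curry (y i) \<omega> s) (u n)"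
            by (simp add: Fourier_sum_def)
          obtain K0 where K0: "F \<subseteq> {..<K0}" using F finite_nat_set_iff_bounded by auto
          have "L2_norm N (\<lambda>s. (\<Sum>i<K. L2_inner N (u n) (curry (y i) \<omega>) * curry (y i) \<omega> s) - u n s) = 
             L2_norm N (\<lambda>s. u n s - (\<Sum>m\<in>F. L2_inner N (u n) (curry (y m) \<omega>) * curry (y m) \<omega> s))" if "K \<ge> K0" for K
          proof -
            have "(\<Sum>i<K. L2_inner N (u n) (curry (y i) \<omega>) * curry (y i) \<omega> s) = (\<Sum>m\<in>F. L2_inner N (u n) (curry (y m) \<omega>) * curry (y m) \<omega> s)" for s
              by (rule sum.mono_neutral_right) (use K0 that y.inner_y_zero[OF _ u(1)] in \<open>auto simp: F_def\<close>)
            then show ?thesis by (simp add: L2_norm_minus_commute[of N "u n"])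
          qed
          then have "(\<lambda>K. L2_norm N (\<lambda>s. (\<Sum>i<K. L2_inner N (u n) (curry (y i) \<omega>) * curry (y i) \<omega> s) - u n s)) \<longlonglongrightarrow>
             L2_norm N (\<lambda>s. u n s - (\<Sum>m\<in>F. L2_inner N (u n) (curry (y m) \<omega>) * curry (y m) \<omega> s))"
            by (intro tendsto_eventually eventually_sequentiallyI[of K0])
          then show ?thesis using LIMSEQ_unique L2_tendstoD(3)[OF lim] by blast
        qed
        then have "\<exists>c. L2_norm N (\<lambda>s. u n s - (\<Sum>m\<in>F. c m * curry (y m) \<omega> s)) = 0" for n
          by (rule exI[of _ "\<lambda>m. L2_inner N (u n) (curry (y m) \<omega>)"])
        then have "card {..<Suc (card F)} \<le> card F"
          by (intro ons_card_le[OF uu(1) y.ons_axioms _ F uu(2)]) simp_all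
        then show False by simp
      qed
      define x where "x n z = y (pos N y n (fst z)) z" for n z
      define lam where "lam n \<omega> = l (pos N y n \<omega>) \<omega>" for n \<omega>
      note pm[measurable] = pos_measurable[OF N y]
      have xc: "curry (x n) \<omega> = curry (y (pos N y n \<omega>)) \<omega>" for n \<omega> by (simp add: x_def curry_def)
      show ?thesis
      proof (rule that)
        show "lam n \<in> borel_measurable M" for n
          unfolding lam_def[abs_def] by (rule measurable_compose_countable[OF l pm])
        show "x n \<in> borel_measurable (M \<Otimes>\<^sub>M N)" for n
          unfolding x_def[abs_def] by (rule measurable_compose_countable[OF y]) measurable
        fix \<omega> assume \<omega>: "\<omega> \<in> space M"
        show "eig_sys N (fibre_op N k \<omega>) (\<lambda>n. lam n \<omega>) (\<lambda>n. curry (x n) \<omega>)"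
          unfolding xc lam_def by (rule eig_sys_pos(1)[OF N y es[OF \<omega>] inf[OF \<omega>]])
        show "L2_norm N (curry (x n) \<omega>) = 1" for n
          unfolding xc by (rule eig_sys_pos(2)[OF N y es[OF \<omega>] inf[OF \<omega>]])
        show "Fourier_sum N (\<lambda>n. curry (x n) \<omega>) g" if "L2_separable N" "g \<in> L2 N" for g
          unfolding xc by (rule eig_sys_pos(3)[OF N y es[OF \<omega>] inf[OF \<omega>] that(2) complete[OF \<omega> that]])
      qed
    qed
  qed
qed

section \<open>Operators with an eigenvector expansion\<close>

text \<open>As a function of \<open>i\<close>, the truth value of \<open>l \<le> d i\<close> changes
  exactly once, in the cell with \<open>d j < l\<close> and \<open>l \<le> d (Suc j)\<close>; only
  the tag of that cell survives.\<close>

lemma rs_jump: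
  fixes d \<xi> :: "nat \<Rightarrow> real" and \<phi> :: "real \<Rightarrow> complex"
  assumes "\<And>i. i < n \<Longrightarrow> d i \<le> d (Suc i)" "d 0 < l" "l \<le> d n"
  shows "\<exists>j<n. d j < l \<and> l \<le> d (Suc j) \<and>
    (\<Sum>i<n. \<phi> (\<xi> i) * ((if l \<le> d (Suc i) then 1 else 0) - (if l \<le> d i then 1 else 0))) = \<phi> (\<xi> j)"
  using assms
proof (induction n)
  case (Suc n)
  show ?case
  proof (cases "l \<le> d n")
    case True
    then obtain j where "j < n" "d j < l" "l \<le> d (Suc j)"
      "(\<Sum>i<n. \<phi> (\<xi> i) * ((if l \<le> d (Suc i) then 1 else 0) - (if l \<le> d i then 1 else 0))) = \<phi> (\<xi> j)"
      using Suc by auto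
    moreover have "l \<le> d (Suc n)" using True Suc.prems(1)[of n] by simp
    ultimately show ?thesis using True by (intro exI[of _ j]) auto
  next
    case False
    have mono: "d i \<le> d n" if "i \<le> n" for i
      using that
    proof (induction rule: inc_induct)
      case (step m)
      then show ?case using Suc.prems(1)[of m] by simp
    qed simp
    have "(\<Sum>i<n. \<phi> (\<xi> i) * ((if l \<le> d (Suc i) then 1 else 0) - (if l \<le> d i then 1 else 0))) = 0"
    proof (rule sum.neutral, rule ballI)
      fix i assume "i \<in> {..<n}"
      then have "d i < l" "d (Suc i) < l" using mono[of i] mono[of "Suc i"] False by auto
      then show "\<phi> (\<xi> i) * ((if l \<le> d (Suc i) then 1 else 0) - (if l \<le> d i then 1 else 0)) = 0" by simp
    qed
    then show ?thesis using False Suc.prems by (intro exI[of _ n]) auto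
  qed
qed simp

text \<open>The factor by which a Riemann-Stieltjes sum multiplies an eigenvector with eigenvalue
  \<open>l\<close>.\<close>

definition rs_coeff :: "(real \<Rightarrow> complex) \<Rightarrow> real \<Rightarrow> nat \<Rightarrow> (nat \<Rightarrow> real) \<Rightarrow> (nat \<Rightarrow> real) \<Rightarrow> real \<Rightarrow> complex" where
  "rs_coeff \<phi> a n d \<xi> l = \<phi> a * (if l \<le> a then 1 else 0) +
    (\<Sum>i<n. \<phi> (\<xi> i) * ((if l \<le> d (Suc i) then 1 else 0) - (if l \<le> d i then 1 else 0)))"

lemma rs_partition_mono:
  assumes "rs_partition a b n d \<xi> \<delta>" "i \<le> j" "j \<le> n" shows "d i \<le> d j"
  using assms(2,3)
proof (induction rule: dec_induct)
  case (step m)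
  have "d m \<le> \<xi> m \<and> \<xi> m \<le> d (Suc m)" using assms(1) step.prems unfolding rs_partition_def by auto
  then show ?case using step by linarith
qed simp

text \<open>An eigenvalue at the left end point is counted by the separate first term, and no cell
  sees it; any other lies in exactly one cell, whose tag is closer to it than the mesh.\<close>

lemma rs_coeff_value:
  assumes p: "rs_partition a b n d \<xi> \<delta>" and l: "l \<in> {a..b}" and \<delta>: "\<delta> > 0"
  shows "\<exists>r\<in>{a..b}. \<bar>r - l\<bar> < \<delta> \<and> rs_coeff \<phi> a n d \<xi> l = \<phi> r"
proof (cases "l = a")
  case True
  have "a \<le> d i" if "i \<le> n" for i using rs_partition_mono[OF p, of 0 i] that p by (simp add: rs_partition_def)
  then have "(\<Sum>i<n. \<phi> (\<xi> i) * ((if l \<le> d (Suc i) then 1 else 0) - (if l \<le> d i then 1 else 0))) = 0"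
    unfolding True by (intro sum.neutral) auto
  then show ?thesis using l \<delta> unfolding rs_coeff_def True by (intro bexI[of _ a]) auto
next
  case False
  have mono: "\<And>i. i < n \<Longrightarrow> d i \<le> d (Suc i)" using rs_partition_mono[OF p] by simp
  obtain j where j: "j < n" "d j < l" "l \<le> d (Suc j)"
      "(\<Sum>i<n. \<phi> (\<xi> i) * ((if l \<le> d (Suc i) then 1 else 0) - (if l \<le> d i then 1 else 0))) = \<phi> (\<xi> j)"
    using rs_jump[where n=n and d=d and l=l and \<phi>=\<phi> and \<xi>=\<xi>] mono False l p by (auto simp: rs_partition_def)
  have "d j \<le> \<xi> j" "\<xi> j \<le> d (Suc j)" "d (Suc j) - d j < \<delta>" using p j(1) by (auto simp: rs_partition_def)
  moreover have "a \<le> d j" "d (Suc j) \<le> b"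
    using rs_partition_mono[OF p, of 0 j] rs_partition_mono[OF p, of "Suc j" n] j(1) p by (auto simp: rs_partition_def)
  ultimately show ?thesis using False l j unfolding rs_coeff_def by (intro bexI[of _ "\<xi> j"]) auto
qed

text \<open>Real and imaginary parts are approximated separately, and the two real polynomials are
  combined into one with complex coefficients.\<close>

lemma Weierstrass_complex_poly:
  fixes \<phi> :: "real \<Rightarrow> complex"
  assumes "continuous_on {a..b} \<phi>" "e > 0"
  obtains P :: "complex poly" where "\<And>r. r \<in> {a..b} \<Longrightarrow> cmod (poly P (complex_of_real r) - \<phi> r) < e"
proof -
  have c: "continuous_on {a..b} (\<lambda>r. Re (\<phi> r))" "continuous_on {a..b} (\<lambda>r. Im (\<phi> r))"
    using assms(1) by (auto intro: continuous_intros)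
  have W: "\<exists>a' n. \<forall>r\<in>{a..b}. \<bar>f r - (\<Sum>i\<le>n::nat. a' i * r ^ i)\<bar> < e / 2" if cf: "continuous_on {a..b} f" for f :: "real \<Rightarrow> real"
  proof -
    obtain g where g: "real_polynomial_function g" "\<And>x. x \<in> {a..b} \<Longrightarrow> \<bar>f x - g x\<bar> < e/2"
      using Stone_Weierstrass_real_polynomial_function[OF compact_Icc cf, of "e/2"] assms(2) by auto
    then show ?thesis unfolding real_polynomial_function_iff_sum by blast
  qed
  obtain u m where u: "\<forall>r\<in>{a..b}. \<bar>Re (\<phi> r) - (\<Sum>i\<le>m::nat. u i * r ^ i)\<bar> < e / 2" using W[OF c(1)] by blast
  obtain v n where v: "\<forall>r\<in>{a..b}. \<bar>Im (\<phi> r) - (\<Sum>i\<le>n::nat. v i * r ^ i)\<bar> < e / 2" using W[OF c(2)] by blast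
  define P where "P = (\<Sum>i\<le>m. monom (complex_of_real (u i)) i) + (\<Sum>i\<le>n. monom (\<i> * complex_of_real (v i)) i)"
  have "poly P (complex_of_real r) = complex_of_real (\<Sum>i\<le>m. u i * r ^ i) + \<i> * complex_of_real (\<Sum>i\<le>n. v i * r ^ i)" for r
    by (simp add: P_def poly_sum poly_monom sum_distrib_left mult.assoc)
  then have "cmod (poly P (complex_of_real r) - \<phi> r) < e" if "r \<in> {a..b}" for r
    using bspec[OF u that] bspec[OF v that] cmod_le[of "poly P (complex_of_real r) - \<phi> r"] by (simp add: abs_minus_commute)
  then show ?thesis using that by blast
qed

section \<open>Eigensystems of a single operator\<close>

locale eig =
  fixes N :: "'b measure" and A :: "('b \<Rightarrow> complex) \<Rightarrow> 'b \<Rightarrow> complex" and l :: "nat \<Rightarrow> real" and y :: "nat \<Rightarrow> 'b \<Rightarrow> complex"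
  assumes es: "eig_sys N A l y"
begin

sublocale ons N y using es by (simp add: eig_sys_def)

lemma l_null: "L2_norm N (y n) = 0 \<Longrightarrow> l n = 0"
  and l_lim: "l \<longlonglongrightarrow> 0"
  and A_y: "AE t in N. A (y n) t = complex_of_real (l n) * y n t"
  and A_L2: "g \<in> L2 N \<Longrightarrow> A g \<in> L2 N"
  and A_exp: "g \<in> L2 N \<Longrightarrow> L2_tendsto N (\<lambda>K s. \<Sum>n<K. complex_of_real (l n) * L2_inner N g (y n) * y n s) (A g)"
  using es by (auto simp: eig_sys_def)

lemma A_inner: "g \<in> L2 N \<Longrightarrow> L2_inner N (A g) (y n) = complex_of_real (l n) * L2_inner N g (y n)"
  by (rule diag_inner[OF _ A_exp])

lemma l_bounded: obtains C where "\<And>n. \<bar>l n\<bar> \<le> C" "C \<ge> 0"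
  using Bseq_eq_bounded[of l] convergent_imp_Bseq[of l] l_lim unfolding convergent_def bounded_iff
  by (metis abs_ge_zero order_trans rangeI real_norm_def)

lemma diag_tendsto_cong:
  assumes "\<And>n. L2_norm N (y n) \<noteq> 0 \<Longrightarrow> a n = a' n" "g \<in> L2 N"
    "L2_tendsto N (\<lambda>K s. \<Sum>n<K. a n * L2_inner N g (y n) * y n s) d"
  shows "L2_tendsto N (\<lambda>K s. \<Sum>n<K. a' n * L2_inner N g (y n) * y n s) d"
proof -
  have "a n * L2_inner N g (y n) = a' n * L2_inner N g (y n)" for n
    using assms(1)[of n] inner_y_zero[OF _ assms(2), of n] by (cases "L2_norm N (y n) = 0") auto
  then show ?thesis using assms(3) by (simp only:)
qed

text \<open>The orthogonal projection on the closed span of \<open>y\<close>; the factor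
  \<open>1\<close> keeps it within the diagonal operators. The difference \<open>h - proj h\<close>
  stands for all that the sequence misses, and the operator vanishes on it.\<close>

definition proj :: "('b \<Rightarrow> complex) \<Rightarrow> 'b \<Rightarrow> complex" where
  "proj h = (SOME p. L2_tendsto N (\<lambda>K s. \<Sum>n<K. 1 * L2_inner N h (y n) * y n s) p)"

lemma proj_tendsto: assumes "h \<in> L2 N" shows "L2_tendsto N (\<lambda>K s. \<Sum>n<K. 1 * L2_inner N h (y n) * y n s) (proj h)"
proof -
  have "\<exists>p. L2_tendsto N (\<lambda>K s. \<Sum>n<K. 1 * L2_inner N h (y n) * y n s) p"
    by (rule diag_limit[OF assms, of "\<lambda>n. 1" 1]) auto
  then show ?thesis unfolding proj_def by (rule someI_ex)
qed

lemma proj_L2: "h \<in> L2 N \<Longrightarrow> proj h \<in> L2 N"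
  by (rule L2_tendstoD(2)[OF proj_tendsto])

lemma proj_inner: "h \<in> L2 N \<Longrightarrow> L2_inner N (proj h) (y n) = L2_inner N h (y n)"
  using diag_inner[OF _ proj_tendsto, of h n] by simp

lemma proj_complete: "h \<in> L2 N \<Longrightarrow> Fourier_sum N y h \<Longrightarrow> AE s in N. proj h s = h s"
  using L2_tendsto_unique[OF proj_tendsto, of h h] by (simp add: Fourier_sum_def)

subsection \<open>The spectrum\<close>

lemma eigenvalue_in_spectrum:
  assumes "L2_norm N (y n) \<noteq> 0" shows "complex_of_real (l n) \<in> L2_spectrum N A"
proof -
  have False if C: "\<forall>g\<in>L2 N. L2_norm N g \<le> C * L2_norm N (\<lambda>s. complex_of_real (l n) * g s - A g s)" for C
  proof -
    have "L2_norm N (\<lambda>s. complex_of_real (l n) * y n s - A (y n) s) = L2_norm N (\<lambda>s. 0)"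
      by (rule L2_norm_cong_AE) (use A_y[of n] in \<open>auto intro!: L2_measurable L2_diff L2_scale y_L2 A_L2\<close>)
    then have "L2_norm N (y n) \<le> 0" using C y_L2[of n] by fastforce
    then show False using assms L2_norm_nonneg[of N "y n"] by linarith
  qed
  then show ?thesis unfolding L2_spectrum_def by blast
qed

text \<open>Unit vectors \<open>y n\<close> are sent to vectors of norm
  \<open>\<bar>l n\<bar>\<close>, which tends to zero, so no inverse is bounded.\<close>

lemma zero_in_spectrum:
  assumes "\<And>n. L2_norm N (y n) = 1" shows "0 \<in> L2_spectrum N A"
proof -
  have False if C: "\<forall>g\<in>L2 N. L2_norm N g \<le> C * L2_norm N (\<lambda>s. 0 * g s - A g s)" for C
  proof -
    have "1 \<le> C * \<bar>l n\<bar>" for n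
    proof -
      have "L2_norm N (\<lambda>s. 0 * y n s - A (y n) s) = L2_norm N (\<lambda>s. complex_of_real (- l n) * y n s)"
        by (rule L2_norm_cong_AE) (use A_y[of n] in \<open>auto intro!: L2_measurable L2_diff L2_scale y_L2 A_L2\<close>)
      also have "\<dots> = \<bar>l n\<bar>" unfolding L2_norm_scale by (simp add: assms)
      finally show ?thesis using C y_L2[of n] assms[of n] by metis
    qed
    moreover have "(\<lambda>n. C * \<bar>l n\<bar>) \<longlonglongrightarrow> C * 0" by (intro tendsto_mult tendsto_const tendsto_rabs_zero l_lim)
    ultimately have "(1::real) \<le> C * 0" by (intro LIMSEQ_le_const) auto
    then show False by simp
  qed
  then show ?thesis unfolding L2_spectrum_def by blast
qed

lemma finite_nonzero:
  assumes "L2_fin_dim N (L2 N)" shows "finite {n. L2_norm N (y n) \<noteq> 0}"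
proof -
  obtain r b where b: "\<And>i. i < r \<Longrightarrow> b i \<in> L2 N" "\<And>g. g \<in> L2 N \<Longrightarrow> \<exists>c. AE s in N. g s = (\<Sum>i<r::nat. c i * b i s)"
    using assms unfolding L2_fin_dim_def by blast
  have "card F \<le> r" if "finite F" "F \<subseteq> {n. L2_norm N (y n) \<noteq> 0}" for F
    by (rule fin_dim_card_le[OF finite_N ons_axioms that(1) _ b(1) b(2)[OF y_L2]]) (use that norm_y in auto)
  then show ?thesis by (meson finite_if_finite_subsets_card_bdd)
qed

text \<open>If \<open>z\<close> is not \<open>0\<close>, only finitely many eigenvalues come within
  half its modulus; if \<open>z = 0\<close>, finite dimension leaves only finitely many non-zero
  vectors. In both cases a minimum over a finite set remains.\<close>

lemma spectrum_gap:
  assumes "\<And>n. L2_norm N (y n) \<noteq> 0 \<Longrightarrow> z \<noteq> complex_of_real (l n)" "z \<noteq> 0 \<or> L2_fin_dim N (L2 N)"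
  obtains \<delta> where "\<delta> > 0" "\<And>n. L2_norm N (y n) \<noteq> 0 \<Longrightarrow> \<delta> \<le> cmod (z - complex_of_real (l n))"
proof -
  have "\<exists>F \<delta>0. finite F \<and> \<delta>0 > 0 \<and> (\<forall>n. n \<notin> F \<longrightarrow> L2_norm N (y n) \<noteq> 0 \<longrightarrow> \<delta>0 \<le> cmod (z - complex_of_real (l n)))"
  proof (cases "z = 0")
    case True
    then have "finite {n. L2_norm N (y n) \<noteq> 0}" using assms(2) finite_nonzero by simp
    then show ?thesis by (intro exI[of _ "{n. L2_norm N (y n) \<noteq> 0}"] exI[of _ 1]) auto
  next
    case False
    then obtain K where K: "\<And>n. n \<ge> K \<Longrightarrow> \<bar>l n\<bar> < cmod z / 2"
      using LIMSEQ_D[OF l_lim, of "cmod z / 2"] by auto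
    have "cmod z / 2 \<le> cmod (z - complex_of_real (l n))" if "n \<ge> K" for n
      using K[OF that] norm_triangle_ineq2[of z "complex_of_real (l n)"] by simp
    then show ?thesis using False by (intro exI[of _ "{..<K}"] exI[of _ "cmod z / 2"]) auto
  qed
  then obtain F \<delta>0 where F: "finite F" "\<delta>0 > 0" "\<And>n. n \<notin> F \<Longrightarrow> L2_norm N (y n) \<noteq> 0 \<Longrightarrow> \<delta>0 \<le> cmod (z - complex_of_real (l n))"
    by blast
  define G where "G = (\<lambda>n. cmod (z - complex_of_real (l n))) ` {n\<in>F. L2_norm N (y n) \<noteq> 0}"
  have G: "finite (insert \<delta>0 G)" "\<And>g. g \<in> insert \<delta>0 G \<Longrightarrow> g > 0" using F(1,2) assms(1) by (auto simp: G_def)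
  show ?thesis
  proof (rule that[of "Min (insert \<delta>0 G)"])
    show "Min (insert \<delta>0 G) > 0" using G by (subst Min_gr_iff) auto
    fix n assume n: "L2_norm N (y n) \<noteq> 0"
    show "Min (insert \<delta>0 G) \<le> cmod (z - complex_of_real (l n))"
    proof (cases "n \<in> F")
      case True
      then show ?thesis using n G(1) by (intro Min_le) (auto simp: G_def)
    next
      case False
      have "Min (insert \<delta>0 G) \<le> \<delta>0" using G(1) by (intro Min_le) auto
      then show ?thesis using F(3)[OF False n] by simp
    qed
  qed
qed

text \<open>The resolvent is diagonal on the closed span of \<open>y\<close>, with multiplier
  \<open>1 / (z - l n)\<close> bounded by the gap, and is \<open>1 / z\<close> on the complement,
  where the operator vanishes. For \<open>z = 0\<close> the space is finite-dimensional by the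
  assumption to be refuted, hence separable, and the complement is null.\<close>

lemma spectrum_sub:
  assumes z: "z \<in> L2_spectrum N A" and complete: "L2_separable N \<Longrightarrow> (\<And>g. g \<in> L2 N \<Longrightarrow> Fourier_sum N y g)"
  shows "(\<exists>n. L2_norm N (y n) \<noteq> 0 \<and> z = complex_of_real (l n)) \<or> (z = 0 \<and> \<not> L2_fin_dim N (L2 N))"
proof (rule ccontr)
  assume no: "\<not> ?thesis"
  then have n1: "\<And>n. L2_norm N (y n) \<noteq> 0 \<Longrightarrow> z \<noteq> complex_of_real (l n)" and n2: "z \<noteq> 0 \<or> L2_fin_dim N (L2 N)" by auto
  obtain \<delta> where \<delta>: "\<delta> > 0" "\<And>n. L2_norm N (y n) \<noteq> 0 \<Longrightarrow> \<delta> \<le> cmod (z - complex_of_real (l n))"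
    using spectrum_gap[OF n1 n2] by blast
  have comp: "AE s in N. proj h s = h s" if "z = 0" "h \<in> L2 N" for h
    using proj_complete[OF that(2) complete] fin_dim_separable n2 that by blast
  define a where "a n = 1 / (z - complex_of_real (l n))" for n
  have a: "cmod (a n) \<le> 1 / \<delta>" if "L2_norm N (y n) \<noteq> 0" for n
    using \<delta>(2)[OF that] \<delta>(1) by (simp add: a_def norm_divide divide_left_mono frac_le)
  have za: "(z - complex_of_real (l n)) * a n = 1" if "L2_norm N (y n) \<noteq> 0" for n
    using n1[OF that] by (simp add: a_def)
  have "\<exists>g\<in>L2 N. AE s in N. z * g s - A g s = h s" if h: "h \<in> L2 N" for h
  proof -
    obtain q where q: "L2_tendsto N (\<lambda>K s. \<Sum>n<K. a n * L2_inner N h (y n) * y n s) q"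
      using diag_limit[OF h, of a "1 / \<delta>"] a by blast
    define w where "w = (if z = 0 then 0 else 1 / z)"
    define g where "g s = q s + w * (h s - proj h s)" for s
    have qL: "q \<in> L2 N" by (rule L2_tendstoD(2)[OF q])
    have g: "g \<in> L2 N" unfolding g_def by (intro L2_add L2_scale L2_diff qL h proj_L2)
    have gi: "L2_inner N g (y n) = a n * L2_inner N h (y n)" for n
    proof -
      have "L2_inner N g (y n) = L2_inner N q (y n) + w * (L2_inner N h (y n) - L2_inner N (proj h) (y n))"
        unfolding g_def by (subst L2_inner_add_left) 
          (auto intro!: L2_scale L2_diff qL h proj_L2 y_L2 simp: L2_inner_scale_left L2_inner_diff_left[OF h proj_L2[OF h] y_L2])
      then show ?thesis using diag_inner[OF h q] proj_inner[OF h] by simp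
    qed
    have "L2_tendsto N (\<lambda>K s. z * (\<Sum>n<K. a n * L2_inner N h (y n) * y n s) - (\<Sum>n<K. complex_of_real (l n) * L2_inner N g (y n) * y n s))
      (\<lambda>s. z * q s - A g s)"
      by (intro L2_tendsto_diff L2_tendsto_scale q A_exp g)
    then have "L2_tendsto N (\<lambda>K s. \<Sum>n<K. ((z - complex_of_real (l n)) * a n) * L2_inner N h (y n) * y n s) (\<lambda>s. z * q s - A g s)"
      by (simp add: gi sum_distrib_left left_diff_distrib sum_subtractf mult.assoc)
    then have t3: "L2_tendsto N (\<lambda>K s. \<Sum>n<K. ((z - complex_of_real (l n)) * a n) * L2_inner N h (y n) * y n s) (\<lambda>s. z * q s - A g s)" .
    have "L2_tendsto N (\<lambda>K s. \<Sum>n<K. 1 * L2_inner N h (y n) * y n s) (\<lambda>s. z * q s - A g s)"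
      by (rule diag_tendsto_cong[where a="\<lambda>n. (z - complex_of_real (l n)) * a n" and a'="\<lambda>n. 1"]) (rule za h t3, assumption?)+
    then have 1: "AE s in N. proj h s = z * q s - A g s" by (rule L2_tendsto_unique[OF proj_tendsto[OF h]])
    have "AE s in N. z * g s - A g s = h s"
    proof (cases "z = 0")
      case True
      from 1 comp[OF True h] show ?thesis by eventually_elim (simp add: True)
    next
      case False
      from 1 show ?thesis
      proof eventually_elim
        case (elim s)
        have "z * g s = z * q s + (h s - proj h s)" using False by (simp add: g_def w_def distrib_left)
        then show ?case using elim by simp
      qed
    qed
    then show ?thesis using g by blast
  qed
  moreover have "\<exists>C. \<forall>g\<in>L2 N. L2_norm N g \<le> C * L2_norm N (\<lambda>s. z * g s - A g s)"
  proof -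
    obtain L where L: "\<And>n. \<bar>l n\<bar> \<le> L" "L \<ge> 0" by (rule l_bounded) (rule that)
    \<comment> \<open>For \<open>z\<close> different from \<open>0\<close> the norm of
      \<open>z * g\<close> is estimated through \<open>u\<close> and \<open>A g\<close>, the latter
      having multiplier \<open>l n * a n\<close> with respect to \<open>u\<close>; for
      \<open>z = 0\<close> the multiplier \<open>a\<close> alone recovers \<open>g\<close>.\<close>
    define C where "C = (if z = 0 then 1 / \<delta> else (1 + L / \<delta>) / cmod z)"
    have "L2_norm N g \<le> C * L2_norm N (\<lambda>s. z * g s - A g s)" if g: "g \<in> L2 N" for g
    proof -
      define u where "u s = z * g s - A g s" for s
      have u: "u \<in> L2 N" unfolding u_def by (intro L2_diff L2_scale g A_L2)
      have ui: "L2_inner N u (y n) = (z - complex_of_real (l n)) * L2_inner N g (y n)" for n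
        unfolding u_def by (subst L2_inner_diff_left) 
          (auto intro!: L2_scale g A_L2 y_L2 simp: L2_inner_scale_left A_inner[OF g] left_diff_distrib)
      have gi: "b n * L2_inner N g (y n) = (b n * a n) * L2_inner N u (y n)" for b n
        using za[of n] inner_y_zero[OF _ g, of n] ui[of n] by (cases "L2_norm N (y n) = 0") (auto simp: mult_ac)
      show ?thesis
      proof (cases "z = 0")
        case True
        have t: "L2_tendsto N (\<lambda>K s. \<Sum>n<K. (1 * a n) * L2_inner N u (y n) * y n s) (proj g)"
          using proj_tendsto[OF g] unfolding gi[of "\<lambda>n. 1"] .
        have "L2_norm N (proj g) \<le> 1 / \<delta> * L2_norm N u"
          by (rule diag_norm[OF u _ _ t]) (use a \<delta> in auto)
        moreover have "L2_norm N (proj g) = L2_norm N g"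
          by (rule L2_norm_cong_AE) (use comp[OF True g] in \<open>auto intro!: L2_measurable proj_L2 g\<close>)
        ultimately have "L2_norm N g \<le> C * L2_norm N u" by (simp add: C_def True)
        then show ?thesis by (simp only: u_def[abs_def])
      next
        case False
        have t: "L2_tendsto N (\<lambda>K s. \<Sum>n<K. (complex_of_real (l n) * a n) * L2_inner N u (y n) * y n s) (A g)"
          using A_exp[OF g] unfolding gi[of "\<lambda>n. complex_of_real (l n)"] .
        have "L2_norm N (A g) \<le> L / \<delta> * L2_norm N u"
        proof (rule diag_norm[OF u _ _ t])
          fix n assume "L2_norm N (y n) \<noteq> 0"
          then have "cmod (complex_of_real (l n)) * cmod (a n) \<le> L * (1 / \<delta>)"
            by (intro mult_mono) (use L a in auto)
          then show "cmod (complex_of_real (l n) * a n) \<le> L / \<delta>" by (simp add: norm_mult)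
        qed (use L \<delta> in auto)
        moreover have "L2_norm N (\<lambda>s. z * g s) \<le> L2_norm N u + L2_norm N (A g)"
          using L2_norm_triangle[OF u A_L2[OF g]] by (simp add: u_def)
        ultimately have "cmod z * L2_norm N g \<le> (1 + L / \<delta>) * L2_norm N u"
          unfolding L2_norm_scale by (simp add: distrib_right)
        then show ?thesis using False by (simp add: C_def u_def[symmetric] field_simps)
      qed
    qed
    then show ?thesis by blast
  qed
  ultimately show False using z unfolding L2_spectrum_def by blast
qed

subsection \<open>The functional calculus\<close>

lemma pow_L2: "h \<in> L2 N \<Longrightarrow> (A ^^ i) h \<in> L2 N"
  by (induction i) (auto intro: A_L2)

lemma pow_inner: "h \<in> L2 N \<Longrightarrow> L2_inner N ((A ^^ i) h) (y n) = complex_of_real (l n) ^ i * L2_inner N h (y n)"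
  by (induction i) (simp_all add: A_inner pow_L2 mult.assoc)

text \<open>The diagonal expansion can fail only for the power \<open>0\<close>, which is the
  identity on the complement of the span as well; \<open>0 ^ i\<close> singles out that
  case.\<close>

lemma pow_exp:
  assumes h: "h \<in> L2 N"
  shows "L2_tendsto N (\<lambda>K s. \<Sum>n<K. complex_of_real (l n) ^ i * L2_inner N h (y n) * y n s)
    (\<lambda>s. (A ^^ i) h s - 0 ^ i * (h s - proj h s))"
proof (cases i)
  case 0
  then show ?thesis using proj_tendsto[OF h] by simp
next
  case (Suc j)
  then show ?thesis using A_exp[OF pow_L2[OF h, of j]] by (simp add: pow_inner[OF h] mult.assoc)
qed

lemma poly_exp:
  assumes h: "h \<in> L2 N"
  shows "L2_tendsto N (\<lambda>K s. \<Sum>n<K. poly p (complex_of_real (l n)) * L2_inner N h (y n) * y n s)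
    (\<lambda>s. poly_op A p h s - poly p 0 * (h s - proj h s))"
proof -
  have t: "L2_tendsto N (\<lambda>K s. \<Sum>i\<le>degree p. coeff p i * (\<Sum>n<K. complex_of_real (l n) ^ i * L2_inner N h (y n) * y n s))
    (\<lambda>s. \<Sum>i\<le>degree p. coeff p i * ((A ^^ i) h s - 0 ^ i * (h s - proj h s)))"
    by (intro L2_tendsto_sum L2_tendsto_scale pow_exp h)
  have "(\<Sum>i\<le>degree p. coeff p i * (\<Sum>n<K. complex_of_real (l n) ^ i * L2_inner N h (y n) * y n s)) = 
     (\<Sum>n<K. poly p (complex_of_real (l n)) * L2_inner N h (y n) * y n s)" for K s
    unfolding poly_altdef sum_distrib_left sum_distrib_right by (subst sum.swap) (simp add: mult.assoc)
  moreover have "(\<Sum>i\<le>degree p. coeff p i * ((A ^^ i) h s - 0 ^ i * (h s - proj h s))) = 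
     poly_op A p h s - poly p 0 * (h s - proj h s)" for s
    unfolding poly_op_def poly_altdef sum_distrib_right sum_subtractf[symmetric]
    by (rule sum.cong) (auto simp: right_diff_distrib mult.assoc)
  ultimately show ?thesis using t by simp
qed

lemma poly_op_L2: "h \<in> L2 N \<Longrightarrow> poly_op A p h \<in> L2 N"
  unfolding poly_op_def[abs_def] by (intro L2_sum L2_scale pow_L2)

text \<open>On the span the polynomials act diagonally, with multipliers uniformly close to \<phi>.
  On the complement they act as their value at \<open>0\<close>; either the complement is null, or
  \<open>0\<close> is a point of the spectrum at which \<phi> vanishes, and then these values tend
  to zero.\<close>

lemma has_fun_calc_diag:
  assumes h: "h \<in> L2 N" and cont: "continuous_on {a..b} \<phi>"
    and ly: "\<And>n. L2_norm N (y n) \<noteq> 0 \<Longrightarrow> l n \<in> {a..b}"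
    and sp: "\<And>r. complex_of_real r \<in> L2_spectrum N A \<Longrightarrow> r \<in> {a..b}"
    and zero: "Fourier_sum N y h \<or> (0 \<in> L2_spectrum N A \<and> \<phi> 0 = 0)"
    and g: "L2_tendsto N (\<lambda>K s. \<Sum>n<K. \<phi> (l n) * L2_inner N h (y n) * y n s) g"
  shows "has_fun_calc N A \<phi> h g"
proof -
  have "\<exists>P :: complex poly. \<forall>r\<in>{a..b}. cmod (poly P (complex_of_real r) - \<phi> r) < inverse (real (Suc j))" for j
  proof -
    have "inverse (real (Suc j)) > 0" by simp
    then show ?thesis
    proof (rule Weierstrass_complex_poly[OF cont])
      fix P :: "complex poly" assume "\<And>r. r \<in> {a..b} \<Longrightarrow> cmod (poly P (complex_of_real r) - \<phi> r) < inverse (real (Suc j))"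
      then show ?thesis by (intro exI[of _ P] ballI)
    qed
  qed
  then obtain P :: "nat \<Rightarrow> complex poly" where P: "\<And>j r. r \<in> {a..b} \<Longrightarrow> cmod (poly (P j) (complex_of_real r) - \<phi> r) < inverse (real (Suc j))"
    by metis
  have "uniform_limit {r. complex_of_real r \<in> L2_spectrum N A} (\<lambda>j r. poly (P j) (complex_of_real r)) \<phi> sequentially"
  proof (rule uniform_limitI)
    fix e :: real assume "e > 0"
    then have "\<forall>\<^sub>F j in sequentially. inverse (real (Suc j)) < e"
      using LIMSEQ_inverse_real_of_nat order_tendstoD(2) by blast
    then show "\<forall>\<^sub>F j in sequentially. \<forall>r\<in>{r. complex_of_real r \<in> L2_spectrum N A}. dist (poly (P j) (complex_of_real r)) (\<phi> r) < e"
    proof eventually_elim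
      case (elim j)
      then show ?case using P[OF sp, of _ j] by (auto simp: dist_norm intro: less_trans)
    qed
  qed
  moreover have "L2_tendsto N (\<lambda>j. poly_op A (P j) h) g"
  proof -
    have gL: "g \<in> L2 N" by (rule L2_tendstoD(2)[OF g])
    define q where "q s = h s - proj h s" for s
    have q: "q \<in> L2 N" unfolding q_def by (intro L2_diff h proj_L2)
    have "L2_norm N (\<lambda>s. poly_op A (P j) h s - g s) \<le> inverse (real (Suc j)) * (L2_norm N h + L2_norm N q)" for j
    proof -
      have "L2_tendsto N (\<lambda>K s. (\<Sum>n<K. poly (P j) (complex_of_real (l n)) * L2_inner N h (y n) * y n s) - (\<Sum>n<K. \<phi> (l n) * L2_inner N h (y n) * y n s))
         (\<lambda>s. (poly_op A (P j) h s - poly (P j) 0 * (h s - proj h s)) - g s)"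
        by (intro L2_tendsto_diff poly_exp h g)
      then have t: "L2_tendsto N (\<lambda>K s. \<Sum>n<K. (poly (P j) (complex_of_real (l n)) - \<phi> (l n)) * L2_inner N h (y n) * y n s)
         (\<lambda>s. (poly_op A (P j) h s - poly (P j) 0 * q s) - g s)"
        by (simp add: left_diff_distrib sum_subtractf q_def)
      have 1: "L2_norm N (\<lambda>s. (poly_op A (P j) h s - poly (P j) 0 * q s) - g s) \<le> inverse (real (Suc j)) * L2_norm N h"
        by (rule diag_norm[OF h _ _ t]) (use P[OF ly] in \<open>auto intro: less_imp_le\<close>)
      have 2: "L2_norm N (\<lambda>s. poly (P j) 0 * q s) \<le> inverse (real (Suc j)) * L2_norm N q"
        using zero
      proof
        assume "Fourier_sum N y h"
        then have "AE s in N. q s = 0" using proj_complete[OF h] by (auto simp: q_def)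
        then have "L2_norm N q = 0" using L2_norm_eq_0_iff[OF q] by simp
        then show ?thesis by (simp add: L2_norm_scale)
      next
        assume z: "0 \<in> L2_spectrum N A \<and> \<phi> 0 = 0"
        then have "0 \<in> {a..b}" using sp[of 0] by simp
        then have "cmod (poly (P j) 0) \<le> inverse (real (Suc j))" using P[of 0 j] z by simp
        then show ?thesis unfolding L2_norm_scale by (rule mult_right_mono) simp
      qed
      have "(\<lambda>s. poly_op A (P j) h s - g s) = (\<lambda>s. ((poly_op A (P j) h s - poly (P j) 0 * q s) - g s) + poly (P j) 0 * q s)"
        by auto
      then have "L2_norm N (\<lambda>s. poly_op A (P j) h s - g s) \<le> 
        L2_norm N (\<lambda>s. (poly_op A (P j) h s - poly (P j) 0 * q s) - g s) + L2_norm N (\<lambda>s. poly (P j) 0 * q s)"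
        by (simp only:) (intro L2_norm_triangle L2_diff poly_op_L2 h L2_scale q gL)
      then show ?thesis using 1 2 by (simp add: distrib_left)
    qed
    moreover have "(\<lambda>j. inverse (real (Suc j)) * (L2_norm N h + L2_norm N q)) \<longlonglongrightarrow> 0"
      using tendsto_mult_left_zero[OF LIMSEQ_inverse_real_of_nat] by simp
    ultimately have "(\<lambda>j. L2_norm N (\<lambda>s. poly_op A (P j) h s - g s)) \<longlonglongrightarrow> 0"
      by (intro null_squeeze_nonneg[OF L2_norm_nonneg])
    then show ?thesis using gL poly_op_L2[OF h] by (simp add: L2_tendsto_def)
  qed
  ultimately show ?thesis unfolding has_fun_calc_def by blast
qed

subsection \<open>Spectral integrals\<close>

lemma filter_sum: "(\<Sum>n | n < K \<and> l n \<le> r. L2_inner N h (y n) * y n s) = 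
   (\<Sum>n<K. (if l n \<le> r then 1 else 0) * L2_inner N h (y n) * y n s)"
proof -
  have "{n. n < K \<and> l n \<le> r} = {n \<in> {..<K}. l n \<le> r}" by auto
  then show ?thesis by (simp add: sum.inter_filter[symmetric] if_distrib if_distribR cong: if_cong)
qed

lemma fibre_E_tendsto:
  assumes h: "h \<in> L2 N"
  shows "L2_tendsto N (\<lambda>K s. \<Sum>n<K. (if l n \<le> r then 1 else 0) * L2_inner N h (y n) * y n s) (fibre_E N l y r h)"
proof -
  have "\<exists>g. L2_tendsto N (\<lambda>K s. \<Sum>n<K. (if l n \<le> r then 1 else 0) * L2_inner N h (y n) * y n s) g"
    by (rule diag_limit[OF h, of "\<lambda>n. if l n \<le> r then 1 else 0" 1]) auto
  then show ?thesis unfolding fibre_E_def filter_sum by (rule someI_ex)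
qed

text \<open>The projections enter as arbitrary limits \<open>Ea\<close> and \<open>E i\<close>, so
  that the fibrewise sums and the sections of the global sums are treated alike.\<close>

lemma rs_sum_tendsto:
  assumes h: "h \<in> L2 N" and Ea: "L2_tendsto N (\<lambda>K s. \<Sum>m<K. (if l m \<le> a then 1 else 0) * L2_inner N h (y m) * y m s) Ea"
    and E: "\<And>i. i \<le> n \<Longrightarrow> L2_tendsto N (\<lambda>K s. \<Sum>m<K. (if l m \<le> d i then 1 else 0) * L2_inner N h (y m) * y m s) (E i)"
  shows "L2_tendsto N (\<lambda>K s. \<Sum>m<K. rs_coeff \<phi> a n d \<xi> (l m) * L2_inner N h (y m) * y m s)
    (\<lambda>s. \<phi> a * Ea s + (\<Sum>i<n. \<phi> (\<xi> i) * (E (Suc i) s - E i s)))"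
proof -
  let ?e = "\<lambda>r K s. \<Sum>m<K. (if l m \<le> r then 1 else 0) * L2_inner N h (y m) * y m s"
  have t: "L2_tendsto N (\<lambda>K s. \<phi> a * ?e a K s + (\<Sum>i<n. \<phi> (\<xi> i) * (?e (d (Suc i)) K s - ?e (d i) K s)))
    (\<lambda>s. \<phi> a * Ea s + (\<Sum>i<n. \<phi> (\<xi> i) * (E (Suc i) s - E i s)))"
    by (intro L2_tendsto_add L2_tendsto_sum L2_tendsto_scale L2_tendsto_diff Ea E) auto
  have "\<phi> a * ?e a K s + (\<Sum>i<n. \<phi> (\<xi> i) * (?e (d (Suc i)) K s - ?e (d i) K s)) = 
     (\<Sum>m<K. rs_coeff \<phi> a n d \<xi> (l m) * L2_inner N h (y m) * y m s)" for K s
    unfolding rs_coeff_def sum_subtractf[symmetric] sum_distrib_left distrib_right sum.distrib sum_distrib_right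
    by (subst sum.swap) (simp add: algebra_simps)
  then show ?thesis using t by simp
qed

lemma rs_sum_norm:
  assumes h: "h \<in> L2 N" and p: "rs_partition a b n d \<xi> \<delta>" "\<delta> > 0"
    and ly: "\<And>m. L2_norm N (y m) \<noteq> 0 \<Longrightarrow> l m \<in> {a..b}"
    and C: "\<And>m r. L2_norm N (y m) \<noteq> 0 \<Longrightarrow> r \<in> {a..b} \<Longrightarrow> cmod (\<phi> r) \<le> C" "C \<ge> 0"
    and R: "L2_tendsto N (\<lambda>K s. \<Sum>m<K. rs_coeff \<phi> a n d \<xi> (l m) * L2_inner N h (y m) * y m s) R"
  shows "L2_norm N R \<le> C * L2_norm N h"
proof (rule diag_norm[OF h _ C(2) R])
  fix m assume m: "L2_norm N (y m) \<noteq> 0"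
  then show "cmod (rs_coeff \<phi> a n d \<xi> (l m)) \<le> C"
    using rs_coeff_value[OF p(1) ly[OF m] p(2), of \<phi>] C(1)[OF m] by fastforce
qed

text \<open>Sum and integral are both diagonal, and their multipliers are values of \<phi> at points
  closer than the mesh.\<close>

lemma rs_sum_bounds:
  assumes h: "h \<in> L2 N" and p: "rs_partition a b n d \<xi> \<delta>" "\<delta> > 0"
    and ly: "\<And>m. L2_norm N (y m) \<noteq> 0 \<Longrightarrow> l m \<in> {a..b}"
    and g: "L2_tendsto N (\<lambda>K s. \<Sum>m<K. \<phi> (l m) * L2_inner N h (y m) * y m s) g"
    and R: "L2_tendsto N (\<lambda>K s. \<Sum>m<K. rs_coeff \<phi> a n d \<xi> (l m) * L2_inner N h (y m) * y m s) R"
    and C: "\<And>r r'. r \<in> {a..b} \<Longrightarrow> r' \<in> {a..b} \<Longrightarrow> \<bar>r - r'\<bar> < \<delta> \<Longrightarrow> cmod (\<phi> r - \<phi> r') \<le> C" "C \<ge> 0"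
  shows "L2_norm N (\<lambda>s. R s - g s) \<le> C * L2_norm N h"
proof (rule diag_norm[OF h])
  show "L2_tendsto N (\<lambda>K s. \<Sum>m<K. (rs_coeff \<phi> a n d \<xi> (l m) - \<phi> (l m)) * L2_inner N h (y m) * y m s) (\<lambda>s. R s - g s)"
    using L2_tendsto_diff[OF R g] by (simp add: left_diff_distrib sum_subtractf)
  fix m assume "L2_norm N (y m) \<noteq> 0"
  then have "l m \<in> {a..b}" by (rule ly)
  then show "cmod (rs_coeff \<phi> a n d \<xi> (l m) - \<phi> (l m)) \<le> C"
    using rs_coeff_value[OF p(1) _ p(2), of "l m" \<phi>] C(1) by fastforce
qed (rule C)

lemma rs_sums_converge:
  assumes h: "h \<in> L2 N" and cont: "continuous_on {a..b} \<phi>"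
    and ly: "\<And>n. L2_norm N (y n) \<noteq> 0 \<Longrightarrow> l n \<in> {a..b}"
    and g: "L2_tendsto N (\<lambda>K s. \<Sum>n<K. \<phi> (l n) * L2_inner N h (y n) * y n s) g"
    and p: "\<And>j::nat. rs_partition a b (n j) (d j) (\<xi> j) (inverse (real (Suc j)))"
    and R: "\<And>j. L2_tendsto N (\<lambda>K s. \<Sum>m<K. rs_coeff \<phi> a (n j) (d j) (\<xi> j) (l m) * L2_inner N h (y m) * y m s) (R j)"
  shows "L2_tendsto N R g"
proof -
  have "(\<lambda>j. L2_norm N (\<lambda>s. R j s - g s)) \<longlonglongrightarrow> 0"
  proof (rule LIMSEQ_I)
    fix \<eta> :: real assume \<eta>: "\<eta> > 0"
    \<comment> \<open>The added \<open>1\<close> keeps the divisor positive and the final estimate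
      strict.\<close>
    define \<eta>' where "\<eta>' = \<eta> / (L2_norm N h + 1)"
    have pos: "L2_norm N h + 1 > 0" by (simp add: add_nonneg_pos)
    have \<eta>': "\<eta>' > 0" using \<eta> pos by (simp add: \<eta>'_def)
    have "uniformly_continuous_on {a..b} \<phi>" by (rule compact_uniformly_continuous[OF cont compact_Icc])
    then obtain \<delta> where \<delta>: "\<delta> > 0" "\<And>r r'. r \<in> {a..b} \<Longrightarrow> r' \<in> {a..b} \<Longrightarrow> \<bar>r - r'\<bar> < \<delta> \<Longrightarrow> cmod (\<phi> r - \<phi> r') < \<eta>'"
      unfolding uniformly_continuous_on_def using \<eta>' by (metis dist_norm dist_real_def)
    obtain J where J: "\<And>j. j \<ge> J \<Longrightarrow> inverse (real (Suc j)) < \<delta>"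
      using LIMSEQ_D[OF LIMSEQ_inverse_real_of_nat \<delta>(1)] by auto
    have "norm (L2_norm N (\<lambda>s. R j s - g s) - 0) < \<eta>" if "j \<ge> J" for j
    proof -
      have "L2_norm N (\<lambda>s. R j s - g s) \<le> \<eta>' * L2_norm N h"
        by (rule rs_sum_bounds[OF h p[of j] _ ly g R[of j]]) (use \<delta>(2) \<eta>' J[OF that] in \<open>auto intro: less_imp_le less_trans\<close>)
      also have "\<dots> < \<eta>' * (L2_norm N h + 1)" using \<eta>' by simp
      also have "\<dots> = \<eta>" using pos by (simp add: \<eta>'_def)
      finally show ?thesis by simp
    qed
    then show "\<exists>no. \<forall>n\<ge>no. norm (L2_norm N (\<lambda>s. R n s - g s) - 0) < \<eta>" by blast
  qed
  then show ?thesis using L2_tendstoD(2)[OF R] L2_tendstoD(2)[OF g] by (simp add: L2_tendsto_def)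
qed

lemma has_fibre_integral_diag:
  assumes h: "h \<in> L2 N" and cont: "continuous_on {a..b} \<phi>"
    and ly: "\<And>n. L2_norm N (y n) \<noteq> 0 \<Longrightarrow> l n \<in> {a..b}"
    and g: "L2_tendsto N (\<lambda>K s. \<Sum>n<K. \<phi> (l n) * L2_inner N h (y n) * y n s) g"
  shows "has_fibre_integral N l y \<phi> a b h g"
  unfolding has_fibre_integral_def
proof (intro conjI allI impI)
  show "g \<in> L2 N" by (rule L2_tendstoD(2)[OF g])
  fix \<eta> :: real assume \<eta>: "\<eta> > 0"
  define \<eta>' where "\<eta>' = \<eta> / (L2_norm N h + 1)"
  have pos: "L2_norm N h + 1 > 0" by (simp add: add_nonneg_pos)
  have \<eta>': "\<eta>' > 0" using \<eta> pos by (simp add: \<eta>'_def)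
  have "uniformly_continuous_on {a..b} \<phi>" by (rule compact_uniformly_continuous[OF cont compact_Icc])
  then obtain \<delta> where \<delta>: "\<delta> > 0" "\<And>r r'. r \<in> {a..b} \<Longrightarrow> r' \<in> {a..b} \<Longrightarrow> \<bar>r - r'\<bar> < \<delta> \<Longrightarrow> cmod (\<phi> r - \<phi> r') < \<eta>'"
    unfolding uniformly_continuous_on_def using \<eta>' by (metis dist_norm dist_real_def)
  have "fibre_rs_sum N l y \<phi> a n d \<xi> h \<in> L2 N \<and> L2_norm N (\<lambda>s. fibre_rs_sum N l y \<phi> a n d \<xi> h s - g s) < \<eta>"
    if p: "rs_partition a b n d \<xi> \<delta>" for n d \<xi>
  proof -
    have R: "L2_tendsto N (\<lambda>K s. \<Sum>m<K. rs_coeff \<phi> a n d \<xi> (l m) * L2_inner N h (y m) * y m s) (fibre_rs_sum N l y \<phi> a n d \<xi> h)"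
      unfolding fibre_rs_sum_def[abs_def] by (rule rs_sum_tendsto[where E = "\<lambda>i. fibre_E N l y (d i) h" and d = d, OF h]) (rule fibre_E_tendsto[OF h])+
    have "L2_norm N (\<lambda>s. fibre_rs_sum N l y \<phi> a n d \<xi> h s - g s) \<le> \<eta>' * L2_norm N h"
      by (rule rs_sum_bounds[OF h p \<delta>(1) ly g R]) (use \<delta>(2) \<eta>' in \<open>auto intro: less_imp_le\<close>)
    also have "\<dots> < \<eta>' * (L2_norm N h + 1)" using \<eta>' by simp
    also have "\<dots> = \<eta>" using pos by (simp add: \<eta>'_def)
    finally show ?thesis using L2_tendstoD(2)[OF R] by simp
  qed
  then show "\<exists>\<delta>>0. \<forall>n d \<xi>. rs_partition a b n d \<xi> \<delta> \<longrightarrow> fibre_rs_sum N l y \<phi> a n d \<xi> h \<in> L2 N \<and>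
        L2_norm N (\<lambda>s. fibre_rs_sum N l y \<phi> a n d \<xi> h s - g s) < \<eta>" using \<delta>(1) by blast
qed

text \<open>Both inner products are limits of the same sums up to conjugation, as the multipliers
  are real.\<close>

lemma diag_selfadj:
  assumes f: "f \<in> L2 N" and g: "g \<in> L2 N"
    and F: "L2_tendsto N (\<lambda>K s. \<Sum>n<K. complex_of_real (a n) * L2_inner N f (y n) * y n s) F"
    and G: "L2_tendsto N (\<lambda>K s. \<Sum>n<K. complex_of_real (a n) * L2_inner N g (y n) * y n s) G"
  shows "L2_inner N F g = L2_inner N f G"
proof -
  have eq: "L2_inner N (\<lambda>s. \<Sum>n<K. complex_of_real (a n) * L2_inner N u (y n) * y n s) v = 
     (\<Sum>n<K. complex_of_real (a n) * L2_inner N u (y n) * cnj (L2_inner N v (y n)))" if "v \<in> L2 N" for u v K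
    by (subst L2_inner_sum_left) (auto intro!: L2_scale y_L2 that simp: L2_inner_scale_left simp flip: L2_inner_cnj)
  have "(\<lambda>K. \<Sum>n<K. complex_of_real (a n) * L2_inner N f (y n) * cnj (L2_inner N g (y n))) \<longlonglongrightarrow> L2_inner N F g"
    using L2_tendsto_inner[OF F g] unfolding eq[OF g] .
  moreover have "(\<lambda>K. \<Sum>n<K. complex_of_real (a n) * L2_inner N g (y n) * cnj (L2_inner N f (y n))) \<longlonglongrightarrow> L2_inner N G f"
    using L2_tendsto_inner[OF G f] unfolding eq[OF f] .
  from tendsto_cnj[OF this] have "(\<lambda>K. \<Sum>n<K. complex_of_real (a n) * L2_inner N f (y n) * cnj (L2_inner N g (y n))) \<longlonglongrightarrow> L2_inner N f G"
    by (simp add: mult_ac flip: L2_inner_cnj)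
  ultimately show ?thesis by (rule LIMSEQ_unique)
qed

lemma diag_idem:
  assumes f: "f \<in> L2 N" and F: "L2_tendsto N (\<lambda>K s. \<Sum>n<K. (if P n then 1 else 0) * L2_inner N f (y n) * y n s) F"
    and G: "L2_tendsto N (\<lambda>K s. \<Sum>n<K. (if P n then 1 else 0) * L2_inner N F (y n) * y n s) G"
  shows "AE s in N. G s = F s"
proof (rule L2_tendsto_unique)
  have "(if P n then 1 else 0) * L2_inner N F (y n) = (if P n then 1 else 0) * L2_inner N f (y n)" for n
    using diag_inner[OF f F, of n] by simp
  then show "L2_tendsto N (\<lambda>K s. \<Sum>n<K. (if P n then 1 else 0) * L2_inner N f (y n) * y n s) G"
    using G by (simp only:)
qed (rule F)

subsection \<open>The numerical range\<close>

text \<open>The form is the sum of the \<open>l n\<close> weighted by the squared coefficients of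
  \<open>x\<close>; the factor \<sigma>, used with values \<open>1\<close> and \<open>-1\<close>,
  gives lower and upper bounds at once. In a complete system the weights add up to \<open>1\<close>.
  Otherwise all vectors are unit vectors, \<open>i \<le> 0\<close> follows from the convergence of
  the eigenvalues to \<open>0\<close>, and missing weight only helps.\<close>

lemma quadratic_form_ge:
  assumes x: "x \<in> L2 N" "L2_norm N x = 1" and i: "\<And>n. L2_norm N (y n) \<noteq> 0 \<Longrightarrow> i \<le> \<sigma> * l n"
    and complete: "Fourier_sum N y x \<or> (\<forall>n. L2_norm N (y n) = 1)"
  shows "i \<le> \<sigma> * Re (L2_inner N (A x) x)"
proof -
  define S where "S K = (\<Sum>n<K. (cmod (L2_inner N x (y n)))\<^sup>2)" for K :: nat
  have "L2_inner N (\<lambda>s. \<Sum>n<K. complex_of_real (l n) * L2_inner N x (y n) * y n s) x =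
     complex_of_real (\<Sum>n<K. l n * (cmod (L2_inner N x (y n)))\<^sup>2)" for K
  proof -
    have "L2_inner N (\<lambda>s. \<Sum>n<K. complex_of_real (l n) * L2_inner N x (y n) * y n s) x =
      (\<Sum>n<K. L2_inner N (\<lambda>s. complex_of_real (l n) * L2_inner N x (y n) * y n s) x)"
      by (rule L2_inner_sum_left) (auto intro!: L2_scale y_L2 x)
    also have "\<dots> = (\<Sum>n<K. complex_of_real (l n * (cmod (L2_inner N x (y n)))\<^sup>2))"
    proof (rule sum.cong)
      fix n
      show "L2_inner N (\<lambda>s. complex_of_real (l n) * L2_inner N x (y n) * y n s) x = complex_of_real (l n * (cmod (L2_inner N x (y n)))\<^sup>2)"
        unfolding L2_inner_scale_left L2_inner_cnj[of N "y n" x] of_real_mult complex_norm_square by simp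
    qed simp
    finally show ?thesis by simp
  qed
  then have "(\<lambda>K. complex_of_real (\<Sum>n<K. l n * (cmod (L2_inner N x (y n)))\<^sup>2)) \<longlonglongrightarrow> L2_inner N (A x) x"
    using L2_tendsto_inner[OF A_exp[OF x(1)] x(1)] by simp
  from tendsto_mult_left[OF tendsto_Re[OF this], of \<sigma>]
  have lim: "(\<lambda>K. \<sigma> * (\<Sum>n<K. l n * (cmod (L2_inner N x (y n)))\<^sup>2)) \<longlonglongrightarrow> \<sigma> * Re (L2_inner N (A x) x)" by simp
  have ge: "i * S K \<le> \<sigma> * (\<Sum>n<K. l n * (cmod (L2_inner N x (y n)))\<^sup>2)" for K
    unfolding S_def sum_distrib_left
  proof (rule sum_mono)
    fix n
    show "i * (cmod (L2_inner N x (y n)))\<^sup>2 \<le> \<sigma> * (l n * (cmod (L2_inner N x (y n)))\<^sup>2)"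
    proof (cases "L2_norm N (y n) = 0")
      case True
      then show ?thesis using inner_y_zero[OF True x(1)] by simp
    next
      case False
      show ?thesis unfolding mult.assoc[symmetric] by (rule mult_right_mono[OF i[OF False]]) simp
    qed
  qed
  show ?thesis using complete
  proof
    assume "Fourier_sum N y x"
    then have "L2_tendsto N (\<lambda>K s. \<Sum>i<K. L2_inner N x (y i) * y i s) x" by (simp add: Fourier_sum_def)
    from tendsto_power[OF L2_tendsto_norm[OF this], of 2]
    have "(\<lambda>K. (L2_norm N (\<lambda>s. \<Sum>i<K. L2_inner N x (y i) * y i s))\<^sup>2) \<longlonglongrightarrow> 1" by (simp add: x(2))
    moreover have "(cmod (L2_inner N x (y n)))\<^sup>2 * (L2_norm N (y n))\<^sup>2 = (cmod (L2_inner N x (y n)))\<^sup>2" for n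
      using norm_y[of n] inner_y_zero[OF _ x(1), of n] by auto
    then have "(L2_norm N (\<lambda>s. \<Sum>i<K. L2_inner N x (y i) * y i s))\<^sup>2 = S K" for K
      by (simp only: norm_comb[OF finite_lessThan] S_def)
    ultimately have "(\<lambda>K. i * S K) \<longlonglongrightarrow> i * 1" by (intro tendsto_mult tendsto_const) simp
    then show ?thesis using LIMSEQ_le[OF _ lim] ge by fastforce
  next
    assume u: "\<forall>n. L2_norm N (y n) = 1"
    have "(\<lambda>n. \<sigma> * l n) \<longlonglongrightarrow> \<sigma> * 0" by (intro tendsto_mult tendsto_const l_lim)
    then have "i \<le> \<sigma> * 0" by (rule LIMSEQ_le_const) (use i u in auto)
    then have iS: "i * 1 \<le> i * S K" for K
      using Bessel[OF _ x(1), of "{..<K}"] x(2) by (intro mult_left_mono_neg) (auto simp: S_def)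
    have "i \<le> \<sigma> * (\<Sum>n<K. l n * (cmod (L2_inner N x (y n)))\<^sup>2)" for K using ge[of K] iS[of K] by linarith
    then show ?thesis by (intro LIMSEQ_le_const[OF lim]) auto
  qed
qed

subsection \<open>Eigenspaces\<close>

text \<open>Comparison of coefficients leaves only the vectors with \<open>l n = r\<close>. If
  \<open>r\<close> is not \<open>0\<close>, the expansion of \<open>A f\<close>, divided by
  \<open>r\<close>, shows that \<open>f\<close> lies in the closed span; for \<open>r = 0\<close>
  this has to be assumed.\<close>

lemma eigenspace_expansion:
  assumes f: "f \<in> L2 N" "AE s in N. complex_of_real r * f s - A f s = 0" and r: "r \<noteq> 0 \<or> Fourier_sum N y f"
    and j: "\<And>n. n \<ge> j \<Longrightarrow> \<not> (L2_norm N (y n) \<noteq> 0 \<and> l n = r)"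
  shows "AE s in N. f s = (\<Sum>n<j. L2_inner N f (y n) * (if L2_norm N (y n) \<noteq> 0 \<and> l n = r then y n s else 0))"
proof -
  have "complex_of_real r * L2_inner N f (y n) = complex_of_real (l n) * L2_inner N f (y n)" for n
  proof -
    have "complex_of_real r * L2_inner N f (y n) = L2_inner N (\<lambda>s. complex_of_real r * f s) (y n)" by (simp add: L2_inner_scale_left)
    also have "\<dots> = L2_inner N (A f) (y n)"
      by (rule L2_inner_cong_AE) (use f in \<open>auto intro!: L2_measurable L2_scale A_L2 y_L2\<close>)
    finally show ?thesis by (simp add: A_inner[OF f(1)])
  qed
  then have eq: "L2_inner N f (y n) = 0 \<or> l n = r" for n
    by (metis mult_right_cancel of_real_eq_iff)
  then have z: "L2_inner N f (y n) = 0" if "\<not> (L2_norm N (y n) \<noteq> 0 \<and> l n = r)" for n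
    using that inner_y_zero[OF _ f(1), of n] by auto
  have t: "L2_tendsto N (\<lambda>K s. \<Sum>n<K. L2_inner N f (y n) * y n s) f"
  proof (cases "r = 0")
    case True
    then show ?thesis using r by (simp add: Fourier_sum_def)
  next
    case False
    have "L2_tendsto N (\<lambda>K s. 1 / complex_of_real r * (\<Sum>n<K. complex_of_real (l n) * L2_inner N f (y n) * y n s)) (\<lambda>s. 1 / complex_of_real r * A f s)"
      by (intro L2_tendsto_scale A_exp f)
    moreover have "1 / complex_of_real r * (\<Sum>n<K. complex_of_real (l n) * L2_inner N f (y n) * y n s) = (\<Sum>n<K. L2_inner N f (y n) * y n s)" for K s
      unfolding sum_distrib_left
    proof (rule sum.cong)
      fix n
      show "1 / complex_of_real r * (complex_of_real (l n) * L2_inner N f (y n) * y n s) = L2_inner N f (y n) * y n s"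
        using eq[of n] False by auto
    qed simp
    ultimately have "L2_tendsto N (\<lambda>K s. \<Sum>n<K. L2_inner N f (y n) * y n s) (\<lambda>s. 1 / complex_of_real r * A f s)" by simp
    then show ?thesis
    proof (rule L2_tendsto_cong_AE)
      show "f \<in> borel_measurable N" using f by auto
      show "AE s in N. 1 / complex_of_real r * A f s = f s"
        using f(2) by eventually_elim (use False in \<open>simp add: field_simps\<close>)
    qed
  qed
  have const: "(\<Sum>n<K. L2_inner N f (y n) * y n s) = (\<Sum>n<j. L2_inner N f (y n) * (if L2_norm N (y n) \<noteq> 0 \<and> l n = r then y n s else 0))" if "K \<ge> j" for K s
  proof -
    have "(\<Sum>n<K. L2_inner N f (y n) * y n s) = (\<Sum>n<j. L2_inner N f (y n) * y n s)"
      by (rule sum.mono_neutral_right) (use that j z in auto)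
    also have "\<dots> = (\<Sum>n<j. L2_inner N f (y n) * (if L2_norm N (y n) \<noteq> 0 \<and> l n = r then y n s else 0))"
      by (rule sum.cong) (use z in auto)
    finally show ?thesis .
  qed
  have "L2_tendsto N (\<lambda>K s. \<Sum>n<K + j. L2_inner N f (y n) * y n s) f"
    by (rule L2_tendsto_subseq[OF t]) (rule filterlim_add_const_nat_at_top)
  then have "L2_tendsto N (\<lambda>K s. \<Sum>n<j. L2_inner N f (y n) * (if L2_norm N (y n) \<noteq> 0 \<and> l n = r then y n s else 0)) f"
    by (simp add: const)
  then show ?thesis
  proof (rule L2_tendsto_unique, intro L2_tendsto_const L2_sum L2_scale)
    show "(\<lambda>s. if L2_norm N (y n) \<noteq> 0 \<and> l n = r then y n s else 0) \<in> L2 N" for n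
      by (cases "L2_norm N (y n) \<noteq> 0 \<and> l n = r") (auto simp: y_L2)
  qed
qed

lemma eigenspace_finite:
  assumes "L2_fin_dim N {g \<in> L2 N. AE t in N. complex_of_real r * g t - A g t = 0}"
  shows "finite {n. L2_norm N (y n) \<noteq> 0 \<and> l n = r}"
proof -
  obtain m b where b: "\<And>i. i < m \<Longrightarrow> b i \<in> {g \<in> L2 N. AE t in N. complex_of_real r * g t - A g t = 0}"
    "\<And>g. g \<in> {g \<in> L2 N. AE t in N. complex_of_real r * g t - A g t = 0} \<Longrightarrow> \<exists>c. AE s in N. g s = (\<Sum>i<m::nat. c i * b i s)"
    using assms unfolding L2_fin_dim_def by blast
  have "card F \<le> m" if F: "finite F" "F \<subseteq> {n. L2_norm N (y n) \<noteq> 0 \<and> l n = r}" for F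
  proof (rule fin_dim_card_le[OF finite_N ons_axioms F(1)])
    show "L2_norm N (y n) = 1" if "n \<in> F" for n using that F(2) norm_y[of n] by auto
    show "b i \<in> L2 N" if "i < m" for i using b(1)[OF that] by simp
    fix n assume "n \<in> F"
    then have "l n = r" using F(2) by auto
    then have "AE t in N. complex_of_real r * y n t - A (y n) t = 0" using A_y[of n] by auto
    then show "\<exists>c. AE s in N. y n s = (\<Sum>i<m. c i * b i s)" using b(2) y_L2[of n] by blast
  qed
  then show ?thesis by (meson finite_if_finite_subsets_card_bdd)
qed

lemma A_proj_compl: assumes h: "h \<in> L2 N" shows "AE s in N. A (\<lambda>s. h s - proj h s) s = 0"
proof -
  have q: "(\<lambda>s. h s - proj h s) \<in> L2 N" by (intro L2_diff h proj_L2)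
  have "L2_inner N (\<lambda>s. h s - proj h s) (y n) = 0" for n
    by (simp add: L2_inner_diff_left h proj_L2 y_L2 proj_inner)
  then have "L2_tendsto N (\<lambda>K s. 0) (A (\<lambda>s. h s - proj h s))" using A_exp[OF q] by simp
  then show ?thesis by (rule L2_tendsto_unique) (simp add: L2_tendsto_const)
qed

text \<open>The complement of the span of \<open>y\<close> is contained in the kernel. If the latter
  is spanned by finitely many \<open>b i\<close>, then these together with the sequence
  \<open>y\<close> span a dense subspace, and countably many combinations suffice.\<close>

lemma kernel_fin_dim_separable:
  assumes "L2_fin_dim N {g \<in> L2 N. AE t in N. complex_of_real 0 * g t - A g t = 0}"
  shows "L2_separable N"
proof -
  obtain m b where b: "\<And>i. i < m \<Longrightarrow> b i \<in> {g \<in> L2 N. AE t in N. complex_of_real 0 * g t - A g t = 0}"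
    "\<And>g. g \<in> {g \<in> L2 N. AE t in N. complex_of_real 0 * g t - A g t = 0} \<Longrightarrow> \<exists>c. AE s in N. g s = (\<Sum>i<m::nat. c i * b i s)"
    using assms unfolding L2_fin_dim_def by blast
  define f where "f i = (if i < m then b i else y (i - m))" for i
  have f: "f i \<in> L2 N" for i using b(1)[of i] y_L2 by (auto simp: f_def)
  show ?thesis
  proof (rule countable_dense_combinations[OF f])
    fix d :: "nat \<Rightarrow> 'b \<Rightarrow> complex" 
    assume d: "\<And>n. d n \<in> L2 N" "\<And>K c e. e > 0 \<Longrightarrow> \<exists>n. L2_norm N (\<lambda>s. (\<Sum>i<K::nat. c i * f i s) - d n s) < e"
    have "\<exists>n. L2_norm N (\<lambda>s. h s - d n s) < e" if h: "h \<in> L2 N" and e: "e > 0" for h e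
    proof -
      have q: "(\<lambda>s. h s - proj h s) \<in> L2 N" by (intro L2_diff h proj_L2)
      have "(\<lambda>s. h s - proj h s) \<in> {g \<in> L2 N. AE t in N. complex_of_real 0 * g t - A g t = 0}"
        using q A_proj_compl[OF h] by simp
      from b(2)[OF this] obtain c where c: "AE s in N. h s - proj h s = (\<Sum>i<m. c i * b i s)" by blast
      obtain K where K: "L2_norm N (\<lambda>s. (\<Sum>n<K. 1 * L2_inner N h (y n) * y n s) - proj h s) < e / 2"
        using LIMSEQ_D[OF L2_tendstoD(3)[OF proj_tendsto[OF h]], of "e/2"] e by auto
      define c' where "c' i = (if i < m then c i else L2_inner N h (y (i - m)))" for i
      have sumeq: "(\<Sum>i<m + K. c' i * f i s) = (\<Sum>i<m. c i * b i s) + (\<Sum>n<K. 1 * L2_inner N h (y n) * y n s)" for s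
      proof -
        have "(\<Sum>i<m + K. c' i * f i s) = (\<Sum>i<m. c' i * f i s) + (\<Sum>i=m..<m + K. c' i * f i s)"
          by (simp add: lessThan_atLeast0 sum.atLeastLessThan_concat)
        also have "(\<Sum>i=m..<m + K. c' i * f i s) = (\<Sum>n<K. c' (n + m) * f (n + m) s)"
          using sum.shift_bounds_nat_ivl[of "\<lambda>i. c' i * f i s" 0 m K] by (simp add: lessThan_atLeast0 add.commute)
        finally show ?thesis by (simp add: c'_def f_def)
      qed
      obtain n where n: "L2_norm N (\<lambda>s. (\<Sum>i<m + K. c' i * f i s) - d n s) < e / 2" using d(2)[of "e/2"] e by auto
      have SL: "(\<lambda>s. \<Sum>i<m + K. c' i * f i s) \<in> L2 N" by (intro L2_sum L2_scale f)
      have "L2_norm N (\<lambda>s. h s - (\<Sum>i<m + K. c' i * f i s)) = L2_norm N (\<lambda>s. proj h s - (\<Sum>n<K. 1 * L2_inner N h (y n) * y n s))"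
      proof (rule L2_norm_cong_AE)
        show "AE s in N. h s - (\<Sum>i<m + K. c' i * f i s) = proj h s - (\<Sum>n<K. 1 * L2_inner N h (y n) * y n s)"
          using c
        proof eventually_elim
          case (elim s)
          then show ?case unfolding sumeq by (simp add: diff_eq_eq algebra_simps)
        qed
      qed (intro L2_measurable L2_diff h SL proj_L2 comb_L2)+
      then have "L2_norm N (\<lambda>s. h s - (\<Sum>i<m + K. c' i * f i s)) < e / 2"
        using K by (simp add: L2_norm_minus_commute[of N "proj h"])
      then show ?thesis using n L2_norm_triangle3[OF h SL d(1)[of n]] by (intro exI[of _ n]) linarith
    qed
    with d(1) have "(\<forall>n. d n \<in> L2 N) \<and> (\<forall>h\<in>L2 N. \<forall>\<eta>>0. \<exists>n. L2_norm N (\<lambda>s. h s - d n s) < \<eta>)" by simp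
    then show ?thesis unfolding L2_separable_def by (rule exI[of _ d])
  qed
qed

end

section \<open>The space \<open>L22\<close>\<close>

text \<open>Used for the lower end point of a spectral integral, which is known only to agree almost
  everywhere with the measurable first point of a partition.\<close>

lemma (in complete_measure) borel_measurable_AE_eq:
  assumes "g \<in> borel_measurable M" "AE x in M. f x = g x" shows "f \<in> borel_measurable M"
proof (rule measurableI)
  fix S :: "'b set" assume S: "S \<in> sets borel"
  show "f -` S \<inter> space M \<in> sets M"
  proof (rule in_sets_AE)
    show "g -` S \<inter> space M \<in> sets M" using assms(1) S by (rule measurable_sets)
    show "AE x in M. (x \<in> g -` S \<inter> space M) = (x \<in> f -` S \<inter> space M)" using assms(2) by eventually_elim auto
  qed auto
qed simp

lemma norm22_eq: "norm22 M N f = sqrt (\<integral>\<omega>. (fun_norm N f \<omega>)\<^sup>2 \<partial>M)"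
  by (simp add: norm22_def fun_norm_def L2_norm_sq curry_def)

locale two_measures =
  fixes M :: "'a measure" and N :: "'b measure"
  assumes finite_M: "finite_measure M" and finite_N: "finite_measure N"
begin

sublocale M: finite_measure M by (rule finite_M)
sublocale N: finite_measure N by (rule finite_N)
sublocale MN: pair_sigma_finite M N ..

lemma L22_measurable: "f \<in> L22 M N \<Longrightarrow> f \<in> borel_measurable (M \<Otimes>\<^sub>M N)"
  and L22_sections: "f \<in> L22 M N \<Longrightarrow> AE \<omega> in M. curry f \<omega> \<in> L2 N"
  and L22_integrable: "f \<in> L22 M N \<Longrightarrow> integrable M (\<lambda>\<omega>. (fun_norm N f \<omega>)\<^sup>2)"
  by (auto simp: L22_def)

lemma fun_norm_meas: "f \<in> borel_measurable (M \<Otimes>\<^sub>M N) \<Longrightarrow> fun_norm N f \<in> borel_measurable M"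
  by (rule fun_norm_measurable[OF finite_N])

lemma fun_norm_nonneg[simp]: "fun_norm N f \<omega> \<ge> 0" by (simp add: fun_norm_def)

lemma L22_dominated:
  assumes G: "G \<in> borel_measurable (M \<Otimes>\<^sub>M N)" "AE \<omega> in M. curry G \<omega> \<in> L2 N" and f: "f \<in> L22 M N"
    and le: "AE \<omega> in M. fun_norm N G \<omega> \<le> C * fun_norm N f \<omega>"
  shows "G \<in> L22 M N"
proof -
  have "integrable M (\<lambda>\<omega>. (fun_norm N G \<omega>)\<^sup>2)"
  proof (rule Bochner_Integration.integrable_bound)
    show "integrable M (\<lambda>\<omega>. C\<^sup>2 * (fun_norm N f \<omega>)\<^sup>2)" using L22_integrable[OF f] by simp
    show "(\<lambda>\<omega>. (fun_norm N G \<omega>)\<^sup>2) \<in> borel_measurable M" using fun_norm_meas[OF G(1)] by measurable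
    show "AE \<omega> in M. norm ((fun_norm N G \<omega>)\<^sup>2) \<le> norm (C\<^sup>2 * (fun_norm N f \<omega>)\<^sup>2)"
      using le
    proof eventually_elim
      case (elim \<omega>)
      then have "(fun_norm N G \<omega>)\<^sup>2 \<le> (C * fun_norm N f \<omega>)\<^sup>2" by (intro power_mono) auto
      then show ?case by (simp add: power_mult_distrib)
    qed
  qed
  then show ?thesis using G by (simp add: L22_def)
qed

lemma curry_diff: "curry (\<lambda>z. f z - g z) \<omega> = (\<lambda>s. curry f \<omega> s - curry g \<omega> s)"
  and curry_add: "curry (\<lambda>z. f z + g z) \<omega> = (\<lambda>s. curry f \<omega> s + curry g \<omega> s)"
  for f g :: "'a \<times> 'b \<Rightarrow> complex"
  by (simp_all add: curry_def)

lemma L22_add: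
  assumes "f \<in> L22 M N" "g \<in> L22 M N" shows "(\<lambda>z. f z + g z) \<in> L22 M N"
proof -
  note [measurable] = L22_measurable[OF assms(1)] L22_measurable[OF assms(2)]
  have m: "(\<lambda>z. f z + g z) \<in> borel_measurable (M \<Otimes>\<^sub>M N)" by measurable
  have "integrable M (\<lambda>\<omega>. (fun_norm N (\<lambda>z. f z + g z) \<omega>)\<^sup>2)"
  proof (rule Bochner_Integration.integrable_bound)
    show "integrable M (\<lambda>\<omega>. 2 * (fun_norm N f \<omega>)\<^sup>2 + 2 * (fun_norm N g \<omega>)\<^sup>2)"
      using L22_integrable[OF assms(1)] L22_integrable[OF assms(2)] by simp
    show "(\<lambda>\<omega>. (fun_norm N (\<lambda>z. f z + g z) \<omega>)\<^sup>2) \<in> borel_measurable M" using fun_norm_meas[OF m] by measurable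
    show "AE \<omega> in M. norm ((fun_norm N (\<lambda>z. f z + g z) \<omega>)\<^sup>2) \<le> norm (2 * (fun_norm N f \<omega>)\<^sup>2 + 2 * (fun_norm N g \<omega>)\<^sup>2)"
      using L22_sections[OF assms(1)] L22_sections[OF assms(2)]
    proof eventually_elim
      case (elim \<omega>)
      have "(fun_norm N (\<lambda>z. f z + g z) \<omega>)\<^sup>2 \<le> (fun_norm N f \<omega> + fun_norm N g \<omega>)\<^sup>2"
        using L2_norm_triangle[OF elim] by (intro power_mono) (simp_all add: fun_norm_def curry_add)
      also have "\<dots> \<le> 2 * (fun_norm N f \<omega>)\<^sup>2 + 2 * (fun_norm N g \<omega>)\<^sup>2"
        using sum_squares_bound[of "fun_norm N f \<omega>" "fun_norm N g \<omega>"] by (simp add: power2_sum)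
      finally show ?case by simp
    qed
  qed
  moreover have "AE \<omega> in M. curry (\<lambda>z. f z + g z) \<omega> \<in> L2 N"
    using L22_sections[OF assms(1)] L22_sections[OF assms(2)] by eventually_elim (simp add: curry_add L2_add)
  ultimately show ?thesis using m by (simp add: L22_def)
qed

lemma L22_diff:
  assumes "f \<in> L22 M N" "g \<in> L22 M N" shows "(\<lambda>z. f z - g z) \<in> L22 M N"
proof -
  have "(\<lambda>z. - g z) \<in> L22 M N"
  proof (rule L22_dominated[OF _ _ assms(2), of _ 1])
    show "(\<lambda>z. - g z) \<in> borel_measurable (M \<Otimes>\<^sub>M N)" using L22_measurable[OF assms(2)] by measurable
    have *: "curry (\<lambda>z. - g z) \<omega> = (\<lambda>s. - curry g \<omega> s)" for \<omega> by (simp add: curry_def)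
    show "AE \<omega> in M. curry (\<lambda>z. - g z) \<omega> \<in> L2 N"
      using L22_sections[OF assms(2)] L2_scale[of _ N "-1"] by (auto simp: *)
    show "AE \<omega> in M. fun_norm N (\<lambda>z. - g z) \<omega> \<le> 1 * fun_norm N g \<omega>" by (simp add: fun_norm_def *)
  qed
  from L22_add[OF assms(1) this] show ?thesis by simp
qed

lemma L22_tendsto_dominated:
  assumes F: "\<And>K. F K \<in> borel_measurable (M \<Otimes>\<^sub>M N)" and G: "G \<in> borel_measurable (M \<Otimes>\<^sub>M N)" and f: "f \<in> L22 M N"
    and lim: "AE \<omega> in M. L2_tendsto N (\<lambda>K. curry (F K) \<omega>) (curry G \<omega>)"
    and le: "AE \<omega> in M. \<forall>K. fun_norm N (F K) \<omega> \<le> C * fun_norm N f \<omega>"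
  shows "L22_tendsto M N F G"
proof -
  have sF: "AE \<omega> in M. curry (F K) \<omega> \<in> L2 N" for K
    using lim by (rule eventually_mono) (simp add: L2_tendsto_def)
  have leF: "AE \<omega> in M. fun_norm N (F K) \<omega> \<le> C * fun_norm N f \<omega>" for K
    using le by (rule eventually_mono) simp
  have sG: "AE \<omega> in M. curry G \<omega> \<in> L2 N"
    using lim by (rule eventually_mono) (simp add: L2_tendsto_def)
  have F22: "F K \<in> L22 M N" for K
    by (rule L22_dominated[OF F sF f leF])
  have leG: "AE \<omega> in M. fun_norm N G \<omega> \<le> C * fun_norm N f \<omega>"
    using lim le
  proof eventually_elim
    case (elim \<omega>)
    show ?case unfolding fun_norm_def
      by (rule LIMSEQ_le_const2[OF L2_tendsto_norm[OF elim(1)]]) (use elim(2) in \<open>auto simp: fun_norm_def\<close>)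
  qed
  have G22: "G \<in> L22 M N" by (rule L22_dominated[OF G sG f leG])
  have "(\<lambda>K. \<integral>\<omega>. (fun_norm N (\<lambda>z. F K z - G z) \<omega>)\<^sup>2 \<partial>M) \<longlonglongrightarrow> (\<integral>\<omega>. 0 \<partial>M)"
  proof (rule integral_dominated_convergence)
    \<comment> \<open>Both sections have norm at most \<open>C\<close> times that of
      \<open>f\<close>, so their distance is at most twice that; \<open>4 * C\<^sup>2\<close> is the
      square.\<close>
    show "integrable M (\<lambda>\<omega>. 4 * C\<^sup>2 * (fun_norm N f \<omega>)\<^sup>2)" using L22_integrable[OF f] by simp
    show "(\<lambda>\<omega>. (fun_norm N (\<lambda>z. F K z - G z) \<omega>)\<^sup>2) \<in> borel_measurable M" for K
      using fun_norm_meas[OF borel_measurable_diff[OF F G], of K] by measurable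
    show "AE \<omega> in M. (\<lambda>K. (fun_norm N (\<lambda>z. F K z - G z) \<omega>)\<^sup>2) \<longlonglongrightarrow> 0"
      using lim
    proof eventually_elim
      case (elim \<omega>)
      from tendsto_power[OF L2_tendstoD(3)[OF elim], of 2] show ?case by (simp add: fun_norm_def curry_diff)
    qed
    show "AE \<omega> in M. norm ((fun_norm N (\<lambda>z. F K z - G z) \<omega>)\<^sup>2) \<le> 4 * C\<^sup>2 * (fun_norm N f \<omega>)\<^sup>2" for K
      using lim le leG
    proof eventually_elim
      case (elim \<omega>)
      have "fun_norm N (\<lambda>z. F K z - G z) \<omega> \<le> fun_norm N (F K) \<omega> + fun_norm N G \<omega>"
        unfolding fun_norm_def curry_diff by (intro L2_norm_triangle_diff L2_tendstoD[OF elim(1)])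
      then have "fun_norm N (\<lambda>z. F K z - G z) \<omega> \<le> 2 * (C * fun_norm N f \<omega>)" using elim(2,3) by (smt (verit))
      then have "(fun_norm N (\<lambda>z. F K z - G z) \<omega>)\<^sup>2 \<le> (2 * (C * fun_norm N f \<omega>))\<^sup>2" by (intro power_mono) auto
      then show ?case by (simp add: power_mult_distrib)
    qed
  qed simp
  from tendsto_real_sqrt[OF this] show ?thesis using F22 G22 by (simp add: L22_tendsto_def norm22_eq)
qed

text \<open>The function \<open>spectral_E\<close> is chosen by convergence in \<open>L22\<close>
  alone; uniqueness carries fibrewise convergence over to it from a limit that was constructed fibre
  by fibre.\<close>

lemma L22_tendsto_unique:
  assumes g: "L22_tendsto M N F g" and h: "L22_tendsto M N F h"
  shows "AE \<omega> in M. AE s in N. curry g \<omega> s = curry h \<omega> s"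
proof -
  have F: "F K \<in> L22 M N" "g \<in> L22 M N" "h \<in> L22 M N" for K using g h by (auto simp: L22_tendsto_def)
  have le: "(norm22 M N (\<lambda>z. g z - h z))\<^sup>2 \<le> 2 * (norm22 M N (\<lambda>z. F K z - g z))\<^sup>2 + 2 * (norm22 M N (\<lambda>z. F K z - h z))\<^sup>2" for K
  proof -
    have "(norm22 M N (\<lambda>z. g z - h z))\<^sup>2 = (\<integral>\<omega>. (fun_norm N (\<lambda>z. g z - h z) \<omega>)\<^sup>2 \<partial>M)" by (simp add: norm22_eq)
    also have "\<dots> \<le> (\<integral>\<omega>. 2 * (fun_norm N (\<lambda>z. F K z - g z) \<omega>)\<^sup>2 + 2 * (fun_norm N (\<lambda>z. F K z - h z) \<omega>)\<^sup>2 \<partial>M)"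
    proof (rule integral_mono_AE)
      show "integrable M (\<lambda>\<omega>. (fun_norm N (\<lambda>z. g z - h z) \<omega>)\<^sup>2)" by (intro L22_integrable L22_diff F)
      show "integrable M (\<lambda>\<omega>. 2 * (fun_norm N (\<lambda>z. F K z - g z) \<omega>)\<^sup>2 + 2 * (fun_norm N (\<lambda>z. F K z - h z) \<omega>)\<^sup>2)"
        by (intro Bochner_Integration.integrable_add integrable_mult_right L22_integrable L22_diff F)
      show "AE \<omega> in M. (fun_norm N (\<lambda>z. g z - h z) \<omega>)\<^sup>2 \<le> 2 * (fun_norm N (\<lambda>z. F K z - g z) \<omega>)\<^sup>2 + 2 * (fun_norm N (\<lambda>z. F K z - h z) \<omega>)\<^sup>2"
        using L22_sections[OF F(1)[of K]] L22_sections[OF F(2)] L22_sections[OF F(3)]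
      proof eventually_elim
        case (elim \<omega>)
        have "fun_norm N (\<lambda>z. g z - h z) \<omega> \<le> fun_norm N (\<lambda>z. F K z - g z) \<omega> + fun_norm N (\<lambda>z. F K z - h z) \<omega>"
          unfolding fun_norm_def curry_diff using L2_norm_triangle3[OF elim(2,1,3)] 
          by (simp add: L2_norm_minus_commute[of N "curry g \<omega>" "curry (F K) \<omega>"])
        then have "(fun_norm N (\<lambda>z. g z - h z) \<omega>)\<^sup>2 \<le> (fun_norm N (\<lambda>z. F K z - g z) \<omega> + fun_norm N (\<lambda>z. F K z - h z) \<omega>)\<^sup>2"
          by (intro power_mono) auto
        also have "\<dots> \<le> 2 * (fun_norm N (\<lambda>z. F K z - g z) \<omega>)\<^sup>2 + 2 * (fun_norm N (\<lambda>z. F K z - h z) \<omega>)\<^sup>2"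
          using sum_squares_bound[of "fun_norm N (\<lambda>z. F K z - g z) \<omega>" "fun_norm N (\<lambda>z. F K z - h z) \<omega>"] by (simp add: power2_sum)
        finally show ?case .
      qed
    qed
    also have "\<dots> = 2 * (\<integral>\<omega>. (fun_norm N (\<lambda>z. F K z - g z) \<omega>)\<^sup>2 \<partial>M) + 2 * (\<integral>\<omega>. (fun_norm N (\<lambda>z. F K z - h z) \<omega>)\<^sup>2 \<partial>M)"
      by (subst Bochner_Integration.integral_add) (auto intro!: L22_integrable L22_diff F)
    also have "\<dots> = 2 * (norm22 M N (\<lambda>z. F K z - g z))\<^sup>2 + 2 * (norm22 M N (\<lambda>z. F K z - h z))\<^sup>2" by (simp add: norm22_eq)
    finally show ?thesis .
  qed
  have "(\<lambda>K. norm22 M N (\<lambda>z. F K z - g z)) \<longlonglongrightarrow> 0" "(\<lambda>K. norm22 M N (\<lambda>z. F K z - h z)) \<longlonglongrightarrow> 0"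
    using g h by (auto simp: L22_tendsto_def)
  then have "(\<lambda>K. 2 * (norm22 M N (\<lambda>z. F K z - g z))\<^sup>2 + 2 * (norm22 M N (\<lambda>z. F K z - h z))\<^sup>2) \<longlonglongrightarrow> 2 * 0\<^sup>2 + 2 * 0\<^sup>2"
    by (intro tendsto_intros)
  then have "(norm22 M N (\<lambda>z. g z - h z))\<^sup>2 \<le> 2 * 0\<^sup>2 + 2 * 0\<^sup>2"
    by (rule LIMSEQ_le_const) (use le in auto)
  moreover have "0 \<le> (\<integral>\<omega>. (fun_norm N (\<lambda>z. g z - h z) \<omega>)\<^sup>2 \<partial>M)" by simp
  ultimately have "(\<integral>\<omega>. (fun_norm N (\<lambda>z. g z - h z) \<omega>)\<^sup>2 \<partial>M) = 0" by (simp add: norm22_eq)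
  then have "AE \<omega> in M. (fun_norm N (\<lambda>z. g z - h z) \<omega>)\<^sup>2 = 0"
    using integral_nonneg_eq_0_iff_AE[OF L22_integrable[OF L22_diff[OF F(2,3)]]] by simp
  then show ?thesis using L22_sections[OF F(2)] L22_sections[OF F(3)]
  proof eventually_elim
    case (elim \<omega>)
    then have "L2_norm N (\<lambda>s. curry g \<omega> s - curry h \<omega> s) = 0" by (simp add: fun_norm_def curry_diff)
    then show ?case using L2_norm_eq_0_iff[OF L2_diff[OF elim(2,3)]] by simp
  qed
qed

lemma AE_product:
  assumes "f \<in> borel_measurable (M \<Otimes>\<^sub>M N)" "g \<in> borel_measurable (M \<Otimes>\<^sub>M N)"
    and ae: "AE \<omega> in M. AE s in N. f (\<omega>, s) = (g (\<omega>, s) :: complex)"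
  shows "AE z in M \<Otimes>\<^sub>M N. f z = g z"
proof (rule MN.AE_pair_measure[OF _ ae])
  note [measurable] = assms(1,2)
  have "{x \<in> space (M \<Otimes>\<^sub>M N). f x - g x = 0} \<in> sets (M \<Otimes>\<^sub>M N)" by measurable
  then show "{x \<in> space (M \<Otimes>\<^sub>M N). f x = g x} \<in> sets (M \<Otimes>\<^sub>M N)" by simp
qed

end

section \<open>Spectral decompositions of partial integral operators\<close>

text \<open>The assumptions \<open>complete\<close> and \<open>infinite\<close> complement each
  other: a space that is not separable is infinite-dimensional, so on almost every fibre the vectors
  span or are all of norm one. Fibrewise assumptions hold only almost everywhere, as the kernel is
  altered on a null set.\<close>

locale spectral_field = two_measures M N for M :: "'a measure" and N :: "'b measure" +
  fixes k :: "'a \<times> 'b \<times> 'b \<Rightarrow> complex" and T :: "('a \<times> 'b \<Rightarrow> complex) \<Rightarrow> 'a \<times> 'b \<Rightarrow> complex"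
    and lam :: "nat \<Rightarrow> 'a \<Rightarrow> real" and x :: "nat \<Rightarrow> 'a \<times> 'b \<Rightarrow> complex" and B :: real
  assumes complete_M: "complete_measure M"
    and T_def: "T = partial_int_op N k" and T_sa: "self_adjoint22 M N T"
    and lam_meas[measurable]: "\<And>n. lam n \<in> borel_measurable M"
    and x_meas[measurable]: "\<And>n. x n \<in> borel_measurable (M \<Otimes>\<^sub>M N)"
    and es: "AE \<omega> in M. eig N (fibre_op N k \<omega>) (\<lambda>n. lam n \<omega>) (\<lambda>n. curry (x n) \<omega>)"
    and complete: "AE \<omega> in M. L2_separable N \<longrightarrow> (\<forall>g\<in>L2 N. Fourier_sum N (\<lambda>n. curry (x n) \<omega>) g)"
    and infinite: "AE \<omega> in M. \<not> L2_fin_dim N (L2 N) \<longrightarrow> (\<forall>n. L2_norm N (curry (x n) \<omega>) = 1)"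
    and bound: "AE \<omega> in M. \<forall>n. \<bar>lam n \<omega>\<bar> \<le> B" and B0: "B \<ge> 0"
begin

lemma T_curry: "curry (T f) \<omega> = fibre_op N k \<omega> (curry f \<omega>)"
  by (simp add: T_def curry_partial_int_op)

lemma T_L22: "f \<in> L22 M N \<Longrightarrow> T f \<in> L22 M N" using T_sa by (simp add: self_adjoint22_def)

definition partial :: "(nat \<Rightarrow> 'a \<Rightarrow> complex) \<Rightarrow> ('a \<times> 'b \<Rightarrow> complex) \<Rightarrow> nat \<Rightarrow> 'a \<times> 'b \<Rightarrow> complex" where
  "partial c f K = (\<lambda>(\<omega>, t). \<Sum>n<K. c n \<omega> * fun_inner N f (x n) \<omega> * x n (\<omega>, t))"

lemma partial_curry: "curry (partial c f K) \<omega> = (\<lambda>s. \<Sum>n<K. c n \<omega> * L2_inner N (curry f \<omega>) (curry (x n) \<omega>) * curry (x n) \<omega> s)"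
  by (simp add: partial_def curry_def fun_inner_def)

lemma partial_measurable:
  assumes "\<And>n. c n \<in> borel_measurable M" "f \<in> borel_measurable (M \<Otimes>\<^sub>M N)"
  shows "partial c f K \<in> borel_measurable (M \<Otimes>\<^sub>M N)"
proof -
  note [measurable] = assms(1) fun_inner_measurable[OF finite_N assms(2) x_meas]
  show ?thesis unfolding partial_def case_prod_beta' by measurable
qed

lemma partial_tendsto:
  assumes c: "\<And>n. c n \<in> borel_measurable M" and f: "f \<in> L22 M N" and G: "G \<in> borel_measurable (M \<Otimes>\<^sub>M N)"
    and C: "AE \<omega> in M. \<forall>n. fun_norm N (x n) \<omega> \<noteq> 0 \<longrightarrow> cmod (c n \<omega>) \<le> C" "C \<ge> 0"
    and lim: "AE \<omega> in M. L2_tendsto N (\<lambda>K. curry (partial c f K) \<omega>) (curry G \<omega>)"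
  shows "L22_tendsto M N (partial c f) G"
proof (rule L22_tendsto_dominated[where F = "partial c f" and C = C, OF partial_measurable[OF c L22_measurable[OF f]] G f lim])
  show "AE \<omega> in M. \<forall>K. fun_norm N (partial c f K) \<omega> \<le> C * fun_norm N f \<omega>"
    using es C(1) L22_sections[OF f]
  proof eventually_elim
    case (elim \<omega>)
    interpret eig N "fibre_op N k \<omega>" "\<lambda>n. lam n \<omega>" "\<lambda>n. curry (x n) \<omega>" by (rule elim(1))
    show ?case
    proof
      fix K
      have "(fun_norm N (partial c f K) \<omega>)\<^sup>2 \<le> C\<^sup>2 * (\<Sum>i<K. (cmod (L2_inner N (curry f \<omega>) (curry (x i) \<omega>)))\<^sup>2)"
        unfolding fun_norm_def partial_curry by (rule diag_norm_le) (use elim in \<open>auto simp: fun_norm_def\<close>)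
      also have "\<dots> \<le> C\<^sup>2 * (fun_norm N f \<omega>)\<^sup>2"
        unfolding fun_norm_def by (intro mult_left_mono Bessel elim) auto
      finally have "(fun_norm N (partial c f K) \<omega>)\<^sup>2 \<le> (C * fun_norm N f \<omega>)\<^sup>2" by (simp only: power_mult_distrib)
      then show "fun_norm N (partial c f K) \<omega> \<le> C * fun_norm N f \<omega>"
        by (rule power2_le_imp_le) (use C(2) in simp)
    qed
  qed
qed

lemma partial_limit:
  assumes c: "\<And>n. c n \<in> borel_measurable M" and f: "f \<in> L22 M N"
    and C: "AE \<omega> in M. \<forall>n. fun_norm N (x n) \<omega> \<noteq> 0 \<longrightarrow> cmod (c n \<omega>) \<le> C" "C \<ge> 0"
  obtains G where "G \<in> borel_measurable (M \<Otimes>\<^sub>M N)" "AE \<omega> in M. L2_tendsto N (\<lambda>K. curry (partial c f K) \<omega>) (curry G \<omega>)"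
    "L22_tendsto M N (partial c f) G"
proof -
  note m = partial_measurable[OF c L22_measurable[OF f]]
  show ?thesis
  proof (rule L2_limit_measurable[OF finite_N m])
    fix G assume G: "G \<in> borel_measurable (M \<Otimes>\<^sub>M N)" and lim: "\<And>\<omega>. \<omega> \<in> space M \<Longrightarrow> (\<And>n. curry (partial c f n) \<omega> \<in> L2 N) \<Longrightarrow>
      (\<And>e. e > 0 \<Longrightarrow> \<exists>K. \<forall>m\<ge>K. \<forall>n\<ge>K. L2_norm N (\<lambda>s. partial c f m (\<omega>, s) - partial c f n (\<omega>, s)) < e) \<Longrightarrow>
      L2_tendsto N (\<lambda>n. curry (partial c f n) \<omega>) (curry G \<omega>)"
    have "AE \<omega> in M. \<omega> \<in> space M" by simp
    with es C(1) L22_sections[OF f] have ae: "AE \<omega> in M. L2_tendsto N (\<lambda>K. curry (partial c f K) \<omega>) (curry G \<omega>)"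
    proof eventually_elim
      case (elim \<omega>)
      interpret eig N "fibre_op N k \<omega>" "\<lambda>n. lam n \<omega>" "\<lambda>n. curry (x n) \<omega>" by (rule elim(1))
      have pa: "partial c f n (\<omega>, s) = (\<Sum>i<n. c i \<omega> * L2_inner N (curry f \<omega>) (curry (x i) \<omega>) * curry (x i) \<omega> s)" for n s
        using fun_cong[OF partial_curry[of c f n \<omega>], of s] by (simp add: curry_conv)
      show ?case
      proof (rule lim[OF elim(4)])
        show "curry (partial c f n) \<omega> \<in> L2 N" for n unfolding partial_curry by (rule comb_L2)
        show "\<exists>K. \<forall>m\<ge>K. \<forall>n\<ge>K. L2_norm N (\<lambda>s. partial c f m (\<omega>, s) - partial c f n (\<omega>, s)) < e" if "e > 0" for e
          unfolding pa by (rule diag_Cauchy[OF elim(3) _ that, of _ C]) (use elim(2) in \<open>auto simp: fun_norm_def\<close>)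
      qed
    qed
    show ?thesis by (rule that[OF G ae partial_tendsto[OF c f G C ae]])
  qed
qed

lemma T_expansion:
  assumes f: "f \<in> L22 M N"
  shows "AE \<omega> in M. L2_tendsto N (\<lambda>K. curry (partial (\<lambda>n \<omega>. complex_of_real (lam n \<omega>)) f K) \<omega>) (curry (T f) \<omega>)"
    "L22_tendsto M N (partial (\<lambda>n \<omega>. complex_of_real (lam n \<omega>)) f) (T f)"
proof -
  show ae: "AE \<omega> in M. L2_tendsto N (\<lambda>K. curry (partial (\<lambda>n \<omega>. complex_of_real (lam n \<omega>)) f K) \<omega>) (curry (T f) \<omega>)"
    using es L22_sections[OF f]
  proof eventually_elim
    case (elim \<omega>)
    show ?case unfolding partial_curry T_curry by (rule eig.A_exp[OF elim])
  qed
  show "L22_tendsto M N (partial (\<lambda>n \<omega>. complex_of_real (lam n \<omega>)) f) (T f)"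
    by (rule partial_tendsto[OF _ f L22_measurable[OF T_L22[OF f]] _ B0 ae]) (use bound in auto)
qed

subsection \<open>The spectral family\<close>

definition cE :: "('a \<Rightarrow> real) \<Rightarrow> nat \<Rightarrow> 'a \<Rightarrow> complex" where "cE l n \<omega> = (if lam n \<omega> \<le> l \<omega> then 1 else 0)"

lemma E_partial_sum_eq: "E_partial_sum N lam x l f = partial (cE l) f"
proof (intro ext)
  fix K :: nat and z :: "'a \<times> 'b"
  obtain \<omega> t where z: "z = (\<omega>, t)" by (cases z)
  have "{n. n < K \<and> lam n \<omega> \<le> l \<omega>} = {n \<in> {..<K}. lam n \<omega> \<le> l \<omega>}" by auto
  then show "E_partial_sum N lam x l f K z = partial (cE l) f K z"
    by (simp add: z E_partial_sum_def partial_def cE_def sum.inter_filter[symmetric] if_distrib if_distribR cong: if_cong)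
qed

lemma spectral_E_tendsto:
  assumes l: "l \<in> borel_measurable M" and f: "f \<in> L22 M N"
  shows "L22_tendsto M N (partial (cE l) f) (spectral_E M N lam x l f)"
    "AE \<omega> in M. L2_tendsto N (\<lambda>K. curry (partial (cE l) f K) \<omega>) (curry (spectral_E M N lam x l f) \<omega>)"
proof -
  have c: "cE l n \<in> borel_measurable M" for n using l unfolding cE_def[abs_def] by measurable
  have bd: "AE \<omega> in M. \<forall>n. fun_norm N (x n) \<omega> \<noteq> 0 \<longrightarrow> cmod (cE l n \<omega>) \<le> 1" by (simp add: cE_def)
  obtain G where G: "AE \<omega> in M. L2_tendsto N (\<lambda>K. curry (partial (cE l) f K) \<omega>) (curry G \<omega>)"
      "L22_tendsto M N (partial (cE l) f) G"
    by (rule partial_limit[where c = "cE l" and C = 1, OF c f bd]) (simp, rule that)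
  show t: "L22_tendsto M N (partial (cE l) f) (spectral_E M N lam x l f)"
    unfolding spectral_E_def E_partial_sum_eq by (rule someI[of _ G]) (rule G)
  then have m: "spectral_E M N lam x l f \<in> borel_measurable (M \<Otimes>\<^sub>M N)" by (simp add: L22_tendsto_def L22_measurable)
  have "AE \<omega> in M. \<omega> \<in> space M" by simp
  with L22_tendsto_unique[OF G(2) t] G(1)
  show "AE \<omega> in M. L2_tendsto N (\<lambda>K. curry (partial (cE l) f K) \<omega>) (curry (spectral_E M N lam x l f) \<omega>)"
  proof eventually_elim
    case (elim \<omega>)
    show ?case by (rule L2_tendsto_cong_AE[OF elim(2) curry_measurable[OF m elim(3)] elim(1)])
  qed
qed

lemma spectral_E_L22: "l \<in> borel_measurable M \<Longrightarrow> f \<in> L22 M N \<Longrightarrow> spectral_E M N lam x l f \<in> L22 M N"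
  using spectral_E_tendsto(1) by (simp add: L22_tendsto_def)

lemma spectral_E_projector:
  assumes l: "l \<in> borel_measurable M" shows "orth_projector22 M N (spectral_E M N lam x l)"
proof -
  let ?E = "spectral_E M N lam x l"
  have sa: "AE \<omega> in M. fun_inner N (?E f) g \<omega> = fun_inner N f (?E g) \<omega>" if f: "f \<in> L22 M N" and g: "g \<in> L22 M N" for f g
    using es L22_sections[OF f] L22_sections[OF g] spectral_E_tendsto(2)[OF l f] spectral_E_tendsto(2)[OF l g]
  proof eventually_elim
    case (elim \<omega>)
    interpret eig N "fibre_op N k \<omega>" "\<lambda>n. lam n \<omega>" "\<lambda>n. curry (x n) \<omega>" by (rule elim(1))
    have c: "cE l n \<omega> = complex_of_real (if lam n \<omega> \<le> l \<omega> then 1 else 0)" for n by (simp add: cE_def)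
    show ?case unfolding fun_inner_def
      by (rule diag_selfadj[OF elim(2,3)]) (use elim(4,5) in \<open>simp_all only: partial_curry c\<close>)
  qed
  have idem: "AE z in M \<Otimes>\<^sub>M N. ?E (?E f) z = ?E f z" if f: "f \<in> L22 M N" for f
  proof (rule AE_product)
    show "?E (?E f) \<in> borel_measurable (M \<Otimes>\<^sub>M N)" "?E f \<in> borel_measurable (M \<Otimes>\<^sub>M N)"
      by (intro L22_measurable spectral_E_L22 l f)+
    show "AE \<omega> in M. AE s in N. ?E (?E f) (\<omega>, s) = ?E f (\<omega>, s)"
      using es L22_sections[OF f] spectral_E_tendsto(2)[OF l f] spectral_E_tendsto(2)[OF l spectral_E_L22[OF l f]]
    proof eventually_elim
      case (elim \<omega>)
      interpret eig N "fibre_op N k \<omega>" "\<lambda>n. lam n \<omega>" "\<lambda>n. curry (x n) \<omega>" by (rule elim(1))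
      have "AE s in N. curry (?E (?E f)) \<omega> s = curry (?E f) \<omega> s"
        by (rule diag_idem[OF elim(2)]) (use elim(3,4) in \<open>simp_all only: partial_curry cE_def\<close>)
      then show ?case by (simp add: curry_conv)
    qed
  qed
  show ?thesis unfolding orth_projector22_def self_adjoint22_def using sa idem spectral_E_L22[OF l] by blast
qed

subsection \<open>Spectral integrals\<close>

text \<open>The bounds on the eigenvalues and on \<phi> are asked for at non-zero vectors only; they
  are void if \<open>N\<close> is the zero measure, in which case the end points used later are
  unspecified.\<close>

lemma has_spectral_integral_diag:
  fixes \<phi> :: "'a \<Rightarrow> real \<Rightarrow> complex" and a b :: "'a \<Rightarrow> real"
  assumes meas: "\<And>l. l \<in> borel_measurable M \<Longrightarrow> AE \<omega> in M. l \<omega> \<in> {a \<omega>..b \<omega>} \<Longrightarrow> (\<lambda>\<omega>. \<phi> \<omega> (l \<omega>)) \<in> borel_measurable M"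
    and cont: "AE \<omega> in M. continuous_on {a \<omega>..b \<omega>} (\<phi> \<omega>)"
    and bd: "AE \<omega> in M. \<forall>n. fun_norm N (x n) \<omega> \<noteq> 0 \<longrightarrow> (\<forall>r\<in>{a \<omega>..b \<omega>}. cmod (\<phi> \<omega> r) \<le> C)" "C \<ge> 0"
    and lam_ab: "AE \<omega> in M. \<forall>n. fun_norm N (x n) \<omega> \<noteq> 0 \<longrightarrow> lam n \<omega> \<in> {a \<omega>..b \<omega>}"
    and \<Phi>: "\<And>g. g \<in> L22 M N \<Longrightarrow> \<Phi> g \<in> L22 M N"
      "\<And>g. g \<in> L22 M N \<Longrightarrow> AE \<omega> in M. L2_tendsto N (\<lambda>K. curry (partial (\<lambda>n \<omega>. \<phi> \<omega> (lam n \<omega>)) g K) \<omega>) (curry (\<Phi> g) \<omega>)"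
  shows "has_spectral_integral M N lam x \<phi> a b \<Phi>"
  unfolding has_spectral_integral_def
proof (intro ballI conjI)
  fix g assume g: "g \<in> L22 M N"
  show "\<Phi> g \<in> L22 M N" by (rule \<Phi>(1)[OF g])
  show "AE \<omega> in M. has_fibre_integral N (\<lambda>n. lam n \<omega>) (\<lambda>n. curry (x n) \<omega>) (\<phi> \<omega>) (a \<omega>) (b \<omega>) (curry g \<omega>) (curry (\<Phi> g) \<omega>)"
    using es L22_sections[OF g] cont lam_ab \<Phi>(2)[OF g]
  proof eventually_elim
    case (elim \<omega>)
    interpret eig N "fibre_op N k \<omega>" "\<lambda>n. lam n \<omega>" "\<lambda>n. curry (x n) \<omega>" by (rule elim(1))
    show ?case
      by (rule has_fibre_integral_diag[OF elim(2,3)]) (use elim(4,5) in \<open>simp_all add: fun_norm_def partial_curry\<close>)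
  qed
  define Q where "Q n d \<xi> \<delta> \<longleftrightarrow> (\<forall>i\<le>n. d i \<in> borel_measurable M) \<and> (\<forall>i<n. \<xi> i \<in> borel_measurable M) \<and>
        (AE \<omega> in M. rs_partition (a \<omega>) (b \<omega>) n (\<lambda>i. d i \<omega>) (\<lambda>i. \<xi> i \<omega>) \<delta>)" for n d \<xi> \<delta>
  let ?R = "\<lambda>n d \<xi>. rs_sum22 M N lam x \<phi> a n d \<xi> g"
  have R_lim: "AE \<omega> in M. L2_tendsto N (\<lambda>K s. \<Sum>m<K. rs_coeff (\<phi> \<omega>) (a \<omega>) n (\<lambda>i. d i \<omega>) (\<lambda>i. \<xi> i \<omega>) (lam m \<omega>) * 
       L2_inner N (curry g \<omega>) (curry (x m) \<omega>) * curry (x m) \<omega> s) (curry (?R n d \<xi>) \<omega>)"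
    and R_meas: "?R n d \<xi> \<in> borel_measurable (M \<Otimes>\<^sub>M N)" if Q: "Q n d \<xi> \<delta>" for n d \<xi> \<delta>
  proof -
    have dm: "\<And>i. i \<le> n \<Longrightarrow> d i \<in> borel_measurable M" and xm: "\<And>i. i < n \<Longrightarrow> \<xi> i \<in> borel_measurable M"
      and p: "AE \<omega> in M. rs_partition (a \<omega>) (b \<omega>) n (\<lambda>i. d i \<omega>) (\<lambda>i. \<xi> i \<omega>) \<delta>" using Q by (auto simp: Q_def)
    have am: "a \<in> borel_measurable M"
      by (rule complete_measure.borel_measurable_AE_eq[OF complete_M dm[of 0]]) (use p in \<open>auto simp: rs_partition_def elim!: eventually_mono\<close>)
    have mono: "d i \<omega> \<le> d j \<omega>" if "rs_partition (a \<omega>) (b \<omega>) n (\<lambda>i. d i \<omega>) (\<lambda>i. \<xi> i \<omega>) \<delta>" "i \<le> j" "j \<le> n" for \<omega> i j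
      using rs_partition_mono[OF that] .
    have pa: "(\<lambda>\<omega>. \<phi> \<omega> (a \<omega>)) \<in> borel_measurable M"
    proof (rule meas[OF am])
      show "AE \<omega> in M. a \<omega> \<in> {a \<omega>..b \<omega>}" using p
      proof eventually_elim
        case (elim \<omega>)
        then show ?case using mono[OF elim, of 0 n] by (simp add: rs_partition_def)
      qed
    qed
    have px: "(\<lambda>\<omega>. \<phi> \<omega> (\<xi> i \<omega>)) \<in> borel_measurable M" if i: "i < n" for i
    proof (rule meas[OF xm[OF i]])
      show "AE \<omega> in M. \<xi> i \<omega> \<in> {a \<omega>..b \<omega>}" using p
      proof eventually_elim
        case (elim \<omega>)
        have "d 0 \<omega> \<le> d i \<omega>" "d (Suc i) \<omega> \<le> d n \<omega>" using mono[OF elim, of 0 i] mono[OF elim, of "Suc i" n] i by auto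
        then show ?case using elim i by (auto simp: rs_partition_def)
      qed
    qed
    note [measurable] = pa px
    have [measurable]: "spectral_E M N lam x a g \<in> borel_measurable (M \<Otimes>\<^sub>M N)"
      by (intro L22_measurable spectral_E_L22 am g)
    have [measurable]: "spectral_E M N lam x (d i) g \<in> borel_measurable (M \<Otimes>\<^sub>M N)" if "i \<le> n" for i
      by (intro L22_measurable spectral_E_L22 dm that g)
    show "?R n d \<xi> \<in> borel_measurable (M \<Otimes>\<^sub>M N)"
      unfolding rs_sum22_def case_prod_beta' prod.collapse
    proof (intro borel_measurable_add borel_measurable_times borel_measurable_sum borel_measurable_diff)
      show "(\<lambda>z. \<phi> (fst z) (a (fst z))) \<in> borel_measurable (M \<Otimes>\<^sub>M N)" by (rule measurable_compose[OF measurable_fst pa])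
      show "(\<lambda>z. \<phi> (fst z) (\<xi> i (fst z))) \<in> borel_measurable (M \<Otimes>\<^sub>M N)" if "i \<in> {..<n}" for i
        by (rule measurable_compose[OF measurable_fst px]) (use that in simp)
    qed measurable
    have "AE \<omega> in M. \<forall>i\<in>{..n}. L2_tendsto N (\<lambda>K. curry (partial (cE (d i)) g K) \<omega>) (curry (spectral_E M N lam x (d i) g) \<omega>)"
      by (rule AE_finite_allI) (use spectral_E_tendsto(2)[OF dm g] in auto)
    with es L22_sections[OF g] spectral_E_tendsto(2)[OF am g]
    show "AE \<omega> in M. L2_tendsto N (\<lambda>K s. \<Sum>m<K. rs_coeff (\<phi> \<omega>) (a \<omega>) n (\<lambda>i. d i \<omega>) (\<lambda>i. \<xi> i \<omega>) (lam m \<omega>) * 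
       L2_inner N (curry g \<omega>) (curry (x m) \<omega>) * curry (x m) \<omega> s) (curry (?R n d \<xi>) \<omega>)"
    proof eventually_elim
      case (elim \<omega>)
      interpret eig N "fibre_op N k \<omega>" "\<lambda>n. lam n \<omega>" "\<lambda>n. curry (x n) \<omega>" by (rule elim(1))
      have "curry (?R n d \<xi>) \<omega> = (\<lambda>s. \<phi> \<omega> (a \<omega>) * curry (spectral_E M N lam x a g) \<omega> s + (\<Sum>i<n. \<phi> \<omega> (\<xi> i \<omega>) * 
         (curry (spectral_E M N lam x (d (Suc i)) g) \<omega> s - curry (spectral_E M N lam x (d i) g) \<omega> s)))"
        by (simp add: rs_sum22_def curry_def)
      moreover have "L2_tendsto N (\<lambda>K s. \<Sum>m<K. rs_coeff (\<phi> \<omega>) (a \<omega>) n (\<lambda>i. d i \<omega>) (\<lambda>i. \<xi> i \<omega>) (lam m \<omega>) * 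
         L2_inner N (curry g \<omega>) (curry (x m) \<omega>) * curry (x m) \<omega> s) 
        (\<lambda>s. \<phi> \<omega> (a \<omega>) * curry (spectral_E M N lam x a g) \<omega> s + (\<Sum>i<n. \<phi> \<omega> (\<xi> i \<omega>) * 
         (curry (spectral_E M N lam x (d (Suc i)) g) \<omega> s - curry (spectral_E M N lam x (d i) g) \<omega> s)))"
        by (rule rs_sum_tendsto[where d="\<lambda>i. d i \<omega>" and E="\<lambda>i. curry (spectral_E M N lam x (d i) g) \<omega>", OF elim(2)])
          (use elim(3,4) in \<open>simp_all add: partial_curry cE_def\<close>)
      ultimately show ?case by simp
    qed
  qed
  have R_le: "AE \<omega> in M. fun_norm N (?R n d \<xi>) \<omega> \<le> C * fun_norm N g \<omega>" if Q: "Q n d \<xi> \<delta>" "\<delta> > 0" for n d \<xi> \<delta>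
  proof -
    have p: "AE \<omega> in M. rs_partition (a \<omega>) (b \<omega>) n (\<lambda>i. d i \<omega>) (\<lambda>i. \<xi> i \<omega>) \<delta>" using Q by (auto simp: Q_def)
    show ?thesis
      using es L22_sections[OF g] p lam_ab bd(1) R_lim[OF Q(1)]
    proof eventually_elim
      case (elim \<omega>)
      interpret eig N "fibre_op N k \<omega>" "\<lambda>n. lam n \<omega>" "\<lambda>n. curry (x n) \<omega>" by (rule elim(1))
      show ?case unfolding fun_norm_def
        by (rule rs_sum_norm[OF elim(2,3) Q(2) _ _ bd(2) elim(6)]) (use elim(4,5) in \<open>auto simp: fun_norm_def\<close>)
    qed
  qed
  have R22: "?R n d \<xi> \<in> L22 M N" if Q: "Q n d \<xi> \<delta>" "\<delta> > 0" for n d \<xi> \<delta>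
    by (rule L22_dominated[OF R_meas[OF Q(1)] _ g R_le[OF Q]]) (rule eventually_mono[OF R_lim[OF Q(1)]], simp add: L2_tendsto_def)
  show "\<forall>\<eta>>0. \<exists>\<delta>>0. \<forall>n d \<xi>. (\<forall>i\<le>n. d i \<in> borel_measurable M) \<and> (\<forall>i<n. \<xi> i \<in> borel_measurable M) \<and>
        (AE \<omega> in M. rs_partition (a \<omega>) (b \<omega>) n (\<lambda>i. d i \<omega>) (\<lambda>i. \<xi> i \<omega>) \<delta>) \<longrightarrow>
        ?R n d \<xi> \<in> L22 M N \<and> norm22 M N (\<lambda>z. ?R n d \<xi> z - \<Phi> g z) < \<eta>"
    unfolding Q_def[symmetric]
  proof (intro allI impI, rule ccontr)
    \<comment> \<open>The moduli of continuity of the \<open>\<phi> \<omega>\<close> need not be uniform in \<open>\<omega>\<close>, so the mesh is found by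
      contradiction, with dominated convergence along a sequence of partitions.\<close>
    fix \<eta> :: real assume \<eta>: "\<eta> > 0" 
      and no: "\<not> (\<exists>\<delta>>0. \<forall>n d \<xi>. Q n d \<xi> \<delta> \<longrightarrow> ?R n d \<xi> \<in> L22 M N \<and> norm22 M N (\<lambda>z. ?R n d \<xi> z - \<Phi> g z) < \<eta>)"
    have "\<exists>n d \<xi>. Q n d \<xi> (inverse (real (Suc j))) \<and> \<not> norm22 M N (\<lambda>z. ?R n d \<xi> z - \<Phi> g z) < \<eta>" for j
    proof -
      have j: "inverse (real (Suc j)) > 0" by simp
      with no obtain n d \<xi> where "Q n d \<xi> (inverse (real (Suc j)))" "\<not> (?R n d \<xi> \<in> L22 M N \<and> norm22 M N (\<lambda>z. ?R n d \<xi> z - \<Phi> g z) < \<eta>)"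
        by blast
      then show ?thesis using R22[OF _ j] by blast
    qed
    then obtain n d \<xi> where Q: "\<And>j. Q (n j) (d j) (\<xi> j) (inverse (real (Suc j)))"
      and ge: "\<And>j. \<not> norm22 M N (\<lambda>z. ?R (n j) (d j) (\<xi> j) z - \<Phi> g z) < \<eta>" by metis
    have "L22_tendsto M N (\<lambda>j. ?R (n j) (d j) (\<xi> j)) (\<Phi> g)"
    proof (rule L22_tendsto_dominated[where C = C, OF _ L22_measurable[OF \<Phi>(1)[OF g]] g])
      show "?R (n j) (d j) (\<xi> j) \<in> borel_measurable (M \<Otimes>\<^sub>M N)" for j by (rule R_meas[OF Q])
      have "AE \<omega> in M. \<forall>j. rs_partition (a \<omega>) (b \<omega>) (n j) (\<lambda>i. d j i \<omega>) (\<lambda>i. \<xi> j i \<omega>) (inverse (real (Suc j)))"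
        unfolding AE_all_countable using Q by (auto simp: Q_def)
      moreover have "AE \<omega> in M. \<forall>j. L2_tendsto N (\<lambda>K s. \<Sum>m<K. rs_coeff (\<phi> \<omega>) (a \<omega>) (n j) (\<lambda>i. d j i \<omega>) (\<lambda>i. \<xi> j i \<omega>) (lam m \<omega>) * 
       L2_inner N (curry g \<omega>) (curry (x m) \<omega>) * curry (x m) \<omega> s) (curry (?R (n j) (d j) (\<xi> j)) \<omega>)"
        unfolding AE_all_countable using R_lim[OF Q] by blast
      ultimately show "AE \<omega> in M. L2_tendsto N (\<lambda>j. curry (?R (n j) (d j) (\<xi> j)) \<omega>) (curry (\<Phi> g) \<omega>)"
        using es L22_sections[OF g] cont lam_ab \<Phi>(2)[OF g]
      proof eventually_elim
        case (elim \<omega>)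
        interpret eig N "fibre_op N k \<omega>" "\<lambda>n. lam n \<omega>" "\<lambda>n. curry (x n) \<omega>" by (rule elim(3))
        show ?case
        proof (rule rs_sums_converge[OF elim(4,5)])
          show "lam i \<omega> \<in> {a \<omega>..b \<omega>}" if "L2_norm N (curry (x i) \<omega>) \<noteq> 0" for i using elim(6) that by (simp add: fun_norm_def)
          show "L2_tendsto N (\<lambda>K s. \<Sum>n<K. \<phi> \<omega> (lam n \<omega>) * L2_inner N (curry g \<omega>) (curry (x n) \<omega>) * curry (x n) \<omega> s) (curry (\<Phi> g) \<omega>)"
            using elim(7) by (simp add: partial_curry)
        qed (use elim(1,2) in blast)+
      qed
      show "AE \<omega> in M. \<forall>j. fun_norm N (?R (n j) (d j) (\<xi> j)) \<omega> \<le> C * fun_norm N g \<omega>"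
        unfolding AE_all_countable using R_le[OF Q] by simp
    qed
    then have "(\<lambda>j. norm22 M N (\<lambda>z. ?R (n j) (d j) (\<xi> j) z - \<Phi> g z)) \<longlonglongrightarrow> 0" by (simp add: L22_tendsto_def)
    then have "eventually (\<lambda>j. norm22 M N (\<lambda>z. ?R (n j) (d j) (\<xi> j) z - \<Phi> g z) < \<eta>) sequentially"
      using \<eta> by (rule order_tendstoD(2))
    then show False using ge by (auto simp: eventually_sequentially)
  qed
qed

end

context eig
begin

text \<open>Linearity is not among the assumptions on \<open>A\<close>; it follows, almost
  everywhere, from the expansion, whose coefficients are linear.\<close>

lemma A_add: assumes "f \<in> L2 N" "g \<in> L2 N" shows "AE s in N. A (\<lambda>s. f s + g s) s = A f s + A g s"
proof (rule L2_tendsto_unique)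
  show "L2_tendsto N (\<lambda>K s. \<Sum>n<K. complex_of_real (l n) * L2_inner N (\<lambda>s. f s + g s) (y n) * y n s) (A (\<lambda>s. f s + g s))"
    by (intro A_exp L2_add assms)
  show "L2_tendsto N (\<lambda>K s. \<Sum>n<K. complex_of_real (l n) * L2_inner N (\<lambda>s. f s + g s) (y n) * y n s) (\<lambda>s. A f s + A g s)"
    using L2_tendsto_add[OF A_exp[OF assms(1)] A_exp[OF assms(2)]]
    by (simp add: L2_inner_add_left[OF assms y_L2] distrib_left distrib_right sum.distrib)
qed

lemma A_scale: assumes "f \<in> L2 N" shows "AE s in N. A (\<lambda>s. c * f s) s = c * A f s"
proof (rule L2_tendsto_unique)
  show "L2_tendsto N (\<lambda>K s. \<Sum>n<K. complex_of_real (l n) * L2_inner N (\<lambda>s. c * f s) (y n) * y n s) (A (\<lambda>s. c * f s))"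
    by (intro A_exp L2_scale assms)
  show "L2_tendsto N (\<lambda>K s. \<Sum>n<K. complex_of_real (l n) * L2_inner N (\<lambda>s. c * f s) (y n) * y n s) (\<lambda>s. c * A f s)"
    using L2_tendsto_scale[OF A_exp[OF assms], of c]
    by (simp add: L2_inner_scale_left sum_distrib_left mult_ac)
qed

end

context spectral_field
begin

subsection \<open>The bounds of the numerical range\<close>

lemma null_norm: assumes "measure N (space N) = 0" shows "L2_norm N f = 0"
proof -
  have "space N \<in> null_sets N" using assms N.emeasure_eq_measure by auto
  then have "AE s in N. s \<notin> space N" by (rule AE_not_in)
  with AE_space have "AE s in N. (cmod (f s))\<^sup>2 = 0" by eventually_elim simp
  then have "(\<integral>s. (cmod (f s))\<^sup>2 \<partial>N) = 0" by (rule integral_eq_zero_AE)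
  then show ?thesis by (simp add: L2_norm_alt)
qed

lemma fun_norm_nonzero_pos: "fun_norm N f \<omega> \<noteq> 0 \<Longrightarrow> measure N (space N) > 0"
  using null_norm[of "curry f \<omega>"] by (auto simp: fun_norm_def zero_less_measure_iff)

lemma complete_or_unit:
  "AE \<omega> in M. \<forall>g\<in>L2 N. Fourier_sum N (\<lambda>n. curry (x n) \<omega>) g \<or> (\<forall>n. L2_norm N (curry (x n) \<omega>) = 1)"
  using complete infinite by eventually_elim (use fin_dim_separable in blast)

lemma num_range_bound:
  assumes q: "q \<in> num_range M N T"
    and i: "AE \<omega> in M. \<forall>n. fun_norm N (x n) \<omega> \<noteq> 0 \<longrightarrow> i \<omega> \<le> \<sigma> * lam n \<omega>"
  shows "AE \<omega> in M. i \<omega> \<le> \<sigma> * q \<omega>"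
proof -
  obtain y where y: "y \<in> L22 M N" "AE \<omega> in M. fun_norm N y \<omega> = 1" "AE \<omega> in M. complex_of_real (q \<omega>) = fun_inner N (T y) y \<omega>"
    using q by (auto simp: num_range_def)
  show ?thesis
    using es complete_or_unit L22_sections[OF y(1)] y(2,3) i
  proof eventually_elim
    case (elim \<omega>)
    interpret eig N "fibre_op N k \<omega>" "\<lambda>n. lam n \<omega>" "\<lambda>n. curry (x n) \<omega>" by (rule elim(1))
    have "i \<omega> \<le> \<sigma> * Re (L2_inner N (fibre_op N k \<omega> (curry y \<omega>)) (curry y \<omega>))"
      by (rule quadratic_form_ge[OF elim(3)]) (use elim(2-) in \<open>auto simp: fun_norm_def\<close>)
    moreover have "L2_inner N (fibre_op N k \<omega> (curry y \<omega>)) (curry y \<omega>) = complex_of_real (q \<omega>)"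
      using elim(5) by (simp add: fun_inner_def T_curry)
    ultimately show ?case by simp
  qed
qed

section \<open>Test fields for the bounds of the numerical range\<close>

context
  assumes pos: "measure N (space N) > 0"
begin

definition c0 :: complex where "c0 = complex_of_real (1 / sqrt (measure N (space N)))"

lemma const_norm: "L2_norm N (\<lambda>s. c0) = 1"
proof -
  have "(cmod c0)\<^sup>2 * measure N (space N) = 1"
    using pos by (simp add: c0_def norm_divide power_divide)
  then show ?thesis by (simp add: L2_norm_alt mult.commute)
qed

lemma const_L22: "(\<lambda>z. c0) \<in> L22 M N"
  by (auto simp: L22_def L2_def fun_norm_def curry_def const_norm)

text \<open>The numerical range admits only fields of norm one over almost every fibre, whereas
  \<open>x n\<close> may vanish on some of them; there a constant function of norm one is
  substituted.\<close>

definition xp :: "nat \<Rightarrow> 'a \<times> 'b \<Rightarrow> complex" where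
  "xp n z = (if fun_norm N (x n) (fst z) \<noteq> 0 then x n z else c0)"

lemma xp_curry: "curry (xp n) \<omega> = (if fun_norm N (x n) \<omega> \<noteq> 0 then curry (x n) \<omega> else (\<lambda>s. c0))"
  by (auto simp: xp_def curry_def)

lemma xp_norm: "AE \<omega> in M. curry (xp n) \<omega> \<in> L2 N \<and> fun_norm N (xp n) \<omega> = 1"
  using es
proof eventually_elim
  case (elim \<omega>)
  interpret eig N "fibre_op N k \<omega>" "\<lambda>n. lam n \<omega>" "\<lambda>n. curry (x n) \<omega>" by (rule elim)
  have "(\<lambda>s. c0) \<in> L2 N" by (simp add: L2_def)
  then show ?case using norm_y[of n] y_L2[of n] const_norm unfolding fun_norm_def[of _ "xp n"] xp_curry
    by (auto simp: fun_norm_def)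
qed

lemma xp_L22: "xp n \<in> L22 M N"
proof (rule L22_dominated[OF _ _ const_L22, of _ 1])
  note [measurable] = fun_norm_meas[OF x_meas]
  show "xp n \<in> borel_measurable (M \<Otimes>\<^sub>M N)" unfolding xp_def[abs_def] by measurable
  show "AE \<omega> in M. curry (xp n) \<omega> \<in> L2 N" using xp_norm[of n] by (rule eventually_mono) simp
  have c: "fun_norm N (\<lambda>z. c0) \<omega> = 1" for \<omega> :: 'a by (simp add: fun_norm_def curry_def const_norm)
  show "AE \<omega> in M. fun_norm N (xp n) \<omega> \<le> 1 * fun_norm N (\<lambda>z. c0) \<omega>" 
    using xp_norm[of n] by (rule eventually_mono) (simp add: c)
qed

definition qp :: "nat \<Rightarrow> 'a \<Rightarrow> real" where "qp n \<omega> = Re (fun_inner N (T (xp n)) (xp n) \<omega>)"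

lemma qp_num_range: "qp n \<in> num_range M N T"
proof -
  have [measurable]: "fun_inner N (T (xp n)) (xp n) \<in> borel_measurable M"
    by (intro fun_inner_measurable finite_N L22_measurable T_L22 xp_L22)
  have "qp n \<in> borel_measurable M" unfolding qp_def[abs_def] by measurable
  moreover have "AE \<omega> in M. complex_of_real (qp n \<omega>) = fun_inner N (T (xp n)) (xp n) \<omega>"
  proof -
    have "AE \<omega> in M. fun_inner N (T (xp n)) (xp n) \<omega> = fun_inner N (xp n) (T (xp n)) \<omega>"
      using T_sa xp_L22[of n] by (auto simp: self_adjoint22_def)
    then show ?thesis
    proof eventually_elim
      case (elim \<omega>)
      also have "fun_inner N (xp n) (T (xp n)) \<omega> = cnj (fun_inner N (T (xp n)) (xp n) \<omega>)"
        unfolding fun_inner_def by (rule L2_inner_cnj)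
      finally have "fun_inner N (T (xp n)) (xp n) \<omega> = cnj (fun_inner N (T (xp n)) (xp n) \<omega>)" .
      then have "Im (fun_inner N (T (xp n)) (xp n) \<omega>) = 0" by (metis cnj.simps(2) equal_neg_zero)
      then show ?case by (simp add: qp_def complex_eq_iff)
    qed
  qed
  moreover have "AE \<omega> in M. fun_norm N (xp n) \<omega> = 1" using xp_norm[of n] by (rule eventually_mono) simp
  ultimately show ?thesis using xp_L22 unfolding num_range_def by blast
qed

lemma qp_lam: "AE \<omega> in M. fun_norm N (x n) \<omega> \<noteq> 0 \<longrightarrow> qp n \<omega> = lam n \<omega>"
  using es
proof eventually_elim
  case (elim \<omega>)
  interpret eig N "fibre_op N k \<omega>" "\<lambda>n. lam n \<omega>" "\<lambda>n. curry (x n) \<omega>" by (rule elim)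
  show ?case
  proof
    assume nz: "fun_norm N (x n) \<omega> \<noteq> 0"
    then have c: "curry (xp n) \<omega> = curry (x n) \<omega>" by (simp add: xp_curry)
    have "L2_inner N (curry (x n) \<omega>) (curry (x n) \<omega>) = 1" using y_unit[of n] norm_y_iff[of n] nz by (auto simp: fun_norm_def)
    then show "qp n \<omega> = lam n \<omega>" by (simp add: qp_def fun_inner_def T_curry c A_inner[OF y_L2])
  qed
qed

text \<open>Up to sign, the infima over \<open>n\<close> are the bounds of the numerical range, the
  upper one with \<open>-1\<close> for \<sigma>. The value \<open>B\<close> at zero vectors is
  neutral, as almost everywhere no eigenvalue exceeds it in modulus, and the truncation keeps the
  family bounded on every single fibre.\<close>

definition clip :: "real \<Rightarrow> nat \<Rightarrow> 'a \<Rightarrow> real" where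
  "clip \<sigma> n \<omega> = (if fun_norm N (x n) \<omega> \<noteq> 0 then max (- B) (min B (\<sigma> * lam n \<omega>)) else B)"

definition inf_lam :: "real \<Rightarrow> 'a \<Rightarrow> real" where "inf_lam \<sigma> \<omega> = (INF n. clip \<sigma> n \<omega>)"

lemma clip_bdd: "bdd_below (range (\<lambda>n. clip \<sigma> n \<omega>))"
  using B0 by (intro bdd_belowI[of _ "-B"]) (auto simp: clip_def)

lemma clip_eq: "\<bar>\<sigma>\<bar> = 1 \<Longrightarrow> \<bar>lam n \<omega>\<bar> \<le> B \<Longrightarrow> fun_norm N (x n) \<omega> \<noteq> 0 \<Longrightarrow> clip \<sigma> n \<omega> = \<sigma> * lam n \<omega>"
  by (auto simp: clip_def abs_if split: if_splits)

lemma inf_lam_measurable: "inf_lam \<sigma> \<in> borel_measurable M"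
proof -
  note [measurable] = fun_norm_meas[OF x_meas]
  have "clip \<sigma> n \<in> borel_measurable M" for n unfolding clip_def[abs_def] by measurable
  then show ?thesis unfolding inf_lam_def[abs_def] by (intro borel_measurable_cINF clip_bdd) auto
qed

lemma inf_lam_le:
  assumes \<sigma>: "\<bar>\<sigma>\<bar> = 1" and q: "q \<in> num_range M N T" shows "AE \<omega> in M. inf_lam \<sigma> \<omega> \<le> \<sigma> * q \<omega>"
proof (rule num_range_bound[OF q])
  show "AE \<omega> in M. \<forall>n. fun_norm N (x n) \<omega> \<noteq> 0 \<longrightarrow> inf_lam \<sigma> \<omega> \<le> \<sigma> * lam n \<omega>"
    using bound
  proof eventually_elim
    case (elim \<omega>)
    have "inf_lam \<sigma> \<omega> \<le> clip \<sigma> n \<omega>" for n unfolding inf_lam_def by (rule cINF_lower[OF clip_bdd UNIV_I])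
    then show ?case using clip_eq[OF \<sigma>] elim by metis
  qed
qed

lemma num_range_le_B:
  assumes \<sigma>: "\<bar>\<sigma>\<bar> = 1" and q: "q \<in> num_range M N T" shows "AE \<omega> in M. - B \<le> \<sigma> * q \<omega>"
proof (rule num_range_bound[OF q])
  show "AE \<omega> in M. \<forall>n. fun_norm N (x n) \<omega> \<noteq> 0 \<longrightarrow> - B \<le> \<sigma> * lam n \<omega>"
    using bound
  proof eventually_elim
    case (elim \<omega>)
    have "\<bar>\<sigma> * lam n \<omega>\<bar> \<le> B" for n using elim \<sigma> by (simp add: abs_mult)
    then show ?case by (meson abs_le_D2 minus_le_iff)
  qed
qed

text \<open>The countably many elements \<open>qp n\<close> of the numerical range suffice. Over
  fibres where \<open>x n\<close> vanishes, \<open>qp n\<close> is some value of the form, and its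
  bound \<open>B\<close> is what \<open>clip\<close> prescribes.\<close>

lemma inf_lam_greatest:
  assumes \<sigma>: "\<bar>\<sigma>\<bar> = 1" and h: "\<And>q. q \<in> num_range M N T \<Longrightarrow> AE \<omega> in M. h \<omega> \<le> \<sigma> * q \<omega>"
  shows "AE \<omega> in M. h \<omega> \<le> inf_lam \<sigma> \<omega>"
proof -
  have "AE \<omega> in M. \<forall>n. h \<omega> \<le> \<sigma> * qp n \<omega>" unfolding AE_all_countable using h qp_num_range by blast
  moreover have "AE \<omega> in M. \<forall>n. fun_norm N (x n) \<omega> \<noteq> 0 \<longrightarrow> qp n \<omega> = lam n \<omega>" unfolding AE_all_countable using qp_lam by blast
  moreover have "AE \<omega> in M. \<forall>n. - B \<le> (- \<sigma>) * qp n \<omega>"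
    unfolding AE_all_countable using num_range_le_B[of "-\<sigma>"] qp_num_range \<sigma> by simp
  ultimately show ?thesis using bound
  proof eventually_elim
    case (elim \<omega>)
    show ?case unfolding inf_lam_def
    proof (rule cINF_greatest)
      fix n
      show "h \<omega> \<le> clip \<sigma> n \<omega>"
      proof (cases "fun_norm N (x n) \<omega> = 0")
        case True
        have "h \<omega> \<le> \<sigma> * qp n \<omega>" using elim(1) by blast
        moreover have "- B \<le> (- \<sigma>) * qp n \<omega>" using elim(3) by blast
        ultimately show ?thesis using True by (simp add: clip_def)
      next
        case False
        then have "clip \<sigma> n \<omega> = \<sigma> * lam n \<omega>" using clip_eq[OF \<sigma>] elim(4) by blast
        then show ?thesis using elim(1,2) False by metis
      qed
    qed simp
  qed
qed

lemma lower_bound_inf: "is_L0_inf M (num_range M N T) (lower_bound M N T)"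
  unfolding lower_bound_def
proof (rule someI[of _ "inf_lam 1"])
  show "is_L0_inf M (num_range M N T) (inf_lam 1)"
    unfolding is_L0_inf_def using inf_lam_measurable inf_lam_le[of 1] inf_lam_greatest[of 1] by auto
qed

text \<open>Reflection at \<open>0\<close>: the supremum is minus the infimum of the negated
  values.\<close>

lemma upper_bound_sup: "is_L0_sup M (num_range M N T) (upper_bound M N T)"
  unfolding upper_bound_def
proof (rule someI[of _ "\<lambda>\<omega>. - inf_lam (-1) \<omega>"])
  show "is_L0_sup M (num_range M N T) (\<lambda>\<omega>. - inf_lam (-1) \<omega>)"
    unfolding is_L0_sup_def
  proof (intro conjI ballI impI)
    show "(\<lambda>\<omega>. - inf_lam (-1) \<omega>) \<in> borel_measurable M" using inf_lam_measurable by measurable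
    show "AE \<omega> in M. q \<omega> \<le> - inf_lam (- 1) \<omega>" if "q \<in> num_range M N T" for q
      using inf_lam_le[OF _ that, of "-1"] by (auto elim!: eventually_mono)
    fix h assume h: "\<forall>f\<in>num_range M N T. AE \<omega> in M. f \<omega> \<le> h \<omega>"
    have "AE \<omega> in M. - h \<omega> \<le> inf_lam (-1) \<omega>"
    proof (rule inf_lam_greatest)
      show "AE \<omega> in M. - h \<omega> \<le> -1 * q \<omega>" if "q \<in> num_range M N T" for q
        using bspec[OF h that] by (auto elim!: eventually_mono)
    qed simp
    then show "AE \<omega> in M. - inf_lam (- 1) \<omega> \<le> h \<omega>" by (auto elim!: eventually_mono)
  qed
qed

lemma bounds_props:
  shows "lower_bound M N T \<in> borel_measurable M" "upper_bound M N T \<in> borel_measurable M"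
    "AE \<omega> in M. lower_bound M N T \<omega> \<le> upper_bound M N T \<omega>"
    "AE \<omega> in M. - B \<le> lower_bound M N T \<omega> \<and> upper_bound M N T \<omega> \<le> B"
    "AE \<omega> in M. \<forall>n. fun_norm N (x n) \<omega> \<noteq> 0 \<longrightarrow> lower_bound M N T \<omega> \<le> lam n \<omega> \<and> lam n \<omega> \<le> upper_bound M N T \<omega>"
proof -
  note L = lower_bound_inf[unfolded is_L0_inf_def] and U = upper_bound_sup[unfolded is_L0_sup_def]
  show "lower_bound M N T \<in> borel_measurable M" "upper_bound M N T \<in> borel_measurable M" using L U by auto
  have lq: "AE \<omega> in M. lower_bound M N T \<omega> \<le> qp n \<omega>" and uq: "AE \<omega> in M. qp n \<omega> \<le> upper_bound M N T \<omega>" for n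
    using L U qp_num_range by auto
  show "AE \<omega> in M. lower_bound M N T \<omega> \<le> upper_bound M N T \<omega>"
    using lq[of 0] uq[of 0] by eventually_elim simp
  have "AE \<omega> in M. - B \<le> lower_bound M N T \<omega>"
  proof -
    have "h \<in> borel_measurable M \<Longrightarrow> \<forall>f\<in>num_range M N T. AE \<omega> in M. h \<omega> \<le> f \<omega> \<Longrightarrow> AE \<omega> in M. h \<omega> \<le> lower_bound M N T \<omega>" for h
      using L by blast
    from this[of "\<lambda>_. - B"] show ?thesis using num_range_le_B[of 1] by simp
  qed
  moreover have "AE \<omega> in M. upper_bound M N T \<omega> \<le> B"
  proof -
    have "h \<in> borel_measurable M \<Longrightarrow> \<forall>f\<in>num_range M N T. AE \<omega> in M. f \<omega> \<le> h \<omega> \<Longrightarrow> AE \<omega> in M. upper_bound M N T \<omega> \<le> h \<omega>" for h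
      using U by blast
    from this[of "\<lambda>_. B"] show ?thesis using num_range_le_B[of "-1"] by simp
  qed
  ultimately show "AE \<omega> in M. - B \<le> lower_bound M N T \<omega> \<and> upper_bound M N T \<omega> \<le> B" by eventually_elim simp
  have "AE \<omega> in M. \<forall>n. fun_norm N (x n) \<omega> \<noteq> 0 \<longrightarrow> qp n \<omega> = lam n \<omega>"
    "AE \<omega> in M. \<forall>n. lower_bound M N T \<omega> \<le> qp n \<omega>" "AE \<omega> in M. \<forall>n. qp n \<omega> \<le> upper_bound M N T \<omega>"
    unfolding AE_all_countable using qp_lam lq uq by blast+
  then show "AE \<omega> in M. \<forall>n. fun_norm N (x n) \<omega> \<noteq> 0 \<longrightarrow> lower_bound M N T \<omega> \<le> lam n \<omega> \<and> lam n \<omega> \<le> upper_bound M N T \<omega>"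
    by eventually_elim metis
qed

end

text \<open>If \<open>N\<close> is the zero measure, nothing is known about the bounds of the
  numerical range, but all vectors are null and the claim is void.\<close>

lemma AE_nonzero_case:
  assumes "measure N (space N) > 0 \<Longrightarrow> AE \<omega> in M. \<forall>n. fun_norm N (x n) \<omega> \<noteq> 0 \<longrightarrow> P n \<omega>"
  shows "AE \<omega> in M. \<forall>n. fun_norm N (x n) \<omega> \<noteq> 0 \<longrightarrow> P n \<omega>"
proof (cases "measure N (space N) > 0")
  case False
  then have "fun_norm N (x n) \<omega> = 0" for n \<omega> using fun_norm_nonzero_pos[of "x n" \<omega>] by auto
  then show ?thesis by simp
qed (rule assms)

section \<open>Spectral integrals of the operator and of its functions\<close>

context
  fixes \<epsilon> :: real assumes \<epsilon>: "\<epsilon> > 0"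
begin

abbreviation (input) "lo \<equiv> lower_bound M N T"
abbreviation (input) "up \<equiv> (\<lambda>\<omega>. upper_bound M N T \<omega> + \<epsilon>)"

lemma lam_interval: "AE \<omega> in M. \<forall>n. fun_norm N (x n) \<omega> \<noteq> 0 \<longrightarrow> lam n \<omega> \<in> {lo \<omega>..up \<omega>}"
proof (rule AE_nonzero_case)
  assume "measure N (space N) > 0"
  from bounds_props(5)[OF this] show "AE \<omega> in M. \<forall>n. fun_norm N (x n) \<omega> \<noteq> 0 \<longrightarrow> lam n \<omega> \<in> {lo \<omega>..up \<omega>}"
    by eventually_elim (use \<epsilon> in fastforce)
qed

lemma T_spectral_integral: "has_spectral_integral M N lam x (\<lambda>\<omega>. complex_of_real) lo up T"
proof (rule has_spectral_integral_diag[where C = "B + \<epsilon>"])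
  show "AE \<omega> in M. \<forall>n. fun_norm N (x n) \<omega> \<noteq> 0 \<longrightarrow> (\<forall>r\<in>{lo \<omega>..up \<omega>}. cmod (complex_of_real r) \<le> B + \<epsilon>)"
  proof (rule AE_nonzero_case)
    assume "measure N (space N) > 0"
    from bounds_props(4)[OF this] show "AE \<omega> in M. \<forall>n. fun_norm N (x n) \<omega> \<noteq> 0 \<longrightarrow> (\<forall>r\<in>{lo \<omega>..up \<omega>}. cmod (complex_of_real r) \<le> B + \<epsilon>)"
    proof eventually_elim
      case (elim \<omega>)
      have "\<bar>r\<bar> \<le> B + \<epsilon>" if "r \<in> {lo \<omega>..up \<omega>}" for r using that elim \<epsilon> by auto
      then show ?case by simp
    qed
  qed
  show "AE \<omega> in M. continuous_on {lo \<omega>..up \<omega>} complex_of_real" by (intro AE_I2 continuous_intros)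
  show "AE \<omega> in M. L2_tendsto N (\<lambda>K. curry (partial (\<lambda>n \<omega>. complex_of_real (lam n \<omega>)) g K) \<omega>) (curry (T g) \<omega>)" if "g \<in> L22 M N" for g
    by (rule T_expansion(1)[OF that])
qed (use B0 \<epsilon> lam_interval T_L22 in \<open>auto intro: borel_measurable_of_real\<close>)

text \<open>Both sides are the diagonal operator with multipliers
  \<open>\<phi> \<omega> (lam n \<omega>)\<close>. On what the sequence misses, the functional
  calculus gives \<phi> at \<open>0\<close> and the integral gives nothing, hence the condition
  \<open>zero\<close>.\<close>

lemma fun_calc_spectral_integral:
  assumes \<phi>: "fibrewise_continuous M lo up \<phi>" and zero: "L2_separable N \<or> (AE \<omega> in M. \<phi> \<omega> 0 = 0)"
  shows "\<exists>\<Phi>. is_fun_calc_op M N k \<phi> \<Phi> \<and> has_spectral_integral M N lam x \<phi> lo up \<Phi>"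
proof -
  have meas: "\<And>l. l \<in> borel_measurable M \<Longrightarrow> AE \<omega> in M. l \<omega> \<in> {lo \<omega>..up \<omega>} \<Longrightarrow> (\<lambda>\<omega>. \<phi> \<omega> (l \<omega>)) \<in> borel_measurable M"
    and cont: "AE \<omega> in M. continuous_on {lo \<omega>..up \<omega>} (\<phi> \<omega>)"
    using \<phi> by (auto simp: fibrewise_continuous_def)
  obtain C where C: "AE \<omega> in M. \<forall>r\<in>{lo \<omega>..up \<omega>}. cmod (\<phi> \<omega> r) \<le> C" using \<phi> by (auto simp: fibrewise_continuous_def)
  \<comment> \<open>At a zero vector \<open>lam n \<omega>\<close> is \<open>0\<close>, which may
    lie outside the interval, where nothing is known about \<phi>, not even measurability; the
    multiplier is set to \<open>0\<close> there.\<close>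
  define c where "c n \<omega> = (if fun_norm N (x n) \<omega> \<noteq> 0 then \<phi> \<omega> (lam n \<omega>) else 0)" for n \<omega>
  have cm: "c n \<in> borel_measurable M" for n
  proof (cases "measure N (space N) > 0")
    case True
    note bp = bounds_props[OF True]
    define l where "l \<omega> = (if fun_norm N (x n) \<omega> \<noteq> 0 then lam n \<omega> else lo \<omega>)" for \<omega>
    note [measurable] = fun_norm_meas[OF x_meas] bp(1)
    have [measurable]: "(\<lambda>\<omega>. \<phi> \<omega> (l \<omega>)) \<in> borel_measurable M"
    proof (rule meas)
      show "l \<in> borel_measurable M" unfolding l_def[abs_def] by measurable
      show "AE \<omega> in M. l \<omega> \<in> {lo \<omega>..up \<omega>}" using lam_interval bp(3) by eventually_elim (use \<epsilon> in \<open>auto simp: l_def\<close>)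
    qed
    have "c n = (\<lambda>\<omega>. if fun_norm N (x n) \<omega> \<noteq> 0 then \<phi> \<omega> (l \<omega>) else 0)" by (auto simp: c_def l_def)
    then show ?thesis by simp
  next
    case False
    then have "c n = (\<lambda>\<omega>. 0)" using fun_norm_nonzero_pos[of "x n"] by (intro ext) (auto simp: c_def)
    then show ?thesis by simp
  qed
  have bd: "AE \<omega> in M. \<forall>n. fun_norm N (x n) \<omega> \<noteq> 0 \<longrightarrow> cmod (c n \<omega>) \<le> \<bar>C\<bar>"
    using lam_interval C by eventually_elim (auto simp: c_def intro: order_trans[OF _ abs_ge_self])
  have "\<exists>G. G \<in> borel_measurable (M \<Otimes>\<^sub>M N) \<and> (AE \<omega> in M. L2_tendsto N (\<lambda>K. curry (partial c g K) \<omega>) (curry G \<omega>)) \<and>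
    L22_tendsto M N (partial c g) G" if g: "g \<in> L22 M N" for g
    by (rule partial_limit[where c = c and C = "\<bar>C\<bar>", OF cm g bd]) auto
  then obtain \<Phi> where \<Phi>: "\<And>g. g \<in> L22 M N \<Longrightarrow> AE \<omega> in M. L2_tendsto N (\<lambda>K. curry (partial c g K) \<omega>) (curry (\<Phi> g) \<omega>)"
    "\<And>g. g \<in> L22 M N \<Longrightarrow> L22_tendsto M N (partial c g) (\<Phi> g)" by metis
  have \<Phi>22: "\<Phi> g \<in> L22 M N" if "g \<in> L22 M N" for g using \<Phi>(2)[OF that] by (simp add: L22_tendsto_def)
  have \<Phi>t: "AE \<omega> in M. L2_tendsto N (\<lambda>K. curry (partial (\<lambda>n \<omega>. \<phi> \<omega> (lam n \<omega>)) g K) \<omega>) (curry (\<Phi> g) \<omega>)" if g: "g \<in> L22 M N" for g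
    using es L22_sections[OF g] \<Phi>(1)[OF g]
  proof eventually_elim
    case (elim \<omega>)
    show ?case unfolding partial_curry
      by (rule eig.diag_tendsto_cong[where a = "\<lambda>n. c n \<omega>", OF elim(1) _ elim(2)])
        (use elim(3) in \<open>simp_all add: c_def fun_norm_def partial_curry\<close>)
  qed
  have "is_fun_calc_op M N k \<phi> \<Phi>"
    unfolding is_fun_calc_op_def
  proof (intro ballI conjI)
    fix g assume g: "g \<in> L22 M N"
    show "\<Phi> g \<in> L22 M N" by (rule \<Phi>22[OF g])
    have zero': "AE \<omega> in M. L2_separable N \<or> \<phi> \<omega> 0 = 0" using zero by (auto elim!: eventually_mono)
    show "AE \<omega> in M. has_fun_calc N (fibre_op N k \<omega>) (\<phi> \<omega>) (curry g \<omega>) (curry (\<Phi> g) \<omega>)"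
      using es L22_sections[OF g] \<Phi>t[OF g] lam_interval cont complete infinite zero'
    proof eventually_elim
      case (elim \<omega>)
      interpret eig N "fibre_op N k \<omega>" "\<lambda>n. lam n \<omega>" "\<lambda>n. curry (x n) \<omega>" by (rule elim(1))
      have ly: "lam n \<omega> \<in> {lo \<omega>..up \<omega>}" if "L2_norm N (curry (x n) \<omega>) \<noteq> 0" for n
        using elim(4) that by (simp add: fun_norm_def)
      have comp: "Fourier_sum N (\<lambda>n. curry (x n) \<omega>) h" if "L2_separable N" "h \<in> L2 N" for h using elim(6) that by blast
      show ?case
      proof (rule has_fun_calc_diag[OF elim(2,5) ly])
        show "r \<in> {lo \<omega>..up \<omega>}" if r: "complex_of_real r \<in> L2_spectrum N (fibre_op N k \<omega>)" for r
          using spectrum_sub[OF r comp]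
        proof
          assume "\<exists>n. L2_norm N (curry (x n) \<omega>) \<noteq> 0 \<and> complex_of_real r = complex_of_real (lam n \<omega>)"
          then show ?thesis using ly by auto
        next
          assume z: "complex_of_real r = 0 \<and> \<not> L2_fin_dim N (L2 N)"
          \<comment> \<open>In infinite dimension every vector is non-zero, so the closed interval
            contains all eigenvalues and their limit \<open>0\<close>.\<close>
          then have "lam n \<omega> \<in> {lo \<omega>..up \<omega>}" for n using elim(7) ly by simp
          then have "0 \<in> {lo \<omega>..up \<omega>}"
            using closed_sequentially[OF closed_atLeastAtMost _ l_lim] by blast
          then show ?thesis using z by simp
        qed
        show "Fourier_sum N (\<lambda>n. curry (x n) \<omega>) (curry g \<omega>) \<or> 0 \<in> L2_spectrum N (fibre_op N k \<omega>) \<and> \<phi> \<omega> 0 = 0"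
        proof (cases "L2_separable N")
          case True
          then show ?thesis using comp elim(2) by blast
        next
          case False
          then have "\<not> L2_fin_dim N (L2 N)" using fin_dim_separable by blast
          then have "0 \<in> L2_spectrum N (fibre_op N k \<omega>)" using elim(7) by (intro zero_in_spectrum) simp
          then show ?thesis using elim(8) False by simp
        qed
        show "L2_tendsto N (\<lambda>K s. \<Sum>n<K. \<phi> \<omega> (lam n \<omega>) * L2_inner N (curry g \<omega>) (curry (x n) \<omega>) * curry (x n) \<omega> s) (curry (\<Phi> g) \<omega>)"
          using elim(3) unfolding partial_curry .
      qed
    qed
  qed
  moreover have "has_spectral_integral M N lam x \<phi> lo up \<Phi>"
  proof (rule has_spectral_integral_diag[where C = "\<bar>C\<bar>", OF meas cont])
    show "AE \<omega> in M. \<forall>n. fun_norm N (x n) \<omega> \<noteq> 0 \<longrightarrow> (\<forall>r\<in>{lo \<omega>..up \<omega>}. cmod (\<phi> \<omega> r) \<le> \<bar>C\<bar>)"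
      using C by eventually_elim (auto intro: order_trans[OF _ abs_ge_self])
  qed (use lam_interval \<Phi>22 \<Phi>t in auto)
  ultimately show ?thesis by blast
qed

end

subsection \<open>The spectrum\<close>

text \<open>Zero vectors carry the eigenvalue \<open>0\<close>, which belongs to
  \<open>fibre_sp\<close> by definition.\<close>

lemma fibre_sp_eq: "AE \<omega> in M. fibre_sp N k \<omega> = range (\<lambda>n. complex_of_real (lam n \<omega>)) \<union> {0}"
  using es complete
proof eventually_elim
  case (elim \<omega>)
  interpret eig N "fibre_op N k \<omega>" "\<lambda>n. lam n \<omega>" "\<lambda>n. curry (x n) \<omega>" by (rule elim(1))
  have "complex_of_real (lam n \<omega>) \<in> L2_spectrum N (fibre_op N k \<omega>) \<union> {0}" for n
    using eigenvalue_in_spectrum[of n] l_null[of n] by (cases "L2_norm N (curry (x n) \<omega>) = 0") auto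
  moreover have "z \<in> range (\<lambda>n. complex_of_real (lam n \<omega>)) \<union> {0}" if "z \<in> L2_spectrum N (fibre_op N k \<omega>)" for z
    using spectrum_sub[OF that] elim(2) by blast
  ultimately show ?case unfolding fibre_sp_def by blast
qed

lemma eigenvalue_sum_value:
  fixes v :: "nat \<Rightarrow> real"
  assumes "disjoint_family A"
  shows "\<omega> \<in> A n \<Longrightarrow> (\<Sum>n. indicator (A n) \<omega> * v n) = v n" "(\<And>n. \<omega> \<notin> A n) \<Longrightarrow> (\<Sum>n. indicator (A n) \<omega> * v n) = 0"
proof -
  assume n: "\<omega> \<in> A n"
  have "indicator (A m) \<omega> * v m = 0" if "m \<noteq> n" for m
    using assms n that by (auto simp: disjoint_family_on_def indicator_def)
  then have "(\<Sum>n. indicator (A n) \<omega> * v n) = (\<Sum>m\<in>{n}. indicator (A m) \<omega> * v m)"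
    by (intro suminf_finite) auto
  then show "(\<Sum>n. indicator (A n) \<omega> * v n) = v n" using n by simp
qed simp

lemma spm_eq: "spm M N k = mix_hull M M (\<lambda>\<omega>. \<omega>) (eigenvalue_sums M lam)"
proof (intro set_eqI iffI)
  define val where "val n \<omega> = (case n of 0 \<Rightarrow> 0 | Suc m \<Rightarrow> lam m \<omega>)" for n \<omega>
  have [measurable]: "val n \<in> borel_measurable M" for n unfolding val_def[abs_def] by (cases n) auto
  {
    fix l assume "l \<in> spm M N k"
    then have lm[measurable]: "l \<in> borel_measurable M" and ls: "AE \<omega> in M. complex_of_real (l \<omega>) \<in> fibre_sp N k \<omega>"
      by (auto simp: spm_def)
    have "AE \<omega> in M. \<exists>n. l \<omega> = val n \<omega>"
      using ls fibre_sp_eq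
    proof eventually_elim
      case (elim \<omega>)
      then have "l \<omega> = 0 \<or> (\<exists>n. l \<omega> = lam n \<omega>)" by auto
      then show ?case
      proof
        assume "l \<omega> = 0" then show ?thesis by (intro exI[of _ 0]) (simp add: val_def)
      next
        assume "\<exists>n. l \<omega> = lam n \<omega>"
        then obtain n where "l \<omega> = lam n \<omega>" ..
        then show ?thesis by (intro exI[of _ "Suc n"]) (simp add: val_def)
      qed
    qed
    \<comment> \<open>Taking the first matching index makes the sets disjoint.\<close>
    define A where "A n = {\<omega> \<in> space M. l \<omega> = val n \<omega> \<and> (\<forall>m<n. l \<omega> \<noteq> val m \<omega>)}" for n
    have A: "A n \<in> sets M" for n unfolding A_def by measurable
    have disj: "disjoint_family A"
      unfolding disjoint_family_on_def
    proof (intro ballI impI)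
      fix m n :: nat assume "m \<noteq> n"
      then show "A m \<inter> A n = {}" by (elim linorder_neqE_nat) (fastforce simp: A_def)+
    qed
    define u where "u = (\<lambda>\<omega>. \<Sum>n. indicator (A n) \<omega> * val n \<omega>)"
    have "u \<in> eigenvalue_sums M lam"
      unfolding eigenvalue_sums_def u_def val_def using A disj by blast
    moreover have "AE \<omega> in M. l \<omega> = u \<omega>"
    proof -
      have "AE \<omega> in M. \<omega> \<in> space M" by simp
      with \<open>AE \<omega> in M. \<exists>n. l \<omega> = val n \<omega>\<close> show ?thesis
      proof eventually_elim
        case (elim \<omega>)
        define n where "n = (LEAST n. l \<omega> = val n \<omega>)"
        have "l \<omega> = val n \<omega>" unfolding n_def using elim(1) by (rule LeastI_ex)
        moreover have "\<forall>m<n. l \<omega> \<noteq> val m \<omega>" unfolding n_def using not_less_Least by blast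
        ultimately have "\<omega> \<in> A n" using elim(2) by (simp add: A_def)
        then show ?case using eigenvalue_sum_value(1)[OF disj, of \<omega> n "\<lambda>n. val n \<omega>"] \<open>l \<omega> = val n \<omega>\<close> by (simp add: u_def)
      qed
    qed
    \<comment> \<open>A one-piece mixing absorbs the difference between \<open>l\<close> and the sum
      \<open>u\<close> on a null set.\<close>
    moreover have "partition_of_unity M {0::nat} (\<lambda>_. space M)" by (simp add: partition_of_unity_def)
    ultimately show "l \<in> mix_hull M M (\<lambda>\<omega>. \<omega>) (eigenvalue_sums M lam)"
      unfolding mix_hull_def is_mixing_def using lm
      by (intro CollectI exI[of _ "{0::nat}"] exI[of _ "\<lambda>_. space M"] exI[of _ "\<lambda>_. u"]) (auto elim!: eventually_mono)
  next
    fix v assume "v \<in> mix_hull M M (\<lambda>\<omega>. \<omega>) (eigenvalue_sums M lam)"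
    then obtain I :: "nat set" and A u where pu: "partition_of_unity M I A" and u: "\<And>i. i \<in> I \<Longrightarrow> u i \<in> eigenvalue_sums M lam"
      and v: "v \<in> borel_measurable M" "\<And>i. i \<in> I \<Longrightarrow> AE \<omega> in M. \<omega> \<in> A i \<longrightarrow> v \<omega> = u i \<omega>"
      unfolding mix_hull_def is_mixing_def by blast
    have Am: "\<And>i. i \<in> I \<Longrightarrow> A i \<in> sets M" using pu by (simp add: partition_of_unity_def)
    have U: "(\<Union>i\<in>I. A i) \<in> sets M" by (rule sets.countable_UN'') (use Am in auto)
    \<comment> \<open>The supremum property of the partition is tested on the union of its members,
      which is measurable because the index set is countable.\<close>
    have "A i - (\<Union>i\<in>I. A i) \<in> null_sets M" if "i \<in> I" for i
    proof -
      have e: "A i - (\<Union>i\<in>I. A i) = {}" using that by auto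
      show ?thesis unfolding e by simp
    qed
    then have "space M - (\<Union>i\<in>I. A i) \<in> null_sets M" using pu U unfolding partition_of_unity_def by blast
    then have "AE \<omega> in M. \<omega> \<notin> space M - (\<Union>i\<in>I. A i)" by (rule AE_not_in)
    moreover have "AE \<omega> in M. \<forall>i\<in>I. \<omega> \<in> A i \<longrightarrow> v \<omega> = u i \<omega>"
      by (rule AE_ball_countable'[OF v(2)]) auto
    moreover have "AE \<omega> in M. \<omega> \<in> space M" by simp
    ultimately have "AE \<omega> in M. complex_of_real (v \<omega>) \<in> fibre_sp N k \<omega>"
      using fibre_sp_eq
    proof eventually_elim
      case (elim \<omega>)
      then obtain i where i: "i \<in> I" "\<omega> \<in> A i" "v \<omega> = u i \<omega>" by blast
      from u[OF i(1)] obtain A' :: "nat \<Rightarrow> 'a set" where A': "disjoint_family A'"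
        "u i = (\<lambda>\<omega>. \<Sum>n. indicator (A' n) \<omega> * (case n of 0 \<Rightarrow> 0 | Suc m \<Rightarrow> lam m \<omega>))"
        unfolding eigenvalue_sums_def by blast
      then have ui: "u i \<omega> = (\<Sum>n. indicator (A' n) \<omega> * val n \<omega>)" by (simp add: val_def)
      have "u i \<omega> = 0 \<or> (\<exists>n. u i \<omega> = val n \<omega>)"
      proof (cases "\<exists>n. \<omega> \<in> A' n")
        case True
        then obtain n where "\<omega> \<in> A' n" ..
        then show ?thesis using eigenvalue_sum_value(1)[OF A'(1), of \<omega> n "\<lambda>n. val n \<omega>"] ui by metis
      next
        case False
        then show ?thesis using eigenvalue_sum_value(2)[OF A'(1), of \<omega> "\<lambda>n. val n \<omega>"] ui by metis
      qed
      moreover have "val n \<omega> = 0 \<or> (\<exists>m. val n \<omega> = lam m \<omega>)" for n by (cases n) (auto simp: val_def)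
      ultimately have "v \<omega> = 0 \<or> (\<exists>n. v \<omega> = lam n \<omega>)" using i(3) by fastforce
      then show ?case using elim(4) by auto
    qed
    then show "v \<in> spm M N k" using v(1) by (simp add: spm_def)
  }
qed

subsection \<open>Eigenspaces\<close>

lemma fibre_ker_L2: "f \<in> fibre_ker N k l \<omega> \<Longrightarrow> f \<in> L2 N" by (simp add: fibre_ker_def)

text \<open>A finite-dimensional kernel contains only finitely many of the non-zero eigenvectors, so
  the space is partitioned by the bound \<open>J\<close> on their indices. The generators are the
  fields \<open>x i\<close> cut down to the fibres where \<open>lam i\<close> agrees with
  \<open>l\<close>; being of norm at most one, they are square integrable over the finite measure
  \<open>M\<close>, and the coefficients are Fourier coefficients.\<close>

lemma ker22_sigma_fin_gen:
  assumes l: "l \<in> spm_disc M N k lam" shows "sigma_fin_gen_module M N (ker22 M N k l)"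
  unfolding sigma_fin_gen_module_def
proof (intro conjI ballI impI)
  have lm[measurable]: "l \<in> borel_measurable M" and fd: "AE \<omega> in M. L2_fin_dim N (fibre_ker N k l \<omega>)"
    using l by (auto simp: spm_disc_def spm_def)
  {
    fix f g assume f: "f \<in> ker22 M N k l" and g: "g \<in> ker22 M N k l"
    have "AE \<omega> in M. curry (\<lambda>z. f z + g z) \<omega> \<in> fibre_ker N k l \<omega>"
    proof -
      have "AE \<omega> in M. curry f \<omega> \<in> fibre_ker N k l \<omega>" "AE \<omega> in M. curry g \<omega> \<in> fibre_ker N k l \<omega>" using f g by (auto simp: ker22_def)
      with es show ?thesis
      proof eventually_elim
        case (elim \<omega>)
        interpret eig N "fibre_op N k \<omega>" "\<lambda>n. lam n \<omega>" "\<lambda>n. curry (x n) \<omega>" by (rule elim(1))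
        have fL: "curry f \<omega> \<in> L2 N" and gL: "curry g \<omega> \<in> L2 N"
          and fk: "AE t in N. complex_of_real (l \<omega>) * curry f \<omega> t - fibre_op N k \<omega> (curry f \<omega>) t = 0"
          and gk: "AE t in N. complex_of_real (l \<omega>) * curry g \<omega> t - fibre_op N k \<omega> (curry g \<omega>) t = 0"
          using elim(2,3) by (auto simp: fibre_ker_def)
        have "AE t in N. complex_of_real (l \<omega>) * (curry f \<omega> t + curry g \<omega> t) - fibre_op N k \<omega> (\<lambda>s. curry f \<omega> s + curry g \<omega> s) t = 0"
          using fk gk A_add[OF fL gL] by eventually_elim (simp add: distrib_left)
        then show ?case unfolding fibre_ker_def curry_add using L2_add[OF fL gL] by simp
      qed
    qed
    then show "(\<lambda>z. f z + g z) \<in> ker22 M N k l" using f g L22_add by (auto simp: ker22_def)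
  next
    fix \<alpha> :: "'a \<Rightarrow> complex" and f assume f: "f \<in> ker22 M N k l" and p: "(\<lambda>(\<omega>, t). \<alpha> \<omega> * f (\<omega>, t)) \<in> L22 M N"
    have c: "curry (\<lambda>(\<omega>, t). \<alpha> \<omega> * f (\<omega>, t)) \<omega> = (\<lambda>s. \<alpha> \<omega> * curry f \<omega> s)" for \<omega> by (simp add: curry_def)
    have "AE \<omega> in M. curry f \<omega> \<in> fibre_ker N k l \<omega>" using f by (auto simp: ker22_def)
    with es have "AE \<omega> in M. curry (\<lambda>(\<omega>, t). \<alpha> \<omega> * f (\<omega>, t)) \<omega> \<in> fibre_ker N k l \<omega>"
    proof eventually_elim
      case (elim \<omega>)
      interpret eig N "fibre_op N k \<omega>" "\<lambda>n. lam n \<omega>" "\<lambda>n. curry (x n) \<omega>" by (rule elim(1))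
      have fL: "curry f \<omega> \<in> L2 N"
        and fk: "AE t in N. complex_of_real (l \<omega>) * curry f \<omega> t - fibre_op N k \<omega> (curry f \<omega>) t = 0"
        using elim(2) by (auto simp: fibre_ker_def)
      have "AE t in N. complex_of_real (l \<omega>) * (\<alpha> \<omega> * curry f \<omega> t) - fibre_op N k \<omega> (\<lambda>s. \<alpha> \<omega> * curry f \<omega> s) t = 0"
        using fk A_scale[OF fL, of "\<alpha> \<omega>"] by eventually_elim (simp add: mult.left_commute)
      then show ?case unfolding fibre_ker_def c using L2_scale[OF fL] by simp
    qed
    then show "(\<lambda>(\<omega>, t). \<alpha> \<omega> * f (\<omega>, t)) \<in> ker22 M N k l" using p by (simp add: ker22_def)
  }
  define P where "P n \<omega> \<longleftrightarrow> fun_norm N (x n) \<omega> \<noteq> 0 \<and> lam n \<omega> = l \<omega>" for n \<omega>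
  note [measurable] = fun_norm_meas[OF x_meas]
  have [measurable]: "Measurable.pred M (P n)" for n unfolding P_def[abs_def] by measurable
  \<comment> \<open>Where no bound exists the least index is arbitrary; this happens on a null set
    only.\<close>
  define J where "J \<omega> = (LEAST j. \<forall>n\<ge>j. \<not> P n \<omega>)" for \<omega>
  have [measurable]: "J \<in> measurable M (count_space UNIV)" unfolding J_def[abs_def] by measurable
  define D where "D j = {\<omega> \<in> space M. J \<omega> = j}" for j
  have D: "D j \<in> sets M" for j unfolding D_def by measurable
  define g where "g i z = (if P i (fst z) then x i z else 0)" for i z
  have gm: "g i \<in> borel_measurable (M \<Otimes>\<^sub>M N)" for i unfolding g_def[abs_def] by measurable
  have gc: "curry (g i) \<omega> = (if P i \<omega> then curry (x i) \<omega> else (\<lambda>s. 0))" for i \<omega> by (auto simp: g_def curry_def)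
  have g_sec: "AE \<omega> in M. curry (g i) \<omega> \<in> fibre_ker N k l \<omega> \<and> fun_norm N (g i) \<omega> \<le> 1" for i
    using es
  proof eventually_elim
    case (elim \<omega>)
    interpret eig N "fibre_op N k \<omega>" "\<lambda>n. lam n \<omega>" "\<lambda>n. curry (x n) \<omega>" by (rule elim)
    show ?case
    proof (cases "P i \<omega>")
      case True
      have "AE t in N. complex_of_real (l \<omega>) * curry (x i) \<omega> t - fibre_op N k \<omega> (curry (x i) \<omega>) t = 0"
        using A_y[of i] True by (auto simp: P_def elim!: eventually_mono)
      then show ?thesis using True y_L2[of i] norm_y[of i] by (auto simp: gc fibre_ker_def fun_norm_def)
    next
      case False
      then show ?thesis by (simp add: gc fibre_ker_def fun_norm_def fibre_op_def)
    qed
  qed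
  have gk: "g i \<in> ker22 M N k l" for i
  proof -
    have "integrable M (\<lambda>\<omega>. (fun_norm N (g i) \<omega>)\<^sup>2)"
    proof (rule M.integrable_const_bound[of _ 1])
      show "AE \<omega> in M. norm ((fun_norm N (g i) \<omega>)\<^sup>2) \<le> 1"
        using g_sec[of i] by eventually_elim (simp add: power_le_one)
      show "(\<lambda>\<omega>. (fun_norm N (g i) \<omega>)\<^sup>2) \<in> borel_measurable M" using fun_norm_meas[OF gm[of i]] by measurable
    qed
    moreover have "AE \<omega> in M. curry (g i) \<omega> \<in> L2 N" "AE \<omega> in M. curry (g i) \<omega> \<in> fibre_ker N k l \<omega>"
      using g_sec[of i] by (auto elim!: eventually_mono intro: fibre_ker_L2)
    ultimately show ?thesis using gm by (simp add: ker22_def L22_def)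
  qed
  have exp: "\<exists>c :: nat \<Rightarrow> 'a \<Rightarrow> complex. (\<forall>i<j. c i \<in> borel_measurable M) \<and>
           (AE z in M \<Otimes>\<^sub>M N. indicator (D j) (fst z) * f z = (\<Sum>i<j. c i (fst z) * (indicator (D j) (fst z) * g i z)))"
    if f: "f \<in> ker22 M N k l" for f j
  proof -
    have f22: "f \<in> L22 M N" and fs: "AE \<omega> in M. curry f \<omega> \<in> fibre_ker N k l \<omega>" using f by (auto simp: ker22_def)
    note fm[measurable] = L22_measurable[OF f22]
    have cm[measurable]: "fun_inner N f (x i) \<in> borel_measurable M" for i by (rule fun_inner_measurable[OF finite_N fm x_meas])
    note [measurable] = gm D
    have "AE z in M \<Otimes>\<^sub>M N. indicator (D j) (fst z) * f z = (\<Sum>i<j. fun_inner N f (x i) (fst z) * (indicator (D j) (fst z) * g i z))"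
    proof (rule AE_product)
      show "(\<lambda>z. indicator (D j) (fst z) * f z) \<in> borel_measurable (M \<Otimes>\<^sub>M N)" by measurable
      show "(\<lambda>z. \<Sum>i<j. fun_inner N f (x i) (fst z) * (indicator (D j) (fst z) * g i z)) \<in> borel_measurable (M \<Otimes>\<^sub>M N)" by measurable
      show "AE \<omega> in M. AE s in N. indicator (D j) (fst (\<omega>, s)) * f (\<omega>, s) = 
          (\<Sum>i<j. fun_inner N f (x i) (fst (\<omega>, s)) * (indicator (D j) (fst (\<omega>, s)) * g i (\<omega>, s)))"
        using es fs fd complete
      proof eventually_elim
        case (elim \<omega>)
        interpret eig N "fibre_op N k \<omega>" "\<lambda>n. lam n \<omega>" "\<lambda>n. curry (x n) \<omega>" by (rule elim(1))
        show ?case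
        proof (cases "\<omega> \<in> D j")
          case False
          then show ?thesis by simp
        next
          case True
          have fk: "curry f \<omega> \<in> L2 N" "AE s in N. complex_of_real (l \<omega>) * curry f \<omega> s - fibre_op N k \<omega> (curry f \<omega>) s = 0"
            using elim(2) by (auto simp: fibre_ker_def)
          have "finite {n. L2_norm N (curry (x n) \<omega>) \<noteq> 0 \<and> lam n \<omega> = l \<omega>}"
            using eigenspace_finite[of "l \<omega>"] elim(3) by (simp add: fibre_ker_def)
          then obtain j0 where j0: "{n. P n \<omega>} \<subseteq> {..<j0}"
            unfolding P_def fun_norm_def using finite_nat_set_iff_bounded by auto
          then have "\<forall>n\<ge>j0. \<not> P n \<omega>" by auto
          then have "\<forall>n\<ge>J \<omega>. \<not> P n \<omega>" unfolding J_def by (rule LeastI)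
          then have j: "\<not> (L2_norm N (curry (x n) \<omega>) \<noteq> 0 \<and> lam n \<omega> = l \<omega>)" if "n \<ge> j" for n
            using True that by (auto simp: D_def P_def fun_norm_def)
          \<comment> \<open>At \<open>l \<omega> = 0\<close> the finite-dimensional kernel forces
            \<open>L2 N\<close> to be separable, and the system is then complete.\<close>
          have r: "l \<omega> \<noteq> 0 \<or> Fourier_sum N (\<lambda>n. curry (x n) \<omega>) (curry f \<omega>)"
          proof (cases "l \<omega> = 0")
            case True
            then have "L2_separable N" using kernel_fin_dim_separable elim(3) by (simp add: fibre_ker_def)
            then show ?thesis using elim(4) fk(1) by blast
          qed simp
          have gs: "curry (g n) \<omega> s = (if L2_norm N (curry (x n) \<omega>) \<noteq> 0 \<and> lam n \<omega> = l \<omega> then curry (x n) \<omega> s else 0)" for n s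
            by (simp add: gc P_def fun_norm_def)
          have "AE s in N. curry f \<omega> s = (\<Sum>n<j. L2_inner N (curry f \<omega>) (curry (x n) \<omega>) * curry (g n) \<omega> s)"
            unfolding gs by (rule eigenspace_expansion[OF fk r j])
          then show ?thesis using True by (simp add: curry_conv fun_inner_def)
        qed
      qed
    qed
    with cm show ?thesis by (intro exI[of _ "\<lambda>i. fun_inner N f (x i)"] conjI allI impI)
  qed
  have "disjoint_family D" by (auto simp: disjoint_family_on_def D_def)
  moreover have "(\<Union>j. D j) = space M" by (auto simp: D_def)
  ultimately show "\<exists>(B :: nat \<Rightarrow> 'a set) (r :: nat \<Rightarrow> nat) g.
        (\<forall>j. B j \<in> sets M) \<and> disjoint_family B \<and> (\<Union>j. B j) = space M \<and>
        (\<forall>j. \<forall>i<r j. g j i \<in> ker22 M N k l) \<and>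
        (\<forall>f\<in>ker22 M N k l. \<forall>j. \<exists>c :: nat \<Rightarrow> 'a \<Rightarrow> complex. (\<forall>i<r j. c i \<in> borel_measurable M) \<and>
           (AE z in M \<Otimes>\<^sub>M N. indicator (B j) (fst z) * f z =
              (\<Sum>i<r j. c i (fst z) * (indicator (B j) (fst z) * g j i z))))"
    using D gk exp by (intro exI[of _ D] exI[of _ "\<lambda>j. j"] exI[of _ "\<lambda>j. g"]) blast
qed

end

section \<open>The spectral theorem\<close>

text \<open>Transfers an eigensystem from the corrected kernel to the given one, whose operators
  agree with it only almost everywhere.\<close>

lemma eig_sys_cong:
  assumes es: "eig_sys N A l y" and A': "\<And>g. g \<in> L2 N \<Longrightarrow> A' g \<in> borel_measurable N" "\<And>g. g \<in> L2 N \<Longrightarrow> AE t in N. A g t = A' g t"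
  shows "eig_sys N A' l y"
proof -
  interpret eig N A l y by unfold_locales (rule es)
  have "A' g \<in> L2 N" if "g \<in> L2 N" for g
    using L2_cong_AE[OF A'(1)[OF that] A_L2[OF that]] A'(2)[OF that] by (auto simp: eq_commute)
  moreover have "AE t in N. A' (y n) t = complex_of_real (l n) * y n t" for n
    using A_y[of n] A'(2)[OF y_L2[of n]] by eventually_elim simp
  moreover have "L2_tendsto N (\<lambda>K s. \<Sum>n<K. complex_of_real (l n) * L2_inner N g (y n) * y n s) (A' g)" if "g \<in> L2 N" for g
    by (rule L2_tendsto_cong_AE[OF A_exp[OF that] A'(1)[OF that] A'(2)[OF that]])
  ultimately show ?thesis using es unfolding eig_sys_def by blast
qed

lemma spectral_field_exists:
  fixes M :: "'a measure" and N :: "'b measure"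
  assumes fM: "finite_measure M" and cM: "complete_measure M" and fN: "finite_measure N"
    and k_meas[measurable]: "k \<in> borel_measurable (M \<Otimes>\<^sub>M (N \<Otimes>\<^sub>M N))"
    and k_bounded: "AE z in M \<Otimes>\<^sub>M (N \<Otimes>\<^sub>M N). cmod (k z) \<le> C"
    and k_herm: "AE z in M \<Otimes>\<^sub>M (N \<Otimes>\<^sub>M N). case z of (\<omega>, t, s) \<Rightarrow> k (\<omega>, t, s) = cnj (k (\<omega>, s, t))"
    and T_def: "T = partial_int_op N k" and T_sa: "self_adjoint22 M N T"
  obtains lam x B where "spectral_field M N k T lam x B"
proof -
  interpret two_measures M N by (rule two_measures.intro[OF fM fN])
  interpret NN: pair_sigma_finite N N ..
  interpret MNN: pair_sigma_finite M "N \<Otimes>\<^sub>M N" ..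
  \<comment> \<open>The corrected kernel may take the value \<open>0\<close>, so its bound has to be
    non-negative.\<close>
  define C' where "C' = max C 0"
  \<comment> \<open>Given the symmetry condition, the bound holds at \<open>(t, s)\<close> if and
    only if it holds at \<open>(s, t)\<close>; so setting the kernel to \<open>0\<close> elsewhere
    preserves symmetry.\<close>
  define k0 where "k0 z = (if cmod (k z) \<le> C \<and> k z = cnj (k (fst z, snd (snd z), fst (snd z))) then k z else 0)" for z
  have swap[measurable]: "(\<lambda>z. k (fst z, snd (snd z), fst (snd z))) \<in> borel_measurable (M \<Otimes>\<^sub>M (N \<Otimes>\<^sub>M N))"
    by (rule measurable_compose[OF _ k_meas]) measurable
  have "{z \<in> space (M \<Otimes>\<^sub>M (N \<Otimes>\<^sub>M N)). k z - cnj (k (fst z, snd (snd z), fst (snd z))) = 0} \<in> sets (M \<Otimes>\<^sub>M (N \<Otimes>\<^sub>M N))" by measurable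
  then have [measurable]: "Measurable.pred (M \<Otimes>\<^sub>M (N \<Otimes>\<^sub>M N)) (\<lambda>z. k z = cnj (k (fst z, snd (snd z), fst (snd z))))"
    by (simp add: pred_def)
  have bk: "bounded_kernel M N C' k0"
    unfolding bounded_kernel_def
  proof (intro conjI ballI)
    show "k0 \<in> borel_measurable (M \<Otimes>\<^sub>M (N \<Otimes>\<^sub>M N))" unfolding k0_def[abs_def] by measurable
  qed (auto simp: k0_def C'_def)
  have herm: "k0 (\<omega>, t, s) = cnj (k0 (\<omega>, s, t))" for \<omega> t s
  proof (cases "cmod (k (\<omega>, t, s)) \<le> C \<and> k (\<omega>, t, s) = cnj (k (\<omega>, s, t))")
    case True
    then have "cmod (k (\<omega>, s, t)) \<le> C \<and> k (\<omega>, s, t) = cnj (k (\<omega>, t, s))" by (metis complex_cnj_cnj complex_mod_cnj)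
    with True show ?thesis unfolding k0_def fst_conv snd_conv by simp
  next
    case False
    then have "\<not> (cmod (k (\<omega>, s, t)) \<le> C \<and> k (\<omega>, s, t) = cnj (k (\<omega>, t, s)))" by (metis complex_cnj_cnj complex_mod_cnj)
    then have "k0 (\<omega>, s, t) = 0" unfolding k0_def fst_conv snd_conv by (rule if_not_P)
    moreover have "k0 (\<omega>, t, s) = 0" using False unfolding k0_def fst_conv snd_conv by (rule if_not_P)
    ultimately show ?thesis by simp
  qed
  have "AE z in M \<Otimes>\<^sub>M (N \<Otimes>\<^sub>M N). k z = k0 z"
    using k_bounded k_herm by eventually_elim (auto simp: k0_def)
  then have "AE \<omega> in M. AE p in N \<Otimes>\<^sub>M N. k (\<omega>, p) = k0 (\<omega>, p)" by (rule MNN.AE_pair)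
  then have k_eq: "AE \<omega> in M. AE t in N. AE s in N. k (\<omega>, t, s) = k0 (\<omega>, t, s)"
    by (rule eventually_mono) (rule NN.AE_pair)
  obtain lam x where lam: "\<And>n::nat. lam n \<in> borel_measurable M" and x: "\<And>n. x n \<in> borel_measurable (M \<Otimes>\<^sub>M N)"
    and es: "\<And>\<omega>. \<omega> \<in> space M \<Longrightarrow> eig_sys N (fibre_op N k0 \<omega>) (\<lambda>n. lam n \<omega>) (\<lambda>n. curry (x n) \<omega>)"
    and comp: "\<And>\<omega> g. \<omega> \<in> space M \<Longrightarrow> L2_separable N \<Longrightarrow> g \<in> L2 N \<Longrightarrow> Fourier_sum N (\<lambda>n. curry (x n) \<omega>) g"
    and unit: "\<And>\<omega> n. \<omega> \<in> space M \<Longrightarrow> \<not> L2_fin_dim N (L2 N) \<Longrightarrow> L2_norm N (curry (x n) \<omega>) = 1"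
    using eigen_fields_exist[OF fN bk herm] by blast
  have cong: "fibre_op N k \<omega> g \<in> borel_measurable N" "AE t in N. fibre_op N k0 \<omega> g t = fibre_op N k \<omega> g t"
    if \<omega>: "\<omega> \<in> space M" and eq: "AE t in N. AE s in N. k (\<omega>, t, s) = k0 (\<omega>, t, s)" and g: "g \<in> L2 N" for \<omega> g
  proof -
    have km: "(\<lambda>p. k (\<omega>, p)) \<in> borel_measurable (N \<Otimes>\<^sub>M N)" by (rule measurable_compose[OF measurable_Pair1'[OF \<omega>] k_meas])
    have [measurable]: "g \<in> borel_measurable N" "(\<lambda>z. k (\<omega>, fst z, snd z)) \<in> borel_measurable (N \<Otimes>\<^sub>M N)" using g km by auto
    have "(\<lambda>z. k (\<omega>, fst z, snd z) * g (snd z)) \<in> borel_measurable (N \<Otimes>\<^sub>M N)" by measurable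
    then show "fibre_op N k \<omega> g \<in> borel_measurable N" unfolding fibre_op_def[abs_def]
      by (intro N.borel_measurable_lebesgue_integral) (simp add: case_prod_beta')
    have "AE t in N. t \<in> space N" by simp
    with eq show "AE t in N. fibre_op N k0 \<omega> g t = fibre_op N k \<omega> g t"
    proof eventually_elim
      case (elim t)
      have [measurable]: "(\<lambda>s. k (\<omega>, t, s)) \<in> borel_measurable N" "(\<lambda>s. k0 (\<omega>, t, s)) \<in> borel_measurable N"
        using measurable_compose[OF measurable_Pair1'[OF elim(2)] km] bounded_kernel_meas(2)[OF fN bk \<omega> elim(2)] by auto
      show ?case unfolding fibre_op_def
        by (rule integral_cong_AE, measurable) (use elim(1) in \<open>auto elim!: eventually_mono\<close>)
    qed
  qed
  \<comment> \<open>For a unit eigenvector, Cauchy-Schwarz bounds the integral of its modulus by the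
    norm of the constant \<open>1\<close>, and the passage from a uniform bound of the image to its
    norm contributes this factor once more.\<close>
  define B where "B = C' * (L2_norm N (\<lambda>s. 1))\<^sup>2"
  have one: "(\<lambda>s. 1) \<in> L2 N" by (simp add: L2_def)
  have C'0: "C' \<ge> 0" by (simp add: C'_def)
  have B0: "B \<ge> 0" unfolding B_def using C'0 by simp
  have bound: "\<bar>lam n \<omega>\<bar> \<le> B" if \<omega>: "\<omega> \<in> space M" for n \<omega>
  proof -
    interpret eig N "fibre_op N k0 \<omega>" "\<lambda>n. lam n \<omega>" "\<lambda>n. curry (x n) \<omega>" by unfold_locales (rule es[OF \<omega>])
    show ?thesis
    proof (cases "L2_norm N (curry (x n) \<omega>) = 0")
      case True
      then show ?thesis using l_null B0 by simp
    next
      case False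
      then have n1: "L2_norm N (curry (x n) \<omega>) = 1" using norm_y[of n] by simp
      have "(\<integral>s. cmod (curry (x n) \<omega> s) \<partial>N) \<le> L2_norm N (\<lambda>s. 1)"
        using L2_integrable_abs_mult(2)[OF y_L2[of n] one] n1 by simp
      then have le: "cmod (fibre_op N k0 \<omega> (curry (x n) \<omega>) t) \<le> C' * L2_norm N (\<lambda>s. 1)" if "t \<in> space N" for t
        using fibre_op_le[OF fN bk \<omega> y_L2 that, of n] C'0 by (meson mult_left_mono order_trans)
      have "\<bar>lam n \<omega>\<bar> = L2_norm N (\<lambda>s. complex_of_real (lam n \<omega>) * curry (x n) \<omega> s)" by (simp add: L2_norm_scale n1)
      also have "\<dots> = L2_norm N (fibre_op N k0 \<omega> (curry (x n) \<omega>))"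
        by (rule L2_norm_cong_AE) (use A_y[of n] in \<open>auto intro!: L2_measurable L2_scale y_L2 A_L2\<close>)
      also have "\<dots> \<le> L2_norm N (\<lambda>s. complex_of_real (C' * L2_norm N (\<lambda>s. 1)) * 1)"
      proof (rule L2_norm_mono)
        show "fibre_op N k0 \<omega> (curry (x n) \<omega>) \<in> borel_measurable N" by (intro L2_measurable A_L2 y_L2)
        show "(\<lambda>s. complex_of_real (C' * L2_norm N (\<lambda>s. 1)) * 1) \<in> L2 N" by (intro L2_scale one)
        show "AE s in N. cmod (fibre_op N k0 \<omega> (curry (x n) \<omega>) s) \<le> cmod (complex_of_real (C' * L2_norm N (\<lambda>s. 1)) * 1)"
          using le C'0 by (intro AE_I2) (simp add: norm_mult)
      qed
      also have "\<dots> = B" unfolding L2_norm_scale using C'0 by (simp add: B_def power2_eq_square norm_mult)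
      finally show ?thesis .
    qed
  qed
  have "spectral_field M N k T lam x B"
  proof (rule spectral_field.intro[OF two_measures_axioms], rule spectral_field_axioms.intro)
    show "complete_measure M" by fact
    have "AE \<omega> in M. \<omega> \<in> space M" by simp
    with k_eq show "AE \<omega> in M. eig N (fibre_op N k \<omega>) (\<lambda>n. lam n \<omega>) (\<lambda>n. curry (x n) \<omega>)"
    proof eventually_elim
      case (elim \<omega>)
      show ?case by (rule eig.intro, rule eig_sys_cong[OF es[OF elim(2)] cong[OF elim(2,1)]])
    qed
    show "AE \<omega> in M. L2_separable N \<longrightarrow> (\<forall>g\<in>L2 N. Fourier_sum N (\<lambda>n. curry (x n) \<omega>) g)" using comp by (intro AE_I2) blast
    show "AE \<omega> in M. \<not> L2_fin_dim N (L2 N) \<longrightarrow> (\<forall>n. L2_norm N (curry (x n) \<omega>) = 1)" using unit by (intro AE_I2) blast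
    show "AE \<omega> in M. \<forall>n. \<bar>lam n \<omega>\<bar> \<le> B" using bound by (intro AE_I2) blast
  qed (rule T_def T_sa lam x B0)+
  then show ?thesis by (rule that)
qed

text \<open>If \<open>N\<close> is the zero measure, every section has norm zero and the numerical
  range says nothing about its bounds; hence the condition on the measure. A finite-dimensional
  \<open>L2 N\<close> has only finitely many orthonormal vectors, so zero vectors with eigenvalue
  \<open>0\<close> are interspersed. In a non-separable \<open>L2 N\<close> no sequence is complete;
  on what is missed \<phi>(T) acts as \<phi>(0), while the integral vanishes, which accounts for the
  alternative in (3).\<close>

theorem mainTheorem1:
  fixes M :: "'a measure" and N :: "'b measure"
    and k :: "'a \<times> 'b \<times> 'b \<Rightarrow> complex"
    and T :: "('a \<times> 'b \<Rightarrow> complex) \<Rightarrow> 'a \<times> 'b \<Rightarrow> complex"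
    and mT MT :: "'a \<Rightarrow> real"
  assumes "finite_measure M" and "complete_measure M" and "finite_measure N"
    and k_meas: "k \<in> borel_measurable (M \<Otimes>\<^sub>M (N \<Otimes>\<^sub>M N))"
    and k_bounded: "\<exists>C. AE z in M \<Otimes>\<^sub>M (N \<Otimes>\<^sub>M N). cmod (k z) \<le> C"
    and k_herm: "AE z in M \<Otimes>\<^sub>M (N \<Otimes>\<^sub>M N). case z of (\<omega>, t, s) \<Rightarrow> k (\<omega>, t, s) = cnj (k (\<omega>, s, t))"
    and T_def: "T = partial_int_op N k"
    and T_sa: "self_adjoint22 M N T"
    and T_cc: "cyclically_compact_op TYPE('i) TYPE('j) M N T"
    and k_psd: "\<And>x. x \<in> L22 M N \<Longrightarrow> AE \<omega> in M.
        (\<integral>s. (\<integral>t. k (\<omega>, t, s) * x (\<omega>, s) * cnj (x (\<omega>, t)) \<partial>N) \<partial>N) \<in> \<real>\<^sub>\<ge>\<^sub>0"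
    and mT_def: "mT = lower_bound M N T"
    and MT_def: "MT = upper_bound M N T"
  shows "(measure N (space N) > 0 \<longrightarrow>
            is_L0_inf M (num_range M N T) mT \<and> is_L0_sup M (num_range M N T) MT) \<and>
    (\<exists>(lam :: nat \<Rightarrow> 'a \<Rightarrow> real) (x :: nat \<Rightarrow> 'a \<times> 'b \<Rightarrow> complex).
      \<comment> \<open>(1)\<close>
      (\<forall>n. lam n \<in> borel_measurable M) \<and>
      (\<forall>n. x n \<in> borel_measurable (M \<Otimes>\<^sub>M N)) \<and>
      (AE \<omega> in M. (\<lambda>n. lam n \<omega>) \<longlonglongrightarrow> 0) \<and>
      (AE \<omega> in M. \<forall>n. curry (x n) \<omega> \<in> L2 N \<and>
         (AE t in N. fibre_op N k \<omega> (curry (x n) \<omega>) t = complex_of_real (lam n \<omega>) * x n (\<omega>, t))) \<and>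
      (AE \<omega> in M. \<forall>m n. m \<noteq> n \<longrightarrow> fun_inner N (x m) (x n) \<omega> = 0) \<and>
      (AE \<omega> in M. \<forall>n. fun_inner N (x n) (x n) \<omega> = 1 \<or>
         (L2_fin_dim N (L2 N) \<and> lam n \<omega> = 0 \<and> (AE t in N. x n (\<omega>, t) = 0))) \<and>
      (AE \<omega> in M. fibre_sp N k \<omega> = range (\<lambda>n. complex_of_real (lam n \<omega>)) \<union> {0}) \<and>
      (\<forall>f\<in>L22 M N. L22_tendsto M N
         (\<lambda>K (\<omega>, t). \<Sum>n<K. complex_of_real (lam n \<omega>) * fun_inner N f (x n) \<omega> * x n (\<omega>, t)) (T f)) \<and>
      \<comment> \<open>(2)\<close>
      (\<forall>l\<in>borel_measurable M. orth_projector22 M N (spectral_E M N lam x l) \<and>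
         (\<forall>f\<in>L22 M N. L22_tendsto M N (E_partial_sum N lam x l f) (spectral_E M N lam x l f))) \<and>
      (\<forall>\<epsilon>>0. has_spectral_integral M N lam x (\<lambda>\<omega>. complex_of_real) mT (\<lambda>\<omega>. MT \<omega> + \<epsilon>) T) \<and>
      \<comment> \<open>(3)\<close>
      (\<forall>\<epsilon>>0. \<forall>\<phi>. fibrewise_continuous M mT (\<lambda>\<omega>. MT \<omega> + \<epsilon>) \<phi> \<and>
         (L2_separable N \<or> (AE \<omega> in M. \<phi> \<omega> 0 = 0)) \<longrightarrow>
         (\<exists>\<Phi>. is_fun_calc_op M N k \<phi> \<Phi> \<and>
            has_spectral_integral M N lam x \<phi> mT (\<lambda>\<omega>. MT \<omega> + \<epsilon>) \<Phi>)) \<and>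
      \<comment> \<open>(4)\<close>
      (\<forall>l\<in>spm_disc M N k lam. sigma_fin_gen_module M N (ker22 M N k l)) \<and>
      \<comment> \<open>(5)\<close>
      spm M N k = mix_hull M M (\<lambda>\<omega>. \<omega>) (eigenvalue_sums M lam))"
proof -
  obtain C where C: "AE z in M \<Otimes>\<^sub>M (N \<Otimes>\<^sub>M N). cmod (k z) \<le> C" using k_bounded by blast
  obtain lam x B where "spectral_field M N k T lam x B"
    using spectral_field_exists[OF assms(1-3) k_meas C k_herm T_def T_sa] by blast
  then interpret spectral_field M N k T lam x B .
  have "AE \<omega> in M. (\<lambda>n. lam n \<omega>) \<longlonglongrightarrow> 0"
    using es by (rule eventually_mono) (rule eig.l_lim)
  moreover have "AE \<omega> in M. \<forall>n. curry (x n) \<omega> \<in> L2 N \<and>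
         (AE t in N. fibre_op N k \<omega> (curry (x n) \<omega>) t = complex_of_real (lam n \<omega>) * x n (\<omega>, t))"
    using es
  proof eventually_elim
    case (elim \<omega>)
    interpret eig N "fibre_op N k \<omega>" "\<lambda>n. lam n \<omega>" "\<lambda>n. curry (x n) \<omega>" by (rule elim)
    show ?case using y_L2 A_y by (simp add: curry_conv)
  qed
  moreover have "AE \<omega> in M. \<forall>m n. m \<noteq> n \<longrightarrow> fun_inner N (x m) (x n) \<omega> = 0"
    using es
  proof eventually_elim
    case (elim \<omega>)
    interpret eig N "fibre_op N k \<omega>" "\<lambda>n. lam n \<omega>" "\<lambda>n. curry (x n) \<omega>" by (rule elim)
    show ?case using y_orth by (simp add: fun_inner_def)
  qed
  moreover have "AE \<omega> in M. \<forall>n. fun_inner N (x n) (x n) \<omega> = 1 \<or>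
         (L2_fin_dim N (L2 N) \<and> lam n \<omega> = 0 \<and> (AE t in N. x n (\<omega>, t) = 0))"
    using es infinite
  proof eventually_elim
    case (elim \<omega>)
    interpret eig N "fibre_op N k \<omega>" "\<lambda>n. lam n \<omega>" "\<lambda>n. curry (x n) \<omega>" by (rule elim(1))
    show ?case
    proof
      fix n
      show "fun_inner N (x n) (x n) \<omega> = 1 \<or> (L2_fin_dim N (L2 N) \<and> lam n \<omega> = 0 \<and> (AE t in N. x n (\<omega>, t) = 0))"
      proof (cases "L2_norm N (curry (x n) \<omega>) = 0")
        case True
        then have "AE t in N. x n (\<omega>, t) = 0" using L2_norm_eq_0_iff[OF y_L2[of n]] by (simp add: curry_conv)
        moreover have "L2_fin_dim N (L2 N)"
        proof (rule ccontr)
          assume "\<not> L2_fin_dim N (L2 N)"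
          then have "L2_norm N (curry (x n) \<omega>) = 1" using elim(2) by blast
          then show False using True by simp
        qed
        ultimately show ?thesis using l_null[OF True] by simp
      next
        case False
        then show ?thesis using y_unit[of n] norm_y_iff[of n] by (simp add: fun_inner_def)
      qed
    qed
  qed
  moreover have "L22_tendsto M N (\<lambda>K (\<omega>, t). \<Sum>n<K. complex_of_real (lam n \<omega>) * fun_inner N f (x n) \<omega> * x n (\<omega>, t)) (T f)"
    if "f \<in> L22 M N" for f
    using T_expansion(2)[OF that] by (simp add: partial_def[abs_def])
  moreover have "L22_tendsto M N (E_partial_sum N lam x l f) (spectral_E M N lam x l f)"
    if "l \<in> borel_measurable M" "f \<in> L22 M N" for l f
    using spectral_E_tendsto(1)[OF that] by (simp add: E_partial_sum_eq)
  moreover have "is_L0_inf M (num_range M N T) mT \<and> is_L0_sup M (num_range M N T) MT" if "measure N (space N) > 0"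
    unfolding mT_def MT_def using lower_bound_inf[OF that] upper_bound_sup[OF that] by blast
  ultimately show ?thesis
    unfolding mT_def MT_def
    using lam_meas x_meas fibre_sp_eq spectral_E_projector T_spectral_integral fun_calc_spectral_integral
      ker22_sigma_fin_gen spm_eq
    by (intro conjI impI exI[of _ lam] exI[of _ x]) blast+
qed

end
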